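(* Let $p_t$, $t\ge0$, denote the transition kernels of the diffusion process on $\mathbb{R}^{nk}$ solving $$dX^i_t=-\frac12\nabla U(X^i_t)\,dt-\sum_{j=1}^n a_{ij}\nabla V(X^i_t-X^j_t)\,dt+dB^i_t,\qquad i=1,\dots,n.$$ Suppose that $\sup\|\nabla^2V\|<\infty$ and that, with $\alpha\in\mathbb{R}$, either (nearest-neighbour interaction) $a_{ij}=\alpha/2$ if $i-j\equiv1\bmod n$ or $i-j\equiv-1\bmod n$, and $a_{ij}=0$ otherwise; or (mean-field interaction) $a_{ij}=\alpha n^{-1}$ for all $i,j$. Then there exist finite constants $c,\theta,A\in(0,\infty)$ that do not depend on the dimension $n$ such that $$W_{f,1}(\mu p_t,\nu p_t)\le e^{(\theta\alpha-c)t}\,W_{f,1}(\mu,\nu)\qquad\text{and}\qquad W_{\ell^1}(\mu p_t,\nu p_t)\le A\,e^{(\theta\alpha-c)t}\,W_{\ell^1}(\mu,\nu)$$ hold for any $t\ge0$ and any probability measures $\mu,\nu$ on $\mathbb{R}^{nk}$. In particular, exponential contractivity holds for $\alpha<c/\theta$.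
   Context: Setting. $k,n\in\mathbb{N}$; $B^1,\dots,B^n$ are independent Brownian motions in $\mathbb{R}^k$; $U\in C^2(\mathbb{R}^k)$ is strictly convex outside a given ball; the interaction potential $V$ is in $C^2(\mathbb{R}^k)$ (with bounded second derivatives). Points of $\mathbb{R}^{nk}$ are written $x=(x^1,\dots,x^n)$ with $x^i\in\mathbb{R}^k$; $|\cdot|$ is the Euclidean norm; $\mu p_t=\int\mu(dx)\,p_t(x,\cdot)$; $a^-=\max(-a,0)$ for real $a$. For $r\in(0,\infty)$, $$\kappa(r)=\inf\Big\{\int_0^1\partial^2_{(x-y)/|x-y|}U((1-t)x+ty)\,dt : x,y\in\mathbb{R}^k,\ |x-y|=r\Big\},$$ where $\partial^2_vU=v\cdot(\nabla^2U)v$. Standing assumptions: $\kappa$ is continuous on $(0,\infty)$, $\liminf_{r\to\infty}\kappa(r)>0$ and $\lim_{r\to0}r\kappa(r)=0$. Define (with $r>0$ understood) $$R_0=\inf\{R\ge0:\kappa(r)\ge0\ \forall r\ge R\},\quad R_1=\inf\{R\ge R_0:\kappa(r)R(R-R_0)\ge8\ \forall r\ge R\},$$ $$\varphi(r)=\exp\Big(-\frac14\int_0^r s\kappa(s)^-ds\Big),\quad\Phi(r)=\int_0^r\varphi(s)\,ds,$$ $$g(r)=1-\frac12\int_0^{r\wedge R_1}\frac{\Phi(s)}{\varphi(s)}ds\Big/\int_0^{R_1}\frac{\Phi(s)}{\varphi(s)}ds,\quad f(r)=\int_0^r\varphi(s)g(s)\,ds.$$ The Kantorovich distances are $W_{f,1}(\mu,\nu)=\inf_\eta\int\sum_{i=1}^n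 f(|x^i-y^i|)\,\eta(dx\,dy)$ and $W_{\ell^1}(\mu,\nu)=\inf_\eta\int\sum_{i=1}^n|x^i-y^i|\,\eta(dx\,dy)$, the infima being over all couplings $\eta$ of $\mu$ and $\nu$. Exponential contractivity refers to the two displayed bounds with negative exponent $\theta\alpha-c$.
   Formalization: The exponent is θ|α|−c instead of θα−c, and contractivity is claimed for |α|<c/θ; for α<0 the original fails (k=1, U=λx²/2, V=x²/2, n=2, mean field, α=−M with M>λ/2: the distance grows). For α≥0 nothing changes. *)

theory Defs
  imports "HOL-Probability.Probability" "HOL-Number_Theory.Cong"
begin

section \<open>Potentials\<close>

definition grad :: "('a::euclidean_space \<Rightarrow> real) \<Rightarrow> 'a \<Rightarrow> 'a" where
  "grad F x = (THE D. GDERIV F x :> D)"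

definition hess :: "('a::euclidean_space \<Rightarrow> real) \<Rightarrow> 'a \<Rightarrow> 'a \<Rightarrow> 'a" where
  "hess F x = frechet_derivative (grad F) (at x)"

definition C2 :: "('a::euclidean_space \<Rightarrow> real) \<Rightarrow> bool" where
  "C2 F \<longleftrightarrow> (\<forall>x. F differentiable (at x)) \<and> (\<forall>x. grad F differentiable (at x)) \<and>
     (\<forall>v. continuous_on UNIV (\<lambda>x. hess F x v))"

text \<open>The complement of a ball is not convex, so the inequality is only required along
  segments which do not meet the ball.\<close>

definition strictly_convex_outside :: "('a::euclidean_space \<Rightarrow> real) \<Rightarrow> 'a set \<Rightarrow> bool" where
  "strictly_convex_outside F K \<longleftrightarrow>
     (\<forall>x y. x \<noteq> y \<longrightarrow> closed_segment x y \<inter> K = {} \<longrightarrow>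
        (\<forall>t. 0 < t \<and> t < 1 \<longrightarrow>
           F ((1 - t) *\<^sub>R x + t *\<^sub>R y) < (1 - t) * F x + t * F y))"

section \<open>The concave distance function\<close>

text \<open>For \<open>U\<close> of class \<open>C\<^sup>2\<close> and strictly convex outside a ball, the Hessian of \<open>U\<close> is bounded
  below, so that the real-valued infimum below is a genuine one for every \<open>r > 0\<close>.\<close>

definition kappa :: "('a::euclidean_space \<Rightarrow> real) \<Rightarrow> real \<Rightarrow> real" where
  "kappa U r = Inf {integral {0..1} (\<lambda>t.
       let e = (x - y) /\<^sub>R norm (x - y)
       in e \<bullet> hess U ((1 - t) *\<^sub>R x + t *\<^sub>R y) e) | x y. norm (x - y) = r}"

text \<open>If \<open>liminf \<kappa>(r) > 0\<close> as \<open>r \<rightarrow> \<infinity>\<close>, the sets in the next two definitions are nonempty.\<close>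

definition R0 :: "('a::euclidean_space \<Rightarrow> real) \<Rightarrow> real" where
  "R0 U = Inf {R. 0 \<le> R \<and> (\<forall>r>0. R \<le> r \<longrightarrow> 0 \<le> kappa U r)}"

definition R1 :: "('a::euclidean_space \<Rightarrow> real) \<Rightarrow> real" where
  "R1 U = Inf {R. R0 U \<le> R \<and> (\<forall>r>0. R \<le> r \<longrightarrow> 8 \<le> kappa U r * R * (R - R0 U))}"

definition phi :: "('a::euclidean_space \<Rightarrow> real) \<Rightarrow> real \<Rightarrow> real" where
  "phi U r = exp (- (1/4) * integral {0..r} (\<lambda>s. s * max (- kappa U s) 0))"

definition Phi :: "('a::euclidean_space \<Rightarrow> real) \<Rightarrow> real \<Rightarrow> real" where
  "Phi U r = integral {0..r} (phi U)"

definition g_fun :: "('a::euclidean_space \<Rightarrow> real) \<Rightarrow> real \<Rightarrow> real" where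
  "g_fun U r = 1 - (1/2) * (integral {0..min r (R1 U)} (\<lambda>s. Phi U s / phi U s) /
                          integral {0..R1 U} (\<lambda>s. Phi U s / phi U s))"

definition f_fun :: "('a::euclidean_space \<Rightarrow> real) \<Rightarrow> real \<Rightarrow> real" where
  "f_fun U r = integral {0..r} (\<lambda>s. phi U s * g_fun U s)"

section \<open>The interacting diffusion\<close>

text \<open>A configuration of \<open>n\<close> particles is an element of \<open>space (conf n)\<close>, that is, a function
  on \<open>{1..n}\<close> which is \<open>undefined\<close> elsewhere.\<close>

abbreviation conf :: "nat \<Rightarrow> (nat \<Rightarrow> 'a::euclidean_space) measure" where
  "conf n \<equiv> Pi\<^sub>M {1..n} (\<lambda>_. borel)"

definition nearest_neighbour :: "nat \<Rightarrow> real \<Rightarrow> nat \<Rightarrow> nat \<Rightarrow> real" where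
  "nearest_neighbour n \<alpha> i j =
     (if [int i - int j = 1] (mod int n) \<or> [int i - int j = -1] (mod int n)
      then \<alpha> / 2 else 0)"

definition mean_field :: "nat \<Rightarrow> real \<Rightarrow> nat \<Rightarrow> nat \<Rightarrow> real" where
  "mean_field n \<alpha> i j = \<alpha> / real n"

definition drift ::
  "('a::euclidean_space \<Rightarrow> real) \<Rightarrow> ('a \<Rightarrow> real) \<Rightarrow> (nat \<Rightarrow> nat \<Rightarrow> real) \<Rightarrow> nat \<Rightarrow>
     (nat \<Rightarrow> 'a) \<Rightarrow> nat \<Rightarrow> 'a" where
  "drift U V a n z i =
     - (1/2) *\<^sub>R grad U (z i) - (\<Sum>j\<in>{1..n}. a i j *\<^sub>R grad V (z i - z j))"

text \<open>Standard Brownian motion started at the origin: the increment over \<open>[s, t]\<close> has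
  independent centred Gaussian coordinates of variance \<open>t - s\<close>.\<close>

definition brownian_motion ::
  "'w measure \<Rightarrow> (real \<Rightarrow> 'w \<Rightarrow> 'a::euclidean_space) \<Rightarrow> bool" where
  "brownian_motion M W \<longleftrightarrow>
     (\<forall>t\<ge>0. W t \<in> borel_measurable M) \<and>
     (AE \<omega> in M. W 0 \<omega> = 0) \<and>
     (\<forall>s t. 0 \<le> s \<and> s < t \<longrightarrow>
        distributed M lborel (\<lambda>\<omega>. W t \<omega> - W s \<omega>)
          (\<lambda>x. ennreal (\<Prod>b\<in>Basis. normal_density 0 (sqrt (t - s)) (x \<bullet> b)))) \<and>
     (\<forall>\<tau> :: nat \<Rightarrow> real. 0 \<le> \<tau> 0 \<and> mono \<tau> \<longrightarrow>
        prob_space.indep_vars M (\<lambda>_. borel)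
          (\<lambda>m \<omega>. W (\<tau> (Suc m)) \<omega> - W (\<tau> m) \<omega>) UNIV) \<and>
     (AE \<omega> in M. continuous_on {0..} (\<lambda>t. W t \<omega>))"

definition independent_brownian_motions ::
  "'w measure \<Rightarrow> nat \<Rightarrow> (nat \<Rightarrow> real \<Rightarrow> 'w \<Rightarrow> 'a::euclidean_space) \<Rightarrow> bool" where
  "independent_brownian_motions M n B \<longleftrightarrow>
     (\<forall>i\<in>{1..n}. brownian_motion M (B i)) \<and>
     prob_space.indep_vars M (\<lambda>_. Pi\<^sub>M {0..} (\<lambda>_. borel))
       (\<lambda>i \<omega>. \<lambda>t\<in>{0..}. B i t \<omega>) {1..n}"

text \<open>The noise being additive, the stochastic differential equation is a pathwise integral
  equation. Adaptedness of \<open>X\<close> is not required: for the locally Lipschitz drifts considered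
  here, the path of \<open>X\<close> up to time \<open>t\<close> is determined by \<open>x\<close> and the path of \<open>B\<close> up to time \<open>t\<close>.\<close>

definition sde_solution ::
  "'w measure \<Rightarrow> nat \<Rightarrow> ((nat \<Rightarrow> 'a::euclidean_space) \<Rightarrow> nat \<Rightarrow> 'a) \<Rightarrow>
     (nat \<Rightarrow> real \<Rightarrow> 'w \<Rightarrow> 'a) \<Rightarrow> (nat \<Rightarrow> 'a) \<Rightarrow> (real \<Rightarrow> 'w \<Rightarrow> nat \<Rightarrow> 'a) \<Rightarrow> bool" where
  "sde_solution M n b B x X \<longleftrightarrow>
     (\<forall>t\<ge>0. X t \<in> measurable M (conf n)) \<and>
     (AE \<omega> in M. \<forall>i\<in>{1..n}. continuous_on {0..} (\<lambda>t. X t \<omega> i) \<and>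
        (\<forall>t\<ge>0. X t \<omega> i = x i + integral {0..t} (\<lambda>s. b (X s \<omega>) i) + B i t \<omega>))"

text \<open>The sample space is taken to be a type of paths, since a definition cannot quantify over
  types. This is no restriction: the law of a solution on path space, together with the
  coordinate process and the noise recovered from it through the equation, is again a solution
  with the same marginal laws.\<close>

definition transition_kernels ::
  "nat \<Rightarrow> ((nat \<Rightarrow> 'a::euclidean_space) \<Rightarrow> nat \<Rightarrow> 'a) \<Rightarrow>
     (real \<Rightarrow> (nat \<Rightarrow> 'a) \<Rightarrow> (nat \<Rightarrow> 'a) measure) \<Rightarrow> bool" where
  "transition_kernels n b p \<longleftrightarrow>
     (\<forall>t\<ge>0. p t \<in> measurable (conf n) (prob_algebra (conf n))) \<and>
     (\<forall>x\<in>space (conf n).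
        \<exists>(M :: (real \<Rightarrow> nat \<Rightarrow> 'a) measure) B X.
          prob_space M \<and> independent_brownian_motions M n B \<and> sde_solution M n b B x X \<and>
          (\<forall>t\<ge>0. p t x = distr M (conf n) (X t)))"

section \<open>Kantorovich distances\<close>

definition couplings :: "'b measure \<Rightarrow> 'b measure \<Rightarrow> ('b \<times> 'b) measure set" where
  "couplings \<mu> \<nu> = {\<eta> \<in> space (prob_algebra (\<mu> \<Otimes>\<^sub>M \<nu>)). distr \<eta> \<mu> fst = \<mu> \<and> distr \<eta> \<nu> snd = \<nu>}"

text \<open>The distances may be infinite. The cost \<open>h\<close> is nonnegative in both instances.\<close>

definition kantorovich ::
  "(real \<Rightarrow> real) \<Rightarrow> nat \<Rightarrow> (nat \<Rightarrow> 'a::euclidean_space) measure \<Rightarrow> (nat \<Rightarrow> 'a) measure \<Rightarrow> ennreal"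
  where
  "kantorovich h n \<mu> \<nu> =
     (INF \<eta>\<in>couplings \<mu> \<nu>. \<integral>\<^sup>+(x, y). ennreal (\<Sum>i\<in>{1..n}. h (norm (x i - y i))) \<partial>\<eta>)"

definition W_f1 ::
  "('a::euclidean_space \<Rightarrow> real) \<Rightarrow> nat \<Rightarrow> (nat \<Rightarrow> 'a) measure \<Rightarrow> (nat \<Rightarrow> 'a) measure \<Rightarrow> ennreal" where
  "W_f1 U = kantorovich (f_fun U)"

definition W_l1 ::
  "nat \<Rightarrow> (nat \<Rightarrow> 'a::euclidean_space) measure \<Rightarrow> (nat \<Rightarrow> 'a) measure \<Rightarrow> ennreal" where
  "W_l1 = kantorovich (\<lambda>r. r)"

end

theory Submission
  imports Defs
begin

text \<open>The noise is additive, so a solution is the almost sure limit of explicit Euler chains driven by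
  the Brownian increments. These chains are stopped on leaving a box whose radius grows slowly as the
  mesh \<open>h\<close> tends to \<open>0\<close>, which keeps the drift bounded although \<open>\<nabla>U\<close> is only locally Lipschitz. Two chains
  are coupled by moving both along the drift and then reflecting the noise of every pair of particles
  at distance at least \<open>\<delta>\<close>, while closer pairs get the same noise. After the drift step the
  noise acts along the line through the pair, so one step changes \<open>f\<close> of the distance \<open>r\<close> by at most
  \<open>h (2 f''(r) - r \<kappa>(r) f'(r) / 2)\<close> up to \<open>o(h)\<close>, and the choice of \<open>f\<close> bounds this by \<open>- c h f(r)\<close>. The
  interaction contributes at most \<open>h\<close> times \<open>\<theta> \<bar>\<alpha>\<bar>\<close> times the total cost, because the rows and columns of
  the interaction matrix sum to at most \<open>\<bar>\<alpha>\<bar>\<close> in absolute value. The error is uniform on boxes, hence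
  vanishes after summation over the \<open>t / h\<close> steps. Second moments carry the estimate over
  to the unstopped limit, and the coupling of the chains is transferred to the diffusions
  by gluing along a countable rounding of the chains' end points.\<close>

section \<open>Gradients, Hessians and the function \<open>\<kappa>\<close>\<close>

text \<open>No stochastic calculus enters: instead of Ito's formula for \<open>f\<close> of the
  distance, a quartic majorant is integrated against exact Gaussian moments, so the contraction is
  proved from Brownian increments on finite grids. The law of these increments is the same for every
  starting point, whereas \<open>transition_kernels\<close> supplies a separate probability space
  for each; writing the solution as one measurable functional \<open>sol\<close> of starting point
  and dyadic noise removes this mismatch. Convergence of the chains is not uniform in the starting
  pair, so the mesh is chosen as a measurable function of that pair (\<open>level\<close>). The
  dimension \<open>n\<close> affects mesh sizes and moment bounds, but not the constants:
  \<open>rate\<close> comes from \<open>U\<close> alone, the prefactor is \<open>1 / df_min\<close>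
  with \<open>df_min\<close> a lower bound of f', and \<theta> is \<open>2 * LV / df_min + 1\<close>
  with \<open>LV\<close> a Lipschitz constant of the gradient of \<open>V\<close>. The exponent
  contains the absolute value of \<alpha>: the drift is unchanged when \<alpha> and \<open>V\<close>
  both change sign, and \<open>V\<close> is arbitrary, so the sign of \<alpha> carries no
  information.\<close>

lemma C2_GDERIV:
  fixes F :: "'a::euclidean_space \<Rightarrow> real"
  assumes "C2 F" shows "GDERIV F x :> grad F x"
proof -
  obtain F' where F': "(F has_derivative F') (at x)"
    using assms unfolding C2_def by (meson differentiable_def)
  interpret bounded_linear F' using F' by (rule has_derivative_bounded_linear)
  have "F' h = h \<bullet> (\<Sum>b\<in>Basis. F' b *\<^sub>R b)" for h
  proof -
    have "F' h = F' (\<Sum>b\<in>Basis. (h \<bullet> b) *\<^sub>R b)" by (simp add: euclidean_representation)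
    also have "\<dots> = (\<Sum>b\<in>Basis. (h \<bullet> b) * F' b)" by (simp add: sum scaleR)
    finally show ?thesis by (simp add: inner_sum_right mult.commute)
  qed
  hence "(\<lambda>h. h \<bullet> (\<Sum>b\<in>Basis. F' b *\<^sub>R b)) = F'" by (intro ext) (rule sym)
  hence "GDERIV F x :> (\<Sum>b\<in>Basis. F' b *\<^sub>R b)"
    using F' by (simp only: gderiv_def)
  moreover have "D = D'" if "GDERIV F x :> D" "GDERIV F x :> D'" for D D'
  proof -
    have "(\<lambda>h. h \<bullet> D) = (\<lambda>h. h \<bullet> D')"
      using that has_derivative_unique unfolding gderiv_def by blast
    hence "(D - D') \<bullet> (D - D') = 0" by (metis inner_diff_right right_minus_eq)
    thus ?thesis by simp
  qed
  ultimately show ?thesis unfolding grad_def by (metis (mono_tags, lifting) theI)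
qed

lemma C2_grad_has_derivative:
  "C2 F \<Longrightarrow> (grad F has_derivative hess F x) (at x)"
  unfolding C2_def hess_def by (metis frechet_derivative_works)

lemma C2_hess_linear: "C2 F \<Longrightarrow> bounded_linear (hess F x)"
  by (meson C2_grad_has_derivative has_derivative_bounded_linear)

lemma C2_continuous_grad: "C2 F \<Longrightarrow> continuous_on S (grad F)"
  by (meson C2_grad_has_derivative has_derivative_continuous continuous_at_imp_continuous_on)

text \<open>\<open>C2\<close> asks for continuity of the Hessian applied to each fixed vector.
  Expanding the vector in the finite basis turns this into a bound for the whole linear map, uniform
  on the compact set.\<close>

lemma hess_bound_compact:
  fixes F :: "'a::euclidean_space \<Rightarrow> real"
  assumes F: "C2 F" and K: "compact K"
  obtains L where "L \<ge> 0" "\<And>x v. x \<in> K \<Longrightarrow> norm (hess F x v) \<le> L * norm v"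
proof -
  have "\<exists>B. \<forall>x\<in>K. norm (hess F x b) \<le> B" for b
  proof -
    have "continuous_on K (\<lambda>x. hess F x b)"
      using F unfolding C2_def by (meson continuous_on_subset subset_UNIV)
    hence "bounded ((\<lambda>x. hess F x b) ` K)"
      using K by (meson compact_continuous_image compact_imp_bounded)
    thus ?thesis by (auto simp: bounded_iff)
  qed
  then obtain B where B: "norm (hess F x b) \<le> B b" if "x \<in> K" for x b
    by metis
  define L where "L = (\<Sum>b\<in>Basis. \<bar>B b\<bar>)"
  show ?thesis
  proof
    show "L \<ge> 0" by (simp add: L_def sum_nonneg)
    fix x v assume x: "x \<in> K"
    interpret bounded_linear "hess F x" using F by (rule C2_hess_linear)
    have "hess F x v = hess F x (\<Sum>b\<in>Basis. (v \<bullet> b) *\<^sub>R b)" by (simp add: euclidean_representation)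
    also have "\<dots> = (\<Sum>b\<in>Basis. (v \<bullet> b) *\<^sub>R hess F x b)" by (simp add: sum scaleR)
    also have "norm \<dots> \<le> (\<Sum>b\<in>Basis. norm v * \<bar>B b\<bar>)"
    proof (rule sum_norm_le)
      fix b :: 'a assume "b \<in> Basis"
      thus "norm ((v \<bullet> b) *\<^sub>R hess F x b) \<le> norm v * \<bar>B b\<bar>"
        using B[OF x, of b] Basis_le_norm[of b v] by (auto intro!: mult_mono)
    qed
    finally show "norm (hess F x v) \<le> L * norm v"
      by (simp add: L_def sum_distrib_left mult.commute)
  qed
qed

lemma grad_lipschitz_cball:
  fixes F :: "'a::euclidean_space \<Rightarrow> real"
  assumes F: "C2 F"
  obtains L where "L \<ge> 0"
    "\<And>x y. norm x \<le> R \<Longrightarrow> norm y \<le> R \<Longrightarrow> norm (grad F x - grad F y) \<le> L * norm (x - y)"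
proof -
  obtain L where L: "L \<ge> 0" "\<And>x v. x \<in> cball 0 R \<Longrightarrow> norm (hess F x v) \<le> L * norm v"
    using hess_bound_compact[OF F compact_cball] by metis
  show ?thesis
  proof (rule that[OF L(1)])
    fix x y :: 'a assume "norm x \<le> R" "norm y \<le> R"
    thus "norm (grad F x - grad F y) \<le> L * norm (x - y)"
      using L by (intro differentiable_bound[OF convex_cball, of 0 R _ "hess F"])
        (auto intro!: onorm_le has_derivative_at_withinI C2_grad_has_derivative[OF F])
  qed
qed

lemma grad_lipschitz:
  fixes F :: "'a::euclidean_space \<Rightarrow> real"
  assumes F: "C2 F" and b: "bdd_above (range (\<lambda>x. onorm (hess F x)))"
  obtains L where "L \<ge> 0" "\<And>x y. norm (grad F x - grad F y) \<le> L * norm (x - y)"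
proof -
  obtain L where L: "onorm (hess F x) \<le> L" for x using b by (auto simp: bdd_above_def)
  show ?thesis
  proof
    show "L \<ge> 0" using L[of 0] onorm_pos_le[OF C2_hess_linear[OF F], of 0] by linarith
    show "norm (grad F x - grad F y) \<le> L * norm (x - y)" for x y
      using L by (intro differentiable_bound[OF convex_UNIV, of _ "hess F"])
        (auto intro!: has_derivative_at_withinI C2_grad_has_derivative[OF F])
  qed
qed

lemma C2_line_derivatives:
  fixes F :: "'a::euclidean_space \<Rightarrow> real"
  assumes F: "C2 F"
  shows "((\<lambda>s. F (p + s *\<^sub>R e)) has_real_derivative e \<bullet> grad F (p + s *\<^sub>R e)) (at s)"
    and "((\<lambda>s. v \<bullet> grad F (p + s *\<^sub>R e)) has_real_derivative v \<bullet> hess F (p + s *\<^sub>R e) e) (at s within S)"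
proof -
  have l: "((\<lambda>s. p + s *\<^sub>R e) has_derivative (\<lambda>h. h *\<^sub>R e)) (at s within S)" for s S
    by (auto intro!: derivative_eq_intros)
  have "(F has_derivative (\<lambda>h. h \<bullet> grad F (p + s *\<^sub>R e))) (at (p + s *\<^sub>R e))"
    using C2_GDERIV[OF F] by (simp add: gderiv_def)
  from has_derivative_compose[OF l this]
  show "((\<lambda>s. F (p + s *\<^sub>R e)) has_real_derivative e \<bullet> grad F (p + s *\<^sub>R e)) (at s)"
    by (simp add: has_field_derivative_def mult.commute[of _ "e \<bullet> _"])
  interpret bounded_linear "hess F (p + s *\<^sub>R e)" using F by (rule C2_hess_linear)
  have "((\<lambda>s. grad F (p + s *\<^sub>R e)) has_derivative (\<lambda>h. hess F (p + s *\<^sub>R e) (h *\<^sub>R e))) (at s within S)"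
    using has_derivative_compose[OF l C2_grad_has_derivative[OF F]] .
  from has_derivative_inner_right[OF this, of v]
  show "((\<lambda>s. v \<bullet> grad F (p + s *\<^sub>R e)) has_real_derivative v \<bullet> hess F (p + s *\<^sub>R e) e) (at s within S)"
    by (simp add: has_field_derivative_def scaleR mult.commute[of _ "v \<bullet> _"])
qed

text \<open>Strict convexity is available only along segments avoiding the ball, but short segments
  through a point at positive distance from it qualify. On such a line the tangent inequalities at 0
  and at s > 0 show that the directional derivative at s is at least its value at 0, which a
  negative second derivative at 0 would contradict.\<close>

lemma hess_nonneg_outside:
  fixes U :: "'a::euclidean_space \<Rightarrow> real"
  assumes U: "C2 U" and sc: "strictly_convex_outside U (ball z \<rho>)" and p: "dist z p > \<rho>"
  shows "e \<bullet> hess U p e \<ge> 0"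
proof (cases "e = 0")
  case True thus ?thesis by simp
next
  case e: False
  define \<tau> where "\<tau> = (dist z p - \<rho>) / norm e"
  have \<tau>: "\<tau> > 0" using p e by (simp add: \<tau>_def)
  have out: "p + s *\<^sub>R e \<notin> ball z \<rho>" if "\<bar>s\<bar> < \<tau>" for s
  proof -
    have "dist z p \<le> dist z (p + s *\<^sub>R e) + \<bar>s\<bar> * norm e"
      using dist_triangle[of z p "p + s *\<^sub>R e"] by (simp add: dist_norm)
    moreover have "\<bar>s\<bar> * norm e < dist z p - \<rho>"
      using that e by (simp add: \<tau>_def field_simps)
    ultimately show ?thesis by simp
  qed
  define u where "u = (\<lambda>s. U (p + s *\<^sub>R e))"
  define u' where "u' = (\<lambda>s. e \<bullet> grad U (p + s *\<^sub>R e))"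
  have du: "(u has_real_derivative u' s) (at s)" for s
    unfolding u_def u'_def using C2_line_derivatives(1)[OF U] .
  have cv: "convex_on {-\<tau><..<\<tau>} u"
  proof (rule convex_onI)
    fix t a b :: real assume t: "0 < t" "t < 1" and a: "a \<in> {-\<tau><..<\<tau>}" and b: "b \<in> {-\<tau><..<\<tau>}"
    show "u ((1 - t) *\<^sub>R a + t *\<^sub>R b) \<le> (1 - t) * u a + t * u b"
    proof (cases "a = b")
      case True thus ?thesis by (simp add: algebra_simps)
    next
      case False
      have eq: "p + ((1 - s) * a + s * b) *\<^sub>R e = (1 - s) *\<^sub>R (p + a *\<^sub>R e) + s *\<^sub>R (p + b *\<^sub>R e)" for s
        by (simp add: algebra_simps)
      have seg: "closed_segment (p + a *\<^sub>R e) (p + b *\<^sub>R e) \<inter> ball z \<rho> = {}"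
      proof -
        have "(1 - s) *\<^sub>R (p + a *\<^sub>R e) + s *\<^sub>R (p + b *\<^sub>R e) \<notin> ball z \<rho>" if s: "0 \<le> s" "s \<le> 1" for s
        proof -
          have "(1 - s) *\<^sub>R a + s *\<^sub>R b \<in> {-\<tau><..<\<tau>}"
            using convexD_alt[OF convex_real_interval(8) a b s] by simp
          thus ?thesis using out[of "(1 - s) * a + s * b"] by (auto simp flip: eq simp: abs_less_iff)
        qed
        thus ?thesis unfolding closed_segment_def by blast
      qed
      have "p + a *\<^sub>R e \<noteq> p + b *\<^sub>R e" using False e by simp
      with sc seg t show ?thesis unfolding strictly_convex_outside_def u_def
        by (simp add: eq less_imp_le)
    qed
  qed simp
  have mono: "u' s \<ge> u' 0" if "0 < s" "s < \<tau>" for s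
  proof -
    have "u s - u 0 \<ge> u' 0 * (s - 0)"
      by (rule convex_on_imp_above_tangent[OF cv, of 0]) (use that \<tau> du in \<open>auto intro: has_field_derivative_at_within\<close>)
    moreover have "u 0 - u s \<ge> u' s * (0 - s)"
      by (rule convex_on_imp_above_tangent[OF cv, of s]) (use that \<tau> du in \<open>auto intro: has_field_derivative_at_within\<close>)
    ultimately have "s * u' 0 \<le> s * u' s" by (simp add: mult.commute)
    thus ?thesis using that by simp
  qed
  have d: "(u' has_real_derivative e \<bullet> hess U p e) (at 0)"
    unfolding u'_def using C2_line_derivatives(2)[OF U, where s=0 and S=UNIV] by simp
  show ?thesis
  proof (rule ccontr)
    assume "\<not> e \<bullet> hess U p e \<ge> 0"
    then obtain d where "d > 0" "\<And>h. h > 0 \<Longrightarrow> h < d \<Longrightarrow> u' (0 + h) < u' 0"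
      using DERIV_neg_dec_right[OF d] by auto
    moreover define h where "h = min d \<tau> / 2"
    moreover have "h > 0" "h < d" "h < \<tau>" using \<open>d > 0\<close> \<tau> by (auto simp: h_def min_def)
    ultimately show False using mono[of h] by fastforce
  qed
qed

text \<open>Compactness gives the bound on the closed ball, convexity outside it. It is what keeps
  the infimum in \<open>kappa\<close> finite.\<close>

lemma hess_lower_bound:
  fixes U :: "'a::euclidean_space \<Rightarrow> real"
  assumes U: "C2 U" and sc: "strictly_convex_outside U (ball z \<rho>)"
  obtains L where "L \<ge> 0" "\<And>p e. norm e = 1 \<Longrightarrow> e \<bullet> hess U p e \<ge> - L"
proof -
  obtain L where L: "L \<ge> 0" "\<And>x v. x \<in> cball z \<rho> \<Longrightarrow> norm (hess U x v) \<le> L * norm v"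
    using hess_bound_compact[OF U compact_cball] by metis
  show ?thesis
  proof (rule that[OF L(1)])
    fix p e :: 'a assume e: "norm e = 1"
    show "e \<bullet> hess U p e \<ge> - L"
    proof (cases "dist z p > \<rho>")
      case True thus ?thesis using hess_nonneg_outside[OF U sc True, of e] L(1) by linarith
    next
      case False
      hence "norm (hess U p e) \<le> L" using L(2)[of p e] e by simp
      moreover have "\<bar>e \<bullet> hess U p e\<bar> \<le> norm e * norm (hess U p e)" by (rule Cauchy_Schwarz_ineq2)
      ultimately show ?thesis using e by simp
    qed
  qed
qed

text \<open>The fundamental theorem of calculus turns the averaged Hessian in \<open>kappa\<close>
  into a difference quotient of the gradient, the form in which the drift of a pair meets
  it.\<close>

lemma hess_segment_integral:
  fixes U :: "'a::euclidean_space \<Rightarrow> real"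
  assumes U: "C2 U" and "x \<noteq> y"
  defines "e \<equiv> (x - y) /\<^sub>R norm (x - y)"
  shows "((\<lambda>t. e \<bullet> hess U ((1 - t) *\<^sub>R x + t *\<^sub>R y) e) has_integral
           (x - y) \<bullet> (grad U x - grad U y) / (norm (x - y))\<^sup>2) {0..1}"
proof -
  define N where "N = norm (x - y)"
  have N: "N > 0" using assms by (simp add: N_def)
  have xy: "y - x = - (N *\<^sub>R e)" using N by (simp add: e_def N_def)
  have eq: "(1 - t) *\<^sub>R x + t *\<^sub>R y = x + t *\<^sub>R (y - x)" for t by (simp add: algebra_simps)
  have "((\<lambda>t. e \<bullet> hess U (x + t *\<^sub>R (y - x)) (y - x)) has_integral
          (e \<bullet> grad U (x + 1 *\<^sub>R (y - x)) - e \<bullet> grad U (x + 0 *\<^sub>R (y - x)))) {0..1}"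
    by (rule fundamental_theorem_of_calculus)
      (auto simp flip: has_real_derivative_iff_has_vector_derivative intro!: C2_line_derivatives(2)[OF U])
  from has_integral_mult_right[OF this, of "- 1 / N"]
  have "((\<lambda>t. (- 1 / N) * (e \<bullet> hess U (x + t *\<^sub>R (y - x)) (y - x))) has_integral
          (- 1 / N) * (e \<bullet> grad U y - e \<bullet> grad U x)) {0..1}" by simp
  moreover have "(- 1 / N) * (e \<bullet> hess U (x + t *\<^sub>R (y - x)) (y - x)) = e \<bullet> hess U (x + t *\<^sub>R (y - x)) e" for t
  proof -
    interpret bounded_linear "hess U q" for q using U by (rule C2_hess_linear)
    show ?thesis using N by (simp only: xy neg scaleR) simp
  qed
  moreover have "(- 1 / N) * (e \<bullet> grad U y - e \<bullet> grad U x) = (x - y) \<bullet> (grad U x - grad U y) / (norm (x - y))\<^sup>2"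
    using N unfolding e_def N_def[symmetric] inner_scaleR_left by (simp add: inner_diff_right divide_simps power2_eq_square)
  ultimately show ?thesis by (simp add: eq)
qed

text \<open>The Hessian bound makes the set under \<open>Inf\<close> bounded below, so that the
  infimum really is a lower bound of its elements. The first inequality is then a one-sided
  Lipschitz condition with a constant depending on the distance; in this form \<open>kappa\<close>
  enters the dynamics.\<close>

lemma kappa_bounds:
  fixes U :: "'a::euclidean_space \<Rightarrow> real"
  assumes U: "C2 U" and sc: "strictly_convex_outside U (ball z \<rho>)"
  shows "kappa U (norm (x - y)) * (norm (x - y))\<^sup>2 \<le> (x - y) \<bullet> (grad U x - grad U y)"
    and "\<exists>L\<ge>0. \<forall>r>0. kappa U r \<ge> - L"
proof -
  obtain L where L: "L \<ge> 0" "\<And>p e. norm e = 1 \<Longrightarrow> e \<bullet> hess U p e \<ge> - L"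
    using hess_lower_bound[OF U sc] by metis
  define Q where "Q = (\<lambda>x y. (x - y) \<bullet> (grad U x - grad U y) / (norm (x - y))\<^sup>2)"
  define S where "S = (\<lambda>r. {Q x y | x y. norm (x - y) = r})"
  have kS: "kappa U r = Inf (S r)" if "r > 0" for r
  proof -
    have "integral {0..1} (\<lambda>t. let e = (x - y) /\<^sub>R norm (x - y) in e \<bullet> hess U ((1 - t) *\<^sub>R x + t *\<^sub>R y) e) = Q x y"
      if "norm (x - y) = r" for x y
      using hess_segment_integral[OF U, of x y] that \<open>r > 0\<close> unfolding Let_def Q_def
      by (intro integral_unique) auto
    thus ?thesis unfolding kappa_def S_def by (intro arg_cong[where f=Inf]) (auto, metis)
  qed
  have lo: "Q x y \<ge> - L" if "x \<noteq> y" for x y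
  proof -
    have "norm ((x - y) /\<^sub>R norm (x - y)) = 1" using that by simp
    thus ?thesis
      using has_integral_le[OF has_integral_const_real[of "- L" 0 1] hess_segment_integral[OF U that] L(2)]
      unfolding Q_def by simp
  qed
  hence lb: "\<forall>q\<in>S r. - L \<le> q" if "r > 0" for r using that unfolding S_def by force
  hence bdd: "bdd_below (S r)" if "r > 0" for r using that by (meson bdd_belowI)
  show "\<exists>L\<ge>0. \<forall>r>0. kappa U r \<ge> - L"
  proof (intro exI[of _ L] conjI allI impI)
    fix r :: real assume r: "r > 0"
    obtain b :: 'a where "b \<in> Basis" by (meson nonempty_Basis ex_in_conv)
    hence "norm (r *\<^sub>R b - 0) = r" using r by simp
    hence "S r \<noteq> {}" unfolding S_def by blast
    thus "- L \<le> kappa U r" using lb[OF r] kS[OF r] by (simp add: cInf_greatest)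
  qed (rule L(1))
  show "kappa U (norm (x - y)) * (norm (x - y))\<^sup>2 \<le> (x - y) \<bullet> (grad U x - grad U y)"
  proof (cases "x = y")
    case False
    hence "kappa U (norm (x - y)) \<le> Q x y"
      using kS[of "norm (x - y)"] bdd[of "norm (x - y)"] by (auto intro!: cInf_lower simp: S_def)
    thus ?thesis using False by (simp add: Q_def field_simps)
  qed simp
qed

section \<open>The concave function \<open>f\<close>\<close>

lemma integral_from_0_has_derivative:
  fixes F :: "real \<Rightarrow> real"
  assumes "continuous_on {0..} F" "r \<ge> 0"
  shows "((\<lambda>x. integral {0..x} F) has_real_derivative F r) (at r within {0..})"
proof -
  have "((\<lambda>x. integral {0..x} F) has_real_derivative F r) (at r within {0..r+1})"
    using assms by (intro integral_has_real_derivative) (auto elim: continuous_on_subset)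
  moreover have "at r within {0..r+1} = at r within {0..}"
    by (rule at_within_nhd[of _ "{..<r+1}"]) auto
  ultimately show ?thesis by simp
qed

lemma le_by_derivative_bound:
  fixes F :: "real \<Rightarrow> real"
  assumes "u \<le> v"
    and d: "\<And>w. w \<in> {u..v} \<Longrightarrow> (F has_real_derivative F' w) (at w within {u..v})"
    and b: "\<And>w. w \<in> {u..v} \<Longrightarrow> F' w \<le> - l"
  shows "F v \<le> F u - l * (v - u)"
proof -
  have "(F' has_integral (F v - F u)) {u..v}"
    using assms by (intro fundamental_theorem_of_calculus)
      (auto simp flip: has_real_derivative_iff_has_vector_derivative)
  from has_integral_le[OF this has_integral_const_real[of "- l" u v]] b
  have "F v - F u \<le> (v - u) * (- l)" using \<open>u \<le> v\<close> by simp
  thus ?thesis by (simp add: algebra_simps)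
qed

locale kappa_potential =
  fixes U :: "'a::euclidean_space \<Rightarrow> real"
  assumes kappa_cont: "continuous_on {0<..} (kappa U)"
    and kappa_liminf: "Liminf at_top (\<lambda>r. ereal (kappa U r)) > 0"
    and kappa_0: "((\<lambda>r. r * kappa U r) \<longlongrightarrow> 0) (at_right 0)"
begin

lemma kappa_eventually_pos:
  obtains e N where "e > 0" "N > 0" "\<And>r. r \<ge> N \<Longrightarrow> kappa U r \<ge> e"
proof -
  obtain e' where e': "0 < e'" "e' < Liminf at_top (\<lambda>r. ereal (kappa U r))"
    using kappa_liminf dense by blast
  then obtain e where e: "e' = ereal e" by (cases e') auto
  have "\<forall>\<^sub>F r in at_top. ereal e < ereal (kappa U r)"
    using e'(2) unfolding e by (rule less_LiminfD)
  then obtain N where "\<And>r. r \<ge> N \<Longrightarrow> e < kappa U r"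
    by (auto simp: eventually_at_top_linorder)
  thus ?thesis using e' e by (intro that[of e "max N 1"]) (auto intro: less_imp_le)
qed

lemma R0_nonneg: "R0 U \<ge> 0"
  and kappa_nonneg: "r > R0 U \<Longrightarrow> kappa U r \<ge> 0"
proof -
  define A where "A = {R. 0 \<le> R \<and> (\<forall>r>0. R \<le> r \<longrightarrow> 0 \<le> kappa U r)}"
  obtain e N where "e > 0" "N > 0" "\<And>r. r \<ge> N \<Longrightarrow> kappa U r \<ge> e"
    using kappa_eventually_pos by blast
  hence N: "N \<in> A" unfolding A_def by fastforce
  show nn: "R0 U \<ge> 0"
    unfolding R0_def A_def[symmetric] using N by (intro cInf_greatest) (auto simp: A_def)
  show "kappa U r \<ge> 0" if r: "r > R0 U"
  proof -
    obtain R where "R \<in> A" "R < r"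
      using cInf_lessD[of A r] N r unfolding R0_def A_def[symmetric] by blast
    thus ?thesis using r nn unfolding A_def by auto
  qed
qed

lemma R1_gt_R0: "R1 U > R0 U"
  and kappa_R1: "r > R1 U \<Longrightarrow> kappa U r \<ge> 8 / (R1 U * (R1 U - R0 U))"
proof -
  define A where "A = {R. R0 U \<le> R \<and> (\<forall>r>0. R \<le> r \<longrightarrow> 8 \<le> kappa U r * R * (R - R0 U))}"
  obtain e N where e: "e > 0" "N > 0" "\<And>r. r \<ge> N \<Longrightarrow> kappa U r \<ge> e"
    using kappa_eventually_pos by blast
  define M where "M = N + 8 / e + R0 U + 1"
  have M: "M \<ge> N" "M \<ge> 8 / e" "M - R0 U \<ge> 1" using e R0_nonneg by (auto simp: M_def)
  have "M \<in> A"
  proof -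
    have "8 \<le> kappa U r * M * (M - R0 U)" if "M \<le> r" for r
    proof -
      have "8 \<le> e * M * 1" using M(2) e by (simp add: field_simps)
      also have "\<dots> \<le> kappa U r * M * (M - R0 U)"
        using e(1,2) e(3)[of r] M that by (intro mult_mono mult_nonneg_nonneg) auto
      finally show ?thesis .
    qed
    thus ?thesis using M unfolding A_def by auto
  qed
  have ge: "R1 U \<ge> R0 U"
    unfolding R1_def A_def[symmetric] using \<open>M \<in> A\<close> by (intro cInf_greatest) (auto simp: A_def)
  \<comment> \<open>The inequality is known for members R of \<open>A\<close> only. For fixed r
    beyond the infimum, members of \<open>A\<close> approach it from the right, and the expression
    is continuous in R.\<close>
  have lim: "8 \<le> kappa U r * R1 U * (R1 U - R0 U)" if r: "r > R1 U" for r
  proof (rule ccontr)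
    assume "\<not> ?thesis"
    hence l: "kappa U r * R1 U * (R1 U - R0 U) < 8" by simp
    have "((\<lambda>x. kappa U r * x * (x - R0 U)) \<longlongrightarrow> kappa U r * R1 U * (R1 U - R0 U)) (at_right (R1 U))"
      by (intro tendsto_intros)
    from order_tendstoD(2)[OF this l]
    obtain b where b: "b > R1 U" "\<And>x. x > R1 U \<Longrightarrow> x < b \<Longrightarrow> kappa U r * x * (x - R0 U) < 8"
      by (auto simp: eventually_at_right_field)
    have "Inf A < min b r" using b r by (simp add: R1_def A_def)
    then obtain R where R: "R \<in> A" "R < b" "R < r"
      using cInf_lessD[of A "min b r"] \<open>M \<in> A\<close> by auto
    have "R \<ge> R1 U" unfolding R1_def A_def[symmetric] using R
      by (intro cInf_lower bdd_belowI[of _ "R0 U"]) (auto simp: A_def)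
    moreover have "8 \<le> kappa U r * R * (R - R0 U)" using R r ge R0_nonneg by (auto simp: A_def)
    ultimately show False using b(2)[of R] R l by (cases "R = R1 U") auto
  qed
  \<comment> \<open>Were this product 0, the right-hand side of \<open>lim\<close> would
    vanish.\<close>
  have "R1 U * (R1 U - R0 U) \<noteq> 0" using lim[of "R1 U + 1"] by auto
  thus gt: "R1 U > R0 U" using ge by auto
  show "kappa U r \<ge> 8 / (R1 U * (R1 U - R0 U))" if "r > R1 U"
    using lim[OF that] gt R0_nonneg by (simp add: field_simps)
qed

lemma R1_pos: "R1 U > 0" using R1_gt_R0 R0_nonneg by linarith

text \<open>Beyond \<open>R1 U\<close> there is a positive lower bound, and continuity at
  \<open>R1 U\<close> extends half of it to a margin on the left. The margin leaves room to switch
  the concavity of f off continuously before \<open>R1 U\<close>, where the drift contracts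
  already.\<close>

lemma kappa_lower_before_R1:
  obtains Rs k0 where "0 < Rs" "Rs < R1 U" "k0 > 0" "\<And>r. r \<ge> Rs \<Longrightarrow> kappa U r \<ge> k0"
proof -
  define K where "K = 8 / (R1 U * (R1 U - R0 U))"
  have K: "K > 0" using R1_gt_R0 R1_pos by (simp add: K_def)
  have "isCont (kappa U) (R1 U)"
    using kappa_cont R1_pos by (simp add: continuous_on_eq_continuous_at open_greaterThan)
  then obtain d where d: "d > 0" "\<And>r. \<bar>r - R1 U\<bar> < d \<Longrightarrow> \<bar>kappa U r - kappa U (R1 U)\<bar> < K / 4"
    unfolding continuous_at_eps_delta dist_real_def using K by (metis divide_pos_pos zero_less_numeral)
  have "kappa U (R1 U) > 3 * K / 4"
  proof -
    have "\<bar>kappa U (R1 U + d/2) - kappa U (R1 U)\<bar> < K / 4" using d by auto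
    moreover have "kappa U (R1 U + d/2) \<ge> K" using kappa_R1[of "R1 U + d / 2"] d(1) by (simp add: K_def)
    ultimately show ?thesis by linarith
  qed
  hence near: "kappa U r \<ge> K / 2" if "r > R1 U - d" "r \<le> R1 U" for r
  proof -
    have "\<bar>kappa U r - kappa U (R1 U)\<bar> < K / 4" using d that by auto
    thus ?thesis using \<open>kappa U (R1 U) > 3 * K / 4\<close> by linarith
  qed
  show ?thesis
  proof (rule that[of "max (R1 U / 2) (R1 U - d / 2)" "K / 2"])
    fix r assume "r \<ge> max (R1 U / 2) (R1 U - d / 2)"
    thus "kappa U r \<ge> K / 2"
      using near[of r] kappa_R1[of r] d(1) K unfolding K_def[symmetric] by (cases "r > R1 U") auto
  qed (use R1_pos d K in auto)
qed

text \<open>\<open>- q_fun / 4\<close> is the logarithmic derivative of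
  \<open>phi U\<close>.\<close>

definition q_fun :: "real \<Rightarrow> real" where "q_fun s = s * max (- kappa U s) 0"

lemma q_fun_nonneg: "s \<ge> 0 \<Longrightarrow> q_fun s \<ge> 0" by (simp add: q_fun_def)

lemma q_fun_0: "s > R0 U \<Longrightarrow> q_fun s = 0" using kappa_nonneg[of s] by (simp add: q_fun_def)

text \<open>At 0 the factor s gives the value 0 whatever \<open>kappa U 0\<close> is, and the
  assumption that r \<kappa>(r) tends to 0 gives the matching limit from the right.\<close>

lemma q_fun_cont: "continuous_on {0..} q_fun"
proof -
  have "continuous (at s within {0..}) q_fun" if s: "s \<ge> 0" for s
  proof (cases "s = 0")
    case True
    have "((\<lambda>r. \<bar>r * kappa U r\<bar>) \<longlongrightarrow> 0) (at_right 0)"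
      using tendsto_rabs[OF kappa_0] by simp
    hence "(q_fun \<longlongrightarrow> 0) (at_right 0)"
    proof (rule tendsto_sandwich[rotated 3])
      show "\<forall>\<^sub>F r in at_right 0. q_fun r \<le> \<bar>r * kappa U r\<bar>"
        by (intro eventually_at_right_less[THEN eventually_mono]) (auto simp: q_fun_def abs_mult)
      show "\<forall>\<^sub>F r in at_right 0. 0 \<le> q_fun r"
        by (intro eventually_at_right_less[THEN eventually_mono]) (auto simp: q_fun_def)
    qed simp
    moreover have "at_right (0::real) = at 0 within {0..}"
      by (rule at_within_Ici_at_right[symmetric])
    ultimately show ?thesis using True by (simp add: continuous_within q_fun_def)
  next
    case False
    have "continuous_on {0<..} q_fun"
      unfolding q_fun_def by (intro continuous_intros kappa_cont)
    hence "isCont q_fun s" using False s by (simp add: continuous_on_eq_continuous_at open_greaterThan)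
    thus ?thesis by (rule continuous_at_imp_continuous_at_within)
  qed
  thus ?thesis by (simp add: continuous_on_eq_continuous_within)
qed

lemma phi_alt: "phi U r = exp (- (1/4) * integral {0..r} q_fun)"
  by (simp add: phi_def q_fun_def[abs_def])

lemma phi_deriv: "r \<ge> 0 \<Longrightarrow> (phi U has_real_derivative (- (1/4) * q_fun r * phi U r)) (at r within {0..})"
  unfolding phi_alt[abs_def]
  by (auto intro!: derivative_eq_intros integral_from_0_has_derivative q_fun_cont)

lemma phi_cont: "continuous_on {0..} (phi U)"
  by (rule DERIV_continuous_on) (rule phi_deriv, simp)

lemma phi_pos: "phi U r > 0" by (simp add: phi_def)

lemma q_int: "0 \<le> a \<Longrightarrow> q_fun integrable_on {a..b}"
  using q_fun_cont by (intro integrable_continuous_interval) (auto elim: continuous_on_subset)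

lemma phi_antimono: "0 \<le> r \<Longrightarrow> r \<le> s \<Longrightarrow> phi U s \<le> phi U r"
  unfolding phi_alt using q_int q_fun_nonneg by (auto intro!: integral_subset_le)

lemma phi_le_1: "0 \<le> r \<Longrightarrow> phi U r \<le> 1"
  using phi_antimono[of 0 r] by (simp add: phi_def)

text \<open>\<open>kappa U\<close> is nonnegative beyond \<open>R0 U\<close>, so the exponent stops
  changing there. Hence \<open>phi U (R0 U)\<close> is the minimum of \<open>phi U\<close> on the
  half-line, the source of the lower bounds for f'.\<close>

lemma phi_const: "r \<ge> R0 U \<Longrightarrow> phi U r = phi U (R0 U)"
proof -
  assume r: "r \<ge> R0 U"
  have "integral {R0 U..r} q_fun = integral {R0 U..r} (\<lambda>_. 0)"
    by (rule integral_spike[of "{R0 U}"]) (auto intro: q_fun_0)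
  moreover have "integral {0..R0 U} q_fun + integral {R0 U..r} q_fun = integral {0..r} q_fun"
    using r R0_nonneg q_int by (intro Henstock_Kurzweil_Integration.integral_combine) auto
  ultimately show ?thesis by (simp add: phi_alt)
qed

lemma phi_lower: "r \<ge> 0 \<Longrightarrow> phi U r \<ge> phi U (R0 U)"
  using phi_const[of r] phi_antimono[of r "R0 U"] by linarith

lemma Phi_deriv: "r \<ge> 0 \<Longrightarrow> (Phi U has_real_derivative phi U r) (at r within {0..})"
  unfolding Phi_def[abs_def] by (intro integral_from_0_has_derivative phi_cont)

lemma Phi_cont: "continuous_on {0..} (Phi U)"
  by (rule DERIV_continuous_on) (rule Phi_deriv, simp)

lemma phi_int: "0 \<le> a \<Longrightarrow> phi U integrable_on {a..b}"
  using phi_cont by (intro integrable_continuous_interval) (auto elim: continuous_on_subset)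

lemma Phi_lower: assumes "r \<ge> 0" shows "Phi U r \<ge> phi U (R0 U) * r"
  using integral_le[OF integrable_const_ivl[of "phi U (R0 U)" 0 r] phi_int] phi_lower assms
  by (simp add: Phi_def mult.commute)

definition ratio :: "real \<Rightarrow> real" where "ratio s = Phi U s / phi U s"

lemma ratio_cont: "continuous_on {0..} ratio"
  unfolding ratio_def using phi_pos by (intro continuous_intros Phi_cont phi_cont) (metis less_irrefl)

lemma ratio_int: "0 \<le> a \<Longrightarrow> ratio integrable_on {a..b}"
  using ratio_cont by (intro integrable_continuous_interval) (auto elim: continuous_on_subset)

lemma ratio_lower: assumes "s \<ge> 0" shows "ratio s \<ge> phi U (R0 U) * s"
proof -
  have "Phi U s / 1 \<le> Phi U s / phi U s"
    using assms phi_pos phi_le_1 Phi_lower[OF assms]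
    by (intro divide_left_mono) (auto intro: order_trans[rotated] simp: less_imp_le)
  thus ?thesis using Phi_lower[OF assms] by (simp add: ratio_def)
qed

lemma ratio_nonneg: "s \<ge> 0 \<Longrightarrow> ratio s \<ge> 0"
  using ratio_lower[of s] phi_pos[of "R0 U"] by (meson mult_nonneg_nonneg less_imp_le order_trans)

text \<open>This normaliser lets \<open>g_fun U\<close> fall from 1 to exactly 1/2 up to
  \<open>R1 U\<close>; its reciprocal is one of the two candidates for the contraction rate.\<close>

definition norm_const :: real where "norm_const = integral {0..R1 U} ratio"

lemma norm_const_pos: "norm_const > 0"
proof -
  have "((\<lambda>s. phi U (R0 U) * s) has_integral phi U (R0 U) * (R1 U)\<^sup>2 / 2 - phi U (R0 U) * 0\<^sup>2 / 2) {0..R1 U}"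
    by (rule fundamental_theorem_of_calculus)
      (use R1_pos in \<open>auto simp flip: has_real_derivative_iff_has_vector_derivative intro!: derivative_eq_intros\<close>)
  from has_integral_le[OF this integrable_integral[OF ratio_int]] ratio_lower
  have "phi U (R0 U) * (R1 U)\<^sup>2 / 2 \<le> norm_const" by (simp add: norm_const_def)
  moreover have "phi U (R0 U) * (R1 U)\<^sup>2 / 2 > 0" using phi_pos R1_pos by simp
  ultimately show ?thesis by linarith
qed

lemma g_alt: "g_fun U r = 1 - (1/2) * (integral {0..min r (R1 U)} ratio / norm_const)"
  by (simp add: g_fun_def ratio_def[abs_def] norm_const_def)

lemma g_bounds: "r \<ge> 0 \<Longrightarrow> g_fun U r \<ge> 1/2" "r \<ge> 0 \<Longrightarrow> g_fun U r \<le> 1"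
proof -
  assume r: "r \<ge> 0"
  have "integral {0..min r (R1 U)} ratio \<le> norm_const"
    unfolding norm_const_def using ratio_int ratio_nonneg by (intro integral_subset_le) auto
  moreover have "integral {0..min r (R1 U)} ratio \<ge> 0"
    using ratio_int ratio_nonneg by (intro integral_nonneg) auto
  ultimately show "g_fun U r \<ge> 1/2" "g_fun U r \<le> 1"
    using norm_const_pos by (auto simp: g_alt field_simps)
qed

lemma g_cont: "continuous_on {0..} (g_fun U)"
proof -
  have "continuous_on {0..} (\<lambda>x. integral {0..x} ratio)"
    by (rule DERIV_continuous_on) (rule integral_from_0_has_derivative[OF ratio_cont], simp)
  hence "continuous_on {0..} (\<lambda>r. integral {0..min r (R1 U)} ratio)"
    by (rule continuous_on_compose2) (use R1_pos in \<open>auto intro!: continuous_intros\<close>)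
  thus ?thesis unfolding g_alt[abs_def] by (intro continuous_intros) (use norm_const_pos in auto)
qed

lemma g_deriv: "0 \<le> r \<Longrightarrow> r \<le> R1 U \<Longrightarrow>
    (g_fun U has_real_derivative - (1/2) * (ratio r / norm_const)) (at r within {0..R1 U})"
proof -
  assume r: "0 \<le> r" "r \<le> R1 U"
  have "((\<lambda>x. 1 - (1/2) * (integral {0..x} ratio / norm_const)) has_real_derivative
      - (1/2) * (ratio r / norm_const)) (at r within {0..R1 U})"
    using r norm_const_pos
    by (auto intro!: derivative_eq_intros has_field_derivative_subset[OF integral_from_0_has_derivative[OF ratio_cont]])
  thus ?thesis
    by (rule has_field_derivative_transform_within[OF _ zero_less_one]) (use r in \<open>auto simp: g_alt min_def\<close>)
qed

definition df :: "real \<Rightarrow> real" where "df r = phi U r * g_fun U r"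

lemma df_cont: "continuous_on {0..} df"
  unfolding df_def by (intro continuous_intros phi_cont g_cont)

lemma f_deriv: "r \<ge> 0 \<Longrightarrow> (f_fun U has_real_derivative df r) (at r within {0..})"
  unfolding f_fun_def[abs_def] df_def[symmetric]
  by (intro integral_from_0_has_derivative) (auto simp: df_cont)

lemma f_0: "f_fun U 0 = 0" by (simp add: f_fun_def)

lemma df_le_1: "r \<ge> 0 \<Longrightarrow> df r \<le> 1"
  unfolding df_def using phi_le_1[of r] phi_pos[of r] g_bounds[of r] by (intro mult_le_one) auto

lemma df_le_phi: "r \<ge> 0 \<Longrightarrow> df r \<le> phi U r"
  unfolding df_def using g_bounds[of r] phi_pos[of r] by (simp add: mult_left_le)

text \<open>\<open>phi U\<close> is at least \<open>phi U (R0 U)\<close> and \<open>g_fun U\<close>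
  is at least 1/2. The comparison of f with the identity rests on this number, and through it
  \<theta> and the prefactor of the \<open>W_l1\<close> bound.\<close>

definition df_min :: real where "df_min = phi U (R0 U) / 2"

lemma df_min_pos: "df_min > 0" by (simp add: df_min_def phi_pos)

lemma df_lower: assumes "r \<ge> 0" shows "df r \<ge> df_min"
proof -
  have "phi U (R0 U) * (1/2) \<le> phi U r * g_fun U r"
    using assms phi_lower phi_pos[of "R0 U"] phi_pos[of r] g_bounds by (intro mult_mono) auto
  thus ?thesis by (simp add: df_def df_min_def)
qed

text \<open>The formula for f'' up to \<open>R1 U\<close>. The first term, from \<open>phi\<close>,
  offsets the negative part of \<open>kappa\<close>; the second, from \<open>g_fun\<close>, provides
  decay, because \<open>Phi U\<close> dominates f.\<close>

lemma df_deriv: "0 \<le> r \<Longrightarrow> r \<le> R1 U \<Longrightarrow>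
    (df has_real_derivative - (1/4 * q_fun r * df r + Phi U r / (2 * norm_const))) (at r within {0..R1 U})"
proof -
  assume r: "0 \<le> r" "r \<le> R1 U"
  have "((\<lambda>r. phi U r * g_fun U r) has_real_derivative
     (- (1/4) * q_fun r * phi U r) * g_fun U r + (- (1/2) * (ratio r / norm_const)) * phi U r) (at r within {0..R1 U})"
    using r by (intro DERIV_mult has_field_derivative_subset[OF phi_deriv] g_deriv) auto
  moreover have "(- (1/4) * q_fun r * phi U r) * g_fun U r + (- (1/2) * (ratio r / norm_const)) * phi U r
      = - (1/4 * q_fun r * df r + Phi U r / (2 * norm_const))"
    using phi_pos[of r] norm_const_pos by (simp add: df_def ratio_def field_simps)
  ultimately show ?thesis by (simp add: df_def[abs_def])
qed

lemma df_const: "r \<ge> R1 U \<Longrightarrow> df r = df (R1 U)"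
  using phi_const[of r] phi_const[of "R1 U"] R1_gt_R0 by (simp add: df_def g_alt)

lemma f_bounds: assumes "r \<ge> 0" shows "f_fun U r \<le> Phi U r" "f_fun U r \<le> r" "f_fun U r \<ge> df_min * r"
proof -
  have i: "df integrable_on {0..r}"
    using df_cont by (intro integrable_continuous_interval) (auto elim: continuous_on_subset)
  have f: "f_fun U r = integral {0..r} df" by (simp add: f_fun_def df_def[abs_def])
  show "f_fun U r \<le> Phi U r"
    unfolding f Phi_def using i phi_int df_le_phi by (intro integral_le) auto
  show "f_fun U r \<le> r"
    using integral_le[OF i integrable_const_ivl[of 1]] df_le_1 assms by (simp add: f)
  show "f_fun U r \<ge> df_min * r"
    using integral_le[OF integrable_const_ivl[of df_min] i] df_lower assms by (simp add: f mult.commute)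
qed

text \<open>The function \<open>G\<close> replaces \<open>- f''\<close>, which jumps at \<open>R1 U\<close>, by a continuous lower bound.\<close>

lemma strong_concavity:
  obtains G c where "continuous_on {0..} G" "\<And>r. r \<ge> 0 \<Longrightarrow> G r \<ge> 0" "G 0 = 0" "c > 0"
    "\<And>u v l. 0 \<le> u \<Longrightarrow> u \<le> v \<Longrightarrow> (\<And>w. w \<in> {u..v} \<Longrightarrow> l \<le> G w) \<Longrightarrow> df v \<le> df u - l * (v - u)"
    "\<And>r. r > 0 \<Longrightarrow> 2 * G r + 1/2 * r * kappa U r * df r \<ge> c * f_fun U r"
proof -
  obtain Rs k0 where Rs: "0 < Rs" "Rs < R1 U" "k0 > 0" "\<And>r. r \<ge> Rs \<Longrightarrow> kappa U r \<ge> k0"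
    using kappa_lower_before_R1 by blast
  \<comment> \<open>A cutoff equal to 1 up to \<open>Rs\<close> and to 0 from \<open>R1 U\<close>
    on. It makes \<open>G\<close> continuous and still at most -f'' below \<open>R1 U\<close>;
    beyond \<open>R1 U\<close>, where f' is constant, \<open>G\<close> vanishes.\<close>
  define ct where "ct = (\<lambda>r. max 0 (min 1 ((R1 U - r) / (R1 U - Rs))))"
  define G where "G = (\<lambda>r. 1/4 * q_fun r * df r + ct r * Phi U r / (2 * norm_const))"
  \<comment> \<open>Up to \<open>Rs\<close> the decay comes from concavity, with rate
    \<open>1 / norm_const\<close>; beyond it from \<open>kappa U r \<ge> k0\<close> together with
    f(r) \<le> r and f' \<ge> \<open>df_min\<close>.\<close>
  define c where "c = min (1 / norm_const) (1/2 * k0 * df_min)"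
  have ct: "ct r \<ge> 0" "ct r \<le> 1" for r by (auto simp: ct_def)
  have Phi0: "Phi U r \<ge> 0" if "r \<ge> 0" for r
    using Phi_lower[OF that] phi_pos[of "R0 U"] that by (meson mult_nonneg_nonneg less_imp_le order_trans)
  have df0: "df r \<ge> 0" if "r \<ge> 0" for r using df_lower[OF that] df_min_pos by linarith
  have G0: "G r \<ge> 0" if "r \<ge> 0" for r
    unfolding G_def using that q_fun_nonneg df0 Phi0 ct norm_const_pos by (intro add_nonneg_nonneg) auto
  have GR: "G r = 0" if "r \<ge> R1 U" for r
    using that R1_gt_R0 Rs(2) by (simp add: G_def q_fun_0 ct_def field_simps max_def min_def)
  show ?thesis
  proof (rule that[of G c])
    show "continuous_on {0..} G"
      unfolding G_def ct_def using norm_const_pos Rs(2)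
      by (intro continuous_intros q_fun_cont df_cont Phi_cont) auto
    show "G 0 = 0" by (simp add: G_def q_fun_def Phi_def)
    show "c > 0" using norm_const_pos Rs df_min_pos by (simp add: c_def)
    have below: "df v \<le> df u - l * (v - u)"
      if "0 \<le> u" "u \<le> v" "v \<le> R1 U" "\<And>w. w \<in> {u..v} \<Longrightarrow> l \<le> G w" for u v l
    proof (rule le_by_derivative_bound[OF \<open>u \<le> v\<close>])
      fix w assume w: "w \<in> {u..v}"
      show "(df has_real_derivative - (1/4 * q_fun w * df w + Phi U w / (2 * norm_const))) (at w within {u..v})"
        using w that by (intro has_field_derivative_subset[OF df_deriv]) auto
      have "ct w * Phi U w / (2 * norm_const) \<le> 1 * Phi U w / (2 * norm_const)"
        using w that ct Phi0[of w] norm_const_pos by (intro divide_right_mono mult_right_mono) auto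
      thus "- (1/4 * q_fun w * df w + Phi U w / (2 * norm_const)) \<le> - l"
        using that(4)[OF w] by (simp add: G_def)
    qed
    show "df v \<le> df u - l * (v - u)" if uv: "0 \<le> u" "u \<le> v" and l: "\<And>w. w \<in> {u..v} \<Longrightarrow> l \<le> G w" for u v l
    proof (cases "v \<le> R1 U")
      case True thus ?thesis using below uv l by blast
    next
      case False
      \<comment> \<open>The interval reaches beyond \<open>R1 U\<close>, where \<open>G\<close> is
        0. So \<open>l\<close> is not positive, and it is enough that f' is constant there.\<close>
      hence l0: "l \<le> 0" using l[of v] GR[of v] uv by simp
      show ?thesis
      proof (cases "u \<le> R1 U")
        case True
        have "df (R1 U) \<le> df u - l * (R1 U - u)" using below[of u "R1 U" l] True uv l False by auto
        also have "\<dots> \<le> df u - l * (v - u)" using False l0 by (simp add: mult_left_mono_neg)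
        finally show ?thesis using df_const[of v] False by simp
      next
        case False
        thus ?thesis using df_const[of u] df_const[of v] uv l0 by (simp add: mult_nonpos_nonneg)
      qed
    qed
    show "2 * G r + 1/2 * r * kappa U r * df r \<ge> c * f_fun U r" if r: "r > 0" for r
    proof (cases "r \<le> Rs")
      case True
      have "ct r = 1" using True Rs(2) by (simp add: ct_def field_simps)
      \<comment> \<open>The negative part of \<open>kappa\<close> inside \<open>G\<close> and
        \<open>kappa\<close> itself add up to the positive part, which is dropped below; what
        remains is \<open>Phi U r / norm_const\<close>.\<close>
      hence "2 * G r + 1/2 * r * kappa U r * df r = 1/2 * (r * (max (- kappa U r) 0 + kappa U r)) * df r + Phi U r / norm_const"
        by (simp add: G_def q_fun_def field_simps)
      also have "\<dots> \<ge> 0 + f_fun U r / norm_const"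
        using r df0[of r] f_bounds(1)[of r] norm_const_pos
        by (intro add_mono divide_right_mono mult_nonneg_nonneg) auto
      finally have "f_fun U r / norm_const \<le> 2 * G r + 1/2 * r * kappa U r * df r" by simp
      moreover have "c * f_fun U r \<le> 1 / norm_const * f_fun U r"
        unfolding c_def using f_bounds(3)[of r] r df_min_pos
        by (intro mult_right_mono) (auto intro: order_trans[rotated])
      ultimately show ?thesis by simp
    next
      case False
      have "c * f_fun U r \<le> (1/2 * k0 * df_min) * r"
        unfolding c_def using f_bounds(2,3)[of r] r df_min_pos Rs(3)
        by (intro mult_mono) (auto intro: order_trans[rotated])
      also have "\<dots> = 1/2 * r * k0 * df_min" by simp
      also have "\<dots> \<le> 1/2 * r * kappa U r * df r"
        using r Rs(3) Rs(4)[of r] False df_lower[of r] df_min_pos by (intro mult_mono) auto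
      finally show ?thesis using G0[of r] r by simp
    qed
  qed (rule G0)
qed

end

section \<open>Taylor bounds for f and the scalar one-step estimate\<close>

context kappa_potential
begin

lemma df_antimono: "0 \<le> u \<Longrightarrow> u \<le> v \<Longrightarrow> df v \<le> df u"
proof -
  assume uv: "0 \<le> u" "u \<le> v"
  obtain G where G: "\<And>r. r \<ge> 0 \<Longrightarrow> G r \<ge> 0"
    "\<And>u v l. 0 \<le> u \<Longrightarrow> u \<le> v \<Longrightarrow> (\<And>w. w \<in> {u..v} \<Longrightarrow> l \<le> G w) \<Longrightarrow> df v \<le> df u - l * (v - u)"
    using strong_concavity by metis
  have "df v \<le> df u - 0 * (v - u)" using uv by (intro G) auto
  thus ?thesis by simp
qed

text \<open>A second-order Taylor bound in which the lower bound l for -f'' is expressed through f',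
  since f'' may jump at \<open>R1 U\<close>. The difference between f and the parabola is
  nondecreasing before s and nonincreasing after it.\<close>

lemma f_quadratic_bound:
  assumes "0 \<le> a" "a \<le> s" "s \<le> b" and u: "s + u \<in> {a..b}"
    and l: "\<And>v w. a \<le> v \<Longrightarrow> v \<le> w \<Longrightarrow> w \<le> b \<Longrightarrow> df w \<le> df v - l * (w - v)"
  shows "f_fun U (s + u) \<le> f_fun U s + df s * u - l / 2 * u\<^sup>2"
proof -
  define H where "H = (\<lambda>w. f_fun U w - df s * (w - s) + l / 2 * (w - s)\<^sup>2)"
  define H' where "H' = (\<lambda>w. df w - df s + l * (w - s))"
  have d: "(H has_real_derivative H' w) (at w within A)" if "w \<ge> 0" "A \<subseteq> {0..}" for w A
    unfolding H_def H'_def using that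
    by (auto intro!: derivative_eq_intros has_field_derivative_subset[OF f_deriv] simp: field_simps)
  have "H (s + u) \<le> H s"
  proof (cases "u \<ge> 0")
    case True
    have "H (s + u) \<le> H s - 0 * (s + u - s)"
    proof (rule le_by_derivative_bound)
      fix w assume w: "w \<in> {s..s + u}"
      show "(H has_real_derivative H' w) (at w within {s..s + u})" using w assms by (intro d) auto
      have "df w \<le> df s - l * (w - s)" using w assms(1-4) by (intro l) auto
      thus "H' w \<le> - 0" by (simp add: H'_def)
    qed (use True in simp)
    thus ?thesis by simp
  next
    case False
    have "- H s \<le> - H (s + u) - 0 * (s - (s + u))"
    proof (rule le_by_derivative_bound)
      fix w assume w: "w \<in> {s + u..s}"
      show "((\<lambda>w. - H w) has_real_derivative - H' w) (at w within {s + u..s})"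
        using w assms by (intro DERIV_minus d) auto
      have "df s \<le> df w - l * (s - w)" using w assms(1-4) by (intro l) auto
      thus "- H' w \<le> - 0" by (simp add: H'_def algebra_simps)
    qed (use False in simp)
    thus ?thesis by simp
  qed
  thus ?thesis by (simp add: H_def)
qed

lemma f_tangent: "s \<ge> 0 \<Longrightarrow> v \<ge> 0 \<Longrightarrow> f_fun U v \<le> f_fun U s + df s * (v - s)"
  using f_quadratic_bound[of 0 s "max s v" "v - s" 0] df_antimono by simp

lemma f_nonneg: "r \<ge> 0 \<Longrightarrow> f_fun U r \<ge> 0"
  using f_bounds(3)[of r] df_min_pos by (meson mult_nonneg_nonneg less_imp_le order_trans)

lemma f_mono: assumes "0 \<le> u" "u \<le> v" shows "f_fun U u \<le> f_fun U v"
proof -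
  have "f_fun U u \<le> f_fun U v + df v * (u - v)" using assms by (intro f_tangent) auto
  moreover have "df v * (u - v) \<le> 0"
    using assms df_lower[of v] df_min_pos by (intro mult_nonneg_nonpos) auto
  ultimately show ?thesis by linarith
qed

lemma f_cont: "continuous_on {0..} (f_fun U)"
  by (rule DERIV_continuous_on) (rule f_deriv, simp)

lemma f_subadditive: assumes "a \<ge> 0" "b \<ge> 0" shows "f_fun U (a + b) \<le> f_fun U a + b"
proof -
  have "f_fun U (a + b) \<le> f_fun U a + df a * (a + b - a)" using assms by (intro f_tangent) auto
  moreover have "df a * b \<le> 1 * b" using assms df_le_1 by (intro mult_right_mono) auto
  ultimately show ?thesis by simp
qed

text \<open>Reflected noise with centred increment \<open>u\<close> of variance \<open>4 h\<close> moves the distance \<open>s\<close> to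
  \<open>\<bar>s + u\<bar>\<close>. Bounding \<open>f\<close> by a quartic polynomial in \<open>u\<close> reduces the expectation to moments;
  for small \<open>s\<close>, where the kink at \<open>0\<close> is felt, no noise is added.\<close>

lemma f_quartic_bound:
  assumes \<tau>: "\<tau> > 0" and s: "\<tau> \<le> s" and M: "g \<le> M" "0 \<le> M"
    and l: "\<And>v w. s - \<tau> \<le> v \<Longrightarrow> v \<le> w \<Longrightarrow> w \<le> s + \<tau> \<Longrightarrow> df w \<le> df v - g * (w - v)"
  shows "f_fun U \<bar>s + u\<bar> \<le> f_fun U s + df s * u - g / 2 * u\<^sup>2 + (2 / \<tau> ^ 3 + M / (2 * \<tau>\<^sup>2)) * u ^ 4"
proof (cases "\<bar>u\<bar> \<le> \<tau>")
  case True
  have "f_fun U (s + u) \<le> f_fun U s + df s * u - g / 2 * u\<^sup>2"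
    using s \<tau> True l by (intro f_quadratic_bound[of "s - \<tau>" s "s + \<tau>"]) auto
  moreover have "(2 / \<tau> ^ 3 + M / (2 * \<tau>\<^sup>2)) * u ^ 4 \<ge> 0" using \<tau> M by simp
  moreover have "\<bar>s + u\<bar> = s + u" using True s by auto
  ultimately show ?thesis by simp
next
  case False
  \<comment> \<open>For |u| > \<tau> only the tangent of f at s is used. Folding at 0 costs at most
    2 |u|; this and the quadratic term are both absorbed by the quartic one.\<close>
  have "f_fun U \<bar>s + u\<bar> \<le> f_fun U s + df s * (\<bar>s + u\<bar> - s)" using s \<tau> by (intro f_tangent) auto
  also have "df s * (\<bar>s + u\<bar> - s) = df s * u + df s * (\<bar>s + u\<bar> - (s + u))" by (simp add: algebra_simps)
  also have "df s * (\<bar>s + u\<bar> - (s + u)) \<le> 1 * (2 * \<bar>u\<bar>)"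
    using df_le_1[of s] s \<tau> df_lower[of s] df_min_pos by (intro mult_mono) auto
  also have "1 * (2 * \<bar>u\<bar>) \<le> 2 / \<tau> ^ 3 * u ^ 4"
  proof -
    have "\<tau> ^ 3 \<le> \<bar>u\<bar> ^ 3" using False \<tau> by (intro power_mono) auto
    hence "\<tau> ^ 3 * \<bar>u\<bar> \<le> \<bar>u\<bar> ^ 3 * \<bar>u\<bar>" by (intro mult_right_mono) auto
    moreover have "\<bar>u\<bar> ^ 3 * \<bar>u\<bar> = u ^ 4" by (simp add: power_eq_if)
    ultimately show ?thesis using \<tau> by (simp add: field_simps)
  qed
  finally have 1: "f_fun U \<bar>s + u\<bar> \<le> f_fun U s + df s * u + 2 / \<tau> ^ 3 * u ^ 4" by simp
  have "\<tau>\<^sup>2 \<le> u\<^sup>2" using False \<tau> by (intro abs_le_square_iff[THEN iffD1]) auto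
  hence "\<tau>\<^sup>2 * u\<^sup>2 \<le> u\<^sup>2 * u\<^sup>2" by (intro mult_right_mono) auto
  hence "u\<^sup>2 \<le> u ^ 4 / \<tau>\<^sup>2" using \<tau> by (simp add: field_simps flip: power_add)
  hence "M / 2 * u\<^sup>2 \<le> M / 2 * (u ^ 4 / \<tau>\<^sup>2)" using M by (intro mult_left_mono) auto
  moreover have "g / 2 * u\<^sup>2 \<le> M / 2 * u\<^sup>2" using M by (intro mult_right_mono) auto
  ultimately show ?thesis using 1 by (simp add: algebra_simps)
qed

text \<open>A distance r becomes s in the drift step, with at most \<open>h * I\<close> due to the
  interaction. For s below \<delta> no noise follows. Otherwise a noise u with mean 0, second moment
  4 h and fourth moment at most M h^2 follows; the quartic majorant is kept abstract in
  \<open>a\<close>, \<open>d\<close>, \<open>b\<close>, \<open>C\<close>, so that the bound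
  \<open>a - 4 * h * b + M * C * h\<^sup>2\<close> of its expectation can be inserted once the law
  of u is at hand. \<epsilon> is the error allowed per unit of time.\<close>

definition step_contracts :: "real \<Rightarrow> real \<Rightarrow> real \<Rightarrow> real \<Rightarrow> real \<Rightarrow> real \<Rightarrow> real \<Rightarrow> real \<Rightarrow> bool" where
  "step_contracts c S \<epsilon> L B M \<delta> h0 \<longleftrightarrow> (\<forall>h r s I. 0 < h \<longrightarrow> h < h0 \<longrightarrow> 0 \<le> r \<longrightarrow> r \<le> S \<longrightarrow> 0 \<le> s \<longrightarrow> s \<le> S \<longrightarrow> 0 \<le> I \<longrightarrow>
      s \<le> r - 1/2 * h * r * kappa U r + h * I + h\<^sup>2 * L * r \<longrightarrow> \<bar>s - r\<bar> \<le> h * B \<longrightarrow>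
      (s < \<delta> \<longrightarrow> f_fun U s \<le> (1 - c * h) * f_fun U r + h * I + \<epsilon> * h) \<and>
      (s \<ge> \<delta> \<longrightarrow> (\<exists>a d b C. C \<ge> 0 \<and> (\<forall>u. f_fun U \<bar>s + u\<bar> \<le> a + d * u - b * u\<^sup>2 + C * u ^ 4) \<and>
         a - 4 * h * b + M * C * h\<^sup>2 \<le> (1 - c * h) * f_fun U r + h * I + \<epsilon> * h)))"

text \<open>The order of the quantifiers is the point: \<open>c\<close> is fixed before the range S
  of distances and the constants of the box, and only \<delta> and the bound on the mesh depend on
  these.\<close>

definition contraction_rate :: "real \<Rightarrow> bool" where
  "contraction_rate c \<longleftrightarrow> c > 0 \<and> (\<forall>S \<epsilon> L B M. S > 0 \<longrightarrow> \<epsilon> > 0 \<longrightarrow> B \<ge> 0 \<longrightarrow> M \<ge> 0 \<longrightarrow>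
    (\<exists>\<delta>>0. \<exists>h0>0. step_contracts c S \<epsilon> L B M \<delta> h0))"

text \<open>To first order the drift changes f by at most h f'(r) (I - r \<kappa>(r) / 2), and noise
  of variance 4 h by at most - 2 h G(s). Since f' \<le> 1, the interaction costs at most h I, and
  the remaining terms are bounded by - c h f(r) through the last inequality for
  \<open>G\<close>.\<close>

lemma scalar_contraction: "\<exists>c. contraction_rate c"
proof -
  obtain G c where Gc: "continuous_on {0..} G" and G0: "\<And>r. r \<ge> 0 \<Longrightarrow> G r \<ge> 0" and G00: "G 0 = 0" and c: "c > 0"
    and G1: "\<And>u v l. 0 \<le> u \<Longrightarrow> u \<le> v \<Longrightarrow> (\<And>w. w \<in> {u..v} \<Longrightarrow> l \<le> G w) \<Longrightarrow> df v \<le> df u - l * (v - u)"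
    and G2: "\<And>r. r > 0 \<Longrightarrow> 2 * G r + 1/2 * r * kappa U r * df r \<ge> c * f_fun U r"
    using strong_concavity by metis
  show ?thesis
    unfolding contraction_rate_def
  proof (rule exI[of _ c], intro conjI c allI impI)
    fix S \<epsilon> L B M :: real assume S: "S > 0" and eps: "\<epsilon> > 0" and B: "B \<ge> 0" and M: "M \<ge> 0"
    \<comment> \<open>At most five errors of size \<open>h * e\<close> accumulate: one from the
      terms of order h^2, two from replacing G(r) by G(s), and two from G(s) itself if s < \<tau> or
      from the oscillation of G around s otherwise.\<close>
    define e where "e = \<epsilon> / 8"
    have e: "e > 0" using eps by (simp add: e_def)
    have uc: "uniformly_continuous_on {0..S + 1} G"
      using Gc by (intro compact_uniformly_continuous) (auto elim: continuous_on_subset)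
    then obtain \<tau>0 where \<tau>0: "\<tau>0 > 0" "\<And>x y. x \<in> {0..S + 1} \<Longrightarrow> y \<in> {0..S + 1} \<Longrightarrow> dist y x < \<tau>0 \<Longrightarrow> dist (G y) (G x) < e"
      unfolding uniformly_continuous_on_def using e by metis
    \<comment> \<open>A distance within which \<open>G\<close> varies by at most \<open>e\<close>;
      it also serves as the threshold \<delta>. As it is at most 1, the interval up to
      \<open>S + 1\<close> contains s + u for |u| \<le> \<tau>.\<close>
    define \<tau> where "\<tau> = min (\<tau>0 / 2) 1"
    have \<tau>: "\<tau> > 0" "\<tau> \<le> 1" "\<tau> < \<tau>0" using \<tau>0 by (auto simp: \<tau>_def)
    have Gdiff: "\<bar>G y - G x\<bar> \<le> e" if "x \<in> {0..S+1}" "y \<in> {0..S+1}" "\<bar>y - x\<bar> \<le> \<tau>" for x y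
      using \<tau>0(2)[OF that(1,2)] that(3) \<tau> by (auto simp: dist_real_def)
    obtain Gm where Gm: "\<And>x. x \<in> {0..S+1} \<Longrightarrow> G x \<le> Gm"
    proof -
      have "compact (G ` {0..S + 1})" using Gc by (intro compact_continuous_image) (auto elim: continuous_on_subset)
      hence "bdd_above (G ` {0..S + 1})" by (meson bounded_imp_bdd_above compact_imp_bounded)
      then obtain M where "\<And>x. x \<in> {0..S+1} \<Longrightarrow> G x \<le> M" unfolding bdd_above_def by blast
      thus ?thesis by (rule that)
    qed
    have Gm0: "Gm \<ge> 0" using Gm[of 0] G00 S by simp
    define C where "C = 2 / \<tau> ^ 3 + Gm / (2 * \<tau>\<^sup>2)"
    have C: "C \<ge> 0" using \<tau> Gm0 by (simp add: C_def)
    define D where "D = \<bar>L\<bar> * S + M * C + 1"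
    have D: "D > 0" using S M C by (simp add: D_def add_nonneg_pos)
    \<comment> \<open>The first bound makes the terms of order h^2 at most \<open>h * e\<close>, the
      second keeps s within \<tau> of r.\<close>
    define h0 where "h0 = min (e / D) (\<tau> / (B + 1))"
    have h0: "h0 > 0" using e D \<tau> B by (simp add: h0_def)
    show "\<exists>\<delta>>0. \<exists>h0>0. step_contracts c S \<epsilon> L B M \<delta> h0"
      unfolding step_contracts_def
    proof (rule exI[of _ \<tau>], intro conjI \<tau>(1), rule exI[of _ h0], intro conjI h0, intro allI impI)
      fix h r s I :: real
      assume h: "0 < h" "h < h0" and r: "0 \<le> r" "r \<le> S" and s: "0 \<le> s" "s \<le> S" and I: "0 \<le> I"
        and sr: "s \<le> r - 1/2 * h * r * kappa U r + h * I + h\<^sup>2 * L * r" and sr': "\<bar>s - r\<bar> \<le> h * B"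
      have hD: "h * D \<le> e" using h D by (simp add: h0_def field_simps)
      have hB: "h * B \<le> \<tau>"
      proof -
        have "h * (B + 1) \<le> \<tau>" using h B by (simp add: h0_def field_simps)
        thus ?thesis using h by (simp add: algebra_simps)
      qed
      have Gsr: "G s \<ge> G r - e" using Gdiff[of r s] r s sr' hB by auto
      have fs: "f_fun U s \<le> f_fun U r - h * (1/2 * r * kappa U r * df r) + h * I + h\<^sup>2 * \<bar>L\<bar> * S"
      proof -
        have "f_fun U s \<le> f_fun U r + df r * (s - r)" using r s by (intro f_tangent)
        also have "df r * (s - r) \<le> df r * (- (1/2 * h * r * kappa U r) + h * I + h\<^sup>2 * L * r)"
          using sr df_lower[of r] df_min_pos r by (intro mult_left_mono) auto
        also have "\<dots> \<le> - (h * (1/2 * r * kappa U r * df r)) + 1 * (h * I) + 1 * (h\<^sup>2 * \<bar>L\<bar> * S)"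
        proof -
          have "df r * (h * I) \<le> 1 * (h * I)" using df_le_1 r h I by (intro mult_right_mono) auto
          moreover have "df r * (h\<^sup>2 * L * r) \<le> 1 * (h\<^sup>2 * \<bar>L\<bar> * S)"
          proof -
            have "df r * (h\<^sup>2 * L * r) \<le> df r * (h\<^sup>2 * \<bar>L\<bar> * S)"
              using r df_lower[of r] df_min_pos by (intro mult_left_mono mult_mono) auto
            also have "\<dots> \<le> 1 * (h\<^sup>2 * \<bar>L\<bar> * S)" using df_le_1[of r] r S by (intro mult_right_mono) auto
            finally show ?thesis .
          qed
          ultimately show ?thesis by (simp add: algebra_simps)
        qed
        finally show ?thesis by simp
      qed
      have key: "f_fun U r - h * (1/2 * r * kappa U r * df r) - 2 * h * G r \<le> (1 - c * h) * f_fun U r"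
      proof (cases "r = 0")
        case True thus ?thesis by (simp add: f_0 G00)
      next
        case False
        hence "h * (c * f_fun U r) \<le> h * (2 * G r + 1/2 * r * kappa U r * df r)"
          using G2[of r] r h by (intro mult_left_mono) auto
        thus ?thesis by (simp add: algebra_simps)
      qed
      have hDe: "h\<^sup>2 * \<bar>L\<bar> * S + M * C * h\<^sup>2 \<le> h * e"
      proof -
        have "h\<^sup>2 * \<bar>L\<bar> * S + M * C * h\<^sup>2 \<le> h * (h * D)"
          by (simp add: D_def power2_eq_square algebra_simps)
        also have "\<dots> \<le> h * e" using hD h by (intro mult_left_mono) auto
        finally show ?thesis .
      qed
      have MC: "M * C * h\<^sup>2 \<ge> 0" using M C by simp
      have Gh: "2 * h * G r \<le> 2 * h * G s + 2 * (h * e)"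
      proof -
        have "2 * h * G r \<le> 2 * h * (G s + e)" using Gsr h by (intro mult_left_mono) auto
        thus ?thesis by (simp add: algebra_simps)
      qed
      have eh: "\<epsilon> * h = 8 * (h * e)" "h * e > 0" using e h by (auto simp: e_def)
      show "(s < \<tau> \<longrightarrow> f_fun U s \<le> (1 - c * h) * f_fun U r + h * I + \<epsilon> * h) \<and>
        (s \<ge> \<tau> \<longrightarrow> (\<exists>a d b C. C \<ge> 0 \<and> (\<forall>u. f_fun U \<bar>s + u\<bar> \<le> a + d * u - b * u\<^sup>2 + C * u ^ 4) \<and>
           a - 4 * h * b + M * C * h\<^sup>2 \<le> (1 - c * h) * f_fun U r + h * I + \<epsilon> * h))"
      proof (intro conjI impI)
        assume "s < \<tau>"
        \<comment> \<open>Without noise the gain 2 h G(s) is missing, but near 0 it is negligible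
          because \<open>G 0 = 0\<close>.\<close>
        hence "G s \<le> e" using Gdiff[of 0 s] s S G00 by auto
        hence "2 * h * G s \<le> 2 * h * e" using h by (intro mult_left_mono) auto
        thus "f_fun U s \<le> (1 - c * h) * f_fun U r + h * I + \<epsilon> * h"
          using fs key hDe MC Gh eh by linarith
      next
        assume st: "s \<ge> \<tau>"
        have "f_fun U \<bar>s + u\<bar> \<le> f_fun U s + df s * u - (G s - e) / 2 * u\<^sup>2 + C * u ^ 4" for u
          unfolding C_def
        proof (rule f_quartic_bound)
          show "G s - e \<le> Gm" using Gm[of s] s e by simp
          fix v w assume vw: "s - \<tau> \<le> v" "v \<le> w" "w \<le> s + \<tau>"
          show "df w \<le> df v - (G s - e) * (w - v)"
          proof (rule G1)
            fix x assume "x \<in> {v..w}"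
            thus "G s - e \<le> G x" using Gdiff[of s x] vw s st \<tau> by (simp add: abs_le_iff)
          qed (use vw st in auto)
        qed (use \<tau> st Gm0 in auto)
        moreover have "f_fun U s - 4 * h * ((G s - e) / 2) + M * C * h\<^sup>2 \<le> (1 - c * h) * f_fun U r + h * I + \<epsilon> * h"
        proof -
          have "4 * h * ((G s - e) / 2) = 2 * h * G s - 2 * (h * e)" by (simp add: field_simps)
          thus ?thesis using fs key hDe Gh eh by linarith
        qed
        ultimately show "\<exists>a d b C. C \<ge> 0 \<and> (\<forall>u. f_fun U \<bar>s + u\<bar> \<le> a + d * u - b * u\<^sup>2 + C * u ^ 4) \<and>
           a - 4 * h * b + M * C * h\<^sup>2 \<le> (1 - c * h) * f_fun U r + h * I + \<epsilon> * h"
          using C by blast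
      qed
    qed
  qed
qed

end

section \<open>The Euler scheme along a path\<close>

definition in_box :: "nat \<Rightarrow> real \<Rightarrow> (nat \<Rightarrow> 'a::euclidean_space) \<Rightarrow> bool" where
  "in_box n R z \<longleftrightarrow> (\<forall>i\<in>{1..n}. norm (z i) \<le> R)"

definition l1_dist :: "nat \<Rightarrow> (nat \<Rightarrow> 'a::euclidean_space) \<Rightarrow> (nat \<Rightarrow> 'a) \<Rightarrow> real" where
  "l1_dist n z w = (\<Sum>i\<in>{1..n}. norm (z i - w i))"

definition move ::
  "nat \<Rightarrow> ((nat \<Rightarrow> 'a::euclidean_space) \<Rightarrow> nat \<Rightarrow> 'a) \<Rightarrow> real \<Rightarrow> real \<Rightarrow> (nat \<Rightarrow> 'a) \<Rightarrow> (nat \<Rightarrow> 'a) \<Rightarrow> nat \<Rightarrow> 'a"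
  where "move n b h R z \<xi> = (if in_box n R z then (\<lambda>i\<in>{1..n}. z i + h *\<^sub>R b z i + \<xi> i) else z)"

primrec euler ::
  "nat \<Rightarrow> ((nat \<Rightarrow> 'a::euclidean_space) \<Rightarrow> nat \<Rightarrow> 'a) \<Rightarrow> real \<Rightarrow> real \<Rightarrow> (nat \<Rightarrow> 'a) \<Rightarrow> (nat \<Rightarrow> nat \<Rightarrow> 'a) \<Rightarrow> nat \<Rightarrow> nat \<Rightarrow> 'a"
  where
    "euler n b h R x w 0 = x"
  | "euler n b h R x w (Suc m) = move n b h R (euler n b h R x w m) (w m)"

definition locally_lipschitz :: "nat \<Rightarrow> ((nat \<Rightarrow> 'a::euclidean_space) \<Rightarrow> nat \<Rightarrow> 'a) \<Rightarrow> bool" where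
  "locally_lipschitz n b \<longleftrightarrow> (\<forall>R. \<exists>L\<ge>0. \<forall>z w. in_box n R z \<longrightarrow> in_box n R w \<longrightarrow>
     (\<forall>i\<in>{1..n}. norm (b z i - b w i) \<le> L * l1_dist n z w))"

lemma l1_dist_nonneg [simp]: "l1_dist n z w \<ge> 0" by (simp add: l1_dist_def sum_nonneg)

lemma l1_dist_sym: "l1_dist n z w = l1_dist n w z" by (simp add: l1_dist_def norm_minus_commute)

lemma l1_dist_triangle: "l1_dist n x z \<le> l1_dist n x y + l1_dist n y z"
  unfolding l1_dist_def sum.distrib[symmetric]
  by (intro sum_mono norm_diff_triangle_le[OF order_refl order_refl])

lemma l1_dist_component: "i \<in> {1..n} \<Longrightarrow> norm (z i - w i) \<le> l1_dist n z w"
  unfolding l1_dist_def by (rule member_le_sum) auto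

text \<open>A discrete Gronwall argument along one fixed path, with \<eta> bounding the oscillation
  of the path over one mesh width. The same induction shows that the chain stays in the box of
  radius K + 1, so it is never stopped and one Lipschitz constant is enough.\<close>

lemma euler_error:
  fixes b :: "(nat \<Rightarrow> 'a::euclidean_space) \<Rightarrow> nat \<Rightarrow> 'a"
  assumes h: "h > 0"
    and cont: "\<And>i. i \<in> {1..n} \<Longrightarrow> continuous_on {0..real N * h} (\<lambda>s. b (X s) i)"
    and eq: "\<And>i s. i \<in> {1..n} \<Longrightarrow> s \<in> {0..real N * h} \<Longrightarrow> X s i = x i + integral {0..s} (\<lambda>u. b (X u) i) + \<beta> i s"
    and \<beta>0: "\<And>i. i \<in> {1..n} \<Longrightarrow> \<beta> i 0 = 0"
    and K: "\<And>s. s \<in> {0..real N * h} \<Longrightarrow> in_box n K (X s)" and R: "R \<ge> K + 1"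
    and L: "L \<ge> 0" "\<And>z w i. in_box n (K + 1) z \<Longrightarrow> in_box n (K + 1) w \<Longrightarrow> i \<in> {1..n} \<Longrightarrow>
        norm (b z i - b w i) \<le> L * l1_dist n z w"
    and osc: "\<And>s s'. s \<in> {0..real N * h} \<Longrightarrow> s' \<in> {0..real N * h} \<Longrightarrow> \<bar>s - s'\<bar> \<le> h \<Longrightarrow> l1_dist n (X s) (X s') \<le> \<eta>"
    and small: "exp (n * L * (real N * h)) * \<eta> \<le> 1" and "\<eta> \<ge> 0"
    and "m \<le> N"
  defines "Z \<equiv> euler n b h R x (\<lambda>m i. \<beta> i (real (Suc m) * h) - \<beta> i (real m * h))"
  shows "l1_dist n (Z m) (X (real m * h)) \<le> exp (n * L * (real N * h)) * \<eta>"
proof -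
  define q where "q = 1 + h * n * L"
  have q: "q \<ge> 1" using h L by (simp add: q_def)
  have qm: "q ^ m \<le> exp (n * L * (real N * h))" if "m \<le> N" for m
  proof -
    have "q ^ m \<le> exp (h * n * L) ^ m" using q by (intro power_mono) (auto simp: q_def)
    also have "\<dots> = exp (real m * (h * n * L))" by (simp add: exp_of_nat_mult)
    also have "\<dots> \<le> exp (n * L * (real N * h))"
    proof -
      have "real m * (h * n * L) \<le> real N * (h * n * L)" using that h L by (intro mult_right_mono) auto
      thus ?thesis by (simp add: mult_ac)
    qed
    finally show ?thesis .
  qed
  have box1: "in_box n (K + 1) z" if "in_box n K w" "l1_dist n z w \<le> 1" for z w :: "nat \<Rightarrow> 'a"
    unfolding in_box_def
  proof
    fix i assume i: "i \<in> {1..n}"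
    have "norm (z i) \<le> norm (w i) + norm (z i - w i)"
      by (metis add.commute diff_add_cancel norm_triangle_ineq)
    also have "norm (z i - w i) \<le> 1" using l1_dist_component[OF i, of z w] that by linarith
    also have "norm (w i) \<le> K" using that i unfolding in_box_def by blast
    finally show "norm (z i) \<le> K + 1" by simp
  qed
  \<comment> \<open>Adding \<eta> to the error E turns the recursion E' \<le> E + h n L (E + \<eta>)
    into E' + \<eta> \<le> q (E + \<eta>), which is purely geometric.\<close>
  have "l1_dist n (Z m) (X (real m * h)) + \<eta> \<le> q ^ m * \<eta>" if "m \<le> N" for m
    using that
  proof (induction m)
    case 0
    have "X 0 i = x i" if "i \<in> {1..n}" for i
      using eq[OF that, of 0] \<beta>0[OF that] h by simp
    hence "l1_dist n (Z 0) (X (real 0 * h)) = 0" by (simp add: l1_dist_def Z_def)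
    thus ?case by simp
  next
    case (Suc m)
    define s where "s = real m * h"
    define s' where "s' = real (Suc m) * h"
    have s: "0 \<le> s" "s' = s + h" using h by (auto simp: s_def s'_def algebra_simps)
    have "s' \<le> real N * h" unfolding s'_def using h Suc.prems by (intro mult_right_mono) auto
    note s = s this
    have E: "l1_dist n (Z m) (X s) + \<eta> \<le> q ^ m * \<eta>" using Suc by (simp add: s_def)
    have "q ^ m * \<eta> \<le> 1"
      using qm[of m] Suc.prems small \<open>\<eta> \<ge> 0\<close> by (meson Suc_leD mult_right_mono order_trans)
    hence El: "l1_dist n (Z m) (X s) \<le> 1" using E \<open>\<eta> \<ge> 0\<close> by linarith
    have bX: "in_box n (K + 1) (X u)" if "u \<in> {0..real N * h}" for u
      using box1[OF K[OF that], of "X u"] by (simp add: l1_dist_def)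
    have bZ: "in_box n (K + 1) (Z m)" using box1[OF K[of s] El] s h by auto
    have comp: "norm (Z (Suc m) i - X s' i) \<le> norm (Z m i - X s i) + h * (L * (l1_dist n (Z m) (X s) + \<eta>))"
      if i: "i \<in> {1..n}" for i
    proof -
      have bi: "(\<lambda>u. b (X u) i) integrable_on {a..c}" if "0 \<le> a" "c \<le> real N * h" for a c
        using that cont[OF i] by (intro integrable_continuous_interval) (auto elim: continuous_on_subset)
      have "in_box n R (Z m)" using bZ R by (auto simp: in_box_def)
      hence 1: "Z (Suc m) i = Z m i + h *\<^sub>R b (Z m) i + (\<beta> i s' - \<beta> i s)"
        using i by (simp add: Z_def move_def s_def s'_def)
      have "X s' i - X s i = integral {s..s'} (\<lambda>u. b (X u) i) + (\<beta> i s' - \<beta> i s)"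
        using eq[OF i, of s] eq[OF i, of s'] s h
          Henstock_Kurzweil_Integration.integral_combine[of 0 s s' "\<lambda>u. b (X u) i"] bi[of 0 s']
        by (auto simp: algebra_simps)
      hence 2: "X s' i = X s i + integral {s..s'} (\<lambda>u. b (X u) i) + (\<beta> i s' - \<beta> i s)"
        by (simp add: algebra_simps)
      have "integral {s..s'} (\<lambda>u. b (Z m) i - b (X u) i) = h *\<^sub>R b (Z m) i - integral {s..s'} (\<lambda>u. b (X u) i)"
        using bi[of s s'] s h by (subst Henstock_Kurzweil_Integration.integral_diff) auto
      hence "Z (Suc m) i - X s' i = (Z m i - X s i) + integral {s..s'} (\<lambda>u. b (Z m) i - b (X u) i)"
        unfolding 1 2 by simp
      also have "norm \<dots> \<le> norm (Z m i - X s i) + norm (integral {s..s'} (\<lambda>u. b (Z m) i - b (X u) i))"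
        by (rule norm_triangle_ineq)
      also have "norm (integral {s..s'} (\<lambda>u. b (Z m) i - b (X u) i)) \<le> L * (l1_dist n (Z m) (X s) + \<eta>) * (s' - s)"
      proof (rule integral_bound)
        show "continuous_on {s..s'} (\<lambda>u. b (Z m) i - b (X u) i)"
          using s cont[OF i] by (auto intro!: continuous_intros elim: continuous_on_subset)
        fix u assume u: "u \<in> {s..s'}"
        have "norm (b (Z m) i - b (X u) i) \<le> L * l1_dist n (Z m) (X u)"
          using u s by (intro L(2) bZ bX i) auto
        also have "l1_dist n (Z m) (X u) \<le> l1_dist n (Z m) (X s) + l1_dist n (X s) (X u)"
          by (rule l1_dist_triangle)
        also have "l1_dist n (X s) (X u) \<le> \<eta>" using u s h by (intro osc) auto
        finally show "norm (b (Z m) i - b (X u) i) \<le> L * (l1_dist n (Z m) (X s) + \<eta>)"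
          using L(1) by (simp add: mult_left_mono)
      qed (use s h in auto)
      finally show ?thesis using s by (simp add: mult_ac)
    qed
    have "l1_dist n (Z (Suc m)) (X s') \<le> (\<Sum>i\<in>{1..n}. norm (Z m i - X s i) + h * (L * (l1_dist n (Z m) (X s) + \<eta>)))"
      unfolding l1_dist_def[of n "Z (Suc m)"] by (intro sum_mono comp)
    also have "\<dots> = l1_dist n (Z m) (X s) + n * (h * (L * (l1_dist n (Z m) (X s) + \<eta>)))"
      by (simp add: sum.distrib l1_dist_def)
    finally have "l1_dist n (Z (Suc m)) (X s') + \<eta> \<le> q * (l1_dist n (Z m) (X s) + \<eta>)"
      by (simp add: q_def algebra_simps)
    also have "\<dots> \<le> q * (q ^ m * \<eta>)" using E q by (intro mult_left_mono) auto
    finally show ?case by (simp add: s'_def mult.assoc)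
  qed
  from this[OF \<open>m \<le> N\<close>] mult_right_mono[OF qm[OF \<open>m \<le> N\<close>] \<open>\<eta> \<ge> 0\<close>] \<open>\<eta> \<ge> 0\<close> show ?thesis
    by linarith
qed

text \<open>By compactness the path is bounded on [0, t], so the growing radius of the stopping box
  eventually exceeds it, and uniform continuity makes the oscillation over one mesh width
  small.\<close>

lemma euler_converges:
  fixes b :: "(nat \<Rightarrow> 'a::euclidean_space) \<Rightarrow> nat \<Rightarrow> 'a" and t :: real
  assumes t: "t > 0" and lip: "locally_lipschitz n b"
    and cX: "\<And>i. i \<in> {1..n} \<Longrightarrow> continuous_on {0..t} (\<lambda>s. X s i)"
    and eq: "\<And>i s. i \<in> {1..n} \<Longrightarrow> s \<in> {0..t} \<Longrightarrow> X s i = x i + integral {0..s} (\<lambda>u. b (X u) i) + \<beta> i s"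
    and \<beta>0: "\<And>i. i \<in> {1..n} \<Longrightarrow> \<beta> i 0 = 0"
    and Rj: "filterlim Rj at_top sequentially" and Nj: "filterlim Nj at_top sequentially"
  defines "Z \<equiv> \<lambda>j. euler n b (t / real (Nj j)) (Rj j) x
      (\<lambda>m i. \<beta> i (real (Suc m) * (t / real (Nj j))) - \<beta> i (real m * (t / real (Nj j))))"
  shows "(\<lambda>j. l1_dist n (Z j (Nj j)) (X t)) \<longlonglongrightarrow> 0"
proof -
  have "\<exists>K. \<forall>s\<in>{0..t}. norm (X s i) \<le> K" if "i \<in> {1..n}" for i
  proof -
    have "bounded ((\<lambda>s. X s i) ` {0..t})"
      using cX[OF that] by (intro compact_imp_bounded compact_continuous_image) auto
    thus ?thesis by (auto simp: bounded_iff)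
  qed
  then obtain Ki where Ki: "\<And>i s. i \<in> {1..n} \<Longrightarrow> s \<in> {0..t} \<Longrightarrow> norm (X s i) \<le> Ki i" by metis
  define K where "K = (\<Sum>i\<in>{1..n}. \<bar>Ki i\<bar>)"
  have K: "in_box n K (X s)" if "s \<in> {0..t}" for s
    unfolding in_box_def
  proof
    fix i assume i: "i \<in> {1..n}"
    have "norm (X s i) \<le> \<bar>Ki i\<bar>" using Ki[OF i that] by simp
    also have "\<dots> \<le> K" unfolding K_def using i by (intro member_le_sum) auto
    finally show "norm (X s i) \<le> K" .
  qed
  obtain L where L: "L \<ge> 0" "\<And>z w i. in_box n (K + 1) z \<Longrightarrow> in_box n (K + 1) w \<Longrightarrow> i \<in> {1..n} \<Longrightarrow>
        norm (b z i - b w i) \<le> L * l1_dist n z w"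
    using lip unfolding locally_lipschitz_def by meson
  have bX: "in_box n (K + 1) (X s)" if "s \<in> {0..t}" for s using K[OF that] by (auto simp: in_box_def)
  have l1c: "((\<lambda>v. l1_dist n (X v) (X u)) \<longlongrightarrow> 0) (at u within {0..t})" if "u \<in> {0..t}" for u
  proof -
    have "((\<lambda>v. \<Sum>i\<in>{1..n}. norm (X v i - X u i)) \<longlongrightarrow> (\<Sum>i\<in>{1..n}. norm (X u i - X u i))) (at u within {0..t})"
      using cX that by (intro tendsto_intros) (auto simp: continuous_on_def)
    thus ?thesis by (simp add: l1_dist_def)
  qed
  have cont: "continuous_on {0..t} (\<lambda>s. b (X s) i)" if i: "i \<in> {1..n}" for i
    unfolding continuous_on_def
  proof
    fix u assume u: "u \<in> {0..t}"
    have "((\<lambda>v. b (X v) i - b (X u) i) \<longlongrightarrow> 0) (at u within {0..t})"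
    proof (rule Lim_null_comparison)
      show "\<forall>\<^sub>F v in at u within {0..t}. norm (b (X v) i - b (X u) i) \<le> L * l1_dist n (X v) (X u)"
        unfolding eventually_at_filter using u by (auto intro!: always_eventually L(2) bX i)
      show "((\<lambda>v. L * l1_dist n (X v) (X u)) \<longlongrightarrow> 0) (at u within {0..t})"
        using tendsto_mult_right_zero[OF l1c[OF u]] .
    qed
    thus "((\<lambda>v. b (X v) i) \<longlongrightarrow> b (X u) i) (at u within {0..t})" by (simp add: LIM_zero_iff)
  qed
  have uc: "\<exists>d>0. \<forall>s\<in>{0..t}. \<forall>s'\<in>{0..t}. \<bar>s - s'\<bar> < d \<longrightarrow> l1_dist n (X s) (X s') \<le> \<eta>" if "\<eta> > 0" for \<eta>
  proof -
    define e where "e = \<eta> / (real n + 1)"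
    have e: "e > 0" using that by (simp add: e_def)
    have "\<exists>d>0. \<forall>s\<in>{0..t}. \<forall>s'\<in>{0..t}. dist s' s < d \<longrightarrow> dist (X s' i) (X s i) < e" if "i \<in> {1..n}" for i
      using compact_uniformly_continuous[OF cX[OF that] compact_Icc] e unfolding uniformly_continuous_on_def by blast
    then obtain di where di: "\<And>i. i \<in> {1..n} \<Longrightarrow> di i > 0"
      "\<And>i s s'. i \<in> {1..n} \<Longrightarrow> s \<in> {0..t} \<Longrightarrow> s' \<in> {0..t} \<Longrightarrow> dist s' s < di i \<Longrightarrow> dist (X s' i) (X s i) < e"
      by metis
    define d where "d = Min (insert 1 (di ` {1..n}))"
    have d: "d > 0" using di(1) by (auto simp: d_def)
    have dle: "d \<le> di i" if "i \<in> {1..n}" for i unfolding d_def using that by (intro Min_le) auto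
    have "l1_dist n (X s) (X s') \<le> \<eta>" if "s \<in> {0..t}" "s' \<in> {0..t}" "\<bar>s - s'\<bar> < d" for s s'
    proof -
      have "l1_dist n (X s) (X s') \<le> (\<Sum>i\<in>{1..n}. e)"
        unfolding l1_dist_def
      proof (rule sum_mono)
        fix i assume i: "i \<in> {1..n}"
        thus "norm (X s i - X s' i) \<le> e"
          using di(2)[of i s' s] dle[OF i] that by (auto simp: dist_norm)
      qed
      also have "\<dots> = real n * e" by simp
      also have "\<dots> \<le> (real n + 1) * e" using e by (intro mult_right_mono) auto
      also have "\<dots> = \<eta>" by (simp add: e_def)
      finally show ?thesis .
    qed
    thus ?thesis using d by blast
  qed
  define E where "E = exp (n * L * t)"
  have E: "E > 0" by (simp add: E_def)
  show ?thesis
  proof (rule LIMSEQ_I)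
    fix \<epsilon> :: real assume \<epsilon>: "\<epsilon> > 0"
    \<comment> \<open>The bound 1 is what \<open>euler_error\<close> requires to keep the chains in
      the enlarged box, the bound \<epsilon> / 2 is the accuracy.\<close>
    define \<eta> where "\<eta> = min 1 (\<epsilon> / 2) / E"
    have \<eta>: "\<eta> > 0" "E * \<eta> \<le> 1" "E * \<eta> < \<epsilon>" using E \<epsilon> by (auto simp: \<eta>_def min_def)
    obtain d where d: "d > 0" "\<And>s s'. s \<in> {0..t} \<Longrightarrow> s' \<in> {0..t} \<Longrightarrow> \<bar>s - s'\<bar> < d \<Longrightarrow> l1_dist n (X s) (X s') \<le> \<eta>"
      using uc[OF \<eta>(1)] by blast
    obtain k where k: "real k > t / d" "k > 0" using reals_Archimedean2[of "max 1 (t / d)"] by auto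
    have "\<forall>\<^sub>F j in sequentially. K + 1 \<le> Rj j" using Rj by (auto simp: filterlim_at_top)
    moreover have "\<forall>\<^sub>F j in sequentially. k \<le> Nj j" using Nj by (auto simp: filterlim_at_top)
    ultimately have "\<forall>\<^sub>F j in sequentially. norm (l1_dist n (Z j (Nj j)) (X t) - 0) < \<epsilon>"
    proof eventually_elim
      case (elim j)
      define N where "N = Nj j"
      define h where "h = t / real N"
      have N: "N > 0" using k elim by (auto simp: N_def)
      have h: "h > 0" "real N * h = t" using N t by (auto simp: h_def)
      have "t / d < real N" using k elim by (simp add: N_def)
      hence "h < d" using N d(1) by (simp add: h_def field_simps)
      have "l1_dist n (Z j N) (X (real N * h)) \<le> exp (n * L * (real N * h)) * \<eta>"
        unfolding Z_def N_def[symmetric] h_def[symmetric]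
        by (rule euler_error[where K=K])
          (use h cont eq \<beta>0 K L elim \<eta> d \<open>h < d\<close> in \<open>auto simp: E_def[symmetric]\<close>)
      thus ?case using \<eta>(3) l1_dist_nonneg[of n "Z j N" "X t"] by (simp add: h E_def[symmetric] N_def[symmetric])
    qed
    thus "\<exists>no. \<forall>j\<ge>no. norm (l1_dist n (Z j (Nj j)) (X t) - 0) < \<epsilon>"
      by (simp add: eventually_sequentially)
  qed
qed

section \<open>Gaussian noise and reflections\<close>

text \<open>Reflection in the hyperplane orthogonal to d; division by zero makes
  \<open>reflect 0\<close> the identity.\<close>

definition reflect :: "'a::euclidean_space \<Rightarrow> 'a \<Rightarrow> 'a" where
  "reflect d v = v - (2 * (d \<bullet> v) / (d \<bullet> d)) *\<^sub>R d"

lemma reflect_0 [simp]: "reflect 0 v = v" by (simp add: reflect_def)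

lemma reflect_add: "reflect d (v + w) = reflect d v + reflect d w"
  by (simp add: reflect_def inner_add_right add_divide_distrib algebra_simps)

lemma reflect_inner: "reflect d v \<bullet> w = v \<bullet> reflect d w"
  by (simp add: reflect_def inner_diff_left inner_diff_right inner_commute)

lemma reflect_reflect [simp]: "reflect d (reflect d v) = v"
  by (cases "d = 0") (auto simp: reflect_def inner_diff_right algebra_simps)

lemma reflect_norm [simp]: "norm (reflect d v) = norm v"
  by (simp add: norm_eq_sqrt_inner reflect_inner)

lemma reflect_measurable [measurable]:
  assumes [measurable]: "F \<in> borel_measurable M" "H \<in> borel_measurable M"
  shows "(\<lambda>x. reflect (F x) (H x)) \<in> borel_measurable M"
  unfolding reflect_def by measurable

lemma reflect_swap:
  assumes "norm e = norm b" shows "reflect (e - b) e = b"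
proof (cases "e = b")
  case False
  have "(e - b) \<bullet> (e - b) = 2 * ((e - b) \<bullet> e)"
    using assms by (simp add: inner_diff_left inner_diff_right inner_commute norm_eq_sqrt_inner)
  moreover have "(e - b) \<bullet> (e - b) \<noteq> 0" using False by simp
  ultimately show ?thesis by (simp add: reflect_def)
qed simp

lemma nn_integral_lborel_translate:
  fixes F :: "'a::euclidean_space \<Rightarrow> ennreal"
  assumes [measurable]: "F \<in> borel_measurable borel"
  shows "(\<integral>\<^sup>+y. F (y + a) \<partial>lborel) = (\<integral>\<^sup>+y. F y \<partial>lborel)"
proof -
  have "(\<integral>\<^sup>+y. F y \<partial>lborel) = (\<integral>\<^sup>+y. F y \<partial>distr lborel borel ((+) a))"
    by (simp add: lborel_distr_plus)
  also have "\<dots> = (\<integral>\<^sup>+y. F (a + y) \<partial>lborel)" by (subst nn_integral_distr) auto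
  finally show ?thesis by (simp add: add.commute)
qed

text \<open>The image of Lebesgue measure is translation invariant and gives the unit ball its volume;
  integrating \<open>1\<^sub>A(x + y) 1\<^sub>B(y)\<close> in both orders, with \<open>B\<close> the unit ball, identifies it.\<close>

lemma lborel_distr_reflect:
  fixes d :: "'a::euclidean_space"
  shows "distr lborel borel (reflect d) = lborel"
proof (rule measure_eqI)
  define \<mu> where "\<mu> = distr lborel borel (reflect d)"
  have [measurable_cong]: "sets \<mu> = sets borel" by (simp add: \<mu>_def)
  have nn: "(\<integral>\<^sup>+x. F x \<partial>\<mu>) = (\<integral>\<^sup>+x. F (reflect d x) \<partial>lborel)"
    if [measurable]: "F \<in> borel_measurable borel" for F
    unfolding \<mu>_def by (rule nn_integral_distr) auto
  have trans: "(\<integral>\<^sup>+x. F (x + a) \<partial>\<mu>) = (\<integral>\<^sup>+x. F x \<partial>\<mu>)" if [measurable]: "F \<in> borel_measurable borel" for F a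
  proof -
    have "(\<integral>\<^sup>+x. F (x + a) \<partial>\<mu>) = (\<integral>\<^sup>+x. F (reflect d (x + reflect d a)) \<partial>lborel)"
      by (subst nn) (auto simp: reflect_add)
    also have "\<dots> = (\<integral>\<^sup>+x. F (reflect d x) \<partial>lborel)" by (rule nn_integral_lborel_translate) auto
    finally show ?thesis by (simp add: nn)
  qed
  interpret \<mu>: sigma_finite_measure \<mu>
    unfolding \<mu>_def
  proof (rule sigma_finite_measure.intro)
    show "\<exists>A. countable A \<and> A \<subseteq> sets (distr lborel borel (reflect d)) \<and> \<Union>A = space (distr lborel borel (reflect d))
        \<and> (\<forall>a\<in>A. emeasure (distr lborel borel (reflect d)) a \<noteq> \<infinity>)"
    proof (intro exI[of _ "range (\<lambda>k::nat. cball 0 (real k))"] conjI ballI)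
      show "\<Union>(range (\<lambda>k::nat. cball (0::'a) (real k))) = space (distr lborel borel (reflect d))"
        by (auto simp: real_arch_simple)
      fix A assume "A \<in> range (\<lambda>k::nat. cball (0::'a) (real k))"
      then obtain k :: nat where A: "A = cball 0 (real k)" by auto
      have "reflect d -` A = A" by (auto simp: A)
      thus "emeasure (distr lborel borel (reflect d)) A \<noteq> \<infinity>"
        by (subst emeasure_distr) (use emeasure_bounded_finite[OF bounded_cball, of "0::'a" "real k"] in \<open>auto simp: A\<close>)
    qed auto
  qed
  interpret pair_sigma_finite \<mu> lborel ..
  define B where "B = ball (0::'a) 1"
  have v: "emeasure \<mu> B = emeasure lborel B"
  proof -
    have "reflect d -` B = B" by (auto simp: B_def)
    thus ?thesis unfolding \<mu>_def by (subst emeasure_distr) (auto simp: B_def)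
  qed
  have v0: "emeasure lborel B \<noteq> 0" "emeasure lborel B \<noteq> \<infinity>"
    using emeasure_lborel_ball_finite[of "0::'a" 1] content_ball_pos[of 1 "0::'a"]
    by (auto simp: B_def less_top emeasure_eq_measure2 measure_def)
  fix A assume "A \<in> sets (distr lborel borel (reflect d))"
  hence [measurable]: "A \<in> sets borel" by simp
  have [measurable]: "B \<in> sets borel" by (simp add: B_def)
  have "emeasure \<mu> A * emeasure lborel B = (\<integral>\<^sup>+y. (\<integral>\<^sup>+x. indicator A x \<partial>\<mu>) * indicator B y \<partial>lborel)"
    by (simp add: nn_integral_cmult)
  also have "\<dots> = (\<integral>\<^sup>+y. (\<integral>\<^sup>+x. indicator A (x + y) * indicator B y \<partial>\<mu>) \<partial>lborel)"
    by (simp add: nn_integral_multc trans[of "indicator A"])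
  also have "\<dots> = (\<integral>\<^sup>+x. (\<integral>\<^sup>+y. indicator A (x + y) * indicator B y \<partial>lborel) \<partial>\<mu>)"
    by (rule Fubini') measurable
  also have "\<dots> = (\<integral>\<^sup>+x. (\<integral>\<^sup>+y. indicator A y * indicator B (y - x) \<partial>lborel) \<partial>\<mu>)"
  proof (rule nn_integral_cong)
    fix x
    show "(\<integral>\<^sup>+y. indicator A (x + y) * indicator B y \<partial>lborel) = (\<integral>\<^sup>+y. indicator A y * indicator B (y - x) \<partial>(lborel :: 'a measure))"
      using nn_integral_lborel_translate[of "\<lambda>y. indicator A y * indicator B (y - x)" x]
      by (simp add: add.commute)
  qed
  also have "\<dots> = (\<integral>\<^sup>+y. (\<integral>\<^sup>+x. indicator A y * indicator B (y - x) \<partial>\<mu>) \<partial>lborel)"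
    by (rule Fubini'[symmetric]) measurable
  also have "\<dots> = (\<integral>\<^sup>+y. indicator A y * emeasure \<mu> B \<partial>lborel)"
  proof (rule nn_integral_cong)
    fix y
    have "(\<integral>\<^sup>+x. indicator B (y - x) \<partial>\<mu>) = (\<integral>\<^sup>+x. indicator B (x + (- y)) \<partial>\<mu>)"
      by (intro nn_integral_cong) (auto simp: B_def indicator_def norm_minus_commute)
    also have "\<dots> = emeasure \<mu> B" by (subst trans) auto
    finally show "(\<integral>\<^sup>+x. indicator A y * indicator B (y - x) \<partial>\<mu>) = indicator A y * emeasure \<mu> B"
      by (subst nn_integral_cmult) auto
  qed
  also have "\<dots> = emeasure lborel A * emeasure lborel B" by (simp add: nn_integral_multc v)
  finally have "emeasure \<mu> A * emeasure lborel B = emeasure lborel A * emeasure lborel B" .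
  thus "emeasure (distr lborel borel (reflect d)) A = emeasure lborel A"
    using v0 unfolding \<mu>_def by (auto simp: ennreal_mult_cancel_left mult.commute[of _ "emeasure lborel B"])
qed simp

definition gauss :: "real \<Rightarrow> 'a::euclidean_space measure" where
  "gauss h = density lborel (\<lambda>x. ennreal (\<Prod>b\<in>Basis. normal_density 0 (sqrt h) (x \<bullet> b)))"

lemma sets_gauss [measurable_cong, simp]: "sets (gauss h) = sets borel" by (simp add: gauss_def)

lemma space_gauss [simp]: "space (gauss h) = UNIV" by (simp add: gauss_def)

text \<open>The product density depends on the norm only. Reflections preserve the norm and Lebesgue
  measure, hence also the Gaussian measure.\<close>

lemma gauss_density_norm:
  "(\<Prod>b\<in>Basis. normal_density 0 (sqrt h) ((x::'a::euclidean_space) \<bullet> b)) =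
     (1 / sqrt (2 * pi * (sqrt h)\<^sup>2)) ^ DIM('a) * exp (- (norm x)\<^sup>2 / (2 * (sqrt h)\<^sup>2))"
proof -
  have "(\<Prod>b\<in>Basis. normal_density 0 (sqrt h) (x \<bullet> b)) =
      (1 / sqrt (2 * pi * (sqrt h)\<^sup>2)) ^ DIM('a) * exp (\<Sum>b\<in>Basis. - (x \<bullet> b)\<^sup>2 / (2 * (sqrt h)\<^sup>2))"
    by (simp add: normal_density_def prod_dividef exp_sum power_one_over prod.distrib)
  also have "(\<Sum>b\<in>Basis. - (x \<bullet> b)\<^sup>2 / (2 * (sqrt h)\<^sup>2)) = - (norm x)\<^sup>2 / (2 * (sqrt h)\<^sup>2)"
    unfolding power2_norm_eq_inner by (subst euclidean_inner) (simp add: sum_negf sum_divide_distrib power2_eq_square)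
  finally show ?thesis .
qed

lemma gauss_distr_reflect: "distr (gauss h) borel (reflect (d::'a::euclidean_space)) = gauss h"
proof (rule measure_eqI)
  fix A assume "A \<in> sets (distr (gauss h) borel (reflect d))"
  hence [measurable]: "A \<in> sets borel" by simp
  define F where "F = (\<lambda>x::'a. ennreal (\<Prod>b\<in>Basis. normal_density 0 (sqrt h) (x \<bullet> b)))"
  have [measurable]: "F \<in> borel_measurable borel" unfolding F_def by measurable
  have F: "F (reflect d x) = F x" for x unfolding F_def gauss_density_norm by simp
  have "emeasure (distr (gauss h) borel (reflect d)) A = emeasure (density lborel F) (reflect d -` A)"
    by (subst emeasure_distr) (auto simp: gauss_def F_def)
  also have "\<dots> = (\<integral>\<^sup>+x. F x * indicator (reflect d -` A) x \<partial>lborel)"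
    by (rule emeasure_density) (auto intro!: measurable_sets_borel[of _ borel])
  also have "\<dots> = (\<integral>\<^sup>+x. F (reflect d x) * indicator A (reflect d x) \<partial>lborel)"
    by (intro nn_integral_cong) (auto simp: F indicator_def)
  also have "\<dots> = (\<integral>\<^sup>+x. F x * indicator A x \<partial>distr lborel borel (reflect d))"
    by (subst nn_integral_distr) auto
  also have "\<dots> = emeasure (gauss h) A"
    by (simp add: lborel_distr_reflect gauss_def F_def[symmetric] emeasure_density)
  finally show "emeasure (distr (gauss h) borel (reflect d)) A = emeasure (gauss h) A" .
qed simp

lemma nn_integral_normal_density: "\<sigma> > 0 \<Longrightarrow> (\<integral>\<^sup>+x. ennreal (normal_density m \<sigma> x) \<partial>lborel) = 1"
  using prob_space.emeasure_space_1[OF prob_space_normal_density[of \<sigma> m]] by (simp add: emeasure_density)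

lemma gauss_marginal_basis:
  assumes h: "h > 0" and b: "b \<in> Basis"
  shows "distr (gauss h) borel (\<lambda>x::'a::euclidean_space. x \<bullet> b) = density lborel (\<lambda>x. ennreal (normal_density 0 (sqrt h) x))"
proof (rule measure_eqI)
  fix A assume "A \<in> sets (distr (gauss h) borel (\<lambda>x::'a. x \<bullet> b))"
  hence [measurable]: "A \<in> sets borel" by simp
  define k where "k = (\<lambda>c x. normal_density 0 (sqrt h) x * (if c = b then indicator A x else 1))"
  have k: "(\<Prod>c\<in>Basis. normal_density 0 (sqrt h) (x \<bullet> c)) * indicator A (x \<bullet> b) = (\<Prod>c\<in>Basis. k c (x \<bullet> c))" for x :: 'a
    using b by (simp add: k_def prod.distrib prod.delta if_distrib[of "indicator A"] cong: if_cong)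
  have km[measurable]: "k c \<in> borel_measurable borel" for c unfolding k_def by measurable
  have "emeasure (distr (gauss h) borel (\<lambda>x::'a. x \<bullet> b)) A =
     (\<integral>\<^sup>+x. ennreal (\<Prod>c\<in>Basis. normal_density 0 (sqrt h) (x \<bullet> c)) * indicator ((\<lambda>x. x \<bullet> b) -` A) x \<partial>(lborel :: 'a measure))"
    unfolding gauss_def by (subst emeasure_distr) (auto intro!: emeasure_density measurable_sets_borel[of _ borel])
  also have "\<dots> = (\<integral>\<^sup>+x. (\<Prod>c\<in>Basis. ennreal (k c (x \<bullet> c))) \<partial>(lborel :: 'a measure))"
  proof (rule nn_integral_cong)
    fix x :: 'a
    have "(\<Prod>c\<in>Basis. ennreal (k c (x \<bullet> c))) = ennreal (\<Prod>c\<in>Basis. k c (x \<bullet> c))"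
      by (rule prod_ennreal) (simp add: k_def)
    thus "ennreal (\<Prod>c\<in>Basis. normal_density 0 (sqrt h) (x \<bullet> c)) * indicator ((\<lambda>x. x \<bullet> b) -` A) x =
        (\<Prod>c\<in>Basis. ennreal (k c (x \<bullet> c)))"
      by (simp add: k[symmetric] indicator_def)
  qed
  also have "\<dots> = (\<Prod>c\<in>Basis. (\<integral>\<^sup>+x. ennreal (k c x) \<partial>lborel))"
    by (rule nn_integral_lborel_prod) (auto simp: k_def)
  also have "\<dots> = (\<Prod>c\<in>Basis. if c = b then (\<integral>\<^sup>+x. ennreal (k b x) \<partial>lborel) else 1)"
    using h by (intro prod.cong) (auto simp: k_def nn_integral_normal_density)
  also have "\<dots> = (\<integral>\<^sup>+x. ennreal (k b x) \<partial>lborel)" using b by (simp add: prod.delta)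
  also have "\<dots> = emeasure (density lborel (\<lambda>x. ennreal (normal_density 0 (sqrt h) x))) A"
    by (subst emeasure_density) (auto simp: k_def indicator_def intro!: nn_integral_cong)
  finally show "emeasure (distr (gauss h) borel (\<lambda>x::'a. x \<bullet> b)) A = \<dots>" .
qed simp

lemma prob_space_gauss: assumes "h > 0" shows "prob_space (gauss h :: 'a::euclidean_space measure)"
proof -
  obtain b :: 'a where b: "b \<in> Basis" by (meson nonempty_Basis ex_in_conv)
  have "prob_space (distr (gauss h) borel (\<lambda>x::'a. x \<bullet> b))"
    using assms by (simp add: gauss_marginal_basis[OF assms b] prob_space_normal_density)
  thus ?thesis by (rule prob_space_distrD[rotated]) measurable
qed

text \<open>A reflection exchanges e with a basis vector of the same length, which reduces the
  marginal along e to a coordinate.\<close>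

lemma gauss_marginal:
  assumes h: "h > 0" and e: "norm (e::'a::euclidean_space) = 1"
  shows "distr (gauss h) borel (\<lambda>x. x \<bullet> e) = density lborel (\<lambda>x. ennreal (normal_density 0 (sqrt h) x))"
proof -
  obtain b :: 'a where b: "b \<in> Basis" by (meson nonempty_Basis ex_in_conv)
  have "distr (gauss h) borel (\<lambda>x. x \<bullet> e) = distr (distr (gauss h) borel (reflect (e - b))) borel (\<lambda>x. x \<bullet> e)"
    by (simp add: gauss_distr_reflect)
  also have "\<dots> = distr (gauss h) borel (\<lambda>x. reflect (e - b) x \<bullet> e)"
    by (subst distr_distr) (auto simp: comp_def)
  also have "\<dots> = distr (gauss h) borel (\<lambda>x. x \<bullet> b)"
    using e b by (simp add: reflect_inner reflect_swap)
  finally show ?thesis by (simp add: gauss_marginal_basis[OF h b])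
qed

lemma gauss_moments:
  assumes h: "h > 0" and e: "norm (e::'a::euclidean_space) = 1"
  shows "has_bochner_integral (gauss h) (\<lambda>x. x \<bullet> e) 0"
    and "has_bochner_integral (gauss h) (\<lambda>x. (x \<bullet> e)\<^sup>2) h"
    and "has_bochner_integral (gauss h) (\<lambda>x. (x \<bullet> e) ^ 4) (3 * h\<^sup>2)"
proof -
  have *: "has_bochner_integral (gauss h) (\<lambda>x. (x \<bullet> e) ^ k) m"
    if "has_bochner_integral lborel (\<lambda>x. normal_density 0 (sqrt h) x * x ^ k) m" for k m
  proof -
    have "has_bochner_integral (density lborel (\<lambda>x. ennreal (normal_density 0 (sqrt h) x))) (\<lambda>x. x ^ k) m"
      using that by (intro has_bochner_integral_density) auto
    hence "has_bochner_integral (distr (gauss h) borel (\<lambda>x. x \<bullet> e)) (\<lambda>x. x ^ k) m"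
      by (simp add: gauss_marginal[OF h e])
    thus ?thesis by (simp add: has_bochner_integral_iff integrable_distr_eq integral_distr)
  qed
  have s: "sqrt h > 0" using h by simp
  show "has_bochner_integral (gauss h) (\<lambda>x. x \<bullet> e) 0"
    using *[of 1 0] normal_moment_odd[OF s, of 0 0] by simp
  show "has_bochner_integral (gauss h) (\<lambda>x. (x \<bullet> e)\<^sup>2) h"
    using *[of 2 h] normal_moment_even[OF s, of 0 1] h by simp
  show "has_bochner_integral (gauss h) (\<lambda>x. (x \<bullet> e) ^ 4) (3 * h\<^sup>2)"
    using *[of 4 "3 * h\<^sup>2"] normal_moment_even[OF s, of 0 2] h
    by (simp add: fact_numeral power2_eq_square field_simps)
qed

lemma gauss_norm2:
  fixes h :: real
  assumes h: "h > 0"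
  shows "has_bochner_integral (gauss h) (\<lambda>x::'a::euclidean_space. (norm x)\<^sup>2) (DIM('a) * h)"
proof -
  have "has_bochner_integral (gauss h) (\<lambda>x::'a. \<Sum>b\<in>Basis. (x \<bullet> b)\<^sup>2) (\<Sum>b\<in>(Basis::'a set). h)"
    by (intro has_bochner_integral_sum gauss_moments h) auto
  moreover have "(norm x)\<^sup>2 = (\<Sum>b\<in>Basis. (x \<bullet> b)\<^sup>2)" for x :: 'a
    unfolding power2_norm_eq_inner by (subst euclidean_inner) (simp add: power2_eq_square)
  ultimately show ?thesis by simp
qed

abbreviation gauss_conf :: "nat \<Rightarrow> real \<Rightarrow> (nat \<Rightarrow> 'a::euclidean_space) measure" where
  "gauss_conf n h \<equiv> Pi\<^sub>M {1..n} (\<lambda>_. gauss h)"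

section \<open>Joint law of the Brownian increments on a grid\<close>

lemma (in prob_space) indep_vars_PiM_finite:
  assumes ind: "indep_vars (\<lambda>_. N) X I" and J: "J \<subseteq> I" "finite J" "J \<noteq> {}" and A: "\<And>j. j \<in> J \<Longrightarrow> A j \<in> sets N"
  shows "prob {\<omega>\<in>space M. \<forall>j\<in>J. X j \<omega> \<in> A j} = (\<Prod>j\<in>J. prob {\<omega>\<in>space M. X j \<omega> \<in> A j})"
proof -
  have "prob (\<Inter>j\<in>J. X j -` A j \<inter> space M) = (\<Prod>j\<in>J. prob (X j -` A j \<inter> space M))"
    by (rule indep_varsD[OF ind J(3) J(2) J(1)]) (use A in auto)
  moreover have "(\<Inter>j\<in>J. X j -` A j \<inter> space M) = {\<omega>\<in>space M. \<forall>j\<in>J. X j \<omega> \<in> A j}"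
    using J by auto
  moreover have "X j -` A j \<inter> space M = {\<omega>\<in>space M. X j \<omega> \<in> A j}" for j by auto
  ultimately show ?thesis by simp
qed

text \<open>The definitions give independence in time for each single motion, and independence of
  the path-valued variables of different particles. An event on the increments of one particle is an
  event on its path, so probabilities factor over particles first and over time afterwards.\<close>

lemma brownian_increments_array:
  fixes B :: "nat \<Rightarrow> real \<Rightarrow> 'w \<Rightarrow> 'a::euclidean_space"
  assumes "prob_space M" and B: "independent_brownian_motions M n B" and h: "h > 0" and n: "n \<ge> 1" and K: "K \<ge> 1"
  shows "prob_space.indep_vars M (\<lambda>_. borel)
    (\<lambda>p \<omega>. B (snd p) (real (Suc (fst p)) * h) \<omega> - B (snd p) (real (fst p) * h) \<omega>) ({..<K} \<times> {1..n})"
proof -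
  interpret prob_space M by fact
  define \<xi> where "\<xi> = (\<lambda>p \<omega>. B (snd p) (real (Suc (fst p)) * h) \<omega> - B (snd p) (real (fst p) * h) \<omega>)"
  have Bm [measurable]: "B i s \<in> borel_measurable M" if "i \<in> {1..n}" "s \<ge> 0" for i s
    using B that by (auto simp: independent_brownian_motions_def brownian_motion_def)
  have \<xi>m: "\<xi> p \<in> borel_measurable M" if "p \<in> {..<K} \<times> {1..n}" for p
    unfolding \<xi>_def using that h by (intro borel_measurable_diff Bm) auto
  have ind1: "indep_vars (\<lambda>_. borel) (\<lambda>m \<omega>. \<xi> (m, i) \<omega>) UNIV" if "i \<in> {1..n}" for i
  proof -
    have "brownian_motion M (B i)" using B that by (auto simp: independent_brownian_motions_def)
    hence *: "0 \<le> \<tau> 0 \<and> mono \<tau> \<longrightarrow> indep_vars (\<lambda>_. borel) (\<lambda>m \<omega>. B i (\<tau> (Suc m)) \<omega> - B i (\<tau> m) \<omega>) UNIV"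
      for \<tau> :: "nat \<Rightarrow> real" unfolding brownian_motion_def by blast
    have "mono (\<lambda>m. real m * h)" using h by (intro monoI mult_right_mono) auto
    thus ?thesis using *[of "\<lambda>m. real m * h"] h by (simp add: \<xi>_def)
  qed
  have ind2: "indep_vars (\<lambda>_. Pi\<^sub>M {0..} (\<lambda>_. borel)) (\<lambda>i \<omega>. \<lambda>t\<in>{0..}. B i t \<omega>) {1..n}"
    using B by (auto simp: independent_brownian_motions_def)
  show ?thesis
    unfolding \<xi>_def[symmetric] indep_vars_def2
  proof (intro conjI ballI \<xi>m)
    show "indep_sets (\<lambda>p. {\<xi> p -` A \<inter> space M |A. A \<in> sets borel}) ({..<K} \<times> {1..n})"
    proof (subst indep_sets_finite)
      show "{..<K} \<times> {1..n} \<noteq> {}" using n K by (auto simp: lessThan_empty_iff)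
      show "{\<xi> p -` A \<inter> space M |A. A \<in> sets borel} \<subseteq> events" if "p \<in> {..<K} \<times> {1..n}" for p
        using \<xi>m[OF that] by (auto intro: measurable_sets)
      show "space M \<in> {\<xi> p -` A \<inter> space M |A. A \<in> sets borel}" for p by (auto intro!: exI[of _ UNIV])
      show "\<forall>A\<in>Pi ({..<K} \<times> {1..n}) (\<lambda>p. {\<xi> p -` A \<inter> space M |A. A \<in> sets borel}).
          prob (\<Inter>j\<in>{..<K} \<times> {1..n}. A j) = (\<Prod>j\<in>{..<K} \<times> {1..n}. prob (A j))"
      proof
        fix A assume "A \<in> Pi ({..<K} \<times> {1..n}) (\<lambda>p. {\<xi> p -` A \<inter> space M |A. A \<in> sets borel})"
        hence "\<forall>p\<in>{..<K} \<times> {1..n}. \<exists>S. S \<in> sets borel \<and> A p = \<xi> p -` S \<inter> space M" by (auto simp: Pi_def) blast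
        then obtain S where S: "\<And>p. p \<in> {..<K} \<times> {1..n} \<Longrightarrow> S p \<in> sets borel"
          "\<And>p. p \<in> {..<K} \<times> {1..n} \<Longrightarrow> A p = \<xi> p -` S p \<inter> space M" by metis
        \<comment> \<open>The event for particle i as a set of paths. It involves finitely many
          times, hence is measurable in the uncountable product.\<close>
        define C where "C = (\<lambda>i. {f \<in> space (Pi\<^sub>M {0::real..} (\<lambda>_. borel :: 'a measure)).
            \<forall>m\<in>{..<K}. f (real (Suc m) * h) - f (real m * h) \<in> S (m, i)})"
        have C: "C i \<in> sets (Pi\<^sub>M {0..} (\<lambda>_. borel))" if "i \<in> {1..n}" for i
        proof -
          have [measurable]: "(\<lambda>f. f s) \<in> borel_measurable (Pi\<^sub>M {0::real..} (\<lambda>_. borel :: 'a measure))" if "s \<ge> 0" for s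
            using that by (intro measurable_component_singleton) auto
          have [measurable]: "S (m, i) \<in> sets borel" if "m < K" for m using S(1)[of "(m,i)"] that \<open>i \<in> {1..n}\<close> by auto
          have "Measurable.pred (Pi\<^sub>M {0::real..} (\<lambda>_. borel :: 'a measure)) (\<lambda>f. f (real (Suc m) * h) - f (real m * h) \<in> S (m, i))"
            if "m < K" for m
            using h that by (intro pred_sets2[of _ borel] borel_measurable_diff) (auto intro!: measurable_component_singleton)
          thus ?thesis unfolding C_def by (intro sets.sets_Collect_finite_All) (auto simp: pred_def)
        qed
        have path: "(\<lambda>t\<in>{0..}. B i t \<omega>) \<in> C i \<longleftrightarrow> (\<forall>m\<in>{..<K}. \<xi> (m, i) \<omega> \<in> S (m, i))" for i \<omega>
          using h by (auto simp: C_def space_PiM \<xi>_def)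
        have "(\<Inter>j\<in>{..<K} \<times> {1..n}. A j) = {\<omega>\<in>space M. \<forall>i\<in>{1..n}. (\<lambda>t\<in>{0..}. B i t \<omega>) \<in> C i}"
          unfolding path using S(2) n K by (auto simp: lessThan_empty_iff)
        also have "prob \<dots> = (\<Prod>i\<in>{1..n}. prob {\<omega>\<in>space M. (\<lambda>t\<in>{0..}. B i t \<omega>) \<in> C i})"
          by (rule indep_vars_PiM_finite[OF ind2]) (use n C in auto)
        also have "\<dots> = (\<Prod>i\<in>{1..n}. \<Prod>m\<in>{..<K}. prob (A (m, i)))"
        proof (rule prod.cong[OF refl])
          fix i assume i: "i \<in> {1..n}"
          have "prob {\<omega>\<in>space M. (\<lambda>t\<in>{0..}. B i t \<omega>) \<in> C i} = prob {\<omega>\<in>space M. \<forall>m\<in>{..<K}. \<xi> (m, i) \<omega> \<in> S (m, i)}"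
            by (simp only: path)
          also have "\<dots> = (\<Prod>m\<in>{..<K}. prob {\<omega>\<in>space M. \<xi> (m, i) \<omega> \<in> S (m, i)})"
            by (rule indep_vars_PiM_finite[OF ind1[OF i]]) (use K i S(1) in \<open>auto simp: lessThan_empty_iff\<close>)
          also have "\<dots> = (\<Prod>m\<in>{..<K}. prob (A (m, i)))"
            using i by (intro prod.cong refl arg_cong[where f=prob]) (auto simp: S(2))
          finally show "prob {\<omega>\<in>space M. (\<lambda>t\<in>{0..}. B i t \<omega>) \<in> C i} = (\<Prod>m\<in>{..<K}. prob (A (m, i)))" .
        qed
        also have "\<dots> = (\<Prod>j\<in>{..<K} \<times> {1..n}. prob (A j))"
          by (subst prod.swap) (simp add: prod.cartesian_product)
        finally show "prob (\<Inter>j\<in>{..<K} \<times> {1..n}. A j) = (\<Prod>j\<in>{..<K} \<times> {1..n}. prob (A j))" .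
      qed
    qed auto
  qed
qed

lemma brownian_increments_law:
  fixes B :: "nat \<Rightarrow> real \<Rightarrow> 'w \<Rightarrow> 'a::euclidean_space"
  assumes "prob_space M" and B: "independent_brownian_motions M n B" and h: "h > 0" and n: "n \<ge> 1" and K: "K \<ge> 1"
  shows "distr M (Pi\<^sub>M {..<K} (\<lambda>_. conf n))
      (\<lambda>\<omega>. \<lambda>m\<in>{..<K}. \<lambda>i\<in>{1..n}. B i (real (Suc m) * h) \<omega> - B i (real m * h) \<omega>)
    = Pi\<^sub>M {..<K} (\<lambda>_. gauss_conf n h)"
proof -
  interpret prob_space M by fact
  define \<xi> where "\<xi> = (\<lambda>p \<omega>. B (snd p) (real (Suc (fst p)) * h) \<omega> - B (snd p) (real (fst p) * h) \<omega>)"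
  have ind: "indep_vars (\<lambda>_. borel) \<xi> ({..<K} \<times> {1..n})"
    using brownian_increments_array[OF assms] by (simp add: \<xi>_def)
  have law1: "distr M borel (\<xi> p) = gauss h" if p: "p \<in> {..<K} \<times> {1..n}" for p
  proof -
    have "brownian_motion M (B (snd p))" using B p by (auto simp: independent_brownian_motions_def)
    hence *: "0 \<le> s \<and> s < t \<longrightarrow> distributed M lborel (\<lambda>\<omega>. B (snd p) t \<omega> - B (snd p) s \<omega>)
          (\<lambda>x. ennreal (\<Prod>b\<in>Basis. normal_density 0 (sqrt (t - s)) (x \<bullet> b)))" for s t
      unfolding brownian_motion_def by blast
    have "real (Suc (fst p)) * h - real (fst p) * h = h" by (simp add: algebra_simps)
    hence "distributed M lborel (\<xi> p) (\<lambda>x. ennreal (\<Prod>b\<in>Basis. normal_density 0 (sqrt h) (x \<bullet> b)))"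
      using *[of "real (fst p) * h" "real (Suc (fst p)) * h"] h by (simp add: \<xi>_def)
    hence "distr M lborel (\<xi> p) = gauss h"
      unfolding gauss_def by (rule distributed_distr_eq_density)
    moreover have "distr M lborel (\<xi> p) = distr M borel (\<xi> p)" by (rule distr_cong) auto
    ultimately show ?thesis by simp
  qed
  define \<zeta> where "\<zeta> = (\<lambda>m \<omega>. \<lambda>i\<in>{1..n}. \<xi> (m, i) \<omega>)"
  have "indep_vars (\<lambda>m. Pi\<^sub>M ({m} \<times> {1..n}) (\<lambda>_. borel)) (\<lambda>m \<omega>. restrict (\<lambda>i. \<xi> i \<omega>) ({m} \<times> {1..n})) {..<K}"
    by (rule indep_vars_restrict[OF ind]) (auto simp: disjoint_family_on_def)
  hence "indep_vars (\<lambda>m. conf n) (\<lambda>m \<omega>. (\<lambda>f. \<lambda>i\<in>{1..n}. f (m, i)) (restrict (\<lambda>i. \<xi> i \<omega>) ({m} \<times> {1..n}))) {..<K}"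
    by (rule indep_vars_compose2) (rule measurable_restrict, rule measurable_component_singleton, auto)
  moreover have "(\<lambda>f. \<lambda>i\<in>{1..n}. f (m, i)) (restrict (\<lambda>i. \<xi> i \<omega>) ({m} \<times> {1..n})) = \<zeta> m \<omega>" for m \<omega>
    by (auto simp: \<zeta>_def restrict_def)
  ultimately have ind\<zeta>: "indep_vars (\<lambda>m. conf n) \<zeta> {..<K}" by simp
  have law\<zeta>: "distr M (conf n) (\<zeta> m) = gauss_conf n h" if m: "m < K" for m
  proof -
    have "indep_vars (\<lambda>i. Pi\<^sub>M {(m, i)} (\<lambda>_. borel)) (\<lambda>i \<omega>. restrict (\<lambda>p. \<xi> p \<omega>) {(m, i)}) {1..n}"
      by (rule indep_vars_restrict[OF ind]) (use m in \<open>auto simp: disjoint_family_on_def\<close>)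
    hence "indep_vars (\<lambda>_. borel) (\<lambda>i \<omega>. (\<lambda>f. f (m, i)) (restrict (\<lambda>p. \<xi> p \<omega>) {(m, i)})) {1..n}"
      by (rule indep_vars_compose2) (rule measurable_component_singleton, auto)
    hence "indep_vars (\<lambda>_. borel) (\<lambda>i \<omega>. \<xi> (m, i) \<omega>) {1..n}" by simp
    hence "distr M (conf n) (\<zeta> m) = Pi\<^sub>M {1..n} (\<lambda>i. distr M borel (\<lambda>\<omega>. \<xi> (m, i) \<omega>))"
      unfolding \<zeta>_def using n m ind
      by (subst (asm) indep_vars_iff_distr_eq_PiM') (auto simp: indep_vars_def2)
    also have "\<dots> = gauss_conf n h" using m by (intro PiM_cong refl law1) auto
    finally show ?thesis .
  qed
  have "distr M (Pi\<^sub>M {..<K} (\<lambda>_. conf n)) (\<lambda>\<omega>. \<lambda>m\<in>{..<K}. \<zeta> m \<omega>) = Pi\<^sub>M {..<K} (\<lambda>m. distr M (conf n) (\<zeta> m))"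
  proof (rule indep_vars_iff_distr_eq_PiM'[THEN iffD1, OF _ _ ind\<zeta>])
    show "{..<K} \<noteq> {}" using K by (auto simp: lessThan_empty_iff)
    show "random_variable (conf n) (\<zeta> m)" if "m \<in> {..<K}" for m
      using ind\<zeta> that unfolding indep_vars_def2 by blast
  qed
  also have "\<dots> = Pi\<^sub>M {..<K} (\<lambda>_. gauss_conf n h)" by (intro PiM_cong refl law\<zeta>) auto
  finally show ?thesis by (simp add: \<zeta>_def \<xi>_def)
qed

declare One_nat_def [simp del]

text \<open>The noise is recorded at the dyadic times \<open>m t / 2\<^sup>j\<close>, all of which are reached by refining a single
  grid; \<open>dyadic_incr\<close> recovers the increments of level \<open>j\<close>.\<close>

abbreviation dyadic_space :: "nat \<Rightarrow> (nat \<times> nat \<Rightarrow> nat \<Rightarrow> 'a::euclidean_space) measure" where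
  "dyadic_space n \<equiv> Pi\<^sub>M UNIV (\<lambda>_. conf n)"

definition dyadic_noise ::
  "real \<Rightarrow> nat \<Rightarrow> (nat \<Rightarrow> real \<Rightarrow> 'w \<Rightarrow> 'a::euclidean_space) \<Rightarrow> 'w \<Rightarrow> nat \<times> nat \<Rightarrow> nat \<Rightarrow> 'a" where
  "dyadic_noise t n B \<omega> = (\<lambda>(j, m). \<lambda>i\<in>{1..n}. B i (real m * (t / 2 ^ j)) \<omega> - B i 0 \<omega>)"

definition dyadic_incr :: "nat \<Rightarrow> nat \<Rightarrow> (nat \<times> nat \<Rightarrow> nat \<Rightarrow> 'a::euclidean_space) \<Rightarrow> nat \<Rightarrow> nat \<Rightarrow> 'a" where
  "dyadic_incr n j w m = (\<lambda>i\<in>{1..n}. w (j, Suc m) i - w (j, m) i)"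

lemma dyadic_incr_measurable [measurable]:
  "(\<lambda>w. dyadic_incr n j w m) \<in> dyadic_space n \<rightarrow>\<^sub>M conf n"
  unfolding dyadic_incr_def
proof (rule measurable_restrict)
  fix i assume i: "i \<in> {1..n}"
  have [measurable]: "(\<lambda>w. w p i) \<in> borel_measurable (dyadic_space n)" for p :: "nat \<times> nat"
    using measurable_compose[OF measurable_component_singleton[of p UNIV "\<lambda>_. conf n"] measurable_component_singleton[OF i]]
    by simp
  show "(\<lambda>w. w (j, Suc m) i - w (j, m) i) \<in> borel_measurable (dyadic_space n)" by measurable
qed

lemma dyadic_incr_noise:
  "dyadic_incr n j (dyadic_noise t n B \<omega>) m =
     (\<lambda>i\<in>{1..n}. B i (real (Suc m) * (t / 2 ^ j)) \<omega> - B i (real m * (t / 2 ^ j)) \<omega>)"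
  by (auto simp: dyadic_incr_def dyadic_noise_def)

lemma brownian_motion_measurable:
  "independent_brownian_motions M n B \<Longrightarrow> i \<in> {1..n} \<Longrightarrow> s \<ge> 0 \<Longrightarrow> B i s \<in> borel_measurable M"
  by (auto simp: independent_brownian_motions_def brownian_motion_def)

lemma dyadic_noise_measurable:
  assumes "independent_brownian_motions M n B" "t > 0"
  shows "dyadic_noise t n B \<in> M \<rightarrow>\<^sub>M dyadic_space n"
proof -
  have "(\<lambda>\<omega>. dyadic_noise t n B \<omega> p) \<in> M \<rightarrow>\<^sub>M conf n" for p
    unfolding dyadic_noise_def using assms(2)
    by (cases p) (auto intro!: measurable_restrict borel_measurable_diff brownian_motion_measurable[OF assms(1)])
  thus ?thesis
    by (intro measurable_PiM_single') (auto simp: space_PiM dyadic_noise_def)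
qed

text \<open>A finite set of dyadic times lies on the grid of the finest level involved, where the
  noise is a sum of increments with a known law. The common law lets solutions living on different
  probability spaces be expressed through one noise measure.\<close>

lemma dyadic_noise_law_unique:
  fixes B :: "nat \<Rightarrow> real \<Rightarrow> 'w \<Rightarrow> 'a::euclidean_space" and B' :: "nat \<Rightarrow> real \<Rightarrow> 'v \<Rightarrow> 'a"
  assumes M: "prob_space M" "independent_brownian_motions M n B"
    and M': "prob_space M'" "independent_brownian_motions M' n B'"
    and t: "t > 0" and n: "n \<ge> 1"
  shows "distr M (dyadic_space n) (dyadic_noise t n B) = distr M' (dyadic_space n) (dyadic_noise t n B')"
proof (rule measure_eqI_PiM_infinite)
  fix A :: "nat \<times> nat \<Rightarrow> (nat \<Rightarrow> 'a) set" and J :: "(nat \<times> nat) set"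
  assume J: "finite J" and A: "\<And>p. p \<in> J \<Longrightarrow> A p \<in> sets (conf n)"
  \<comment> \<open>The inserted 0 covers an empty J, and \<open>Suc\<close> makes \<open>K\<close>
    positive, as \<open>brownian_increments_law\<close> requires.\<close>
  define jm where "jm = Max (insert 0 (fst ` J))"
  define K where "K = Suc (Max (insert 0 ((\<lambda>(j, m). m * 2 ^ (jm - j)) ` J)))"
  define h where "h = t / 2 ^ jm"
  have h: "h > 0" using t by (simp add: h_def)
  have le: "j \<le> jm" "m * 2 ^ (jm - j) \<le> K" if "(j, m) \<in> J" for j m
  proof -
    show "j \<le> jm" unfolding jm_def using J that by (intro Max_ge) force+
    have "m * 2 ^ (jm - j) \<le> Max (insert 0 ((\<lambda>(j, m). m * 2 ^ (jm - j)) ` J))"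
      using J that by (intro Max_ge) force+
    thus "m * 2 ^ (jm - j) \<le> K" by (simp add: K_def)
  qed
  define F where "F = (\<lambda>(j, m) (v :: nat \<Rightarrow> nat \<Rightarrow> 'a). \<lambda>i\<in>{1..n}. \<Sum>l<m * 2 ^ (jm - j). v l i)"
  define G where "G = Pi\<^sub>M {..<K} (\<lambda>_. gauss_conf n h :: (nat \<Rightarrow> 'a) measure)"
  define E where "E = {v \<in> space (Pi\<^sub>M {..<K} (\<lambda>_. conf n :: (nat \<Rightarrow> 'a) measure)). \<forall>p\<in>J. F p v \<in> A p}"
  have Fm: "F p \<in> Pi\<^sub>M {..<K} (\<lambda>_. conf n) \<rightarrow>\<^sub>M conf n" if "p \<in> J" for p
  proof -
    obtain j m where p: "p = (j, m)" by (cases p)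
    have "(\<lambda>v. v l i) \<in> borel_measurable (Pi\<^sub>M {..<K} (\<lambda>_. conf n :: (nat \<Rightarrow> 'a) measure))"
      if "l < K" "i \<in> {1..n}" for l i
      by (rule measurable_compose[OF measurable_component_singleton[of l] measurable_component_singleton]) (use that in auto)
    thus ?thesis unfolding F_def p using le(2)[of j m] that p
      by (auto intro!: measurable_restrict borel_measurable_sum)
  qed
  have E: "E \<in> sets (Pi\<^sub>M {..<K} (\<lambda>_. conf n))"
  proof -
    have "{v \<in> space (Pi\<^sub>M {..<K} (\<lambda>_. conf n :: (nat \<Rightarrow> 'a) measure)). F p v \<in> A p} \<in> sets (Pi\<^sub>M {..<K} (\<lambda>_. conf n))"
      if "p \<in> J" for p
      using measurable_sets[OF Fm[OF that] A[OF that]] by (simp add: vimage_def Int_def conj_commute)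
    thus ?thesis unfolding E_def using J by (intro sets.sets_Collect_finite_All) auto
  qed
  have emb: "prod_emb UNIV (\<lambda>_. conf n) J (Pi\<^sub>E J A) = {w \<in> space (dyadic_space n). \<forall>p\<in>J. w p \<in> A p}"
    by (auto simp: prod_emb_def space_PiM PiE_iff extensional_def)
  have key: "emeasure (distr N (dyadic_space n) (dyadic_noise t n C)) (prod_emb UNIV (\<lambda>_. conf n) J (Pi\<^sub>E J A)) = emeasure G E"
    if N: "prob_space N" "independent_brownian_motions N n C" for N :: "'u measure" and C :: "nat \<Rightarrow> real \<Rightarrow> 'u \<Rightarrow> 'a"
  proof -
    define v where "v = (\<lambda>\<omega>. \<lambda>m\<in>{..<K}. \<lambda>i\<in>{1..n}. C i (real (Suc m) * h) \<omega> - C i (real m * h) \<omega>)"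
    have vm: "v \<in> N \<rightarrow>\<^sub>M Pi\<^sub>M {..<K} (\<lambda>_. conf n)"
      unfolding v_def using h
      by (intro measurable_restrict borel_measurable_diff brownian_motion_measurable[OF N(2)]) auto
    have noise: "dyadic_noise t n C \<omega> (j, m) = F (j, m) (v \<omega>)" if "(j, m) \<in> J" for j m \<omega>
    proof -
      have eq: "real m * (t / 2 ^ j) = real (m * 2 ^ (jm - j)) * h"
      proof -
        have "(2::real) ^ jm = 2 ^ (jm - j) * 2 ^ j" using le(1)[OF that] by (simp flip: power_add)
        thus ?thesis by (simp add: h_def)
      qed
      have "C i (real m * (t / 2 ^ j)) \<omega> - C i 0 \<omega> = (\<Sum>l<m * 2 ^ (jm - j). v \<omega> l i)" if i: "i \<in> {1..n}" for i
      proof -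
        have "(\<Sum>l<m * 2 ^ (jm - j). v \<omega> l i) =
            (\<Sum>l<m * 2 ^ (jm - j). C i (real (Suc l) * h) \<omega> - C i (real l * h) \<omega>)"
          using le(2)[OF \<open>(j, m) \<in> J\<close>] i by (intro sum.cong) (auto simp: v_def)
        \<comment> \<open>The sum telescopes down to time 0. As \<open>dyadic_noise\<close>
          subtracts the value there, the identity holds for each \<omega> and not only almost
          surely.\<close>
        also have "\<dots> = C i (real (m * 2 ^ (jm - j)) * h) \<omega> - C i 0 \<omega>"
          by (subst sum_lessThan_telescope) simp
        finally show ?thesis unfolding eq by simp
      qed
      thus ?thesis by (auto simp: dyadic_noise_def F_def)
    qed
    have dm: "dyadic_noise t n C \<in> N \<rightarrow>\<^sub>M dyadic_space n" by (rule dyadic_noise_measurable[OF N(2) t])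
    have "prod_emb UNIV (\<lambda>_. conf n) J (Pi\<^sub>E J A) \<in> sets (dyadic_space n)"
      using J A by (intro sets_PiM_I) auto
    hence "emeasure (distr N (dyadic_space n) (dyadic_noise t n C)) (prod_emb UNIV (\<lambda>_. conf n) J (Pi\<^sub>E J A)) =
        emeasure N (dyadic_noise t n C -` {w \<in> space (dyadic_space n). \<forall>p\<in>J. w p \<in> A p} \<inter> space N)"
      unfolding emb by (intro emeasure_distr dm)
    also have "dyadic_noise t n C -` {w \<in> space (dyadic_space n). \<forall>p\<in>J. w p \<in> A p} \<inter> space N = v -` E \<inter> space N"
      using measurable_space[OF dm] measurable_space[OF vm] noise by (auto simp: E_def)
    also have "emeasure N \<dots> = emeasure (distr N (Pi\<^sub>M {..<K} (\<lambda>_. conf n)) v) E"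
      by (rule emeasure_distr[OF vm E, symmetric])
    also have "\<dots> = emeasure G E"
      unfolding v_def G_def by (subst brownian_increments_law[OF N h n]) (auto simp: K_def)
    finally show ?thesis .
  qed
  show "emeasure (distr M (dyadic_space n) (dyadic_noise t n B)) (prod_emb UNIV (\<lambda>_. conf n) J (Pi\<^sub>E J A)) =
      emeasure (distr M' (dyadic_space n) (dyadic_noise t n B')) (prod_emb UNIV (\<lambda>_. conf n) J (Pi\<^sub>E J A))"
    using key[OF M] key[OF M'] by simp
next
  show "finite_measure (distr M (dyadic_space n) (dyadic_noise t n B))"
    using prob_space.prob_space_distr[OF M(1) dyadic_noise_measurable[OF M(2) t]] by (simp add: prob_space_def)
qed simp_all

lemma dyadic_incr_law:
  fixes B :: "nat \<Rightarrow> real \<Rightarrow> 'w \<Rightarrow> 'a::euclidean_space"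
  assumes M: "prob_space M" "independent_brownian_motions M n B" and t: "t > 0" and n: "n \<ge> 1"
  shows "distr (distr M (dyadic_space n) (dyadic_noise t n B)) (Pi\<^sub>M {..<2 ^ j} (\<lambda>_. conf n))
      (\<lambda>w. \<lambda>m\<in>{..<2 ^ j}. dyadic_incr n j w m) = Pi\<^sub>M {..<2 ^ j} (\<lambda>_. gauss_conf n (t / 2 ^ j))"
proof -
  have "distr (distr M (dyadic_space n) (dyadic_noise t n B)) (Pi\<^sub>M {..<2 ^ j} (\<lambda>_. conf n))
      (\<lambda>w. \<lambda>m\<in>{..<2 ^ j}. dyadic_incr n j w m) =
    distr M (Pi\<^sub>M {..<2 ^ j} (\<lambda>_. conf n)) (\<lambda>\<omega>. \<lambda>m\<in>{..<2 ^ j}. dyadic_incr n j (dyadic_noise t n B \<omega>) m)"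
    by (subst distr_distr) (auto simp: comp_def intro!: measurable_restrict dyadic_incr_measurable dyadic_noise_measurable[OF M(2) t])
  also have "\<dots> = Pi\<^sub>M {..<2 ^ j} (\<lambda>_. gauss_conf n (t / 2 ^ j))"
    unfolding dyadic_incr_noise using t by (intro brownian_increments_law[OF M _ n]) auto
  finally show ?thesis .
qed

section \<open>Iterated kernels\<close>

primrec iter_kernel :: "'s measure \<Rightarrow> ('s \<Rightarrow> 's measure) \<Rightarrow> nat \<Rightarrow> 's \<Rightarrow> 's measure" where
  "iter_kernel S K 0 = return S"
| "iter_kernel S K (Suc m) = (\<lambda>x. iter_kernel S K m x \<bind> K)"

lemma iter_kernel_measurable [measurable]:
  assumes [measurable]: "K \<in> S \<rightarrow>\<^sub>M prob_algebra S"
  shows "iter_kernel S K m \<in> S \<rightarrow>\<^sub>M prob_algebra S"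
proof (induction m)
  case (Suc m)
  note Suc[measurable]
  show ?case by (simp, measurable)
qed simp

lemma kernel_space:
  assumes "K \<in> S \<rightarrow>\<^sub>M prob_algebra S'" "x \<in> space S"
  shows "prob_space (K x)" "sets (K x) = sets S'" "space (K x) = space S'"
  using measurable_space[OF assms] by (auto simp: space_prob_algebra dest: sets_eq_imp_space_eq)

text \<open>Used with f a projection: the components of the coupled chain are then Markov chains in
  their own right. Induction pushes f through one \<open>bind\<close> at a time.\<close>

lemma iter_kernel_distr:
  assumes K [measurable]: "K \<in> S \<rightarrow>\<^sub>M prob_algebra S" and K' [measurable]: "K' \<in> S' \<rightarrow>\<^sub>M prob_algebra S'"
    and f [measurable]: "f \<in> S \<rightarrow>\<^sub>M S'"
    and eq: "\<And>x. x \<in> space S \<Longrightarrow> distr (K x) S' f = K' (f x)"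
    and x: "x \<in> space S"
  shows "distr (iter_kernel S K m x) S' f = iter_kernel S' K' m (f x)"
proof (induction m)
  case 0
  show ?case using x by (simp add: distr_return)
next
  case (Suc m)
  have sp: "sets (iter_kernel S K m x) = sets S" "space (iter_kernel S K m x) \<noteq> {}"
    "space (iter_kernel S K m x) = space S"
    using kernel_space[OF iter_kernel_measurable[OF K] x] x by auto
  have "distr (iter_kernel S K (Suc m) x) S' f = iter_kernel S K m x \<bind> (\<lambda>y. distr (K y) S' f)"
    using sp(2) by (simp, intro distr_bind[where K=S]) (auto simp: measurable_cong_sets[OF sp(1)] intro: measurable_prob_algebraD)
  also have "\<dots> = iter_kernel S K m x \<bind> (\<lambda>y. K' (f y))"
    by (intro bind_cong refl eq) (simp add: sp)
  also have "\<dots> = distr (iter_kernel S K m x) S' f \<bind> K'"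
    by (intro bind_distr[symmetric, where K=S'])
      (auto simp: measurable_cong_sets[OF sp(1)] sp(2) intro: measurable_prob_algebraD)
  finally show ?case by (simp add: Suc)
qed

text \<open>A discrete Gronwall inequality for expectations. Each of the m errors is propagated by
  at most m factors \<open>a\<close>, which \<open>max 1 a ^ m\<close> dominates whether
  \<open>a\<close> is below or above 1.\<close>

lemma iter_kernel_nn_integral_le:
  assumes K [measurable]: "K \<in> S \<rightarrow>\<^sub>M prob_algebra S" and F [measurable]: "F \<in> borel_measurable S"
    and a: "a \<ge> 0" and e: "e \<ge> 0"
    and le: "\<And>x. x \<in> space S \<Longrightarrow> (\<integral>\<^sup>+y. F y \<partial>K x) \<le> ennreal a * F x + ennreal e"
    and x: "x \<in> space S"
  shows "(\<integral>\<^sup>+y. F y \<partial>iter_kernel S K m x) \<le> ennreal (a ^ m) * F x + ennreal (m * e * max 1 a ^ m)"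
proof (induction m)
  case 0
  show ?case using x by (simp add: nn_integral_return)
next
  case (Suc m)
  have sp: "sets (iter_kernel S K m x) = sets S" "prob_space (iter_kernel S K m x)"
    "space (iter_kernel S K m x) = space S"
    using kernel_space[OF iter_kernel_measurable[OF K] x] x by auto
  have [measurable_cong]: "sets (iter_kernel S K m x) = sets S" by (rule sp)
  have "(\<integral>\<^sup>+y. F y \<partial>iter_kernel S K (Suc m) x) = (\<integral>\<^sup>+z. (\<integral>\<^sup>+y. F y \<partial>K z) \<partial>iter_kernel S K m x)"
    by (simp, intro nn_integral_bind[where B=S]) (auto simp: measurable_cong_sets[OF sp(1)] intro: measurable_prob_algebraD)
  also have "\<dots> \<le> (\<integral>\<^sup>+z. ennreal a * F z + ennreal e \<partial>iter_kernel S K m x)"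
    by (intro nn_integral_mono le) (simp add: sp)
  also have "\<dots> = ennreal a * (\<integral>\<^sup>+z. F z \<partial>iter_kernel S K m x) + ennreal e"
    using prob_space.emeasure_space_1[OF sp(2)] by (subst nn_integral_add) (auto simp: nn_integral_cmult)
  also have "\<dots> \<le> ennreal a * (ennreal (a ^ m) * F x + ennreal (m * e * max 1 a ^ m)) + ennreal e"
    by (intro add_mono mult_left_mono Suc) auto
  also have "\<dots> = ennreal (a ^ Suc m) * F x + (ennreal (a * (m * e * max 1 a ^ m)) + ennreal e)"
    using a e by (simp add: distrib_left ennreal_mult' mult.assoc add.assoc)
  also have "ennreal (a * (m * e * max 1 a ^ m)) + ennreal e = ennreal (a * (m * e * max 1 a ^ m) + e)"
    using a e by (intro ennreal_plus[symmetric]) auto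
  also have "\<dots> \<le> ennreal (Suc m * e * max 1 a ^ Suc m)"
  proof (rule ennreal_leI)
    have "a * (m * e * max 1 a ^ m) \<le> max 1 a * (m * e * max 1 a ^ m)" using a e by (intro mult_right_mono) auto
    moreover have "e * 1 \<le> e * max 1 a ^ Suc m" using e by (intro mult_left_mono one_le_power) auto
    ultimately show "a * (m * e * max 1 a ^ m) + e \<le> Suc m * e * max 1 a ^ Suc m"
      by (simp add: algebra_simps)
  qed
  finally show ?case by (simp add: add_left_mono)
qed

text \<open>A recursion fed with independent, identically distributed inputs is a Markov chain. This
  identifies the Euler chain built on the noise space with the chain defined by kernels.\<close>

lemma iter_kernel_random_recursion:
  assumes \<gamma>: "prob_space \<gamma>" "sets \<gamma> = sets N" and x: "x \<in> space S"
    and mv [measurable]: "(\<lambda>(z, \<xi>). mv z \<xi>) \<in> S \<Otimes>\<^sub>M N \<rightarrow>\<^sub>M S"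
    and eu0: "\<And>w. eu w 0 = x" and euS: "\<And>w m. eu w (Suc m) = mv (eu w m) (w m)"
  shows "(\<lambda>w. eu w m) \<in> Pi\<^sub>M {..<m} (\<lambda>_. \<gamma>) \<rightarrow>\<^sub>M S"
    and "distr (Pi\<^sub>M {..<m} (\<lambda>_. \<gamma>)) S (\<lambda>w. eu w m) = iter_kernel S (\<lambda>z. distr \<gamma> S (mv z)) m x"
proof -
  interpret \<gamma>: prob_space \<gamma> by (rule \<gamma>)
  note [measurable_cong] = \<gamma>(2)
  have K [measurable]: "(\<lambda>z. distr \<gamma> S (mv z)) \<in> S \<rightarrow>\<^sub>M prob_algebra S"
  proof (rule measurable_distr_prob_space2[where M=N])
    show "(\<lambda>z. \<gamma>) \<in> S \<rightarrow>\<^sub>M prob_algebra N" using \<gamma> by (intro measurable_const) (simp add: space_prob_algebra)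
  qed (rule mv)
  \<comment> \<open>The state at time m depends on inputs with index below m only, so the input m
    splits off as an independent factor of the product measure.\<close>
  have upd: "eu (w(m := \<xi>)) k = eu w k" if "k \<le> m" for w m \<xi> k
    using that by (induction k) (auto simp: eu0 euS)
  have meas: "(\<lambda>w. eu w k) \<in> Pi\<^sub>M {..<m} (\<lambda>_. \<gamma>) \<rightarrow>\<^sub>M S" if "k \<le> m" for k m
    using that
  proof (induction k)
    case 0
    show ?case using x by (simp add: eu0)
  next
    case (Suc k)
    hence "(\<lambda>w. (eu w k, w k)) \<in> Pi\<^sub>M {..<m} (\<lambda>_. \<gamma>) \<rightarrow>\<^sub>M S \<Otimes>\<^sub>M \<gamma>"
      by (intro measurable_Pair measurable_component_singleton) auto
    hence "(\<lambda>w. (eu w k, w k)) \<in> Pi\<^sub>M {..<m} (\<lambda>_. \<gamma>) \<rightarrow>\<^sub>M S \<Otimes>\<^sub>M N"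
      by (simp add: measurable_cong_sets[OF refl sets_pair_measure_cong[OF refl \<gamma>(2)]])
    from measurable_compose[OF this mv] show ?case by (simp add: euS)
  qed
  show "(\<lambda>w. eu w m) \<in> Pi\<^sub>M {..<m} (\<lambda>_. \<gamma>) \<rightarrow>\<^sub>M S" by (rule meas) simp
  show "distr (Pi\<^sub>M {..<m} (\<lambda>_. \<gamma>)) S (\<lambda>w. eu w m) = iter_kernel S (\<lambda>z. distr \<gamma> S (mv z)) m x"
  proof (induction m)
    case 0
    have "prob_space (Pi\<^sub>M {..<0::nat} (\<lambda>_. \<gamma>))" by (rule prob_space_PiM) (rule \<gamma>)
    thus ?case using x by (simp add: eu0 prob_space.distr_const)
  next
    case (Suc m)
    define P where "P = Pi\<^sub>M {..<m} (\<lambda>_::nat. \<gamma>)"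
    have P: "prob_space P" unfolding P_def by (rule prob_space_PiM) (rule \<gamma>)
    interpret P: prob_space P by (rule P)
    interpret pair_sigma_finite \<gamma> P ..
    have mP [measurable]: "(\<lambda>w. eu w m) \<in> P \<rightarrow>\<^sub>M S" unfolding P_def by (rule meas) simp
    have "distr (\<gamma> \<Otimes>\<^sub>M P) (Pi\<^sub>M (insert m {..<m}) (\<lambda>_. \<gamma>)) (\<lambda>(\<xi>, w). w(m := \<xi>)) = Pi\<^sub>M (insert m {..<m}) (\<lambda>_. \<gamma>)"
      unfolding P_def by (intro distr_pair_PiM_eq_PiM) (auto intro: \<gamma>)
    moreover have "insert m {..<m} = {..<Suc m}" by auto
    ultimately have PiM_Suc: "Pi\<^sub>M {..<Suc m} (\<lambda>_. \<gamma>) = distr (\<gamma> \<Otimes>\<^sub>M P) (Pi\<^sub>M {..<Suc m} (\<lambda>_. \<gamma>)) (\<lambda>(\<xi>, w). w(m := \<xi>))"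
      by simp
    have um: "(\<lambda>(\<xi>, w). w(m := \<xi>)) \<in> \<gamma> \<Otimes>\<^sub>M P \<rightarrow>\<^sub>M Pi\<^sub>M {..<Suc m} (\<lambda>_. \<gamma>)"
      unfolding P_def case_prod_beta by (rule measurable_fun_upd[where J="{..<m}"]) auto
    have "distr (Pi\<^sub>M {..<Suc m} (\<lambda>_. \<gamma>)) S (\<lambda>w. eu w (Suc m)) =
        distr (\<gamma> \<Otimes>\<^sub>M P) S (\<lambda>(\<xi>, w). mv (eu w m) \<xi>)"
      by (subst PiM_Suc, subst distr_distr[OF meas[OF order_refl] um])
        (auto simp: comp_def euS upd intro!: distr_cong)
    also have "\<dots> = P \<bind> (\<lambda>w. distr \<gamma> S (mv (eu w m)))"
    proof (rule measure_eqI)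
      have [measurable]: "(\<lambda>w. distr \<gamma> S (mv (eu w m))) \<in> P \<rightarrow>\<^sub>M subprob_algebra S"
        by (intro measurable_prob_algebraD) measurable
      show "sets (distr (\<gamma> \<Otimes>\<^sub>M P) S (\<lambda>(\<xi>, w). mv (eu w m) \<xi>)) = sets (P \<bind> (\<lambda>w. distr \<gamma> S (mv (eu w m))))"
        by (simp add: P.not_empty)
      fix A assume "A \<in> sets (distr (\<gamma> \<Otimes>\<^sub>M P) S (\<lambda>(\<xi>, w). mv (eu w m) \<xi>))"
      hence A [measurable]: "A \<in> sets S" by simp
      have "emeasure (distr (\<gamma> \<Otimes>\<^sub>M P) S (\<lambda>(\<xi>, w). mv (eu w m) \<xi>)) A =
          (\<integral>\<^sup>+p. indicator A p \<partial>distr (\<gamma> \<Otimes>\<^sub>M P) S (\<lambda>(\<xi>, w). mv (eu w m) \<xi>))" by simp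
      also have "\<dots> = (\<integral>\<^sup>+p. (case p of (\<xi>, w) \<Rightarrow> indicator A (mv (eu w m) \<xi>)) \<partial>(\<gamma> \<Otimes>\<^sub>M P))"
        by (subst nn_integral_distr) (auto simp: case_prod_beta intro!: nn_integral_cong)
      also have "\<dots> = (\<integral>\<^sup>+w. (\<integral>\<^sup>+\<xi>. indicator A (mv (eu w m) \<xi>) \<partial>\<gamma>) \<partial>P)"
        by (subst nn_integral_snd[symmetric]) auto
      also have "\<dots> = (\<integral>\<^sup>+w. emeasure (distr \<gamma> S (mv (eu w m))) A \<partial>P)"
      proof (rule nn_integral_cong)
        fix w assume "w \<in> space P"
        hence [measurable]: "mv (eu w m) \<in> \<gamma> \<rightarrow>\<^sub>M S" using measurable_space[OF mP] by measurable
        have "(\<integral>\<^sup>+\<xi>. indicator A (mv (eu w m) \<xi>) \<partial>\<gamma>) = (\<integral>\<^sup>+y. indicator A y \<partial>distr \<gamma> S (mv (eu w m)))"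
          by (subst nn_integral_distr) auto
        thus "(\<integral>\<^sup>+\<xi>. indicator A (mv (eu w m) \<xi>) \<partial>\<gamma>) = emeasure (distr \<gamma> S (mv (eu w m))) A" by simp
      qed
      also have "\<dots> = emeasure (P \<bind> (\<lambda>w. distr \<gamma> S (mv (eu w m)))) A"
        by (rule emeasure_bind[symmetric, where N=S]) (auto simp: P.not_empty)
      finally show "emeasure (distr (\<gamma> \<Otimes>\<^sub>M P) S (\<lambda>(\<xi>, w). mv (eu w m) \<xi>)) A = \<dots>" .
    qed
    also have "\<dots> = distr P S (\<lambda>w. eu w m) \<bind> (\<lambda>z. distr \<gamma> S (mv z))"
      by (intro bind_distr[symmetric, where K=S]) (auto simp: P.not_empty intro: measurable_prob_algebraD)
    finally show ?case by (simp add: Suc P_def)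
  qed
qed

section \<open>Coupling of two Euler chains\<close>

text \<open>Applied to a fixed pair of configurations, where every \<open>Q i\<close> is the
  identity or a fixed reflection: independence survives because each coordinate is transformed
  separately.\<close>

lemma gauss_conf_distr_componentwise:
  fixes Q :: "nat \<Rightarrow> 'a::euclidean_space \<Rightarrow> 'a"
  assumes h: "h > 0" and Q: "\<And>i. i \<in> {1..n} \<Longrightarrow> Q i \<in> borel_measurable borel"
    "\<And>i. i \<in> {1..n} \<Longrightarrow> distr (gauss h) borel (Q i) = gauss h"
  shows "distr (gauss_conf n h) (conf n) (\<lambda>\<xi>. \<lambda>i\<in>{1..n}. Q i (\<xi> i)) = gauss_conf n h"
proof -
  interpret G: prob_space "gauss h :: 'a measure" by (rule prob_space_gauss[OF h])
  interpret product_prob_space "\<lambda>_. gauss h :: 'a measure" "{1..n}"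
    by unfold_locales
  have Qm: "(\<lambda>\<xi>. \<lambda>i\<in>{1..n}. Q i (\<xi> i)) \<in> gauss_conf n h \<rightarrow>\<^sub>M conf n"
  proof (rule measurable_restrict)
    fix i assume i: "i \<in> {1..n}"
    have "(\<lambda>\<xi>. \<xi> i) \<in> gauss_conf n h \<rightarrow>\<^sub>M (borel :: 'a measure)"
      using measurable_component_singleton[OF i, of "\<lambda>_. gauss h :: 'a measure"] by (simp add: measurable_cong_sets[OF refl sets_gauss])
    thus "(\<lambda>\<xi>. Q i (\<xi> i)) \<in> borel_measurable (gauss_conf n h)" by (rule measurable_compose) (rule Q(1)[OF i])
  qed
  show ?thesis
  proof (rule PiM_eqI)
    show "sets (distr (gauss_conf n h) (conf n) (\<lambda>\<xi>. \<lambda>i\<in>{1..n}. Q i (\<xi> i))) = sets (gauss_conf n h :: (nat \<Rightarrow> 'a) measure)"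
      by (simp cong: sets_PiM_cong)
    fix A :: "nat \<Rightarrow> 'a set" assume "\<And>i. i \<in> {1..n} \<Longrightarrow> A i \<in> sets (gauss h)"
    hence A: "\<And>i. i \<in> {1..n} \<Longrightarrow> A i \<in> sets borel" by simp
    have QA: "Q i -` A i \<in> sets borel" if "i \<in> {1..n}" for i
      using measurable_sets[OF Q(1)[OF that] A[OF that]] by simp
    have "emeasure (distr (gauss_conf n h) (conf n) (\<lambda>\<xi>. \<lambda>i\<in>{1..n}. Q i (\<xi> i))) (Pi\<^sub>E {1..n} A)
       = emeasure (gauss_conf n h) ((\<lambda>\<xi>. \<lambda>i\<in>{1..n}. Q i (\<xi> i)) -` Pi\<^sub>E {1..n} A \<inter> space (gauss_conf n h))"
      using A by (intro emeasure_distr Qm sets_PiM_I_finite) auto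
    also have "(\<lambda>\<xi>. \<lambda>i\<in>{1..n}. Q i (\<xi> i)) -` Pi\<^sub>E {1..n} A \<inter> space (gauss_conf n h) = Pi\<^sub>E {1..n} (\<lambda>i. Q i -` A i)"
      by (auto simp: space_PiM PiE_iff)
    also have "emeasure (gauss_conf n h) \<dots> = (\<Prod>i\<in>{1..n}. emeasure (gauss h) (Q i -` A i))"
      using QA by (intro emeasure_PiM) auto
    also have "\<dots> = (\<Prod>i\<in>{1..n}. emeasure (gauss h) (A i))"
    proof (rule prod.cong[OF refl])
      fix i assume i: "i \<in> {1..n}"
      have "emeasure (distr (gauss h) borel (Q i)) (A i) = emeasure (gauss h) (Q i -` A i)"
        using Q(1)[OF i] A[OF i] by (subst emeasure_distr) auto
      thus "emeasure (gauss h) (Q i -` A i) = emeasure (gauss h) (A i)" using Q(2)[OF i] by simp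
    qed
    finally show "emeasure (distr (gauss_conf n h) (conf n) (\<lambda>\<xi>. \<lambda>i\<in>{1..n}. Q i (\<xi> i))) (Pi\<^sub>E {1..n} A)
      = (\<Prod>i\<in>{1..n}. emeasure (gauss h) (A i))" .
  qed simp
qed

lemma prob_space_gauss_conf: "h > 0 \<Longrightarrow> prob_space (gauss_conf n h :: (nat \<Rightarrow> 'a::euclidean_space) measure)"
  by (rule prob_space_PiM) (rule prob_space_gauss)

lemma sets_gauss_conf [measurable_cong]:
  "sets (gauss_conf n h :: (nat \<Rightarrow> 'a::euclidean_space) measure) = sets (conf n)"
  by (simp cong: sets_PiM_cong)

lemma gauss_conf_in_prob_algebra: "h > 0 \<Longrightarrow> gauss_conf n h \<in> space (prob_algebra (conf n))"
  by (simp add: space_prob_algebra prob_space_gauss_conf sets_gauss_conf)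

lemma nn_integral_gauss_conf_component:
  assumes h: "h > 0" and i: "i \<in> {1..n}" and [measurable]: "F \<in> borel_measurable borel"
  shows "(\<integral>\<^sup>+\<xi>. F (\<xi> i :: 'a::euclidean_space) \<partial>gauss_conf n h) = (\<integral>\<^sup>+x. F x \<partial>gauss h)"
proof -
  interpret G: prob_space "gauss h :: 'a measure" by (rule prob_space_gauss[OF h])
  interpret product_prob_space "\<lambda>_. gauss h :: 'a measure" "{1..n}" by unfold_locales
  have "distr (gauss_conf n h) (gauss h) (\<lambda>\<xi>. \<xi> i :: 'a) = gauss h" by (rule PiM_component[OF i])
  hence "(\<integral>\<^sup>+x. F x \<partial>gauss h) = (\<integral>\<^sup>+x. F x \<partial>distr (gauss_conf n h) (gauss h) (\<lambda>\<xi>. \<xi> i :: 'a))" by simp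
  also have "\<dots> = (\<integral>\<^sup>+\<xi>. F (\<xi> i) \<partial>gauss_conf n h)"
    using i by (intro nn_integral_distr measurable_component_singleton) (auto simp: measurable_cong_sets[OF sets_gauss refl])
  finally show ?thesis by simp
qed

lemma conf_component_measurable: "i \<in> {1..n} \<Longrightarrow> (\<lambda>z. z i) \<in> borel_measurable (conf n)"
  by (rule measurable_component_singleton)

definition drift_measurable :: "nat \<Rightarrow> ((nat \<Rightarrow> 'a::euclidean_space) \<Rightarrow> nat \<Rightarrow> 'a) \<Rightarrow> bool" where
  "drift_measurable n b \<longleftrightarrow> (\<forall>i\<in>{1..n}. (\<lambda>z. b z i) \<in> borel_measurable (conf n))"

lemma drift_measurableD:
  "drift_measurable n b \<Longrightarrow> X \<in> M \<rightarrow>\<^sub>M conf n \<Longrightarrow> i \<in> {1..n} \<Longrightarrow> (\<lambda>\<omega>. b (X \<omega>) i) \<in> borel_measurable M"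
  unfolding drift_measurable_def by (rule measurable_compose[of X M "conf n" "\<lambda>z. b z i"]) blast+

lemma in_box_measurable: "{z \<in> space (conf n). in_box n R (z :: nat \<Rightarrow> 'a::euclidean_space)} \<in> sets (conf n)"
  unfolding in_box_def
proof (rule sets.sets_Collect_finite_All)
  fix i assume "i \<in> {1..n}"
  note [measurable] = conf_component_measurable[OF this]
  show "{z \<in> space (conf n). norm (z i :: 'a) \<le> R} \<in> sets (conf n)" by measurable
qed simp

lemma in_box_pred [measurable]: "Measurable.pred (conf n) (in_box n R)"
  using in_box_measurable by (simp add: pred_def)

lemma move_measurable [measurable]:
  fixes b :: "(nat \<Rightarrow> 'a::euclidean_space) \<Rightarrow> nat \<Rightarrow> 'a"
  assumes b: "drift_measurable n b" and X [measurable]: "X \<in> M \<rightarrow>\<^sub>M conf n" and Y [measurable]: "Y \<in> M \<rightarrow>\<^sub>M conf n"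
  shows "(\<lambda>\<omega>. move n b h R (X \<omega>) (Y \<omega>)) \<in> M \<rightarrow>\<^sub>M conf n"
proof -
  have [measurable]: "(\<lambda>\<omega>. X \<omega> i) \<in> borel_measurable M" "(\<lambda>\<omega>. Y \<omega> i) \<in> borel_measurable M"
    "(\<lambda>\<omega>. b (X \<omega>) i) \<in> borel_measurable M" if "i \<in> {1..n}" for i
    using measurable_compose[OF X conf_component_measurable[OF that]]
      measurable_compose[OF Y conf_component_measurable[OF that]]
      drift_measurableD[OF b X that] by auto
  have [measurable]: "(\<lambda>\<omega>. \<lambda>i\<in>{1..n}. X \<omega> i + h *\<^sub>R b (X \<omega>) i + Y \<omega> i) \<in> M \<rightarrow>\<^sub>M conf n"
    by (rule measurable_restrict) measurable
  show ?thesis unfolding move_def by measurable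
qed

definition drift_diff :: "((nat \<Rightarrow> 'a::euclidean_space) \<Rightarrow> nat \<Rightarrow> 'a) \<Rightarrow> real \<Rightarrow> (nat \<Rightarrow> 'a) \<Rightarrow> (nat \<Rightarrow> 'a) \<Rightarrow> nat \<Rightarrow> 'a"
  where "drift_diff b h z w i = (z i + h *\<^sub>R b z i) - (w i + h *\<^sub>R b w i)"

definition pair_noise ::
  "nat \<Rightarrow> ((nat \<Rightarrow> 'a::euclidean_space) \<Rightarrow> nat \<Rightarrow> 'a) \<Rightarrow> real \<Rightarrow> real \<Rightarrow> (nat \<Rightarrow> 'a) \<Rightarrow> (nat \<Rightarrow> 'a) \<Rightarrow> (nat \<Rightarrow> 'a) \<Rightarrow> nat \<Rightarrow> 'a"
  where "pair_noise n b h \<delta> z w \<xi> =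
    (\<lambda>i\<in>{1..n}. if \<delta> \<le> norm (drift_diff b h z w i) then reflect (drift_diff b h z w i) (\<xi> i) else \<xi> i)"

definition pair_move ::
  "nat \<Rightarrow> ((nat \<Rightarrow> 'a::euclidean_space) \<Rightarrow> nat \<Rightarrow> 'a) \<Rightarrow> real \<Rightarrow> real \<Rightarrow> real \<Rightarrow>
     (nat \<Rightarrow> 'a) \<times> (nat \<Rightarrow> 'a) \<Rightarrow> (nat \<Rightarrow> 'a) \<Rightarrow> (nat \<Rightarrow> 'a) \<times> (nat \<Rightarrow> 'a)"
  where "pair_move n b h R \<delta> p \<xi> =
    (move n b h R (fst p) \<xi>, move n b h R (snd p) (pair_noise n b h \<delta> (fst p) (snd p) \<xi>))"

abbreviation "conf2 n \<equiv> conf n \<Otimes>\<^sub>M conf n"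

definition step_kernel ::
  "nat \<Rightarrow> ((nat \<Rightarrow> 'a::euclidean_space) \<Rightarrow> nat \<Rightarrow> 'a) \<Rightarrow> real \<Rightarrow> real \<Rightarrow> (nat \<Rightarrow> 'a) \<Rightarrow> (nat \<Rightarrow> 'a) measure"
  where "step_kernel n b h R z = distr (gauss_conf n h) (conf n) (move n b h R z)"

definition pair_kernel ::
  "nat \<Rightarrow> ((nat \<Rightarrow> 'a::euclidean_space) \<Rightarrow> nat \<Rightarrow> 'a) \<Rightarrow> real \<Rightarrow> real \<Rightarrow> real \<Rightarrow>
     (nat \<Rightarrow> 'a) \<times> (nat \<Rightarrow> 'a) \<Rightarrow> ((nat \<Rightarrow> 'a) \<times> (nat \<Rightarrow> 'a)) measure"
  where "pair_kernel n b h R \<delta> p = distr (gauss_conf n h) (conf2 n) (pair_move n b h R \<delta> p)"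

lemma pair_noise_measurable:
  fixes b :: "(nat \<Rightarrow> 'a::euclidean_space) \<Rightarrow> nat \<Rightarrow> 'a"
  assumes b: "drift_measurable n b"
    and X [measurable]: "X \<in> M \<rightarrow>\<^sub>M conf n" and Y [measurable]: "Y \<in> M \<rightarrow>\<^sub>M conf n" and Z [measurable]: "Z \<in> M \<rightarrow>\<^sub>M conf n"
  shows "(\<lambda>\<omega>. pair_noise n b h \<delta> (X \<omega>) (Y \<omega>) (Z \<omega>)) \<in> M \<rightarrow>\<^sub>M conf n"
  unfolding pair_noise_def drift_diff_def
proof (rule measurable_restrict)
  fix i assume i: "i \<in> {1..n}"
  have [measurable]: "(\<lambda>\<omega>. X \<omega> i) \<in> borel_measurable M" "(\<lambda>\<omega>. Y \<omega> i) \<in> borel_measurable M"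
    "(\<lambda>\<omega>. Z \<omega> i) \<in> borel_measurable M"
    "(\<lambda>\<omega>. b (X \<omega>) i) \<in> borel_measurable M" "(\<lambda>\<omega>. b (Y \<omega>) i) \<in> borel_measurable M"
    using measurable_compose[OF X conf_component_measurable[OF i]]
      measurable_compose[OF Y conf_component_measurable[OF i]]
      measurable_compose[OF Z conf_component_measurable[OF i]]
      drift_measurableD[OF b X i] drift_measurableD[OF b Y i]
    by auto
  show "(\<lambda>\<omega>. if \<delta> \<le> norm (X \<omega> i + h *\<^sub>R b (X \<omega>) i - (Y \<omega> i + h *\<^sub>R b (Y \<omega>) i))
      then reflect (X \<omega> i + h *\<^sub>R b (X \<omega>) i - (Y \<omega> i + h *\<^sub>R b (Y \<omega>) i)) (Z \<omega> i) else Z \<omega> i) \<in> borel_measurable M"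
    by measurable
qed

lemma step_kernel_measurable:
  assumes "drift_measurable n b" "h > 0"
  shows "step_kernel n b h R \<in> conf n \<rightarrow>\<^sub>M prob_algebra (conf n)"
  unfolding step_kernel_def
proof (rule measurable_distr_prob_space2[where M="conf n"])
  show "(\<lambda>x. gauss_conf n h) \<in> conf n \<rightarrow>\<^sub>M prob_algebra (conf n)"
    by (intro measurable_const gauss_conf_in_prob_algebra assms)
  show "(\<lambda>(x, y). move n b h R x y) \<in> conf n \<Otimes>\<^sub>M conf n \<rightarrow>\<^sub>M conf n"
    unfolding case_prod_beta by (intro move_measurable assms) auto
qed

lemma pair_move_measurable:
  assumes b: "drift_measurable n b" and [measurable]: "X \<in> M \<rightarrow>\<^sub>M conf2 n" "Y \<in> M \<rightarrow>\<^sub>M conf n"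
  shows "(\<lambda>\<omega>. pair_move n b h R \<delta> (X \<omega>) (Y \<omega>)) \<in> M \<rightarrow>\<^sub>M conf2 n"
  unfolding pair_move_def
  by (intro measurable_Pair move_measurable[OF b] pair_noise_measurable[OF b]) measurable

lemma pair_kernel_measurable:
  assumes "drift_measurable n b" "h > 0"
  shows "pair_kernel n b h R \<delta> \<in> conf2 n \<rightarrow>\<^sub>M prob_algebra (conf2 n)"
  unfolding pair_kernel_def
proof (rule measurable_distr_prob_space2[where M="conf n"])
  show "(\<lambda>x. gauss_conf n h) \<in> conf2 n \<rightarrow>\<^sub>M prob_algebra (conf n)"
    by (intro measurable_const gauss_conf_in_prob_algebra assms)
  show "(\<lambda>(x, y). pair_move n b h R \<delta> x y) \<in> conf2 n \<Otimes>\<^sub>M conf n \<rightarrow>\<^sub>M conf2 n"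
    unfolding case_prod_beta by (intro pair_move_measurable assms) auto
qed

text \<open>The first chain uses the noise as it is. The second uses a transformed noise whose
  reflection directions depend on the current pair and not on the noise, so it is again Gaussian
  with independent coordinates.\<close>

lemma pair_kernel_marginals:
  fixes b :: "(nat \<Rightarrow> 'a::euclidean_space) \<Rightarrow> nat \<Rightarrow> 'a"
  assumes b: "drift_measurable n b" and h: "h > 0" and p: "p \<in> space (conf2 n)"
  shows "distr (pair_kernel n b h R \<delta> p) (conf n) fst = step_kernel n b h R (fst p)"
    and "distr (pair_kernel n b h R \<delta> p) (conf n) snd = step_kernel n b h R (snd p)"
proof -
  have zw: "fst p \<in> space (conf n)" "snd p \<in> space (conf n)" using p by (auto simp: space_pair_measure)
  have pm: "pair_move n b h R \<delta> p \<in> gauss_conf n h \<rightarrow>\<^sub>M conf2 n"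
    by (rule pair_move_measurable[OF b measurable_const[OF p]]) measurable
  have nm: "pair_noise n b h \<delta> (fst p) (snd p) \<in> gauss_conf n h \<rightarrow>\<^sub>M conf n"
    by (rule pair_noise_measurable[OF b measurable_const[OF zw(1)] measurable_const[OF zw(2)]]) measurable
  have mm: "move n b h R (snd p) \<in> conf n \<rightarrow>\<^sub>M conf n"
    by (rule move_measurable[OF b measurable_const[OF zw(2)]]) measurable
  show "distr (pair_kernel n b h R \<delta> p) (conf n) fst = step_kernel n b h R (fst p)"
    unfolding pair_kernel_def step_kernel_def
    by (subst distr_distr[OF _ pm]) (auto simp: comp_def pair_move_def)
  define Q where "Q = (\<lambda>i \<xi>. if \<delta> \<le> norm (drift_diff b h (fst p) (snd p) i)
      then reflect (drift_diff b h (fst p) (snd p) i) \<xi> else \<xi>)"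
  have "distr (gauss_conf n h) (conf n) (pair_noise n b h \<delta> (fst p) (snd p)) = gauss_conf n h"
  proof -
    have "distr (gauss_conf n h) (conf n) (\<lambda>\<xi>. \<lambda>i\<in>{1..n}. Q i (\<xi> i)) = gauss_conf n h"
    proof (rule gauss_conf_distr_componentwise[OF h])
      fix i
      show "Q i \<in> borel_measurable borel" by (cases "\<delta> \<le> norm (drift_diff b h (fst p) (snd p) i)") (auto simp: Q_def)
      have "distr (gauss h) borel (\<lambda>x::'a. x) = gauss h" by (rule distr_id2) simp
      thus "distr (gauss h) borel (Q i) = gauss h"
        by (cases "\<delta> \<le> norm (drift_diff b h (fst p) (snd p) i)") (auto simp: Q_def gauss_distr_reflect[unfolded eta_contract_eq])
    qed
    thus ?thesis by (simp add: Q_def pair_noise_def[abs_def])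
  qed
  hence "step_kernel n b h R (snd p) = distr (distr (gauss_conf n h) (conf n) (pair_noise n b h \<delta> (fst p) (snd p))) (conf n) (move n b h R (snd p))"
    by (simp add: step_kernel_def)
  also have "\<dots> = distr (gauss_conf n h) (conf n) (\<lambda>\<xi>. move n b h R (snd p) (pair_noise n b h \<delta> (fst p) (snd p) \<xi>))"
    by (subst distr_distr[OF mm nm]) (simp add: comp_def)
  also have "\<dots> = distr (pair_kernel n b h R \<delta> p) (conf n) snd"
    unfolding pair_kernel_def by (subst distr_distr[OF _ pm]) (auto simp: comp_def pair_move_def)
  finally show "distr (pair_kernel n b h R \<delta> p) (conf n) snd = step_kernel n b h R (snd p)" by simp
qed

text \<open>\<open>\<xi> - reflect d \<xi>\<close> is a multiple of d: the noise has no component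
  transversal to d, and the new distance is the modulus of a one-dimensional quantity.\<close>

lemma norm_reflected_difference:
  assumes d: "d \<noteq> 0"
  shows "norm (d + \<xi> - reflect d \<xi>) = \<bar>norm d + 2 * (\<xi> \<bullet> (d /\<^sub>R norm d))\<bar>"
proof -
  have "d + \<xi> - reflect d \<xi> = (norm d + 2 * (\<xi> \<bullet> (d /\<^sub>R norm d))) *\<^sub>R (d /\<^sub>R norm d)"
    unfolding scaleR_left_distrib
    using d by (simp add: reflect_def dot_square_norm power2_eq_square inner_commute divide_inverse mult_ac)
  hence "norm (d + \<xi> - reflect d \<xi>) = \<bar>norm d + 2 * (\<xi> \<bullet> (d /\<^sub>R norm d))\<bar> * norm (d /\<^sub>R norm d)"
    by (simp only: norm_scaleR)
  moreover have "norm (d /\<^sub>R norm d) = 1" using d by simp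
  ultimately show ?thesis by (simp only: mult_1_right)
qed

text \<open>The increment u is twice the component of \<xi> along the unit vector of d, so it has
  mean 0, second moment 4 h and fourth moment 16 times 3 h^2; this is the origin of the constant
  48.\<close>

lemma expected_reflected_cost:
  fixes d :: "'a::euclidean_space"
  assumes h: "h > 0" and d: "d \<noteq> 0" and F0: "\<And>r. r \<ge> 0 \<Longrightarrow> F r \<ge> 0" and C: "C \<ge> 0"
    and F: "\<And>u. F \<bar>norm d + u\<bar> \<le> a + d' * u - k * u\<^sup>2 + C * u ^ 4"
  shows "(\<integral>\<^sup>+\<xi>. ennreal (F (norm (d + \<xi> - reflect d \<xi>))) \<partial>gauss h) \<le> ennreal (a - 4 * h * k + 48 * C * h\<^sup>2)"
proof -
  interpret prob_space "gauss h :: 'a measure" by (rule prob_space_gauss[OF h])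
  define e where "e = d /\<^sub>R norm d"
  have e: "norm e = 1" using d by (simp add: e_def)
  define p where "p = (\<lambda>\<xi>. a + d' * (2 * (\<xi> \<bullet> e)) - k * (2 * (\<xi> \<bullet> e))\<^sup>2 + C * (2 * (\<xi> \<bullet> e)) ^ 4)"
  have le: "F (norm (d + \<xi> - reflect d \<xi>)) \<le> p \<xi>" for \<xi>
    unfolding norm_reflected_difference[OF d] p_def e_def by (rule F)
  note m = gauss_moments[OF h e]
  have "has_bochner_integral (gauss h) (\<lambda>\<xi>. a + (2 * d') * (\<xi> \<bullet> e) - (4 * k) * (\<xi> \<bullet> e)\<^sup>2 + (16 * C) * (\<xi> \<bullet> e) ^ 4)
     (a + (2 * d') * 0 - (4 * k) * h + (16 * C) * (3 * h\<^sup>2))"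
  proof (intro has_bochner_integral_add has_bochner_integral_diff has_bochner_integral_mult_right m)
    show "has_bochner_integral (gauss h) (\<lambda>\<xi>::'a. a) a"
      using prob_space by (simp add: has_bochner_integral_iff)
  qed
  moreover have "(\<lambda>\<xi>. a + (2 * d') * (\<xi> \<bullet> e) - (4 * k) * (\<xi> \<bullet> e)\<^sup>2 + (16 * C) * (\<xi> \<bullet> e) ^ 4) = p"
    by (simp add: p_def fun_eq_iff power_mult_distrib)
  ultimately have hp: "has_bochner_integral (gauss h) p (a - 4 * h * k + 48 * C * h\<^sup>2)"
    by (simp add: algebra_simps)
  have "(\<integral>\<^sup>+\<xi>. ennreal (F (norm (d + \<xi> - reflect d \<xi>))) \<partial>gauss h) \<le> (\<integral>\<^sup>+\<xi>. ennreal (p \<xi>) \<partial>gauss h)"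
    by (intro nn_integral_mono ennreal_leI le)
  also have "\<dots> = ennreal (\<integral>\<xi>. p \<xi> \<partial>gauss h)"
    using hp order_trans[OF F0 le] by (intro nn_integral_eq_integral) (auto simp: has_bochner_integral_iff)
  also have "(\<integral>\<xi>. p \<xi> \<partial>gauss h) = a - 4 * h * k + 48 * C * h\<^sup>2" using hp by (simp add: has_bochner_integral_iff)
  finally show ?thesis .
qed

section \<open>The interacting particle system\<close>

lemma gauss_mean:
  assumes h: "h > 0" shows "has_bochner_integral (gauss h) (\<lambda>x. x \<bullet> (y::'a::euclidean_space)) 0"
proof -
  have "has_bochner_integral (gauss h) (\<lambda>x. \<Sum>b\<in>Basis. (y \<bullet> b) * (x \<bullet> b)) (\<Sum>b\<in>(Basis::'a set). (y \<bullet> b) * 0)"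
    by (intro has_bochner_integral_sum has_bochner_integral_mult_right gauss_moments h) auto
  moreover have "(\<Sum>b\<in>Basis. (y \<bullet> b) * (x \<bullet> b)) = x \<bullet> y" for x
    by (subst euclidean_inner[of x y]) (simp add: mult.commute)
  ultimately show ?thesis by simp
qed

lemma gauss_shifted_norm2:
  fixes h :: real
  assumes h: "h > 0"
  shows "(\<integral>\<^sup>+x. ennreal ((norm (y + x))\<^sup>2) \<partial>gauss h) = ennreal ((norm (y::'a::euclidean_space))\<^sup>2 + DIM('a) * h)"
proof -
  interpret prob_space "gauss h :: 'a measure" by (rule prob_space_gauss[OF h])
  have "has_bochner_integral (gauss h) (\<lambda>x. ((norm y)\<^sup>2 + 2 * (x \<bullet> y)) + (norm x)\<^sup>2) (((norm y)\<^sup>2 + 2 * 0) + DIM('a) * h)"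
    by (intro has_bochner_integral_add has_bochner_integral_mult_right gauss_mean gauss_norm2 h)
      (use prob_space in \<open>simp add: has_bochner_integral_iff\<close>)
  hence "has_bochner_integral (gauss h) (\<lambda>x. (norm (y + x))\<^sup>2) ((norm y)\<^sup>2 + DIM('a) * h)"
    by (simp add: power2_norm_eq_inner inner_add_left inner_add_right inner_commute algebra_simps)
  thus ?thesis by (simp add: nn_integral_eq_integral has_bochner_integral_iff)
qed

context kappa_potential
begin

text \<open>Chosen in the context of \<open>U\<close> alone, hence independent of \<open>V\<close>,
  \<open>n\<close> and the interaction matrix.\<close>

definition rate :: real where "rate = (SOME c. contraction_rate c)"

lemma contraction_rate: "contraction_rate rate"
  unfolding rate_def using scalar_contraction by (rule someI_ex)

lemma rate_pos: "rate > 0" using contraction_rate by (simp add: contraction_rate_def)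

lemma f_norm_continuous: "continuous_on A (\<lambda>x. f_fun U (norm x))"
  by (rule continuous_on_compose2[OF f_cont]) (auto intro!: continuous_intros)

lemma f_norm_measurable [measurable]:
  assumes [measurable]: "X \<in> M \<rightarrow>\<^sub>M (borel :: 'b::real_normed_vector measure)"
  shows "(\<lambda>\<omega>. f_fun U (norm (X \<omega>))) \<in> borel_measurable M"
  by (rule measurable_compose[OF assms borel_measurable_continuous_onI[OF f_norm_continuous]])

end

definition norm_sq :: "nat \<Rightarrow> (nat \<Rightarrow> 'a::euclidean_space) \<Rightarrow> real" where
  "norm_sq n z = (\<Sum>i\<in>{1..n}. (norm (z i))\<^sup>2)"

lemma norm_sq_nonneg [simp]: "norm_sq n z \<ge> 0" by (simp add: norm_sq_def sum_nonneg)

text \<open>Here \<alpha> is a bound for the absolute row and column sums of the matrix; both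
  interaction patterns satisfy it with the absolute value of their own parameter. \<open>LV\<close>
  is a Lipschitz constant of the gradient of \<open>V\<close>.\<close>

locale interacting = kappa_potential U for U :: "'a::euclidean_space \<Rightarrow> real" +
  fixes V :: "'a \<Rightarrow> real" and \<zeta> :: 'a and \<rho> LV :: real and n :: nat and a :: "nat \<Rightarrow> nat \<Rightarrow> real" and \<alpha> :: real
  assumes U_C2: "C2 U" and U_convex: "strictly_convex_outside U (ball \<zeta> \<rho>)"
    and V_C2: "C2 V" and LV_nonneg: "LV \<ge> 0"
    and V_lipschitz: "\<And>x y. norm (grad V x - grad V y) \<le> LV * norm (x - y)"
    and row: "\<And>i. i \<in> {1..n} \<Longrightarrow> (\<Sum>j\<in>{1..n}. \<bar>a i j\<bar>) \<le> \<alpha>"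
    and col: "\<And>j. j \<in> {1..n} \<Longrightarrow> (\<Sum>i\<in>{1..n}. \<bar>a i j\<bar>) \<le> \<alpha>"
    and n_pos: "n \<ge> 1"
begin

abbreviation b :: "(nat \<Rightarrow> 'a) \<Rightarrow> nat \<Rightarrow> 'a" where "b \<equiv> drift U V a n"

lemma alpha_nonneg: "\<alpha> \<ge> 0"
proof -
  have "0 \<le> (\<Sum>j\<in>{1..n}. \<bar>a 1 j\<bar>)" by (rule sum_nonneg) simp
  also have "\<dots> \<le> \<alpha>" using n_pos by (intro row) simp
  finally show ?thesis .
qed

definition interaction :: "(nat \<Rightarrow> 'a) \<Rightarrow> (nat \<Rightarrow> 'a) \<Rightarrow> nat \<Rightarrow> real" where
  "interaction z w i = (\<Sum>j\<in>{1..n}. \<bar>a i j\<bar> * (LV * (norm (z i - w i) + norm (z j - w j))))"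

lemma interaction_nonneg: "interaction z w i \<ge> 0"
  unfolding interaction_def using LV_nonneg by (intro sum_nonneg mult_nonneg_nonneg) auto

lemma drift_difference:
  "norm ((b z i - b w i) + (1/2) *\<^sub>R (grad U (z i) - grad U (w i))) \<le> interaction z w i"
proof -
  have "(b z i - b w i) + (1/2) *\<^sub>R (grad U (z i) - grad U (w i)) =
      - (\<Sum>j\<in>{1..n}. a i j *\<^sub>R (grad V (z i - z j) - grad V (w i - w j)))"
    by (simp add: drift_def scaleR_diff_right sum_subtractf)
  also have "norm \<dots> = norm (\<Sum>j\<in>{1..n}. a i j *\<^sub>R (grad V (z i - z j) - grad V (w i - w j)))"
    by (rule norm_minus_cancel)
  also have "\<dots> \<le> interaction z w i"
    unfolding interaction_def
  proof (rule sum_norm_le)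
    fix j assume "j \<in> {1..n}"
    have "norm (grad V (z i - z j) - grad V (w i - w j)) \<le> LV * norm ((z i - z j) - (w i - w j))"
      by (rule V_lipschitz)
    also have "norm ((z i - z j) - (w i - w j)) = norm ((z i - w i) - (z j - w j))" by (simp add: algebra_simps)
    also have "LV * \<dots> \<le> LV * (norm (z i - w i) + norm (z j - w j))"
      using LV_nonneg by (intro mult_left_mono norm_triangle_ineq4)
    finally show "norm (a i j *\<^sub>R (grad V (z i - z j) - grad V (w i - w j)))
        \<le> \<bar>a i j\<bar> * (LV * (norm (z i - w i) + norm (z j - w j)))"
      by (simp add: mult_left_mono)
  qed
  finally show ?thesis .
qed

text \<open>The entry \<open>a i j\<close> multiplies the distances of the pairs i and j. The first
  is handled by row sums, the second by column sums after exchanging the summations; hence a factor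
  2 and no factor n.\<close>

lemma interaction_sum: "(\<Sum>i\<in>{1..n}. interaction z w i) \<le> 2 * LV * \<alpha> * l1_dist n z w"
proof -
  define r where "r = (\<lambda>i. norm (z i - w i))"
  have r: "r i \<ge> 0" for i by (simp add: r_def)
  have "(\<Sum>i\<in>{1..n}. interaction z w i) =
     LV * ((\<Sum>i\<in>{1..n}. (\<Sum>j\<in>{1..n}. \<bar>a i j\<bar>) * r i) + (\<Sum>i\<in>{1..n}. \<Sum>j\<in>{1..n}. \<bar>a i j\<bar> * r j))"
    by (simp add: interaction_def r_def sum_distrib_left sum_distrib_right algebra_simps sum.distrib)
  also have "(\<Sum>i\<in>{1..n}. \<Sum>j\<in>{1..n}. \<bar>a i j\<bar> * r j) = (\<Sum>j\<in>{1..n}. (\<Sum>i\<in>{1..n}. \<bar>a i j\<bar>) * r j)"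
    by (subst sum.swap) (simp add: sum_distrib_right)
  also have "LV * ((\<Sum>i\<in>{1..n}. (\<Sum>j\<in>{1..n}. \<bar>a i j\<bar>) * r i) + \<dots>) \<le> LV * ((\<Sum>i\<in>{1..n}. \<alpha> * r i) + (\<Sum>j\<in>{1..n}. \<alpha> * r j))"
    using row col r LV_nonneg by (intro mult_left_mono add_mono sum_mono mult_right_mono) auto
  also have "\<dots> = 2 * LV * \<alpha> * l1_dist n z w" by (simp add: l1_dist_def r_def sum_distrib_left mult_ac)
  finally show ?thesis .
qed

lemma interaction_le: "i \<in> {1..n} \<Longrightarrow> interaction z w i \<le> 2 * LV * \<alpha> * l1_dist n z w"
proof -
  assume i: "i \<in> {1..n}"
  have "interaction z w i \<le> (\<Sum>i\<in>{1..n}. interaction z w i)"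
    using i interaction_nonneg by (intro member_le_sum) auto
  thus ?thesis using interaction_sum[of z w] by linarith
qed

lemma drift_locally_lipschitz: "locally_lipschitz n b"
  unfolding locally_lipschitz_def
proof
  fix R
  obtain L where L: "L \<ge> 0"
    "\<And>x y. norm x \<le> R \<Longrightarrow> norm y \<le> R \<Longrightarrow> norm (grad U x - grad U y) \<le> L * norm (x - y)"
    using grad_lipschitz_cball[OF U_C2] by metis
  show "\<exists>L\<ge>0. \<forall>z w. in_box n R z \<longrightarrow> in_box n R w \<longrightarrow> (\<forall>i\<in>{1..n}. norm (b z i - b w i) \<le> L * l1_dist n z w)"
  proof (intro exI[of _ "L / 2 + 2 * LV * \<alpha>"] conjI allI impI ballI)
    show "0 \<le> L / 2 + 2 * LV * \<alpha>" using L LV_nonneg alpha_nonneg by simp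
    fix z w :: "nat \<Rightarrow> 'a" and i assume z: "in_box n R z" "in_box n R w" and i: "i \<in> {1..n}"
    have "b z i - b w i = ((b z i - b w i) + (1/2) *\<^sub>R (grad U (z i) - grad U (w i))) - (1/2) *\<^sub>R (grad U (z i) - grad U (w i))"
      by simp
    also have "norm \<dots> \<le> norm ((b z i - b w i) + (1/2) *\<^sub>R (grad U (z i) - grad U (w i))) + norm ((1/2) *\<^sub>R (grad U (z i) - grad U (w i)))"
      by (rule norm_triangle_ineq4)
    also have "\<dots> \<le> 2 * LV * \<alpha> * l1_dist n z w + L / 2 * l1_dist n z w"
    proof (rule add_mono)
      show "norm ((b z i - b w i) + (1/2) *\<^sub>R (grad U (z i) - grad U (w i))) \<le> 2 * LV * \<alpha> * l1_dist n z w"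
        using drift_difference interaction_le[OF i] by (rule order_trans)
      have "norm (grad U (z i) - grad U (w i)) \<le> L * norm (z i - w i)"
        using z i by (intro L) (auto simp: in_box_def)
      also have "\<dots> \<le> L * l1_dist n z w" using l1_dist_component[OF i] L(1) by (intro mult_left_mono) auto
      finally show "norm ((1/2) *\<^sub>R (grad U (z i) - grad U (w i))) \<le> L / 2 * l1_dist n z w" by simp
    qed
    finally show "norm (b z i - b w i) \<le> (L / 2 + 2 * LV * \<alpha>) * l1_dist n z w" by (simp add: algebra_simps)
  qed
qed

lemma drift_is_measurable: "drift_measurable n b"
  unfolding drift_measurable_def
proof
  fix i assume i: "i \<in> {1..n}"
  have [measurable]: "grad U \<in> borel_measurable borel" "grad V \<in> borel_measurable borel"
    using C2_continuous_grad[OF U_C2] C2_continuous_grad[OF V_C2] by (auto intro: borel_measurable_continuous_onI)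
  have "(\<lambda>z :: nat \<Rightarrow> 'a. grad V (z i - z j)) \<in> borel_measurable (conf n)" if "j \<in> {1..n}" for j
  proof -
    note [measurable] = conf_component_measurable[OF i] conf_component_measurable[OF that]
    show ?thesis by measurable
  qed
  note [measurable] = conf_component_measurable[OF i] this
  show "(\<lambda>z. b z i) \<in> borel_measurable (conf n)"
    unfolding drift_def by (intro borel_measurable_diff borel_measurable_sum borel_measurable_scaleR) auto
qed

lemma drift_bounded_on_box:
  obtains C where "C \<ge> 0" "\<And>z i. in_box n R z \<Longrightarrow> i \<in> {1..n} \<Longrightarrow> norm (b z i) \<le> C"
proof (cases "R \<ge> 0")
  case True
  obtain L where L: "L \<ge> 0" "\<And>z w i. in_box n R z \<Longrightarrow> in_box n R w \<Longrightarrow> i \<in> {1..n} \<Longrightarrow> norm (b z i - b w i) \<le> L * l1_dist n z w"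
    using drift_locally_lipschitz unfolding locally_lipschitz_def by meson
  define C where "C = L * (real n * R) + (\<Sum>i\<in>{1..n}. norm (b (\<lambda>_. 0) i))"
  show ?thesis
  proof (rule that[of C])
    show "C \<ge> 0" unfolding C_def using L True by (intro add_nonneg_nonneg sum_nonneg) auto
    fix z :: "nat \<Rightarrow> 'a" and i assume z: "in_box n R z" and i: "i \<in> {1..n}"
    have "norm (b z i) \<le> norm (b z i - b (\<lambda>_. 0) i) + norm (b (\<lambda>_. 0) i)"
      by (metis diff_add_cancel norm_triangle_ineq)
    also have "norm (b z i - b (\<lambda>_. 0) i) \<le> L * l1_dist n z (\<lambda>_. 0)"
      using z i True by (intro L) (auto simp: in_box_def)
    also have "l1_dist n z (\<lambda>_. 0) \<le> (\<Sum>i\<in>{1..n}. R)"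
      unfolding l1_dist_def using z by (intro sum_mono) (auto simp: in_box_def)
    also have "norm (b (\<lambda>_. 0) i) \<le> (\<Sum>i\<in>{1..n}. norm (b (\<lambda>_. 0) i))" using i by (intro member_le_sum) auto
    finally show "norm (b z i) \<le> C" using L(1) by (simp add: C_def mult_left_mono)
  qed
next
  case False
  have "\<not> in_box n R z" for z :: "nat \<Rightarrow> 'a"
  proof
    assume "in_box n R z"
    hence "norm (z 1) \<le> R" using n_pos by (auto simp: in_box_def)
    thus False using False norm_ge_zero[of "z 1"] by linarith
  qed
  thus ?thesis by (intro that[of 0]) auto
qed

text \<open>The gradient of \<open>U\<close> may grow superlinearly, but
  \<open>kappa U r \<ge> - L\<close> bounds its radial part from below by a quadratic term, and only
  this part enters the second moment to first order. The constant may depend on n.\<close>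

lemma drift_growth:
  obtains C where "C \<ge> 0" "\<And>z. (\<Sum>i\<in>{1..n}. z i \<bullet> b z i) \<le> C * (1 + norm_sq n z)"
proof -
  obtain L where L: "L \<ge> 0" "\<And>r. r > 0 \<Longrightarrow> kappa U r \<ge> - L"
    using kappa_bounds(2)[OF U_C2 U_convex] by auto
  define K where "K = norm (grad U (0::'a)) + \<alpha> * norm (grad V (0::'a))"
  define C where "C = L / 2 + K + real n * K + 4 * LV * \<alpha> * real n"
  have K: "K \<ge> 0" using alpha_nonneg by (simp add: K_def)
  have i_le: "z i \<bullet> b z i \<le> L / 2 * (norm (z i))\<^sup>2 + norm (z i) * K + norm (z i) * interaction z (\<lambda>_. 0) i"
    if i: "i \<in> {1..n}" for z i
  proof -
    have bb: "b z i = ((b z i - b (\<lambda>_. 0) i) + (1/2) *\<^sub>R (grad U (z i) - grad U 0)) - (1/2) *\<^sub>R (grad U (z i) - grad U 0) + b (\<lambda>_. 0) i"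
      (is "_ = ?A - ?B + ?D") by simp
    have "z i \<bullet> b z i = z i \<bullet> ?A - (1/2) * (z i \<bullet> (grad U (z i) - grad U 0)) + z i \<bullet> ?D"
      by (subst bb) (simp only: inner_add_right inner_diff_right inner_scaleR_right)
    moreover have "z i \<bullet> ?A \<le> norm (z i) * interaction z (\<lambda>_. 0) i"
      using norm_cauchy_schwarz[of "z i" ?A] drift_difference[of z i "\<lambda>_. 0"]
      by (meson mult_left_mono norm_ge_zero order_trans)
    moreover have "- (1/2) * (z i \<bullet> (grad U (z i) - grad U 0)) \<le> L / 2 * (norm (z i))\<^sup>2"
    proof (cases "z i = 0")
      case False
      have "- L * (norm (z i - 0))\<^sup>2 \<le> kappa U (norm (z i - 0)) * (norm (z i - 0))\<^sup>2"
        using L(2)[of "norm (z i - 0)"] False by (intro mult_right_mono) auto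
      also have "\<dots> \<le> (z i - 0) \<bullet> (grad U (z i) - grad U 0)" by (rule kappa_bounds[OF U_C2 U_convex])
      finally show ?thesis by simp
    qed simp
    moreover have "z i \<bullet> ?D \<le> norm (z i) * K"
    proof -
      have "norm ?D \<le> norm ((1/2) *\<^sub>R grad U (0::'a)) + norm (\<Sum>j\<in>{1..n}. a i j *\<^sub>R grad V (0::'a))"
        using norm_triangle_ineq4[of "- (1/2) *\<^sub>R grad U (0::'a)" "\<Sum>j\<in>{1..n}. a i j *\<^sub>R grad V (0::'a)"]
        by (simp add: drift_def)
      also have "norm (\<Sum>j\<in>{1..n}. a i j *\<^sub>R grad V (0::'a)) \<le> (\<Sum>j\<in>{1..n}. \<bar>a i j\<bar> * norm (grad V (0::'a)))"
        by (rule sum_norm_le) simp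
      also have "\<dots> \<le> \<alpha> * norm (grad V (0::'a))"
        using row[OF i] by (simp add: mult_right_mono flip: sum_distrib_right)
      also have "norm ((1/2) *\<^sub>R grad U (0::'a)) \<le> norm (grad U (0::'a))" by simp
      finally have "norm ?D \<le> K" by (simp add: K_def)
      thus ?thesis using norm_cauchy_schwarz[of "z i" ?D] by (meson mult_left_mono norm_ge_zero order_trans)
    qed
    ultimately show ?thesis by linarith
  qed
  show ?thesis
  proof (rule that[of C])
    show "C \<ge> 0" using L K LV_nonneg alpha_nonneg by (simp add: C_def)
    fix z :: "nat \<Rightarrow> 'a"
    have s1: "(\<Sum>i\<in>{1..n}. norm (z i) * K) \<le> K * (real n + norm_sq n z)"
    proof -
      have "norm (z i) * K \<le> (1 + (norm (z i))\<^sup>2) * K" for i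
      proof (rule mult_right_mono[OF _ K])
        have "0 \<le> (norm (z i) - 1)\<^sup>2" by simp
        hence "2 * norm (z i) \<le> 1 + (norm (z i))\<^sup>2" by (simp add: power2_eq_square algebra_simps)
        thus "norm (z i) \<le> 1 + (norm (z i))\<^sup>2" using norm_ge_zero[of "z i"] by linarith
      qed
      hence "(\<Sum>i\<in>{1..n}. norm (z i) * K) \<le> (\<Sum>i\<in>{1..n}. (1 + (norm (z i))\<^sup>2) * K)" by (intro sum_mono)
      also have "\<dots> = K * (real n + norm_sq n z)"
        by (simp add: norm_sq_def sum.distrib algebra_simps sum_distrib_left)
      finally show ?thesis .
    qed
    define N where "N = (\<Sum>i\<in>{1..n}. norm (z i))"
    have N2: "N\<^sup>2 \<le> real n * norm_sq n z"
      using Cauchy_Schwarz_ineq_sum[of "\<lambda>_. 1" "\<lambda>i. norm (z i)" "{1..n}"] by (simp add: N_def norm_sq_def)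
    have s2: "(\<Sum>i\<in>{1..n}. norm (z i) * interaction z (\<lambda>_. 0) i) \<le> 2 * LV * \<alpha> * real n * norm_sq n z"
    proof -
      have "(\<Sum>i\<in>{1..n}. norm (z i) * interaction z (\<lambda>_. 0) i) \<le> (\<Sum>i\<in>{1..n}. norm (z i) * (2 * LV * \<alpha> * N))"
        using interaction_le[of _ z "\<lambda>_. 0"] by (intro sum_mono mult_left_mono) (auto simp: l1_dist_def N_def)
      also have "\<dots> = 2 * LV * \<alpha> * N\<^sup>2" by (simp add: N_def power2_eq_square sum_distrib_left sum_distrib_right mult_ac)
      also have "\<dots> \<le> 2 * LV * \<alpha> * (real n * norm_sq n z)"
        using N2 LV_nonneg alpha_nonneg by (intro mult_left_mono) auto
      finally show ?thesis by (simp add: mult_ac)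
    qed
    have "(\<Sum>i\<in>{1..n}. z i \<bullet> b z i) \<le> (\<Sum>i\<in>{1..n}. L / 2 * (norm (z i))\<^sup>2 + norm (z i) * K + norm (z i) * interaction z (\<lambda>_. 0) i)"
      by (intro sum_mono i_le)
    also have "\<dots> = L / 2 * norm_sq n z + (\<Sum>i\<in>{1..n}. norm (z i) * K) + (\<Sum>i\<in>{1..n}. norm (z i) * interaction z (\<lambda>_. 0) i)"
      by (simp add: sum.distrib norm_sq_def sum_distrib_left)
    also have "\<dots> \<le> L / 2 * norm_sq n z + K * (real n + norm_sq n z) + 2 * LV * \<alpha> * real n * norm_sq n z"
      using s1 s2 by linarith
    also have "\<dots> \<le> C * (1 + norm_sq n z)"
    proof -
      have "C * (1 + norm_sq n z) - (L / 2 * norm_sq n z + K * (real n + norm_sq n z) + 2 * LV * \<alpha> * real n * norm_sq n z) =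
         L / 2 + K + 4 * LV * \<alpha> * real n + (real n * K) * norm_sq n z + 2 * LV * \<alpha> * real n * norm_sq n z"
        by (simp add: C_def algebra_simps)
      also have "\<dots> \<ge> 0" using L K LV_nonneg alpha_nonneg norm_sq_nonneg[of n z] by simp
      finally show ?thesis by linarith
    qed
    finally show "(\<Sum>i\<in>{1..n}. z i \<bullet> b z i) \<le> C * (1 + norm_sq n z)" .
  qed
qed

end

context interacting
begin

definition cost :: "(nat \<Rightarrow> 'a) \<Rightarrow> (nat \<Rightarrow> 'a) \<Rightarrow> real" where
  "cost z w = (\<Sum>i\<in>{1..n}. f_fun U (norm (z i - w i)))"

lemma cost_nonneg [simp]: "cost z w \<ge> 0" unfolding cost_def by (intro sum_nonneg f_nonneg) auto

lemma cost_l1: "cost z w \<le> l1_dist n z w" "df_min * l1_dist n z w \<le> cost z w"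
  unfolding cost_def l1_dist_def sum_distrib_left by (intro sum_mono f_bounds; simp)+

text \<open>The interaction terms sum to at most 2 LV \<alpha> times the l1 distance, and dividing
  by \<open>df_min\<close> passes to the cost. The summand 1 keeps the constant positive when
  \<open>LV\<close> is 0.\<close>

definition theta :: real where "theta = 2 * LV / df_min + 1"

definition exponent :: real where "exponent = theta * \<alpha> - rate"

text \<open>Squaring the distance q after the \<open>U\<close>-part of the drift brings in the
  one-sided bound by \<open>kappa\<close>. Then 2 q r \<le> q^2 + r^2 avoids the square root, and
  division by 2 r produces the coefficients 1/2 and L^2 / 8. The interaction is added by the
  triangle inequality.\<close>

lemma drift_step_bound:
  assumes h: "h > 0" and i: "i \<in> {1..n}" and L: "norm (grad U (z i) - grad U (w i)) \<le> L * norm (z i - w i)"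
  shows "norm (drift_diff b h z w i) \<le> norm (z i - w i) - 1/2 * h * norm (z i - w i) * kappa U (norm (z i - w i))
     + h * interaction z w i + h\<^sup>2 * (L\<^sup>2 / 8) * norm (z i - w i)"
proof -
  define x where "x = z i - w i"
  define g where "g = grad U (z i) - grad U (w i)"
  define r where "r = norm x"
  have r0: "r \<ge> 0" by (simp add: r_def)
  have gr: "norm g \<le> L * r" using L by (simp add: g_def r_def x_def)
  have "drift_diff b h z w i = (x - (h/2) *\<^sub>R g) + h *\<^sub>R ((b z i - b w i) + (1/2) *\<^sub>R g)"
    by (simp add: drift_diff_def x_def algebra_simps)
  hence "norm (drift_diff b h z w i) \<le> norm (x - (h/2) *\<^sub>R g) + norm (h *\<^sub>R ((b z i - b w i) + (1/2) *\<^sub>R g))"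
    by (metis norm_triangle_ineq)
  also have "norm (h *\<^sub>R ((b z i - b w i) + (1/2) *\<^sub>R g)) \<le> h * interaction z w i"
    using drift_difference[of z i w] h by (simp add: g_def mult_left_mono)
  also have "norm (x - (h/2) *\<^sub>R g) \<le> r - 1/2 * h * r * kappa U r + h\<^sup>2 * (L\<^sup>2 / 8) * r"
  proof (cases "r = 0")
    case True thus ?thesis using gr by (simp add: r_def)
  next
    case False
    hence r: "r > 0" using r0 by simp
    define q where "q = norm (x - (h/2) *\<^sub>R g)"
    have "(norm g)\<^sup>2 \<le> (L * r)\<^sup>2" using gr by (intro power_mono) auto
    hence g2: "(h\<^sup>2 / 4) * (norm g)\<^sup>2 \<le> (h\<^sup>2 / 4) * (L * r)\<^sup>2" by (intro mult_left_mono) auto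
    have kx: "h * (kappa U r * r\<^sup>2) \<le> h * (x \<bullet> g)"
      using kappa_bounds(1)[OF U_C2 U_convex, of "z i" "w i"] h by (intro mult_left_mono) (auto simp: x_def g_def r_def)
    have "q\<^sup>2 = r\<^sup>2 - h * (x \<bullet> g) + (h\<^sup>2 / 4) * (norm g)\<^sup>2"
      unfolding q_def r_def power2_norm_eq_inner
      by (simp add: inner_diff_left inner_diff_right inner_commute power2_eq_square)
    hence q2: "q\<^sup>2 \<le> r\<^sup>2 - h * (kappa U r * r\<^sup>2) + (h\<^sup>2 / 4) * (L * r)\<^sup>2" using g2 kx by linarith
    have "0 \<le> (q - r)\<^sup>2" by simp
    hence "2 * (q * r) \<le> q\<^sup>2 + r\<^sup>2" by (simp add: power2_eq_square algebra_simps)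
    also have "\<dots> \<le> 2 * ((r - 1/2 * h * r * kappa U r + h\<^sup>2 * (L\<^sup>2 / 8) * r) * r)"
      using q2 by (simp add: power2_eq_square algebra_simps)
    finally show ?thesis using r unfolding q_def by simp
  qed
  finally show ?thesis by (simp add: x_def r_def)
qed

definition cost_step :: "real \<Rightarrow> real \<Rightarrow> real \<Rightarrow> real \<Rightarrow> bool" where
  "cost_step R \<delta> \<epsilon> h \<longleftrightarrow> (\<forall>z\<in>space (conf n). \<forall>w\<in>space (conf n). in_box n R z \<longrightarrow> in_box n R w \<longrightarrow>
      (\<integral>\<^sup>+\<xi>. ennreal (cost (move n b h R z \<xi>) (move n b h R w (pair_noise n b h \<delta> z w \<xi>))) \<partial>gauss_conf n h)
        \<le> ennreal (exp (exponent * h) * cost z w + \<epsilon> * h))"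

definition moment_step :: "real \<Rightarrow> real \<Rightarrow> real \<Rightarrow> bool" where
  "moment_step C R h \<longleftrightarrow> (\<forall>z\<in>space (conf n). in_box n R z \<longrightarrow>
      (\<integral>\<^sup>+\<xi>. ennreal (norm_sq n (move n b h R z \<xi>)) \<partial>gauss_conf n h) \<le> ennreal ((1 + C * h) * norm_sq n z + C * h))"

text \<open>Particle by particle this is \<open>step_contracts\<close>. The interaction terms are
  estimated only after summation over the particles, since a single one is not controlled by the
  cost of its own particle.\<close>

lemma one_step_cost:
  assumes "\<epsilon> > 0"
  obtains \<delta> h0 where "\<delta> > 0" "h0 > 0" "\<And>h. 0 < h \<Longrightarrow> h < h0 \<Longrightarrow> cost_step R \<delta> \<epsilon> h"
proof -
  obtain L where L: "L \<ge> 0"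
    "\<And>x y. norm x \<le> R \<Longrightarrow> norm y \<le> R \<Longrightarrow> norm (grad U x - grad U y) \<le> L * norm (x - y)"
    using grad_lipschitz_cball[OF U_C2] by metis
  obtain CR where CR: "CR \<ge> 0" "\<And>z i. in_box n R z \<Longrightarrow> i \<in> {1..n} \<Longrightarrow> norm (b z i) \<le> CR"
    using drift_bounded_on_box by metis
  define B where "B = 2 * CR"
  define S where "S = 2 * \<bar>R\<bar> + B + 1"
  have B: "B \<ge> 0" and S: "S > 0" using CR by (auto simp: B_def S_def)
  \<comment> \<open>The errors of the n particles add up to \<epsilon>. This influences the
    admissible mesh, not the rate.\<close>
  define e where "e = \<epsilon> / real n"
  have e: "e > 0" using assms n_pos by (simp add: e_def)
  obtain \<delta> h0 where d0: "\<delta> > 0" "h0 > 0" and sc: "step_contracts rate S e (L\<^sup>2 / 8) B 48 \<delta> h0"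
    using contraction_rate S e B unfolding contraction_rate_def by (meson zero_le_numeral)
  \<comment> \<open>\<open>h \<le> 1\<close> keeps the distances after the drift step below
    \<open>S\<close>; \<open>h \<le> 1 / rate\<close> keeps \<open>1 - rate * h\<close>
    nonnegative.\<close>
  define h1 where "h1 = min h0 (min 1 (1 / rate))"
  show ?thesis
  proof (rule that[OF d0(1), of h1])
    show "h1 > 0" using d0 rate_pos by (simp add: h1_def)
    fix h assume h: "0 < h" "h < h1"
    show "cost_step R \<delta> \<epsilon> h"
      unfolding cost_step_def
    proof (intro ballI impI)
      fix z w :: "nat \<Rightarrow> 'a"
      assume zw: "z \<in> space (conf n)" "w \<in> space (conf n)" and box: "in_box n R z" "in_box n R w"
      have hh: "h < h0" "h \<le> 1" "rate * h \<le> 1" using h rate_pos by (auto simp: h1_def field_simps)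
      define t where "t = (\<lambda>i. (1 - rate * h) * f_fun U (norm (z i - w i)) + h * interaction z w i + e * h)"
      define z' where "z' = (\<lambda>\<xi>. move n b h R z \<xi>)"
      define w' where "w' = (\<lambda>\<xi>. move n b h R w (pair_noise n b h \<delta> z w \<xi>))"
      have t0: "t i \<ge> 0" for i
        unfolding t_def using hh h e interaction_nonneg f_nonneg by (intro add_nonneg_nonneg mult_nonneg_nonneg) auto
      have comp: "(\<integral>\<^sup>+\<xi>. ennreal (f_fun U (norm (z' \<xi> i - w' \<xi> i))) \<partial>gauss_conf n h) \<le> ennreal (t i)"
        if i: "i \<in> {1..n}" for i
      proof -
        define d where "d = drift_diff b h z w i"
        define r where "r = norm (z i - w i)"
        have zi: "norm (z i) \<le> R" "norm (w i) \<le> R" using box i by (auto simp: in_box_def)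
        have diff: "z' \<xi> i - w' \<xi> i = (if \<delta> \<le> norm d then d + \<xi> i - reflect d (\<xi> i) else d)" for \<xi>
          using box i by (simp add: z'_def w'_def move_def pair_noise_def d_def drift_diff_def)
        have r0: "r \<ge> 0" by (simp add: r_def)
        have rS: "r \<le> 2 * \<bar>R\<bar>" using zi norm_triangle_ineq4[of "z i" "w i"] by (simp add: r_def)
        have sr: "\<bar>norm d - r\<bar> \<le> h * B"
        proof -
          have "\<bar>norm d - r\<bar> \<le> norm (d - (z i - w i))" unfolding r_def by (rule norm_triangle_ineq3)
          also have "d - (z i - w i) = h *\<^sub>R (b z i - b w i)"
            by (simp add: d_def drift_diff_def algebra_simps)
          also have "norm \<dots> \<le> h * (CR + CR)"
            using h CR(2)[OF box(1) i] CR(2)[OF box(2) i] norm_triangle_ineq4[of "b z i" "b w i"]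
            by (simp add: mult_left_mono)
          finally show ?thesis by (simp add: B_def)
        qed
        have "h * B \<le> 1 * B" using hh B by (intro mult_right_mono) auto
        hence dS: "norm d \<le> S" using sr rS by (simp add: S_def)
        have db: "norm d \<le> r - 1/2 * h * r * kappa U r + h * interaction z w i + h\<^sup>2 * (L\<^sup>2 / 8) * r"
          unfolding d_def r_def by (rule drift_step_bound[OF h(1) i]) (rule L(2)[OF zi])
        have res: "(norm d < \<delta> \<longrightarrow> f_fun U (norm d) \<le> t i) \<and>
          (norm d \<ge> \<delta> \<longrightarrow> (\<exists>a d' k C. C \<ge> 0 \<and> (\<forall>u. f_fun U \<bar>norm d + u\<bar> \<le> a + d' * u - k * u\<^sup>2 + C * u ^ 4) \<and>
            a - 4 * h * k + 48 * C * h\<^sup>2 \<le> t i))"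
          using sc[unfolded step_contracts_def, rule_format, of h r "norm d" "interaction z w i"] h hh r0 rS dS db sr interaction_nonneg[of z w i] B
          by (simp add: t_def r_def[symmetric] S_def)
        show ?thesis
        proof (cases "\<delta> \<le> norm d")
          case True
          then obtain a d' k C where F: "C \<ge> 0" "\<And>u. f_fun U \<bar>norm d + u\<bar> \<le> a + d' * u - k * u\<^sup>2 + C * u ^ 4"
            and le: "a - 4 * h * k + 48 * C * h\<^sup>2 \<le> t i" using res by blast
          have dn: "d \<noteq> 0" using True d0 by auto
          have "(\<integral>\<^sup>+\<xi>. ennreal (f_fun U (norm (z' \<xi> i - w' \<xi> i))) \<partial>gauss_conf n h) =
              (\<integral>\<^sup>+\<xi>. ennreal (f_fun U (norm (d + \<xi> i - reflect d (\<xi> i)))) \<partial>gauss_conf n h)"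
            by (simp add: diff True)
          also have "\<dots> = (\<integral>\<^sup>+\<xi>. ennreal (f_fun U (norm (d + \<xi> - reflect d \<xi>))) \<partial>gauss h)"
            by (rule nn_integral_gauss_conf_component[OF h(1) i]) measurable
          also have "\<dots> \<le> ennreal (a - 4 * h * k + 48 * C * h\<^sup>2)"
            by (rule expected_reflected_cost[OF h(1) dn f_nonneg F])
          also have "\<dots> \<le> ennreal (t i)" by (rule ennreal_leI[OF le])
          finally show ?thesis .
        next
          case False
          have "(\<integral>\<^sup>+\<xi>. ennreal (f_fun U (norm (z' \<xi> i - w' \<xi> i))) \<partial>gauss_conf n h) = ennreal (f_fun U (norm d))"
            using prob_space.emeasure_space_1[OF prob_space_gauss_conf[OF h(1), of n, where ?'a='a]] by (simp add: diff False)
          also have "\<dots> \<le> ennreal (t i)" using res False by (intro ennreal_leI) auto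
          finally show ?thesis .
        qed
      qed
      have meas: "(\<lambda>\<xi>. ennreal (f_fun U (norm (z' \<xi> i - w' \<xi> i)))) \<in> borel_measurable (gauss_conf n h)"
        if i: "i \<in> {1..n}" for i
      proof -
        have "z' \<in> gauss_conf n h \<rightarrow>\<^sub>M conf n" unfolding z'_def
          by (rule move_measurable[OF drift_is_measurable measurable_const[OF zw(1)]]) measurable
        moreover have "w' \<in> gauss_conf n h \<rightarrow>\<^sub>M conf n" unfolding w'_def
          by (intro move_measurable[OF drift_is_measurable measurable_const[OF zw(2)]]
              pair_noise_measurable[OF drift_is_measurable measurable_const[OF zw(1)] measurable_const[OF zw(2)]]) measurable
        ultimately have [measurable]: "(\<lambda>\<xi>. z' \<xi> i) \<in> borel_measurable (gauss_conf n h)"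
          "(\<lambda>\<xi>. w' \<xi> i) \<in> borel_measurable (gauss_conf n h)"
          using measurable_compose[OF _ conf_component_measurable[OF i]] by blast+
        show ?thesis by measurable
      qed
      have "(\<integral>\<^sup>+\<xi>. ennreal (cost (z' \<xi>) (w' \<xi>)) \<partial>gauss_conf n h) =
          (\<integral>\<^sup>+\<xi>. (\<Sum>i\<in>{1..n}. ennreal (f_fun U (norm (z' \<xi> i - w' \<xi> i)))) \<partial>gauss_conf n h)"
        unfolding cost_def by (intro nn_integral_cong sum_ennreal[symmetric] f_nonneg) auto
      also have "\<dots> = (\<Sum>i\<in>{1..n}. \<integral>\<^sup>+\<xi>. ennreal (f_fun U (norm (z' \<xi> i - w' \<xi> i))) \<partial>gauss_conf n h)"
        by (rule nn_integral_sum) (rule meas)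
      also have "\<dots> \<le> (\<Sum>i\<in>{1..n}. ennreal (t i))" by (intro sum_mono comp)
      also have "\<dots> = ennreal (\<Sum>i\<in>{1..n}. t i)" by (rule sum_ennreal) (rule t0)
      also have "(\<Sum>i\<in>{1..n}. t i) \<le> exp (exponent * h) * cost z w + \<epsilon> * h"
      proof -
        have "(\<Sum>i\<in>{1..n}. t i) = (1 - rate * h) * cost z w + h * (\<Sum>i\<in>{1..n}. interaction z w i) + real n * (e * h)"
          by (simp add: t_def cost_def sum.distrib sum_distrib_left)
        also have "real n * (e * h) = \<epsilon> * h" using n_pos by (simp add: e_def)
        also have "(\<Sum>i\<in>{1..n}. interaction z w i) \<le> theta * \<alpha> * cost z w"
        proof -
          have "(\<Sum>i\<in>{1..n}. interaction z w i) \<le> 2 * LV * \<alpha> * l1_dist n z w" by (rule interaction_sum)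
          also have "\<dots> \<le> 2 * LV * \<alpha> * (cost z w / df_min)"
            using cost_l1(2)[of z w] df_min_pos LV_nonneg alpha_nonneg
            by (intro mult_left_mono) (auto simp: field_simps)
          also have "\<dots> = (2 * LV / df_min) * (\<alpha> * cost z w)" by simp
          also have "\<dots> \<le> theta * (\<alpha> * cost z w)"
            using alpha_nonneg cost_nonneg by (intro mult_right_mono) (auto simp: theta_def)
          finally show ?thesis by (simp add: mult.assoc)
        qed
        also have "(1 - rate * h) * cost z w + h * (theta * \<alpha> * cost z w) + \<epsilon> * h = (1 + exponent * h) * cost z w + \<epsilon> * h"
          by (simp add: exponent_def algebra_simps)
        also have "(1 + exponent * h) * cost z w \<le> exp (exponent * h) * cost z w"
          using cost_nonneg by (intro mult_right_mono) auto
        finally show ?thesis using h by (simp add: mult_left_mono)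
      qed
      finally show "(\<integral>\<^sup>+\<xi>. ennreal (cost (move n b h R z \<xi>) (move n b h R w (pair_noise n b h \<delta> z w \<xi>))) \<partial>gauss_conf n h)
          \<le> ennreal (exp (exponent * h) * cost z w + \<epsilon> * h)"
        by (simp add: z'_def w'_def ennreal_leI)
    qed
  qed
qed

text \<open>On a box the drift is bounded, so for small h the second-order terms h^2 |b|^2 sum to at
  most h. Only the mesh bound depends on the radius; the growth constant does not, which allows the
  boxes to grow.\<close>

lemma one_step_moment:
  obtains C where "C \<ge> 0" "\<And>R. \<exists>h0>0. \<forall>h. 0 < h \<longrightarrow> h < h0 \<longrightarrow> moment_step C R h"
proof -
  obtain C where C: "C \<ge> 0" "\<And>z. (\<Sum>i\<in>{1..n}. z i \<bullet> b z i) \<le> C * (1 + norm_sq n z)"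
    using drift_growth by metis
  define C' where "C' = 2 * C + 1 + real n * DIM('a)"
  show ?thesis
  proof (rule that[of C'])
    show "C' \<ge> 0" using C by (simp add: C'_def)
    fix R
    obtain CR where CR: "CR \<ge> 0" "\<And>z i. in_box n R z \<Longrightarrow> i \<in> {1..n} \<Longrightarrow> norm (b z i) \<le> CR"
      using drift_bounded_on_box by metis
    define h0 where "h0 = 1 / (real n * CR\<^sup>2 + 1)"
    have D: "real n * CR\<^sup>2 + 1 > 0" by (simp add: add_nonneg_pos)
    show "\<exists>h0>0. \<forall>h. 0 < h \<longrightarrow> h < h0 \<longrightarrow> moment_step C' R h"
      unfolding moment_step_def
    proof (intro exI[of _ h0] conjI allI ballI impI)
      show "h0 > 0" using D by (simp add: h0_def)
      fix h and z :: "nat \<Rightarrow> 'a" assume h: "0 < h" "h < h0" and z: "z \<in> space (conf n)" "in_box n R z"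
      have hn: "h * (real n * CR\<^sup>2) \<le> 1"
      proof -
        have "h * (real n * CR\<^sup>2 + 1) \<le> 1" using h D by (simp add: h0_def field_simps)
        thus ?thesis using h by (simp add: algebra_simps)
      qed
      define y where "y = (\<lambda>i. z i + h *\<^sub>R b z i)"
      have "(\<integral>\<^sup>+\<xi>. ennreal (norm_sq n (move n b h R z \<xi>)) \<partial>gauss_conf n h) =
          (\<integral>\<^sup>+\<xi>. (\<Sum>i\<in>{1..n}. ennreal ((norm (y i + \<xi> i))\<^sup>2)) \<partial>gauss_conf n h)"
        using z by (intro nn_integral_cong) (simp add: norm_sq_def move_def y_def)
      also have "\<dots> = (\<Sum>i\<in>{1..n}. \<integral>\<^sup>+\<xi>. ennreal ((norm (y i + \<xi> i))\<^sup>2) \<partial>gauss_conf n h)"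
      proof (rule nn_integral_sum)
        fix i assume "i \<in> {1..n}"
        hence [measurable]: "(\<lambda>\<xi>. \<xi> i) \<in> borel_measurable (gauss_conf n h :: (nat \<Rightarrow> 'a) measure)"
          using conf_component_measurable by (simp add: measurable_cong_sets[OF sets_gauss_conf refl])
        show "(\<lambda>\<xi>. ennreal ((norm (y i + \<xi> i))\<^sup>2)) \<in> borel_measurable (gauss_conf n h)" by measurable
      qed
      also have "\<dots> = (\<Sum>i\<in>{1..n}. ennreal ((norm (y i))\<^sup>2 + DIM('a) * h))"
      proof (rule sum.cong[OF refl])
        fix i assume i: "i \<in> {1..n}"
        have "(\<integral>\<^sup>+\<xi>. ennreal ((norm (y i + \<xi> i))\<^sup>2) \<partial>gauss_conf n h) = (\<integral>\<^sup>+x. ennreal ((norm (y i + x))\<^sup>2) \<partial>gauss h)"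
          by (rule nn_integral_gauss_conf_component[OF h(1) i]) measurable
        thus "(\<integral>\<^sup>+\<xi>. ennreal ((norm (y i + \<xi> i))\<^sup>2) \<partial>gauss_conf n h) = ennreal ((norm (y i))\<^sup>2 + DIM('a) * h)"
          by (simp add: gauss_shifted_norm2[OF h(1)])
      qed
      also have "\<dots> = ennreal (\<Sum>i\<in>{1..n}. (norm (y i))\<^sup>2 + DIM('a) * h)"
        using h by (intro sum_ennreal) auto
      also have "(\<Sum>i\<in>{1..n}. (norm (y i))\<^sup>2 + DIM('a) * h) \<le> (1 + C' * h) * norm_sq n z + C' * h"
      proof -
        have "(norm (y i))\<^sup>2 \<le> (norm (z i))\<^sup>2 + 2 * h * (z i \<bullet> b z i) + h\<^sup>2 * CR\<^sup>2" if i: "i \<in> {1..n}" for i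
        proof -
          have "(norm (y i))\<^sup>2 = (norm (z i))\<^sup>2 + 2 * h * (z i \<bullet> b z i) + h\<^sup>2 * (norm (b z i))\<^sup>2"
            unfolding y_def power2_norm_eq_inner
            by (simp add: inner_add_left inner_add_right inner_commute power2_eq_square)
          moreover have "h\<^sup>2 * (norm (b z i))\<^sup>2 \<le> h\<^sup>2 * CR\<^sup>2"
            using CR(2)[OF z(2) i] by (intro mult_left_mono power_mono) auto
          ultimately show ?thesis by linarith
        qed
        hence "(\<Sum>i\<in>{1..n}. (norm (y i))\<^sup>2 + DIM('a) * h) \<le>
            (\<Sum>i\<in>{1..n}. ((norm (z i))\<^sup>2 + 2 * h * (z i \<bullet> b z i) + h\<^sup>2 * CR\<^sup>2) + DIM('a) * h)"
          by (intro sum_mono add_right_mono)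
        also have "\<dots> = norm_sq n z + 2 * h * (\<Sum>i\<in>{1..n}. z i \<bullet> b z i) + real n * (h\<^sup>2 * CR\<^sup>2) + real n * (DIM('a) * h)"
          by (simp add: sum.distrib norm_sq_def sum_distrib_left)
        also have "2 * h * (\<Sum>i\<in>{1..n}. z i \<bullet> b z i) \<le> 2 * h * (C * (1 + norm_sq n z))"
          using C(2) h by (intro mult_left_mono) auto
        also have "real n * (h\<^sup>2 * CR\<^sup>2) \<le> h * 1"
        proof -
          have "h * (h * (real n * CR\<^sup>2)) \<le> h * 1" using hn h by (intro mult_left_mono) auto
          thus ?thesis by (simp add: power2_eq_square mult_ac)
        qed
        also have "norm_sq n z + 2 * h * (C * (1 + norm_sq n z)) + h * 1 + real n * (DIM('a) * h) \<le> (1 + C' * h) * norm_sq n z + C' * h"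
        proof -
          have "(1 + C' * h) * norm_sq n z + C' * h - (norm_sq n z + 2 * h * (C * (1 + norm_sq n z)) + h * 1 + real n * (DIM('a) * h))
             = (1 + real n * DIM('a)) * h * norm_sq n z" by (simp add: C'_def algebra_simps)
          also have "\<dots> \<ge> 0" using h norm_sq_nonneg[of n z] by simp
          finally show ?thesis by linarith
        qed
        finally show ?thesis by simp
      qed
      finally show "(\<integral>\<^sup>+\<xi>. ennreal (norm_sq n (move n b h R z \<xi>)) \<partial>gauss_conf n h) \<le> ennreal ((1 + C' * h) * norm_sq n z + C' * h)"
        by (simp add: ennreal_leI)
    qed
  qed
qed

end

section \<open>Choice of growing boxes, and convergence of means under a second moment bound\<close>

lemma diagonal_sequence:
  fixes P :: "nat \<Rightarrow> nat \<Rightarrow> bool"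
  assumes ev: "\<And>k. \<forall>\<^sub>F j in sequentially. P k j"
  obtains K where "filterlim K at_top sequentially" "\<forall>\<^sub>F j in sequentially. P (K j) j"
proof -
  define A where "A = (\<lambda>j. {k. k \<le> j \<and> P k j})"
  \<comment> \<open>The largest admissible k not exceeding j. The default 0 is itself eventually
    admissible.\<close>
  define K where "K = (\<lambda>j. Max (insert 0 (A j)))"
  have fin: "finite (A j)" for j unfolding A_def by (rule finite_subset[of _ "{..j}"]) auto
  have "filterlim K at_top sequentially"
    unfolding filterlim_at_top
  proof
    fix k
    show "\<forall>\<^sub>F j in sequentially. k \<le> K j"
      using ev[of k] eventually_ge_at_top[of k]
    proof eventually_elim
      case (elim j)
      thus ?case unfolding K_def by (intro Max_ge) (use fin in \<open>auto simp: A_def\<close>)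
    qed
  qed
  moreover have "\<forall>\<^sub>F j in sequentially. P (K j) j"
    using ev[of 0]
  proof eventually_elim
    case (elim j)
    have "K j \<in> insert 0 (A j)" unfolding K_def using fin by (intro Max_in) auto
    thus ?case using elim by (auto simp: A_def)
  qed
  ultimately show ?thesis by (rule that)
qed

text \<open>Uniform integrability in elementary form: F \<le> min F K + F^2 / K, where dominated
  convergence treats the truncated part and the second moments the rest.\<close>

lemma (in prob_space) nn_integral_tendsto_0_bounded_square:
  fixes F :: "nat \<Rightarrow> 'a \<Rightarrow> real"
  assumes [measurable]: "\<And>j. F j \<in> borel_measurable M" and F0: "\<And>j x. F j x \<ge> 0"
    and lim: "AE x in M. (\<lambda>j. F j x) \<longlonglongrightarrow> 0"
    and D: "\<And>j. j \<ge> j0 \<Longrightarrow> (\<integral>\<^sup>+x. ennreal ((F j x)\<^sup>2) \<partial>M) \<le> ennreal D" "D \<ge> 0"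
  shows "(\<lambda>j. \<integral>\<^sup>+x. ennreal (F j x) \<partial>M) \<longlonglongrightarrow> 0"
proof (rule order_tendstoI)
  fix e :: ennreal assume "0 < e"
  then obtain c where c: "0 < c" "c < e" using dense by blast
  then obtain e' :: real where "c = ennreal e'" "e' \<ge> 0" by (cases c) auto
  hence e': "e' > 0" "ennreal e' < e" using c by auto
  \<comment> \<open>The remainder D / K is at most e' / 4, which together with e' / 2 for the
    truncated part stays below e'.\<close>
  define K where "K = 4 * D / e' + 1"
  have K: "K > 0" using D(2) e' by (simp add: K_def add_nonneg_pos)
  have "(\<lambda>j. \<integral>\<^sup>+x. ennreal (min (F j x) K) \<partial>M) \<longlonglongrightarrow> (\<integral>\<^sup>+x. 0 \<partial>M)"
  proof (rule nn_integral_dominated_convergence[where w="\<lambda>_. ennreal K"])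
    show "AE x in M. ennreal (min (F j x) K) \<le> ennreal K" for j by (auto intro!: AE_I2 ennreal_leI)
    show "(\<integral>\<^sup>+x. ennreal K \<partial>M) < \<infinity>" by (simp add: emeasure_space_1)
    show "AE x in M. (\<lambda>j. ennreal (min (F j x) K)) \<longlonglongrightarrow> 0"
      using lim
    proof eventually_elim
      case (elim x)
      have "(\<lambda>j. min (F j x) K) \<longlonglongrightarrow> min 0 K" by (intro tendsto_min elim tendsto_const)
      from tendsto_ennrealI[OF this] show ?case using K by simp
    qed
  qed auto
  hence "\<forall>\<^sub>F j in sequentially. (\<integral>\<^sup>+x. ennreal (min (F j x) K) \<partial>M) < ennreal (e' / 2)"
    using e' by (intro order_tendstoD(2)) auto
  thus "\<forall>\<^sub>F j in sequentially. (\<integral>\<^sup>+x. ennreal (F j x) \<partial>M) < e"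
    using eventually_ge_at_top[of j0]
  proof eventually_elim
    case (elim j)
    have le: "ennreal (F j x) \<le> ennreal (min (F j x) K) + ennreal (1 / K) * ennreal ((F j x)\<^sup>2)" for x
    proof -
      have "F j x \<le> min (F j x) K + 1 / K * (F j x)\<^sup>2"
      proof (cases "F j x \<le> K")
        case False
        hence "K * F j x \<le> F j x * F j x" using F0[of j x] by (intro mult_right_mono) auto
        hence "F j x \<le> 1 / K * (F j x)\<^sup>2" using K by (simp add: field_simps power2_eq_square)
        thus ?thesis using False K by simp
      qed (use K in simp)
      hence "ennreal (F j x) \<le> ennreal (min (F j x) K + 1 / K * (F j x)\<^sup>2)" by (rule ennreal_leI)
      also have "\<dots> = ennreal (min (F j x) K) + ennreal (1 / K * (F j x)\<^sup>2)"
        using K F0[of j x] by (intro ennreal_plus) auto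
      also have "ennreal (1 / K * (F j x)\<^sup>2) = ennreal (1 / K) * ennreal ((F j x)\<^sup>2)"
        using K by (intro ennreal_mult) auto
      finally show ?thesis .
    qed
    have "(\<integral>\<^sup>+x. ennreal (F j x) \<partial>M) \<le> (\<integral>\<^sup>+x. ennreal (min (F j x) K) + ennreal (1 / K) * ennreal ((F j x)\<^sup>2) \<partial>M)"
      by (intro nn_integral_mono le)
    also have "\<dots> = (\<integral>\<^sup>+x. ennreal (min (F j x) K) \<partial>M) + ennreal (1 / K) * (\<integral>\<^sup>+x. ennreal ((F j x)\<^sup>2) \<partial>M)"
      by (subst nn_integral_add) (auto simp: nn_integral_cmult)
    also have "\<dots> \<le> ennreal (e' / 2) + ennreal (1 / K) * ennreal D"
      using elim D(1)[of j] by (intro add_mono mult_left_mono) auto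
    also have "\<dots> = ennreal (e' / 2 + 1 / K * D)"
      using K D(2) e' by (simp add: ennreal_mult[symmetric] ennreal_plus[symmetric] del: ennreal_plus)
    also have "\<dots> \<le> ennreal e'"
    proof (rule ennreal_leI)
      have "D * 4 \<le> e' * K" using e' by (simp add: K_def field_simps)
      hence "D / K \<le> e' / 4" using K by (simp add: divide_le_eq)
      moreover have "1 / K * D = D / K" by simp
      ultimately show "e' / 2 + 1 / K * D \<le> e'" using e'(1) by linarith
    qed
    also have "\<dots> < e" by (rule e')
    finally show ?case .
  qed
qed simp

context interacting
begin

lemma cost_measurable [measurable]:
  assumes "X \<in> M \<rightarrow>\<^sub>M conf n" "Y \<in> M \<rightarrow>\<^sub>M conf n"
  shows "(\<lambda>\<omega>. cost (X \<omega>) (Y \<omega>)) \<in> borel_measurable M"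
  unfolding cost_def
proof (rule borel_measurable_sum)
  fix i assume i: "i \<in> {1..n}"
  note [measurable] = measurable_compose[OF assms(1) conf_component_measurable[OF i]]
    measurable_compose[OF assms(2) conf_component_measurable[OF i]]
  show "(\<lambda>\<omega>. f_fun U (norm (X \<omega> i - Y \<omega> i))) \<in> borel_measurable M" by measurable
qed

lemma norm_sq_measurable [measurable]:
  assumes "X \<in> M \<rightarrow>\<^sub>M conf n"
  shows "(\<lambda>\<omega>. norm_sq n (X \<omega>)) \<in> borel_measurable M"
  unfolding norm_sq_def
proof (rule borel_measurable_sum)
  fix i assume i: "i \<in> {1..n}"
  note [measurable] = measurable_compose[OF assms conf_component_measurable[OF i]]
  show "(\<lambda>\<omega>. (norm (X \<omega> i))\<^sup>2) \<in> borel_measurable M" by measurable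
qed

text \<open>The error 1 / (k + 1) is tied to the radius k. Along the diagonal sequence the errors
  therefore vanish while the boxes exhaust the space.\<close>

lemma good_parameters:
  assumes t: "t > 0"
  obtains C K \<delta> j0 where "C \<ge> 0" "filterlim K at_top sequentially"
    "\<And>j. j \<ge> j0 \<Longrightarrow> cost_step (real (K j)) (\<delta> j) (1 / (real (K j) + 1)) (t / 2 ^ j)"
    "\<And>j. j \<ge> j0 \<Longrightarrow> moment_step C (real (K j)) (t / 2 ^ j)"
proof -
  obtain C where C: "C \<ge> 0" and mom: "\<And>R. \<exists>h0>0. \<forall>h. 0 < h \<longrightarrow> h < h0 \<longrightarrow> moment_step C R h"
    using one_step_moment by metis
  define P where "P = (\<lambda>k j. (\<exists>\<delta>. cost_step (real k) \<delta> (1 / (real k + 1)) (t / 2 ^ j)) \<and> moment_step C (real k) (t / 2 ^ j))"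
  have hsmall: "\<forall>\<^sub>F j in sequentially. t / 2 ^ j < h0" if "h0 > 0" for h0
  proof -
    have "(\<lambda>j. t * (1 / 2) ^ j) \<longlonglongrightarrow> t * 0" by (intro tendsto_mult tendsto_const LIMSEQ_power_zero) simp
    hence "\<forall>\<^sub>F j in sequentially. t * (1 / 2) ^ j < h0" using that by (intro order_tendstoD(2)) auto
    moreover have "t * (1 / 2) ^ j = t / 2 ^ j" for j by (simp add: power_divide)
    ultimately show ?thesis by simp
  qed
  have ev: "\<forall>\<^sub>F j in sequentially. P k j" for k
  proof -
    obtain \<delta> h1 where 1: "h1 > 0" "\<And>h. 0 < h \<Longrightarrow> h < h1 \<Longrightarrow> cost_step (real k) \<delta> (1 / (real k + 1)) h"
      using one_step_cost[of "1 / (real k + 1)" "real k"] by (metis add_nonneg_pos of_nat_0_le_iff zero_less_divide_1_iff zero_less_one)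
    obtain h2 where 2: "h2 > 0" "\<And>h. 0 < h \<Longrightarrow> h < h2 \<Longrightarrow> moment_step C (real k) h"
      using mom by blast
    show ?thesis using hsmall[OF 1(1)] hsmall[OF 2(1)]
    proof eventually_elim
      case (elim j)
      thus ?case unfolding P_def using 1(2)[of "t / 2 ^ j"] 2(2)[of "t / 2 ^ j"] t by auto
    qed
  qed
  obtain K where K: "filterlim K at_top sequentially" "\<forall>\<^sub>F j in sequentially. P (K j) j"
    using diagonal_sequence[of P] ev by blast
  then obtain j0 where j0: "\<And>j. j \<ge> j0 \<Longrightarrow> P (K j) j" by (auto simp: eventually_sequentially)
  define \<delta> where "\<delta> = (\<lambda>j. SOME \<delta>. cost_step (real (K j)) \<delta> (1 / (real (K j) + 1)) (t / 2 ^ j))"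
  show ?thesis
  proof (rule that[OF C K(1), of j0 \<delta>])
    show "cost_step (real (K j)) (\<delta> j) (1 / (real (K j) + 1)) (t / 2 ^ j)" if "j \<ge> j0" for j
      using j0[OF that] unfolding P_def \<delta>_def by (auto intro: someI_ex)
    show "moment_step C (real (K j)) (t / 2 ^ j)" if "j \<ge> j0" for j using j0[OF that] by (simp add: P_def)
  qed
qed

end

section \<open>Cost and second moments over a whole chain\<close>

locale approximation = interacting U V \<zeta> \<rho> LV n a \<alpha>
  for U :: "'a::euclidean_space \<Rightarrow> real" and V :: "'a \<Rightarrow> real" and \<zeta> :: 'a and \<rho> LV :: real
    and n :: nat and a :: "nat \<Rightarrow> nat \<Rightarrow> real" and \<alpha> :: real +
  fixes t C :: real and K :: "nat \<Rightarrow> nat" and \<delta> :: "nat \<Rightarrow> real" and j0 :: nat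
  assumes t_pos: "t > 0" and C_nonneg: "C \<ge> 0" and K_lim: "filterlim K at_top sequentially"
    and cost_step_j: "\<And>j. j \<ge> j0 \<Longrightarrow> cost_step (real (K j)) (\<delta> j) (1 / (real (K j) + 1)) (t / 2 ^ j)"
    and moment_step_j: "\<And>j. j \<ge> j0 \<Longrightarrow> moment_step C (real (K j)) (t / 2 ^ j)"
begin

definition h :: "nat \<Rightarrow> real" where "h j = t / 2 ^ j"

lemma h_pos: "h j > 0" using t_pos by (simp add: h_def)

lemma h_sum: "2 ^ j * h j = t" by (simp add: h_def)

definition chain :: "nat \<Rightarrow> (nat \<Rightarrow> 'a) \<Rightarrow> (nat \<Rightarrow> 'a) measure" where
  "chain j = iter_kernel (conf n) (step_kernel n b (h j) (real (K j))) (2 ^ j)"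

definition pair_chain :: "nat \<Rightarrow> (nat \<Rightarrow> 'a) \<times> (nat \<Rightarrow> 'a) \<Rightarrow> ((nat \<Rightarrow> 'a) \<times> (nat \<Rightarrow> 'a)) measure" where
  "pair_chain j = iter_kernel (conf2 n) (pair_kernel n b (h j) (real (K j)) (\<delta> j)) (2 ^ j)"

lemmas step_meas = step_kernel_measurable[OF drift_is_measurable h_pos]
lemmas pair_meas = pair_kernel_measurable[OF drift_is_measurable h_pos]

lemma chain_measurable: "chain j \<in> conf n \<rightarrow>\<^sub>M prob_algebra (conf n)"
  unfolding chain_def by (rule iter_kernel_measurable[OF step_meas])

lemma pair_chain_measurable: "pair_chain j \<in> conf2 n \<rightarrow>\<^sub>M prob_algebra (conf2 n)"
  unfolding pair_chain_def by (rule iter_kernel_measurable[OF pair_meas])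

lemma pair_chain_marginals:
  assumes "p \<in> space (conf2 n)"
  shows "distr (pair_chain j p) (conf n) fst = chain j (fst p)" "distr (pair_chain j p) (conf n) snd = chain j (snd p)"
  unfolding pair_chain_def chain_def
  by (rule iter_kernel_distr[OF pair_meas step_meas _ _ assms];
      use pair_kernel_marginals[OF drift_is_measurable h_pos] in auto)+

text \<open>Contraction is known only while both components move. Once one of them has left the box
  it is frozen, so the truncated cost is 0 from then on and the one-step bound holds for all
  pairs.\<close>

definition box_cost :: "nat \<Rightarrow> (nat \<Rightarrow> 'a) \<times> (nat \<Rightarrow> 'a) \<Rightarrow> real" where
  "box_cost j p = (if in_box n (real (K j)) (fst p) \<and> in_box n (real (K j)) (snd p) then cost (fst p) (snd p) else 0)"

lemma box_cost_measurable [measurable]: "box_cost j \<in> borel_measurable (conf2 n)"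
  unfolding box_cost_def by measurable

lemma pair_chain_cost:
  assumes j: "j \<ge> j0" and p: "p \<in> space (conf2 n)"
  shows "(\<integral>\<^sup>+q. ennreal (box_cost j q) \<partial>pair_chain j p)
    \<le> ennreal (exp (exponent * t) * cost (fst p) (snd p) + t * exp (\<bar>exponent\<bar> * t) / (real (K j) + 1))"
proof -
  define e where "e = 1 / (real (K j) + 1) * h j"
  have e: "e \<ge> 0" using h_pos[of j] by (simp add: e_def)
  have step: "(\<integral>\<^sup>+q. ennreal (box_cost j q) \<partial>pair_kernel n b (h j) (real (K j)) (\<delta> j) p)
      \<le> ennreal (exp (exponent * h j)) * ennreal (box_cost j p) + ennreal e"
    if p: "p \<in> space (conf2 n)" for p
  proof -
    have zw: "fst p \<in> space (conf n)" "snd p \<in> space (conf n)" using p by (auto simp: space_pair_measure)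
    have pm: "pair_move n b (h j) (real (K j)) (\<delta> j) p \<in> gauss_conf n (h j) \<rightarrow>\<^sub>M conf2 n"
      by (rule pair_move_measurable[OF drift_is_measurable measurable_const[OF p]]) measurable
    have eq: "(\<integral>\<^sup>+q. ennreal (box_cost j q) \<partial>pair_kernel n b (h j) (real (K j)) (\<delta> j) p) =
        (\<integral>\<^sup>+\<xi>. ennreal (box_cost j (pair_move n b (h j) (real (K j)) (\<delta> j) p \<xi>)) \<partial>gauss_conf n (h j))"
      unfolding pair_kernel_def by (rule nn_integral_distr[OF pm]) measurable
    show ?thesis
    proof (cases "in_box n (real (K j)) (fst p) \<and> in_box n (real (K j)) (snd p)")
      case True
      have "(\<integral>\<^sup>+\<xi>. ennreal (box_cost j (pair_move n b (h j) (real (K j)) (\<delta> j) p \<xi>)) \<partial>gauss_conf n (h j)) \<le>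
         (\<integral>\<^sup>+\<xi>. ennreal (cost (move n b (h j) (real (K j)) (fst p) \<xi>)
         (move n b (h j) (real (K j)) (snd p) (pair_noise n b (h j) (\<delta> j) (fst p) (snd p) \<xi>))) \<partial>gauss_conf n (h j))"
        by (intro nn_integral_mono ennreal_leI) (auto simp: box_cost_def pair_move_def cost_nonneg)
      also have "\<dots> \<le> ennreal (exp (exponent * h j) * cost (fst p) (snd p) + e)"
        using cost_step_j[OF j] zw True unfolding cost_step_def by (simp add: h_def e_def)
      also have "\<dots> = ennreal (exp (exponent * h j)) * ennreal (box_cost j p) + ennreal e"
        using True e cost_nonneg by (simp add: box_cost_def ennreal_plus ennreal_mult)
      finally show ?thesis unfolding eq .
    next
      case False
      have "box_cost j (pair_move n b (h j) (real (K j)) (\<delta> j) p \<xi>) = 0" for \<xi>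
        using False by (auto simp: box_cost_def pair_move_def move_def)
      thus ?thesis unfolding eq by simp
    qed
  qed
  have "(\<integral>\<^sup>+q. ennreal (box_cost j q) \<partial>pair_chain j p)
    \<le> ennreal (exp (exponent * h j) ^ (2 ^ j)) * ennreal (box_cost j p) +
       ennreal (real (2 ^ j) * e * max 1 (exp (exponent * h j)) ^ (2 ^ j))"
    unfolding pair_chain_def
    by (rule iter_kernel_nn_integral_le[OF pair_meas _ _ e step p]) auto
  also have "exp (exponent * h j) ^ (2 ^ j) = exp (exponent * t)"
    using h_sum[of j] by (simp add: mult_ac flip: exp_of_nat_mult)
  also have "real (2 ^ j) * e * max 1 (exp (exponent * h j)) ^ (2 ^ j) \<le> t * exp (\<bar>exponent\<bar> * t) / (real (K j) + 1)"
  proof -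
    have "max 1 (exp (exponent * h j)) \<le> exp (\<bar>exponent\<bar> * h j)"
      using h_pos[of j] by (auto intro!: mult_right_mono)
    hence "max 1 (exp (exponent * h j)) ^ (2 ^ j) \<le> exp (\<bar>exponent\<bar> * h j) ^ (2 ^ j)" by (intro power_mono) auto
    also have "\<dots> = exp (\<bar>exponent\<bar> * t)" using h_sum[of j] by (simp add: mult_ac flip: exp_of_nat_mult)
    finally have le: "real (2 ^ j) * e * max 1 (exp (exponent * h j)) ^ (2 ^ j) \<le> real (2 ^ j) * e * exp (\<bar>exponent\<bar> * t)"
      using e by (intro mult_left_mono) auto
    have "real (2 ^ j) * e = t / (real (K j) + 1)" using h_sum[of j] by (simp add: e_def)
    hence "real (2 ^ j) * e * exp (\<bar>exponent\<bar> * t) = t * exp (\<bar>exponent\<bar> * t) / (real (K j) + 1)" by simp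
    with le show ?thesis by linarith
  qed
  also have "box_cost j p \<le> cost (fst p) (snd p)" using cost_nonneg by (simp add: box_cost_def)
  also have "ennreal (exp (exponent * t)) * ennreal (cost (fst p) (snd p)) + ennreal (t * exp (\<bar>exponent\<bar> * t) / (real (K j) + 1))
     = ennreal (exp (exponent * t) * cost (fst p) (snd p) + t * exp (\<bar>exponent\<bar> * t) / (real (K j) + 1))"
    using t_pos cost_nonneg by (simp add: ennreal_plus ennreal_mult)
  finally show ?thesis by (simp add: ennreal_leI mult_left_mono add_mono)
qed

definition moment_bound :: "(nat \<Rightarrow> 'a) \<Rightarrow> real" where
  "moment_bound x = exp (C * t) * norm_sq n x + C * t * exp (C * t)"

lemma moment_bound_nonneg: "moment_bound x \<ge> 0"
  using C_nonneg t_pos norm_sq_nonneg[of n x] by (simp add: moment_bound_def)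

lemma chain_moment:
  assumes j: "j \<ge> j0" and x: "x \<in> space (conf n)"
  shows "(\<integral>\<^sup>+z. ennreal (norm_sq n z) \<partial>chain j x) \<le> ennreal (moment_bound x)"
proof -
  define A where "A = 1 + C * h j"
  have Ch: "C * h j \<ge> 0" using C_nonneg h_pos[of j] by simp
  have step: "(\<integral>\<^sup>+z'. ennreal (norm_sq n z') \<partial>step_kernel n b (h j) (real (K j)) z)
      \<le> ennreal A * ennreal (norm_sq n z) + ennreal (C * h j)"
    if z: "z \<in> space (conf n)" for z
  proof -
    interpret G: prob_space "gauss_conf n (h j) :: (nat \<Rightarrow> 'a) measure" by (rule prob_space_gauss_conf[OF h_pos])
    have mm: "move n b (h j) (real (K j)) z \<in> gauss_conf n (h j) \<rightarrow>\<^sub>M conf n"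
      by (rule move_measurable[OF drift_is_measurable measurable_const[OF z]]) measurable
    have eq: "(\<integral>\<^sup>+z'. ennreal (norm_sq n z') \<partial>step_kernel n b (h j) (real (K j)) z) =
        (\<integral>\<^sup>+\<xi>. ennreal (norm_sq n (move n b (h j) (real (K j)) z \<xi>)) \<partial>gauss_conf n (h j))"
      unfolding step_kernel_def by (rule nn_integral_distr[OF mm]) measurable
    have r: "ennreal A * ennreal (norm_sq n z) + ennreal (C * h j) = ennreal (A * norm_sq n z + C * h j)"
      using Ch norm_sq_nonneg[of n z] by (simp add: ennreal_plus ennreal_mult A_def)
    show ?thesis
    proof (cases "in_box n (real (K j)) z")
      case True
      thus ?thesis unfolding eq r using moment_step_j[OF j] z unfolding moment_step_def by (simp add: h_def A_def)
    next
      case False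
      have "norm_sq n z \<le> A * norm_sq n z + C * h j"
        using Ch mult_nonneg_nonneg[OF Ch norm_sq_nonneg[of n z]] by (simp add: A_def distrib_right)
      thus ?thesis unfolding eq r using False by (simp add: move_def G.emeasure_space_1 ennreal_leI)
    qed
  qed
  have "(\<integral>\<^sup>+z. ennreal (norm_sq n z) \<partial>chain j x)
    \<le> ennreal (A ^ (2 ^ j)) * ennreal (norm_sq n x) + ennreal (real (2 ^ j) * (C * h j) * max 1 A ^ (2 ^ j))"
    unfolding chain_def
    by (rule iter_kernel_nn_integral_le[OF step_meas _ _ Ch step x]) (use Ch in \<open>auto simp: A_def\<close>)
  also have "\<dots> = ennreal (A ^ (2 ^ j) * norm_sq n x + real (2 ^ j) * (C * h j) * A ^ (2 ^ j))"
    using Ch norm_sq_nonneg[of n x] by (simp add: ennreal_plus ennreal_mult A_def max_def)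
  also have "\<dots> \<le> ennreal (moment_bound x)"
  proof (rule ennreal_leI)
    have "A ^ (2 ^ j) \<le> exp (C * h j) ^ (2 ^ j)" using Ch by (intro power_mono) (auto simp: A_def)
    also have "\<dots> = exp (C * t)" using h_sum[of j] by (simp add: mult_ac flip: exp_of_nat_mult)
    finally have A: "A ^ (2 ^ j) \<le> exp (C * t)" .
    have m: "real (2 ^ j) * (C * h j) = C * t" using h_sum[of j] by (simp add: mult_ac)
    show "A ^ (2 ^ j) * norm_sq n x + real (2 ^ j) * (C * h j) * A ^ (2 ^ j) \<le> moment_bound x"
      unfolding moment_bound_def m using A norm_sq_nonneg[of n x] C_nonneg t_pos
      by (intro add_mono mult_right_mono) (auto intro!: mult_left_mono)
  qed
  finally show ?thesis .
qed

end

section \<open>Convergence of the Euler chains\<close>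

lemma euler_cong:
  assumes "\<And>l i. l < m \<Longrightarrow> i \<in> {1..n} \<Longrightarrow> w l i = w' l i"
  shows "euler n b h R x w m = euler n b h R x w' m"
  using assms
proof (induction m)
  case (Suc m)
  have "move n b h R z (w m) = move n b h R z (w' m)" for z
    using Suc.prems by (auto simp: move_def)
  thus ?case using Suc by simp
qed simp

lemma l1_dist_measurable [measurable]:
  fixes X Y :: "'b \<Rightarrow> nat \<Rightarrow> 'a::euclidean_space"
  assumes "X \<in> M \<rightarrow>\<^sub>M conf n" "Y \<in> M \<rightarrow>\<^sub>M conf n"
  shows "(\<lambda>\<omega>. l1_dist n (X \<omega>) (Y \<omega>)) \<in> borel_measurable M"
  unfolding l1_dist_def
proof (rule borel_measurable_sum)
  fix i assume i: "i \<in> {1..n}"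
  note [measurable] = measurable_compose[OF assms(1) conf_component_measurable[OF i]]
    measurable_compose[OF assms(2) conf_component_measurable[OF i]]
  show "(\<lambda>\<omega>. norm (X \<omega> i - Y \<omega> i)) \<in> borel_measurable M" by measurable
qed

lemma pred_LIMSEQ_0:
  fixes F :: "nat \<Rightarrow> 'a \<Rightarrow> real"
  assumes [measurable]: "\<And>j. F j \<in> borel_measurable M"
  shows "Measurable.pred M (\<lambda>x. (\<lambda>j. F j x) \<longlonglongrightarrow> 0)"
proof -
  have "(\<lambda>j. F j x) \<longlonglongrightarrow> 0 \<longleftrightarrow> (\<forall>k::nat. \<exists>N. \<forall>j. N \<le> j \<longrightarrow> \<bar>F j x\<bar> < inverse (real (Suc k)))" for x
  proof
    assume "(\<lambda>j. F j x) \<longlonglongrightarrow> 0"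
    thus "\<forall>k::nat. \<exists>N. \<forall>j. N \<le> j \<longrightarrow> \<bar>F j x\<bar> < inverse (real (Suc k))"
      using LIMSEQ_D[of "\<lambda>j. F j x" 0] by simp
  next
    assume *: "\<forall>k::nat. \<exists>N. \<forall>j. N \<le> j \<longrightarrow> \<bar>F j x\<bar> < inverse (real (Suc k))"
    show "(\<lambda>j. F j x) \<longlonglongrightarrow> 0"
    proof (rule LIMSEQ_I)
      fix r :: real assume "r > 0"
      then obtain k where k: "inverse (real (Suc k)) < r" using reals_Archimedean by blast
      then obtain N where "\<forall>j. N \<le> j \<longrightarrow> \<bar>F j x\<bar> < inverse (real (Suc k))" using * by blast
      thus "\<exists>no. \<forall>j\<ge>no. norm (F j x - 0) < r" using k by (intro exI[of _ N]) force
    qed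
  qed
  thus ?thesis by simp
qed

lemma l1_dist_sq: "(l1_dist n z w)\<^sup>2 \<le> 2 * real n * (norm_sq n z + norm_sq n w)"
proof -
  have "(l1_dist n z w)\<^sup>2 \<le> real n * (\<Sum>i\<in>{1..n}. (norm (z i - w i))\<^sup>2)"
    using Cauchy_Schwarz_ineq_sum[of "\<lambda>_. 1" "\<lambda>i. norm (z i - w i)" "{1..n}"] by (simp add: l1_dist_def)
  moreover have "(\<Sum>i\<in>{1..n}. (norm (z i - w i))\<^sup>2) \<le> (\<Sum>i\<in>{1..n}. 2 * (norm (z i))\<^sup>2 + 2 * (norm (w i))\<^sup>2)"
  proof (rule sum_mono)
    fix i
    have "(norm (z i - w i))\<^sup>2 \<le> (norm (z i) + norm (w i))\<^sup>2"
      by (intro power_mono norm_triangle_ineq4) simp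
    also have "\<dots> \<le> 2 * (norm (z i))\<^sup>2 + 2 * (norm (w i))\<^sup>2"
      using zero_le_power2[of "norm (z i) - norm (w i)"] by (simp add: power2_eq_square algebra_simps)
    finally show "(norm (z i - w i))\<^sup>2 \<le> 2 * (norm (z i))\<^sup>2 + 2 * (norm (w i))\<^sup>2" .
  qed
  hence "(\<Sum>i\<in>{1..n}. (norm (z i - w i))\<^sup>2) \<le> 2 * (norm_sq n z + norm_sq n w)"
    by (simp add: norm_sq_def sum.distrib sum_distrib_left)
  from mult_left_mono[OF this, of "real n"]
  have "real n * (\<Sum>i\<in>{1..n}. (norm (z i - w i))\<^sup>2) \<le> 2 * real n * (norm_sq n z + norm_sq n w)" by (simp add: algebra_simps)
  ultimately show ?thesis by linarith
qed

context approximation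
begin

definition zj :: "nat \<Rightarrow> (nat \<Rightarrow> 'a) \<Rightarrow> (nat \<times> nat \<Rightarrow> nat \<Rightarrow> 'a) \<Rightarrow> nat \<Rightarrow> 'a" where
  "zj j x w = euler n b (h j) (real (K j)) x (dyadic_incr n j w) (2 ^ j)"

text \<open>Defined for every starting point and every noise, and jointly measurable in both. On the
  null set where the chains do not converge, \<open>lim\<close> supplies some value.\<close>

definition sol :: "(nat \<Rightarrow> 'a) \<Rightarrow> (nat \<times> nat \<Rightarrow> nat \<Rightarrow> 'a) \<Rightarrow> nat \<Rightarrow> 'a" where
  "sol x w = (\<lambda>i\<in>{1..n}. lim (\<lambda>j. zj j x w i))"

lemma zj_measurable [measurable]:
  assumes X: "X \<in> M \<rightarrow>\<^sub>M conf n" and W: "W \<in> M \<rightarrow>\<^sub>M dyadic_space n"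
  shows "(\<lambda>\<omega>. zj j (X \<omega>) (W \<omega>)) \<in> M \<rightarrow>\<^sub>M conf n"
proof -
  have "(\<lambda>\<omega>. euler n b (h j) (real (K j)) (X \<omega>) (dyadic_incr n j (W \<omega>)) m) \<in> M \<rightarrow>\<^sub>M conf n" for m
  proof (induction m)
    case 0
    show ?case using X by simp
  next
    case (Suc m)
    show ?case
      unfolding euler.simps by (rule move_measurable[OF drift_is_measurable Suc measurable_compose[OF W dyadic_incr_measurable]])
  qed
  thus ?thesis by (simp add: zj_def)
qed

lemma sol_measurable [measurable]:
  assumes X: "X \<in> M \<rightarrow>\<^sub>M conf n" and W: "W \<in> M \<rightarrow>\<^sub>M dyadic_space n"
  shows "(\<lambda>\<omega>. sol (X \<omega>) (W \<omega>)) \<in> M \<rightarrow>\<^sub>M conf n"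
  unfolding sol_def
proof (rule measurable_restrict)
  fix i assume i: "i \<in> {1..n}"
  show "(\<lambda>\<omega>. lim (\<lambda>j. zj j (X \<omega>) (W \<omega>) i)) \<in> borel_measurable M"
    by (rule borel_measurable_lim_metric) (rule measurable_compose[OF zj_measurable[OF X W] conf_component_measurable[OF i]])
qed

lemma zj_converges_to_solution:
  fixes M :: "'w measure"
  assumes M: "prob_space M" and B: "independent_brownian_motions M n B" and X: "sde_solution M n b B x X"
  shows "AE \<omega> in M. (\<lambda>j. l1_dist n (zj j x (dyadic_noise t n B \<omega>)) (X t \<omega>)) \<longlonglongrightarrow> 0"
proof -
  have "AE \<omega> in M. B i 0 \<omega> = 0" if "i \<in> {1..n}" for i
    using B that unfolding independent_brownian_motions_def brownian_motion_def by blast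
  hence "AE \<omega> in M. \<forall>i\<in>{1..n}. B i 0 \<omega> = 0" by (intro AE_finite_allI) auto
  moreover have "AE \<omega> in M. \<forall>i\<in>{1..n}. continuous_on {0..} (\<lambda>t. X t \<omega> i) \<and>
        (\<forall>t\<ge>0. X t \<omega> i = x i + integral {0..t} (\<lambda>s. b (X s \<omega>) i) + B i t \<omega>)"
    using X unfolding sde_solution_def by blast
  ultimately show ?thesis
  proof eventually_elim
    case (elim \<omega>)
    have "(\<lambda>j. l1_dist n (euler n b (t / real (2 ^ j)) (real (K j)) x
      (\<lambda>m i. B i (real (Suc m) * (t / real (2 ^ j))) \<omega> - B i (real m * (t / real (2 ^ j))) \<omega>) (2 ^ j)) (X t \<omega>)) \<longlonglongrightarrow> 0"
    proof (rule euler_converges[OF t_pos drift_locally_lipschitz])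
      show "continuous_on {0..t} (\<lambda>s. X s \<omega> i)" if "i \<in> {1..n}" for i
      proof -
        have "continuous_on {0..} (\<lambda>s. X s \<omega> i)" using elim(2) that by blast
        thus ?thesis by (rule continuous_on_subset) auto
      qed
      show "filterlim (\<lambda>j. real (K j)) at_top sequentially"
        by (rule filterlim_compose[OF filterlim_real_sequentially K_lim])
      show "filterlim (\<lambda>j. 2 ^ j :: nat) at_top sequentially"
        by (rule filterlim_at_top_mono[OF filterlim_ident]) (auto intro!: always_eventually less_imp_le less_exp)
    qed (use elim in auto)
    moreover have "euler n b (t / real (2 ^ j)) (real (K j)) x
      (\<lambda>m i. B i (real (Suc m) * (t / real (2 ^ j))) \<omega> - B i (real m * (t / real (2 ^ j))) \<omega>) (2 ^ j) =
      zj j x (dyadic_noise t n B \<omega>)" for j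
      unfolding zj_def dyadic_incr_noise[abs_def] h_def of_nat_power of_nat_numeral by (rule euler_cong) simp
    ultimately show ?case by simp
  qed
qed

end

text \<open>One noise law \<Xi> drives the chains and the solutions for all starting points;
  \<open>p\<close> is the transition kernel at the fixed time \<open>t\<close>. The assumptions
  record what is used of the stochastic differential equation from here on.\<close>

locale driven = approximation U V \<zeta> \<rho> LV n a \<alpha> t C K \<delta> j0
  for U :: "'a::euclidean_space \<Rightarrow> real" and V :: "'a \<Rightarrow> real" and \<zeta> :: 'a and \<rho> LV :: real
    and n :: nat and a :: "nat \<Rightarrow> nat \<Rightarrow> real" and \<alpha> t C :: real and K :: "nat \<Rightarrow> nat" and \<delta> :: "nat \<Rightarrow> real" and j0 :: nat +
  fixes \<Xi> :: "(nat \<times> nat \<Rightarrow> nat \<Rightarrow> 'a) measure" and p :: "(nat \<Rightarrow> 'a) \<Rightarrow> (nat \<Rightarrow> 'a) measure"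
  assumes Xi_prob: "prob_space \<Xi>" and Xi_sets: "sets \<Xi> = sets (dyadic_space n)"
    and Xi_law: "\<And>j. distr \<Xi> (Pi\<^sub>M {..<2 ^ j} (\<lambda>_. conf n)) (\<lambda>w. \<lambda>m\<in>{..<2 ^ j}. dyadic_incr n j w m)
        = Pi\<^sub>M {..<2 ^ j} (\<lambda>_. gauss_conf n (t / 2 ^ j))"
    and zj_lim: "\<And>x. x \<in> space (conf n) \<Longrightarrow> AE w in \<Xi>. (\<lambda>j. l1_dist n (zj j x w) (sol x w)) \<longlonglongrightarrow> 0"
    and sol_law: "\<And>x. x \<in> space (conf n) \<Longrightarrow> distr \<Xi> (conf n) (sol x) = p x"

text \<open>For each starting point the given solution almost surely equals \<open>sol\<close>
  applied to the dyadic noise of its own Brownian motions. By \<open>dyadic_noise_law_unique\<close>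
  this noise has the same law as the reference noise \<Xi>, which is taken from the solution started
  at the zero configuration.\<close>

lemma (in approximation) transition_kernels_driven:
  assumes p: "transition_kernels n b p"
  obtains \<Xi> where "driven U V \<zeta> \<rho> LV n a \<alpha> t C K \<delta> j0 \<Xi> (p t)"
proof -
  have ex: "\<exists>(M :: (real \<Rightarrow> nat \<Rightarrow> 'a) measure) B X.
          prob_space M \<and> independent_brownian_motions M n B \<and> sde_solution M n b B x X \<and>
          (\<forall>t\<ge>0. p t x = distr M (conf n) (X t))" if "x \<in> space (conf n)" for x
    using p that unfolding transition_kernels_def by blast
  have "(\<lambda>i\<in>{1..n}. 0 :: 'a) \<in> space (conf n)" by (simp add: space_PiM)
  from ex[OF this] obtain M0 :: "(real \<Rightarrow> nat \<Rightarrow> 'a) measure" and B0 :: "nat \<Rightarrow> real \<Rightarrow> (real \<Rightarrow> nat \<Rightarrow> 'a) \<Rightarrow> 'a" where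
    M0: "prob_space M0" "independent_brownian_motions M0 n B0" by blast
  define \<Xi> where "\<Xi> = distr M0 (dyadic_space n) (dyadic_noise t n B0)"
  have "driven U V \<zeta> \<rho> LV n a \<alpha> t C K \<delta> j0 \<Xi> (p t)"
  proof (intro driven.intro driven_axioms.intro approximation_axioms)
    show "prob_space \<Xi>"
      unfolding \<Xi>_def by (rule prob_space.prob_space_distr[OF M0(1) dyadic_noise_measurable[OF M0(2) t_pos]])
    show sets: "sets \<Xi> = sets (dyadic_space n)" by (simp add: \<Xi>_def)
    show "distr \<Xi> (Pi\<^sub>M {..<2 ^ j} (\<lambda>_. conf n)) (\<lambda>w. \<lambda>m\<in>{..<2 ^ j}. dyadic_incr n j w m)
        = Pi\<^sub>M {..<2 ^ j} (\<lambda>_. gauss_conf n (t / 2 ^ j))" for j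
      unfolding \<Xi>_def by (rule dyadic_incr_law[OF M0 t_pos n_pos])
    fix x :: "nat \<Rightarrow> 'a" assume x: "x \<in> space (conf n)"
    from ex[OF x] obtain M :: "(real \<Rightarrow> nat \<Rightarrow> 'a) measure" and B :: "nat \<Rightarrow> real \<Rightarrow> (real \<Rightarrow> nat \<Rightarrow> 'a) \<Rightarrow> 'a" and X where
      M: "prob_space M" "independent_brownian_motions M n B" and X: "sde_solution M n b B x X"
      and pt: "p t x = distr M (conf n) (X t)" using t_pos by (meson less_imp_le)
    have Xi: "\<Xi> = distr M (dyadic_space n) (dyadic_noise t n B)"
      unfolding \<Xi>_def by (rule dyadic_noise_law_unique[OF M0 M t_pos n_pos])
    have nm: "dyadic_noise t n B \<in> M \<rightarrow>\<^sub>M dyadic_space n" by (rule dyadic_noise_measurable[OF M(2) t_pos])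
    have Xm: "X t \<in> M \<rightarrow>\<^sub>M conf n" using X t_pos by (auto simp: sde_solution_def)
    have sm: "sol x \<in> dyadic_space n \<rightarrow>\<^sub>M conf n" by (rule sol_measurable[OF measurable_const[OF x]]) measurable
    have zm: "zj j x \<in> dyadic_space n \<rightarrow>\<^sub>M conf n" for j by (rule zj_measurable[OF measurable_const[OF x]]) measurable
    have conv: "AE \<omega> in M. (\<lambda>j. l1_dist n (zj j x (dyadic_noise t n B \<omega>)) (X t \<omega>)) \<longlonglongrightarrow> 0"
      by (rule zj_converges_to_solution[OF M X])
    have eq: "AE \<omega> in M. sol x (dyadic_noise t n B \<omega>) = X t \<omega>"
      using conv AE_space
    proof eventually_elim
      case (elim \<omega>)
      have "lim (\<lambda>j. zj j x (dyadic_noise t n B \<omega>) i) = X t \<omega> i" if i: "i \<in> {1..n}" for i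
      proof (rule limI, rule LIM_zero_cancel, rule Lim_null_comparison[OF _ elim(1)])
        show "\<forall>\<^sub>F j in sequentially. norm (zj j x (dyadic_noise t n B \<omega>) i - X t \<omega> i)
            \<le> l1_dist n (zj j x (dyadic_noise t n B \<omega>)) (X t \<omega>)"
          by (intro always_eventually allI l1_dist_component i)
      qed
      moreover have "X t \<omega> \<in> extensional {1..n}" using measurable_space[OF Xm elim(2)] by (simp add: space_PiM PiE_def)
      ultimately show ?case by (auto simp: sol_def extensional_def)
    qed
    show "AE w in \<Xi>. (\<lambda>j. l1_dist n (zj j x w) (sol x w)) \<longlonglongrightarrow> 0"
      unfolding Xi
    proof (subst AE_distr_iff[OF nm])
      show "{w \<in> space (dyadic_space n). (\<lambda>j. l1_dist n (zj j x w) (sol x w)) \<longlonglongrightarrow> 0} \<in> sets (dyadic_space n)"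
        using pred_LIMSEQ_0[OF l1_dist_measurable[OF zm sm]] by (simp add: pred_def)
      show "AE \<omega> in M. (\<lambda>j. l1_dist n (zj j x (dyadic_noise t n B \<omega>)) (sol x (dyadic_noise t n B \<omega>))) \<longlonglongrightarrow> 0"
        using conv eq by eventually_elim simp
    qed
    show "distr \<Xi> (conf n) (sol x) = p t x"
      unfolding Xi pt
      by (subst distr_distr[OF sm nm], rule distr_cong_AE) (use eq measurable_compose[OF nm sm] Xm in \<open>auto simp: comp_def\<close>)
  qed
  thus ?thesis by (rule that)
qed

context driven
begin

sublocale Xi: prob_space \<Xi> by (rule Xi_prob)

lemmas Xi_sets' [measurable_cong] = Xi_sets

lemma zj_law:
  assumes x: "x \<in> space (conf n)"
  shows "distr \<Xi> (conf n) (zj j x) = chain j x"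
proof -
  define eu where "eu = (\<lambda>w. euler n b (h j) (real (K j)) x w)"
  have mv: "(\<lambda>(z, \<xi>). move n b (h j) (real (K j)) z \<xi>) \<in> conf n \<Otimes>\<^sub>M conf n \<rightarrow>\<^sub>M conf n"
    unfolding case_prod_beta by (intro move_measurable[OF drift_is_measurable]) auto
  note rec = iter_kernel_random_recursion[OF prob_space_gauss_conf[OF h_pos] sets_gauss_conf x mv, where eu=eu]
  have eum: "(\<lambda>w. eu w (2 ^ j)) \<in> Pi\<^sub>M {..<2 ^ j} (\<lambda>_. gauss_conf n (h j)) \<rightarrow>\<^sub>M conf n"
    by (rule rec(1)) (auto simp: eu_def)
  have eum': "(\<lambda>w. eu w (2 ^ j)) \<in> Pi\<^sub>M {..<2 ^ j} (\<lambda>_. conf n) \<rightarrow>\<^sub>M conf n"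
    using eum by (simp add: measurable_cong_sets[OF sets_PiM_cong[OF refl sets_gauss_conf] refl])
  have im: "(\<lambda>w. \<lambda>m\<in>{..<2 ^ j}. dyadic_incr n j w m) \<in> \<Xi> \<rightarrow>\<^sub>M Pi\<^sub>M {..<2 ^ j} (\<lambda>_. conf n)"
    by (rule measurable_restrict) measurable
  have "chain j x = distr (Pi\<^sub>M {..<2 ^ j} (\<lambda>_. gauss_conf n (h j))) (conf n) (\<lambda>w. eu w (2 ^ j))"
    unfolding chain_def step_kernel_def[abs_def] by (rule rec(2)[symmetric]) (auto simp: eu_def)
  also have "\<dots> = distr (distr \<Xi> (Pi\<^sub>M {..<2 ^ j} (\<lambda>_. conf n)) (\<lambda>w. \<lambda>m\<in>{..<2 ^ j}. dyadic_incr n j w m)) (conf n) (\<lambda>w. eu w (2 ^ j))"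
    by (simp add: Xi_law h_def)
  also have "\<dots> = distr \<Xi> (conf n) (\<lambda>w. eu (\<lambda>m\<in>{..<2 ^ j}. dyadic_incr n j w m) (2 ^ j))"
    by (subst distr_distr[OF eum' im]) (simp add: comp_def)
  also have "(\<lambda>w. eu (\<lambda>m\<in>{..<2 ^ j}. dyadic_incr n j w m) (2 ^ j)) = zj j x"
    unfolding eu_def zj_def[abs_def] by (intro ext euler_cong) simp
  finally show ?thesis by simp
qed

lemma zj_meas: "x \<in> space (conf n) \<Longrightarrow> zj j x \<in> \<Xi> \<rightarrow>\<^sub>M conf n"
  by (rule zj_measurable[OF measurable_const]) measurable

lemma sol_meas: "x \<in> space (conf n) \<Longrightarrow> sol x \<in> \<Xi> \<rightarrow>\<^sub>M conf n"
  by (rule sol_measurable[OF measurable_const]) measurable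

lemma zj_moment:
  assumes "j \<ge> j0" "x \<in> space (conf n)"
  shows "(\<integral>\<^sup>+w. ennreal (norm_sq n (zj j x w)) \<partial>\<Xi>) \<le> ennreal (moment_bound x)"
proof -
  have "(\<integral>\<^sup>+w. ennreal (norm_sq n (zj j x w)) \<partial>\<Xi>) = (\<integral>\<^sup>+z. ennreal (norm_sq n z) \<partial>distr \<Xi> (conf n) (zj j x))"
    by (rule nn_integral_distr[OF zj_meas[OF assms(2)], symmetric]) measurable
  thus ?thesis using chain_moment[OF assms] by (simp add: zj_law[OF assms(2)])
qed

text \<open>Fatou's lemma along the chains, whose second moments are bounded uniformly in the
  level.\<close>

lemma sol_moment:
  assumes x: "x \<in> space (conf n)"
  shows "(\<integral>\<^sup>+w. ennreal (norm_sq n (sol x w)) \<partial>\<Xi>) \<le> ennreal (moment_bound x)"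
proof -
  note [measurable] = zj_meas[OF x] sol_meas[OF x]
  have "(\<integral>\<^sup>+w. ennreal (norm_sq n (sol x w)) \<partial>\<Xi>) = (\<integral>\<^sup>+w. liminf (\<lambda>j. ennreal (norm_sq n (zj j x w))) \<partial>\<Xi>)"
  proof (rule nn_integral_cong_AE)
    show "AE w in \<Xi>. ennreal (norm_sq n (sol x w)) = liminf (\<lambda>j. ennreal (norm_sq n (zj j x w)))"
      using zj_lim[OF x]
    proof eventually_elim
      case (elim w)
      have "(\<lambda>j. zj j x w i) \<longlonglongrightarrow> sol x w i" if i: "i \<in> {1..n}" for i
        by (rule LIM_zero_cancel, rule Lim_null_comparison[OF _ elim])
          (intro always_eventually allI l1_dist_component i)
      hence "(\<lambda>j. norm_sq n (zj j x w)) \<longlonglongrightarrow> norm_sq n (sol x w)"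
        unfolding norm_sq_def by (intro tendsto_intros)
      hence "(\<lambda>j. ennreal (norm_sq n (zj j x w))) \<longlonglongrightarrow> ennreal (norm_sq n (sol x w))" by (rule tendsto_ennrealI)
      thus ?case by (rule lim_imp_Liminf[OF sequentially_bot, symmetric])
    qed
  qed
  also have "\<dots> \<le> liminf (\<lambda>j. \<integral>\<^sup>+w. ennreal (norm_sq n (zj j x w)) \<partial>\<Xi>)"
    by (rule nn_integral_liminf) measurable
  also have "\<dots> \<le> ennreal (moment_bound x)"
    using zj_moment[OF _ x]
    by (intro Liminf_le) (auto simp: eventually_sequentially)
  finally show ?thesis .
qed

text \<open>The second moments of chain and solution upgrade almost sure convergence to convergence
  in the mean.\<close>

lemma zj_sol_tendsto:
  assumes x: "x \<in> space (conf n)"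
  shows "(\<lambda>j. \<integral>\<^sup>+w. ennreal (l1_dist n (sol x w) (zj j x w)) \<partial>\<Xi>) \<longlonglongrightarrow> 0"
proof (rule Xi.nn_integral_tendsto_0_bounded_square[where ?j0.0=j0 and D="4 * real n * moment_bound x"])
  note [measurable] = zj_meas[OF x] sol_meas[OF x]
  show "(\<lambda>w. l1_dist n (sol x w) (zj j x w)) \<in> borel_measurable \<Xi>" for j by measurable
  show "AE w in \<Xi>. (\<lambda>j. l1_dist n (sol x w) (zj j x w)) \<longlonglongrightarrow> 0"
    using zj_lim[OF x] by eventually_elim (simp add: l1_dist_sym[of n "sol x _"])
  show "4 * real n * moment_bound x \<ge> 0" using moment_bound_nonneg by simp
  fix j assume j: "j \<ge> j0"
  have "(\<integral>\<^sup>+w. ennreal ((l1_dist n (sol x w) (zj j x w))\<^sup>2) \<partial>\<Xi>)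
     \<le> (\<integral>\<^sup>+w. ennreal (2 * real n) * (ennreal (norm_sq n (sol x w)) + ennreal (norm_sq n (zj j x w))) \<partial>\<Xi>)"
  proof (rule nn_integral_mono)
    fix w
    have "ennreal ((l1_dist n (sol x w) (zj j x w))\<^sup>2) \<le> ennreal (2 * real n * (norm_sq n (sol x w) + norm_sq n (zj j x w)))"
      by (intro ennreal_leI l1_dist_sq)
    also have "\<dots> = ennreal (2 * real n) * (ennreal (norm_sq n (sol x w)) + ennreal (norm_sq n (zj j x w)))"
      by (subst ennreal_mult) auto
    finally show "ennreal ((l1_dist n (sol x w) (zj j x w))\<^sup>2) \<le> \<dots>" .
  qed
  also have "\<dots> = ennreal (2 * real n) * ((\<integral>\<^sup>+w. ennreal (norm_sq n (sol x w)) \<partial>\<Xi>) + (\<integral>\<^sup>+w. ennreal (norm_sq n (zj j x w)) \<partial>\<Xi>))"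
    by (simp add: nn_integral_cmult nn_integral_add)
  also have "\<dots> \<le> ennreal (2 * real n) * (ennreal (moment_bound x) + ennreal (moment_bound x))"
    by (intro mult_left_mono add_mono sol_moment[OF x] zj_moment[OF j x]) simp
  also have "\<dots> = ennreal (4 * real n * moment_bound x)"
    using moment_bound_nonneg[of x] by (simp add: ennreal_mult[symmetric] ennreal_plus[symmetric] del: ennreal_plus)
  finally show "(\<integral>\<^sup>+w. ennreal ((l1_dist n (sol x w) (zj j x w))\<^sup>2) \<partial>\<Xi>) \<le> ennreal (4 * real n * moment_bound x)" .
qed (rule l1_dist_nonneg)

text \<open>For almost every noise the end points converge while the radius tends to infinity.
  Looking at the end point is enough: a chain that leaves the box is frozen outside it.\<close>

lemma zj_exit_tendsto:
  assumes x: "x \<in> space (conf n)"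
  shows "(\<lambda>j. emeasure (chain j x) {z \<in> space (conf n). \<not> in_box n (real (K j)) z}) \<longlonglongrightarrow> 0"
proof -
  note [measurable] = zj_meas[OF x] sol_meas[OF x]
  have eq: "emeasure (chain j x) {z \<in> space (conf n). \<not> in_box n (real (K j)) z} =
      (\<integral>\<^sup>+w. indicator {w. \<not> in_box n (real (K j)) (zj j x w)} w \<partial>\<Xi>)" for j
  proof -
    have "emeasure (chain j x) {z \<in> space (conf n). \<not> in_box n (real (K j)) z} =
      (\<integral>\<^sup>+z. indicator {z \<in> space (conf n). \<not> in_box n (real (K j)) z} z \<partial>distr \<Xi> (conf n) (zj j x))"
      unfolding zj_law[OF x, symmetric] by (rule nn_integral_indicator[symmetric]) auto
    also have "\<dots> = (\<integral>\<^sup>+w. indicator {z \<in> space (conf n). \<not> in_box n (real (K j)) z} (zj j x w) \<partial>\<Xi>)"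
      by (rule nn_integral_distr) auto
    also have "\<dots> = (\<integral>\<^sup>+w. indicator {w. \<not> in_box n (real (K j)) (zj j x w)} w \<partial>\<Xi>)"
      using measurable_space[OF zj_meas[OF x]] by (intro nn_integral_cong) (auto simp: indicator_def)
    finally show ?thesis .
  qed
  have "(\<lambda>j. \<integral>\<^sup>+w. indicator {w. \<not> in_box n (real (K j)) (zj j x w)} w \<partial>\<Xi>) \<longlonglongrightarrow> (\<integral>\<^sup>+w. 0 \<partial>\<Xi>)"
  proof (rule nn_integral_dominated_convergence[where w="\<lambda>_. 1"])
    have "Measurable.pred \<Xi> (\<lambda>w. in_box n (real (K j)) (zj j x w))" for j by measurable
    thus "(\<lambda>w. indicator {w. \<not> in_box n (real (K j)) (zj j x w)} w :: ennreal) \<in> borel_measurable \<Xi>" for j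
      by measurable
    show "AE w in \<Xi>. (\<lambda>j. indicator {w. \<not> in_box n (real (K j)) (zj j x w)} w :: ennreal) \<longlonglongrightarrow> 0"
      using zj_lim[OF x]
    proof eventually_elim
      case (elim w)
      define m where "m = (\<Sum>i\<in>{1..n}. norm (sol x w i)) + 1"
      have "\<forall>\<^sub>F j in sequentially. l1_dist n (zj j x w) (sol x w) < 1"
        using elim by (rule order_tendstoD) simp
      moreover have "\<forall>\<^sub>F j in sequentially. m \<le> real (K j)"
        using filterlim_compose[OF filterlim_real_sequentially K_lim] by (simp add: filterlim_at_top)
      ultimately have "\<forall>\<^sub>F j in sequentially. indicator {w. \<not> in_box n (real (K j)) (zj j x w)} w = (0::ennreal)"
      proof eventually_elim
        case (elim j)
        have "norm (zj j x w i) \<le> real (K j)" if i: "i \<in> {1..n}" for i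
        proof -
          have "norm (zj j x w i) \<le> norm (sol x w i) + norm (zj j x w i - sol x w i)"
            using norm_triangle_ineq[of "sol x w i" "zj j x w i - sol x w i"] by simp
          moreover have "norm (sol x w i) \<le> (\<Sum>i\<in>{1..n}. norm (sol x w i))" using i by (intro member_le_sum) auto
          moreover have "norm (zj j x w i - sol x w i) \<le> l1_dist n (zj j x w) (sol x w)" by (rule l1_dist_component[OF i])
          ultimately show ?thesis using elim by (simp add: m_def)
        qed
        thus ?case by (simp add: in_box_def)
      qed
      thus ?case by (rule tendsto_eventually)
    qed
  qed (auto simp: Xi.emeasure_space_1 indicator_def)
  thus ?thesis by (simp add: eq)
qed

text \<open>Passes from \<open>box_cost\<close> to the full cost. Outside the boxes a distance s is
  at most L + s^2 / L; the constant is multiplied by small exit probabilities, and the quadratic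
  term is controlled by second moments.\<close>

lemma pair_chain_full_cost:
  assumes x: "x \<in> space (conf n)" and y: "y \<in> space (conf n)" and \<epsilon>: "\<epsilon> > 0"
  shows "\<forall>\<^sub>F j in sequentially. (\<integral>\<^sup>+q. ennreal (cost (fst q) (snd q)) \<partial>pair_chain j (x, y))
     \<le> ennreal (exp (exponent * t) * cost x y + \<epsilon>)"
proof -
  define D where "D = moment_bound x + moment_bound y"
  have D: "D \<ge> 0" using moment_bound_nonneg by (simp add: D_def)
  \<comment> \<open>With this L the moment term is at most \<epsilon> / 8. The two exit
    probabilities, each below \<epsilon> / (8 L), contribute \<epsilon> / 4, and the error of the
    truncated cost another \<epsilon> / 4.\<close>
  define L where "L = 16 * real n * D / \<epsilon> + 1"
  have L: "L > 0" using D \<epsilon> by (simp add: L_def add_nonneg_pos)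
  have xy: "(x, y) \<in> space (conf2 n)" using x y by (simp add: space_pair_measure)
  define OUT where "OUT = (\<lambda>j. {z \<in> space (conf n). \<not> in_box n (real (K j)) (z :: nat \<Rightarrow> 'a)})"
  have OUT [measurable]: "OUT j \<in> sets (conf n)" for j unfolding OUT_def by measurable
  have ex: "\<forall>\<^sub>F j in sequentially. emeasure (chain j v) (OUT j) < ennreal (\<epsilon> / (8 * L))" if "v \<in> space (conf n)" for v
    unfolding OUT_def by (rule order_tendstoD(2)[OF zj_exit_tendsto[OF that]]) (use \<epsilon> L in simp)
  have "\<forall>\<^sub>F j in sequentially. 4 * t * exp (\<bar>exponent\<bar> * t) / \<epsilon> \<le> real (K j)"
    using filterlim_compose[OF filterlim_real_sequentially K_lim] by (simp add: filterlim_at_top)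
  with ex[OF x] ex[OF y] eventually_ge_at_top[of j0] show ?thesis
  proof eventually_elim
    case (elim j)
    note j = elim(3)
    define \<pi> where "\<pi> = pair_chain j (x, y)"
    have s\<pi> [measurable_cong]: "sets \<pi> = sets (conf2 n)" and sp\<pi>: "space \<pi> = space (conf2 n)"
      unfolding \<pi>_def using kernel_space[OF pair_chain_measurable xy] by auto
    have m1: "distr \<pi> (conf n) fst = chain j x" and m2: "distr \<pi> (conf n) snd = chain j y"
      unfolding \<pi>_def using pair_chain_marginals[OF xy] by auto
    have i1: "(\<integral>\<^sup>+q. F (fst q) \<partial>\<pi>) = (\<integral>\<^sup>+z. F z \<partial>chain j x)"
      and i2: "(\<integral>\<^sup>+q. F (snd q) \<partial>\<pi>) = (\<integral>\<^sup>+z. F z \<partial>chain j y)"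
      if [measurable]: "F \<in> borel_measurable (conf n)" for F :: "(nat \<Rightarrow> 'a) \<Rightarrow> ennreal"
      unfolding m1[symmetric] m2[symmetric] by (rule nn_integral_distr[symmetric]; measurable)+
    have le: "ennreal (cost (fst q) (snd q)) \<le> ennreal (box_cost j q)
        + (ennreal L * (indicator (OUT j) (fst q) + indicator (OUT j) (snd q))
        + ennreal (2 * real n / L) * (ennreal (norm_sq n (fst q)) + ennreal (norm_sq n (snd q))))"
      if q: "q \<in> space \<pi>" for q
    proof (cases "in_box n (real (K j)) (fst q) \<and> in_box n (real (K j)) (snd q)")
      case True
      thus ?thesis by (simp add: box_cost_def)
    next
      case False
      have zw: "fst q \<in> space (conf n)" "snd q \<in> space (conf n)" using q by (auto simp: sp\<pi> space_pair_measure)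
      have ind: "1 \<le> (indicator (OUT j) (fst q) + indicator (OUT j) (snd q) :: ennreal)"
        using False zw by (auto simp: OUT_def indicator_def)
      define s where "s = l1_dist n (fst q) (snd q)"
      have s0: "s \<ge> 0" by (simp add: s_def l1_dist_nonneg)
      have "s \<le> L + s\<^sup>2 / L"
      proof -
        have "0 \<le> (s - L)\<^sup>2" by simp
        hence "2 * s * L \<le> s\<^sup>2 + L\<^sup>2" by (simp add: power2_eq_square algebra_simps)
        moreover have "0 \<le> s * L" using s0 L by simp
        ultimately have "s * L \<le> s\<^sup>2 + L\<^sup>2" by linarith
        thus ?thesis using L by (simp add: field_simps power2_eq_square)
      qed
      also have "s\<^sup>2 / L \<le> 2 * real n * (norm_sq n (fst q) + norm_sq n (snd q)) / L"
        unfolding s_def using L by (intro divide_right_mono l1_dist_sq) auto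
      finally have "cost (fst q) (snd q) \<le> L + (2 * real n / L) * (norm_sq n (fst q) + norm_sq n (snd q))"
        using cost_l1(1)[of "fst q" "snd q"] by (simp add: s_def)
      hence "ennreal (cost (fst q) (snd q)) \<le> ennreal (L + (2 * real n / L) * (norm_sq n (fst q) + norm_sq n (snd q)))"
        by (rule ennreal_leI)
      also have "\<dots> = ennreal L + ennreal (2 * real n / L) * (ennreal (norm_sq n (fst q)) + ennreal (norm_sq n (snd q)))"
      proof -
        have "ennreal (L + (2 * real n / L) * (norm_sq n (fst q) + norm_sq n (snd q))) =
            ennreal L + ennreal ((2 * real n / L) * (norm_sq n (fst q) + norm_sq n (snd q)))"
          using L by (intro ennreal_plus) auto
        also have "ennreal ((2 * real n / L) * (norm_sq n (fst q) + norm_sq n (snd q))) =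
            ennreal (2 * real n / L) * ennreal (norm_sq n (fst q) + norm_sq n (snd q))"
          using L by (intro ennreal_mult) auto
        also have "ennreal (norm_sq n (fst q) + norm_sq n (snd q)) = ennreal (norm_sq n (fst q)) + ennreal (norm_sq n (snd q))"
          by (intro ennreal_plus) auto
        finally show ?thesis .
      qed
      also have "ennreal L \<le> ennreal L * (indicator (OUT j) (fst q) + indicator (OUT j) (snd q))"
        using mult_left_mono[OF ind, of "ennreal L"] by simp
      finally show ?thesis using False by (simp add: box_cost_def add_mono)
    qed
    have "(\<integral>\<^sup>+q. ennreal (cost (fst q) (snd q)) \<partial>\<pi>) \<le> (\<integral>\<^sup>+q. ennreal (box_cost j q)
        + (ennreal L * (indicator (OUT j) (fst q) + indicator (OUT j) (snd q))
        + ennreal (2 * real n / L) * (ennreal (norm_sq n (fst q)) + ennreal (norm_sq n (snd q)))) \<partial>\<pi>)"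
      by (rule nn_integral_mono) (rule le)
    also have "\<dots> = (\<integral>\<^sup>+q. ennreal (box_cost j q) \<partial>\<pi>)
        + (ennreal L * ((\<integral>\<^sup>+q. indicator (OUT j) (fst q) \<partial>\<pi>) + (\<integral>\<^sup>+q. indicator (OUT j) (snd q) \<partial>\<pi>))
        + ennreal (2 * real n / L) * ((\<integral>\<^sup>+q. ennreal (norm_sq n (fst q)) \<partial>\<pi>) + (\<integral>\<^sup>+q. ennreal (norm_sq n (snd q)) \<partial>\<pi>)))"
      by (simp add: nn_integral_add nn_integral_cmult)
    also have "\<dots> \<le> ennreal (exp (exponent * t) * cost x y + \<epsilon> / 4)
        + (ennreal L * (ennreal (\<epsilon> / (8 * L)) + ennreal (\<epsilon> / (8 * L)))
        + ennreal (2 * real n / L) * (ennreal (moment_bound x) + ennreal (moment_bound y)))"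
    proof (intro add_mono mult_left_mono)
      have "t * exp (\<bar>exponent\<bar> * t) / (real (K j) + 1) \<le> \<epsilon> / 4"
      proof -
        have "4 * t * exp (\<bar>exponent\<bar> * t) \<le> real (K j) * \<epsilon>" using elim(4) \<epsilon> by (simp add: field_simps)
        also have "\<dots> \<le> (real (K j) + 1) * \<epsilon>" using \<epsilon> by (intro mult_right_mono) auto
        finally show ?thesis by (simp add: divide_le_eq mult_ac)
      qed
      thus "(\<integral>\<^sup>+q. ennreal (box_cost j q) \<partial>\<pi>) \<le> ennreal (exp (exponent * t) * cost x y + \<epsilon> / 4)"
        unfolding \<pi>_def using pair_chain_cost[OF j xy] by (elim order_trans) (auto intro: ennreal_leI)
      show "(\<integral>\<^sup>+q. indicator (OUT j) (fst q) \<partial>\<pi>) \<le> ennreal (\<epsilon> / (8 * L))"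
        using elim(1) kernel_space(2)[OF chain_measurable x, of j] by (subst i1) auto
      show "(\<integral>\<^sup>+q. indicator (OUT j) (snd q) \<partial>\<pi>) \<le> ennreal (\<epsilon> / (8 * L))"
        using elim(2) kernel_space(2)[OF chain_measurable y, of j] by (subst i2) auto
      show "(\<integral>\<^sup>+q. ennreal (norm_sq n (fst q)) \<partial>\<pi>) \<le> ennreal (moment_bound x)"
        by (subst i1) (use chain_moment[OF j x] in auto)
      show "(\<integral>\<^sup>+q. ennreal (norm_sq n (snd q)) \<partial>\<pi>) \<le> ennreal (moment_bound y)"
        by (subst i2) (use chain_moment[OF j y] in auto)
    qed auto
    also have "\<dots> = ennreal (exp (exponent * t) * cost x y + \<epsilon> / 4 + (L * (\<epsilon> / (8 * L) + \<epsilon> / (8 * L)) + 2 * real n / L * D))"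
      using L \<epsilon> cost_nonneg[of x y] moment_bound_nonneg
      by (simp add: D_def ennreal_mult[symmetric] ennreal_plus[symmetric] del: ennreal_plus)
    also have "\<dots> \<le> ennreal (exp (exponent * t) * cost x y + \<epsilon>)"
    proof (rule ennreal_leI)
      have "16 * real n * D \<le> \<epsilon> * L" using \<epsilon> by (simp add: L_def field_simps)
      hence "2 * real n / L * D \<le> \<epsilon> / 8" using L by (simp add: field_simps)
      moreover have "L * (\<epsilon> / (8 * L) + \<epsilon> / (8 * L)) = \<epsilon> / 4" using L by (simp add: field_simps)
      ultimately show "exp (exponent * t) * cost x y + \<epsilon> / 4 + (L * (\<epsilon> / (8 * L) + \<epsilon> / (8 * L)) + 2 * real n / L * D)
          \<le> exp (exponent * t) * cost x y + \<epsilon>" using \<epsilon> by linarith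
    qed
    finally show ?case by (simp add: \<pi>_def)
  qed
qed

end

section \<open>Composition of couplings\<close>

abbreviation N_space :: "nat measure" where "N_space \<equiv> count_space UNIV"

text \<open>Conditional law of the first coordinate given that the second is k. On a fibre of
  probability 0 the unconditional marginal is the default, so that every value is a probability
  measure.\<close>

definition fibre_law :: "'a measure \<Rightarrow> ('a \<times> nat) measure \<Rightarrow> nat \<Rightarrow> 'a measure" where
  "fibre_law S \<rho> k = (if emeasure \<rho> {p \<in> space \<rho>. snd p = k} = 0 then distr \<rho> S fst
     else distr (uniform_measure \<rho> {p \<in> space \<rho>. snd p = k}) S fst)"

lemma nn_integral_nat_partition:
  assumes [measurable]: "D \<in> M \<rightarrow>\<^sub>M N_space" "F \<in> borel_measurable M"
  shows "(\<integral>\<^sup>+x. F x \<partial>M) = (\<Sum>k. \<integral>\<^sup>+x. F x * indicator {x \<in> space M. D x = k} x \<partial>M)"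
proof -
  have "(\<integral>\<^sup>+x. F x \<partial>M) = (\<integral>\<^sup>+x. (\<Sum>k. F x * indicator {x \<in> space M. D x = k} x) \<partial>M)"
  proof (rule nn_integral_cong)
    fix x assume x: "x \<in> space M"
    have "(\<Sum>k. F x * indicator {x \<in> space M. D x = k} x) = (\<Sum>k. if k = D x then F x else 0)"
      using x by (intro suminf_cong) (auto simp: indicator_def)
    also have "\<dots> = F x" by (subst suminf_finite[of "{D x}"]) auto
    finally show "F x = (\<Sum>k. F x * indicator {x \<in> space M. D x = k} x)" by simp
  qed
  also have "\<dots> = (\<Sum>k. \<integral>\<^sup>+x. F x * indicator {x \<in> space M. D x = k} x \<partial>M)"
    by (rule nn_integral_suminf) measurable
  finally show ?thesis .
qed

context
  fixes S :: "'a measure" and \<rho> :: "('a \<times> nat) measure"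
  assumes \<rho>: "\<rho> \<in> space (prob_algebra (S \<Otimes>\<^sub>M N_space))"
begin

interpretation \<rho>: prob_space \<rho> using \<rho> by (simp add: space_prob_algebra)

lemma rho_sets [measurable_cong]: "sets \<rho> = sets (S \<Otimes>\<^sub>M N_space)" using \<rho> by (simp add: space_prob_algebra)

lemma fibre_event [measurable]: "{p \<in> space \<rho>. snd p = k} \<in> sets \<rho>"
proof -
  have [measurable]: "snd \<in> \<rho> \<rightarrow>\<^sub>M N_space" by measurable
  show ?thesis by measurable
qed

lemma fibre_law_prob: "fibre_law S \<rho> k \<in> space (prob_algebra S)"
proof -
  have [measurable]: "fst \<in> \<rho> \<rightarrow>\<^sub>M S" by measurable
  show ?thesis
  proof (cases "emeasure \<rho> {p \<in> space \<rho>. snd p = k} = 0")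
    case True
    thus ?thesis by (auto simp: fibre_law_def space_prob_algebra intro!: \<rho>.prob_space_distr)
  next
    case False
    have "prob_space (uniform_measure \<rho> {p \<in> space \<rho>. snd p = k})"
      using False by (intro prob_space_uniform_measure) auto
    thus ?thesis using False by (auto simp: fibre_law_def space_prob_algebra intro!: prob_space.prob_space_distr)
  qed
qed

lemma fibre_law_measurable: "fibre_law S \<rho> \<in> N_space \<rightarrow>\<^sub>M prob_algebra S"
  using fibre_law_prob by auto

text \<open>The conditioning variable is countable, so the space splits into fibres, each of them
  null or carrying a normalised restriction of the measure.\<close>

lemma fibre_law_disintegration:
  assumes F [measurable]: "F \<in> borel_measurable (S \<Otimes>\<^sub>M N_space)"
  shows "(\<integral>\<^sup>+p. F p \<partial>\<rho>) = (\<integral>\<^sup>+k. (\<integral>\<^sup>+x. F (x, k) \<partial>fibre_law S \<rho> k) \<partial>distr \<rho> N_space snd)"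
proof -
  have [measurable]: "fst \<in> \<rho> \<rightarrow>\<^sub>M S" "snd \<in> \<rho> \<rightarrow>\<^sub>M N_space" by measurable
  define G where "G = (\<lambda>k. \<integral>\<^sup>+x. F (x, k) \<partial>fibre_law S \<rho> k)"
  have "(\<integral>\<^sup>+p. F p \<partial>\<rho>) = (\<Sum>k. \<integral>\<^sup>+p. F p * indicator {p \<in> space \<rho>. snd p = k} p \<partial>\<rho>)"
    by (rule nn_integral_nat_partition) measurable
  also have "\<dots> = (\<Sum>k. \<integral>\<^sup>+p. G (snd p) * indicator {p \<in> space \<rho>. snd p = k} p \<partial>\<rho>)"
  proof (rule suminf_cong)
    fix k
    define E where "E = {p \<in> space \<rho>. snd p = k}"
    have E [measurable]: "E \<in> sets \<rho>" unfolding E_def by measurable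
    have Fk [measurable]: "(\<lambda>x. F (x, k)) \<in> borel_measurable S" by measurable
    have "(\<integral>\<^sup>+p. G (snd p) * indicator E p \<partial>\<rho>) = (\<integral>\<^sup>+p. G k * indicator E p \<partial>\<rho>)"
      by (intro nn_integral_cong) (auto simp: E_def indicator_def)
    also have "\<dots> = G k * emeasure \<rho> E" by (simp add: nn_integral_cmult)
    also have "\<dots> = (\<integral>\<^sup>+p. F (fst p, k) * indicator E p \<partial>\<rho>)"
    proof (cases "emeasure \<rho> E = 0")
      case True
      have "AE p in \<rho>. p \<notin> E" using True by (intro AE_not_in) (simp add: null_sets_def)
      hence "(\<integral>\<^sup>+p. F (fst p, k) * indicator E p \<partial>\<rho>) = (\<integral>\<^sup>+p. 0 \<partial>\<rho>)"
        by (intro nn_integral_cong_AE) auto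
      thus ?thesis using True by simp
    next
      case False
      have "fst \<in> uniform_measure \<rho> E \<rightarrow>\<^sub>M S" by measurable
      hence "G k = (\<integral>\<^sup>+p. F (fst p, k) \<partial>uniform_measure \<rho> E)"
        using False unfolding G_def fibre_law_def E_def[symmetric] by (simp add: nn_integral_distr)
      also have "\<dots> = (\<integral>\<^sup>+p. F (fst p, k) * indicator E p \<partial>\<rho>) / emeasure \<rho> E"
        by (rule nn_integral_uniform_measure) auto
      finally show ?thesis by (simp add: ennreal_divide_times ennreal_divide_self[OF False] less_top[symmetric] \<rho>.emeasure_finite)
    qed
    also have "\<dots> = (\<integral>\<^sup>+p. F p * indicator E p \<partial>\<rho>)"
      by (intro nn_integral_cong) (auto simp: E_def indicator_def)
    finally show "(\<integral>\<^sup>+p. F p * indicator {p \<in> space \<rho>. snd p = k} p \<partial>\<rho>) =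
        (\<integral>\<^sup>+p. G (snd p) * indicator {p \<in> space \<rho>. snd p = k} p \<partial>\<rho>)" by (simp add: E_def)
  qed
  also have "\<dots> = (\<integral>\<^sup>+p. G (snd p) \<partial>\<rho>)"
    by (rule nn_integral_nat_partition[symmetric]) measurable
  also have "\<dots> = (\<integral>\<^sup>+k. G k \<partial>distr \<rho> N_space snd)" by (subst nn_integral_distr) auto
  finally show ?thesis by (simp add: G_def)
qed

end

text \<open>Couplings can be composed through a countable-valued variable without disintegration theory:
  conditionally on the two discrete values the outer variables are drawn independently.\<close>

lemma glue_couplings:
  fixes S :: "'a measure"
  assumes \<rho>1: "\<rho>1 \<in> space (prob_algebra (S \<Otimes>\<^sub>M N_space))" and \<rho>2: "\<rho>2 \<in> space (prob_algebra (S \<Otimes>\<^sub>M N_space))"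
    and \<pi>: "\<pi> \<in> space (prob_algebra (N_space \<Otimes>\<^sub>M N_space))"
    and m1: "distr \<pi> N_space fst = distr \<rho>1 N_space snd" and m2: "distr \<pi> N_space snd = distr \<rho>2 N_space snd"
    and c [measurable]: "c \<in> borel_measurable (S \<Otimes>\<^sub>M S)"
    and a [measurable]: "a \<in> borel_measurable (S \<Otimes>\<^sub>M N_space)"
    and a' [measurable]: "a' \<in> borel_measurable (S \<Otimes>\<^sub>M N_space)"
    and le: "\<And>x y k l. x \<in> space S \<Longrightarrow> y \<in> space S \<Longrightarrow> c (x, y) \<le> a (x, k) + d (k, l) + a' (y, l)"
  obtains \<eta> where "\<eta> \<in> space (prob_algebra (S \<Otimes>\<^sub>M S))" "distr \<eta> S fst = distr \<rho>1 S fst" "distr \<eta> S snd = distr \<rho>2 S fst"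
    "(\<integral>\<^sup>+p. c p \<partial>\<eta>) \<le> (\<integral>\<^sup>+p. a p \<partial>\<rho>1) + (\<integral>\<^sup>+p. d p \<partial>\<pi>) + (\<integral>\<^sup>+p. a' p \<partial>\<rho>2)"
proof -
  interpret \<pi>: prob_space \<pi> using \<pi> by (simp add: space_prob_algebra)
  have s\<pi> [measurable_cong]: "sets \<pi> = sets (N_space \<Otimes>\<^sub>M N_space)" using \<pi> by (simp add: space_prob_algebra)
  have s1 [measurable_cong]: "sets \<rho>1 = sets (S \<Otimes>\<^sub>M N_space)" and s2 [measurable_cong]: "sets \<rho>2 = sets (S \<Otimes>\<^sub>M N_space)"
    using \<rho>1 \<rho>2 by (auto simp: space_prob_algebra)
  have [measurable]: "fst \<in> \<rho>1 \<rightarrow>\<^sub>M S" "fst \<in> \<rho>2 \<rightarrow>\<^sub>M S"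
    by (simp_all add: measurable_cong_sets[OF s1 refl] measurable_cong_sets[OF s2 refl])
  define \<kappa>1 where "\<kappa>1 = fibre_law S \<rho>1"
  define \<kappa>2 where "\<kappa>2 = fibre_law S \<rho>2"
  have k1 [measurable]: "\<kappa>1 \<in> N_space \<rightarrow>\<^sub>M prob_algebra S" and k2 [measurable]: "\<kappa>2 \<in> N_space \<rightarrow>\<^sub>M prob_algebra S"
    unfolding \<kappa>1_def \<kappa>2_def by (rule fibre_law_measurable \<rho>1 \<rho>2)+
  have kp: "prob_space (\<kappa>1 k)" "sets (\<kappa>1 k) = sets S" "prob_space (\<kappa>2 k)" "sets (\<kappa>2 k) = sets S" for k
    using fibre_law_prob[OF \<rho>1, of k] fibre_law_prob[OF \<rho>2, of k] by (auto simp: \<kappa>1_def \<kappa>2_def space_prob_algebra)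
  note [measurable_cong] = kp(2,4)
  have sN: "sets (N_space \<Otimes>\<^sub>M N_space) = UNIV"
    by (subst sets_pair_countable[of UNIV UNIV]) auto
  have d [measurable]: "d \<in> borel_measurable (N_space \<Otimes>\<^sub>M N_space)"
    by (simp add: measurable_def sN)
  have [measurable]: "fst \<in> \<pi> \<rightarrow>\<^sub>M N_space" "snd \<in> \<pi> \<rightarrow>\<^sub>M N_space"
    by (auto simp: measurable_def s\<pi> sN)
  define Q where "Q = (\<lambda>p. \<kappa>1 (fst p) \<Otimes>\<^sub>M \<kappa>2 (snd p))"
  have Q [measurable]: "Q \<in> N_space \<Otimes>\<^sub>M N_space \<rightarrow>\<^sub>M prob_algebra (S \<Otimes>\<^sub>M S)" unfolding Q_def by measurable
  have Q' [measurable]: "Q \<in> \<pi> \<rightarrow>\<^sub>M subprob_algebra (S \<Otimes>\<^sub>M S)"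
    using measurable_prob_algebraD[OF Q] by (simp add: measurable_cong_sets[OF s\<pi> refl])
  define \<eta> where "\<eta> = \<pi> \<bind> Q"
  have \<eta>: "\<eta> \<in> space (prob_algebra (S \<Otimes>\<^sub>M S))"
  proof -
    have "(\<lambda>_. \<pi> \<bind> Q) \<in> count_space {()} \<rightarrow>\<^sub>M prob_algebra (S \<Otimes>\<^sub>M S)"
      by (rule measurable_bind_prob_space[OF measurable_const[OF \<pi>] Q])
    from measurable_space[OF this, of "()"] show ?thesis by (simp add: \<eta>_def)
  qed
  have s\<eta> [measurable_cong]: "sets \<eta> = sets (S \<Otimes>\<^sub>M S)" using \<eta> by (simp add: space_prob_algebra)
  have nn: "(\<integral>\<^sup>+p. F p \<partial>\<eta>) = (\<integral>\<^sup>+p. (\<integral>\<^sup>+q. F q \<partial>Q p) \<partial>\<pi>)" if [measurable]: "F \<in> borel_measurable (S \<Otimes>\<^sub>M S)" for F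
    unfolding \<eta>_def by (rule nn_integral_bind[OF _ Q']) measurable
  have pf: "(\<integral>\<^sup>+q. F (fst q) \<partial>Q p) = (\<integral>\<^sup>+x. F x \<partial>\<kappa>1 (fst p))"
    and ps: "(\<integral>\<^sup>+q. F (snd q) \<partial>Q p) = (\<integral>\<^sup>+x. F x \<partial>\<kappa>2 (snd p))"
    if [measurable]: "F \<in> borel_measurable S" for F p
  proof -
    interpret K1: prob_space "\<kappa>1 (fst p)" by (rule kp)
    interpret K2: prob_space "\<kappa>2 (snd p)" by (rule kp)
    interpret pair_sigma_finite "\<kappa>1 (fst p)" "\<kappa>2 (snd p)" ..
    show "(\<integral>\<^sup>+q. F (fst q) \<partial>Q p) = (\<integral>\<^sup>+x. F x \<partial>\<kappa>1 (fst p))"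
      unfolding Q_def by (subst K2.nn_integral_fst[symmetric]) (auto simp: K2.emeasure_space_1)
    show "(\<integral>\<^sup>+q. F (snd q) \<partial>Q p) = (\<integral>\<^sup>+x. F x \<partial>\<kappa>2 (snd p))"
      unfolding Q_def by (subst nn_integral_snd[symmetric]) (auto simp: K1.emeasure_space_1)
  qed
  have marg1: "(\<integral>\<^sup>+p. (\<integral>\<^sup>+x. F (x, fst p) \<partial>\<kappa>1 (fst p)) \<partial>\<pi>) = (\<integral>\<^sup>+q. F q \<partial>\<rho>1)"
    if [measurable]: "F \<in> borel_measurable (S \<Otimes>\<^sub>M N_space)" for F
  proof -
    have "(\<integral>\<^sup>+p. (\<integral>\<^sup>+x. F (x, fst p) \<partial>\<kappa>1 (fst p)) \<partial>\<pi>) = (\<integral>\<^sup>+k. (\<integral>\<^sup>+x. F (x, k) \<partial>\<kappa>1 k) \<partial>distr \<pi> N_space fst)"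
      by (rule nn_integral_distr[symmetric]) auto
    also have "\<dots> = (\<integral>\<^sup>+q. F q \<partial>\<rho>1)"
      unfolding m1 \<kappa>1_def by (rule fibre_law_disintegration[OF \<rho>1, symmetric]) measurable
    finally show ?thesis .
  qed
  have marg2: "(\<integral>\<^sup>+p. (\<integral>\<^sup>+x. F (x, snd p) \<partial>\<kappa>2 (snd p)) \<partial>\<pi>) = (\<integral>\<^sup>+q. F q \<partial>\<rho>2)"
    if [measurable]: "F \<in> borel_measurable (S \<Otimes>\<^sub>M N_space)" for F
  proof -
    have "(\<integral>\<^sup>+p. (\<integral>\<^sup>+x. F (x, snd p) \<partial>\<kappa>2 (snd p)) \<partial>\<pi>) = (\<integral>\<^sup>+k. (\<integral>\<^sup>+x. F (x, k) \<partial>\<kappa>2 k) \<partial>distr \<pi> N_space snd)"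
      by (rule nn_integral_distr[symmetric]) auto
    also have "\<dots> = (\<integral>\<^sup>+q. F q \<partial>\<rho>2)"
      unfolding m2 \<kappa>2_def by (rule fibre_law_disintegration[OF \<rho>2, symmetric]) measurable
    finally show ?thesis .
  qed
  show ?thesis
  proof (rule that[OF \<eta>])
    show "distr \<eta> S fst = distr \<rho>1 S fst"
    proof (rule measure_eqI)
      fix A assume "A \<in> sets (distr \<eta> S fst)"
      hence [measurable]: "A \<in> sets S" by simp
      have "emeasure (distr \<eta> S fst) A = (\<integral>\<^sup>+p. indicator A (fst p) \<partial>\<eta>)"
        by (subst nn_integral_indicator[symmetric], simp, subst nn_integral_distr) auto
      also have "\<dots> = (\<integral>\<^sup>+p. (\<integral>\<^sup>+x. indicator A x \<partial>\<kappa>1 (fst p)) \<partial>\<pi>)" by (simp add: nn pf)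
      also have "\<dots> = (\<integral>\<^sup>+q. indicator A (fst q) \<partial>\<rho>1)"
        using marg1[of "\<lambda>q. indicator A (fst q)"] by simp
      also have "\<dots> = emeasure (distr \<rho>1 S fst) A"
        by (subst nn_integral_indicator[symmetric], simp, subst nn_integral_distr) auto
      finally show "emeasure (distr \<eta> S fst) A = emeasure (distr \<rho>1 S fst) A" .
    qed simp
    show "distr \<eta> S snd = distr \<rho>2 S fst"
    proof (rule measure_eqI)
      fix A assume "A \<in> sets (distr \<eta> S snd)"
      hence [measurable]: "A \<in> sets S" by simp
      have "emeasure (distr \<eta> S snd) A = (\<integral>\<^sup>+p. indicator A (snd p) \<partial>\<eta>)"
        by (subst nn_integral_indicator[symmetric], simp, subst nn_integral_distr) auto
      also have "\<dots> = (\<integral>\<^sup>+p. (\<integral>\<^sup>+x. indicator A x \<partial>\<kappa>2 (snd p)) \<partial>\<pi>)" by (simp add: nn ps)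
      also have "\<dots> = (\<integral>\<^sup>+q. indicator A (fst q) \<partial>\<rho>2)"
        using marg2[of "\<lambda>q. indicator A (fst q)"] by simp
      also have "\<dots> = emeasure (distr \<rho>2 S fst) A"
        by (subst nn_integral_indicator[symmetric], simp, subst nn_integral_distr) auto
      finally show "emeasure (distr \<eta> S snd) A = emeasure (distr \<rho>2 S fst) A" .
    qed simp
    have "(\<integral>\<^sup>+p. c p \<partial>\<eta>) = (\<integral>\<^sup>+p. (\<integral>\<^sup>+q. c q \<partial>Q p) \<partial>\<pi>)" by (rule nn) measurable
    also have "\<dots> \<le> (\<integral>\<^sup>+p. (\<integral>\<^sup>+x. a (x, fst p) \<partial>\<kappa>1 (fst p)) + d p + (\<integral>\<^sup>+y. a' (y, snd p) \<partial>\<kappa>2 (snd p)) \<partial>\<pi>)"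
    proof (rule nn_integral_mono)
      fix p
      have Qp: "prob_space (Q p)" "sets (Q p) = sets (S \<Otimes>\<^sub>M S)"
        using measurable_space[OF Q, of p] by (auto simp: space_prob_algebra space_pair_measure)
      have fs: "fst \<in> Q p \<rightarrow>\<^sub>M S" "snd \<in> Q p \<rightarrow>\<^sub>M S"
        by (simp_all add: measurable_cong_sets[OF Qp(2) refl])
      have [measurable]: "(\<lambda>q. a (fst q, fst p)) \<in> borel_measurable (Q p)"
        "(\<lambda>q. a' (snd q, snd p)) \<in> borel_measurable (Q p)"
        by (rule measurable_compose[OF measurable_Pair[OF fs(1) measurable_const] a]
            measurable_compose[OF measurable_Pair[OF fs(2) measurable_const] a'], simp)+
      have "(\<integral>\<^sup>+q. c q \<partial>Q p) \<le> (\<integral>\<^sup>+q. a (fst q, fst p) + d p + a' (snd q, snd p) \<partial>Q p)"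
      proof (rule nn_integral_mono)
        fix q assume "q \<in> space (Q p)"
        hence "q \<in> space (S \<Otimes>\<^sub>M S)" using sets_eq_imp_space_eq[OF Qp(2)] by simp
        thus "c q \<le> a (fst q, fst p) + d p + a' (snd q, snd p)"
          using le[of "fst q" "snd q" "fst p" "snd p"] by (auto simp: space_pair_measure)
      qed
      also have "\<dots> = (\<integral>\<^sup>+q. a (fst q, fst p) \<partial>Q p) + d p + (\<integral>\<^sup>+q. a' (snd q, snd p) \<partial>Q p)"
        using prob_space.emeasure_space_1[OF Qp(1)] by (simp add: nn_integral_add)
      also have "(\<integral>\<^sup>+q. a (fst q, fst p) \<partial>Q p) = (\<integral>\<^sup>+x. a (x, fst p) \<partial>\<kappa>1 (fst p))"
        by (rule pf[of "\<lambda>x. a (x, fst p)"]) measurable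
      also have "(\<integral>\<^sup>+q. a' (snd q, snd p) \<partial>Q p) = (\<integral>\<^sup>+x. a' (x, snd p) \<partial>\<kappa>2 (snd p))"
        by (rule ps[of "\<lambda>x. a' (x, snd p)"]) measurable
      finally show "(\<integral>\<^sup>+q. c q \<partial>Q p) \<le> (\<integral>\<^sup>+x. a (x, fst p) \<partial>\<kappa>1 (fst p)) + d p + (\<integral>\<^sup>+y. a' (y, snd p) \<partial>\<kappa>2 (snd p))" .
    qed
    also have "\<dots> = (\<integral>\<^sup>+p. (\<integral>\<^sup>+x. a (x, fst p) \<partial>\<kappa>1 (fst p)) \<partial>\<pi>) + (\<integral>\<^sup>+p. d p \<partial>\<pi>)
        + (\<integral>\<^sup>+p. (\<integral>\<^sup>+y. a' (y, snd p) \<partial>\<kappa>2 (snd p)) \<partial>\<pi>)"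
    proof -
      have all: "F \<in> borel_measurable \<pi>" for F :: "nat \<times> nat \<Rightarrow> ennreal"
        by (simp add: measurable_def s\<pi> sN)
      show ?thesis by (simp add: nn_integral_add all)
    qed
    also have "\<dots> = (\<integral>\<^sup>+p. a p \<partial>\<rho>1) + (\<integral>\<^sup>+p. d p \<partial>\<pi>) + (\<integral>\<^sup>+p. a' p \<partial>\<rho>2)" by (simp add: marg1 marg2)
    finally show "(\<integral>\<^sup>+p. c p \<partial>\<eta>) \<le> (\<integral>\<^sup>+p. a p \<partial>\<rho>1) + (\<integral>\<^sup>+p. d p \<partial>\<pi>) + (\<integral>\<^sup>+p. a' p \<partial>\<rho>2)" .
  qed
qed

text \<open>There are countably many configurations with entries in a countable dense set, and
  taking the least index of one within \<epsilon> makes the rounding measurable. The rounded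
  positions are the discrete variable through which couplings are glued.\<close>

lemma conf_rounding:
  assumes n: "n \<ge> 1" and \<epsilon>: "\<epsilon> > 0"
  obtains rep :: "nat \<Rightarrow> nat \<Rightarrow> 'a::euclidean_space" and D where
    "\<And>k. rep k \<in> space (conf n)" "D \<in> conf n \<rightarrow>\<^sub>M N_space"
    "\<And>z. z \<in> space (conf n) \<Longrightarrow> l1_dist n z (rep (D z)) \<le> \<epsilon>"
proof -
  obtain A :: "'a set" where A: "countable A" "\<And>X. open X \<Longrightarrow> X \<noteq> {} \<Longrightarrow> \<exists>d\<in>A. d \<in> X"
    using countable_dense_exists by blast
  define R where "R = {1..n} \<rightarrow>\<^sub>E A"
  have cR: "countable R" unfolding R_def using A(1) by (intro countable_PiE) auto
  have "A \<noteq> {}" using A(2)[of UNIV] by auto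
  hence R0: "R \<noteq> {}" by (auto simp: R_def PiE_eq_empty_iff)
  define rep where "rep = from_nat_into R"
  have repR: "rep k \<in> R" for k unfolding rep_def using R0 by (rule from_nat_into)
  have rep: "rep k \<in> space (conf n)" for k
    using repR[of k] by (auto simp: R_def space_PiM PiE_iff)
  have ex: "\<exists>k. l1_dist n z (rep k) \<le> \<epsilon>" for z :: "nat \<Rightarrow> 'a"
  proof -
    have "\<epsilon> / n > 0" using \<epsilon> n by simp
    hence "\<forall>i\<in>{1..n}. \<exists>d\<in>A. d \<in> ball (z i) (\<epsilon> / n)" by (intro ballI A(2)) auto
    hence "\<forall>i\<in>{1..n}. \<exists>d. d \<in> A \<and> dist (z i) d < \<epsilon> / n" by auto
    from bchoice[OF this] obtain d where d: "\<And>i. i \<in> {1..n} \<Longrightarrow> d i \<in> A" "\<And>i. i \<in> {1..n} \<Longrightarrow> dist (z i) (d i) < \<epsilon> / n"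
      by blast
    have "restrict d {1..n} \<in> R" using d(1) by (auto simp: R_def)
    then obtain k where k: "rep k = restrict d {1..n}"
      unfolding rep_def using from_nat_into_surj[OF cR] by blast
    have "l1_dist n z (rep k) \<le> (\<Sum>i\<in>{1..n}. \<epsilon> / n)"
      unfolding l1_dist_def using d(2) by (intro sum_mono) (auto simp: k dist_norm less_imp_le)
    thus ?thesis using n by auto
  qed
  define D where "D = (\<lambda>z. LEAST k. l1_dist n z (rep k) \<le> \<epsilon>)"
  show ?thesis
  proof (rule that[of rep D])
    show "D \<in> conf n \<rightarrow>\<^sub>M N_space"
      unfolding D_def
    proof (rule measurable_Least)
      fix k
      have [measurable]: "(\<lambda>z. l1_dist n z (rep k)) \<in> borel_measurable (conf n)"
        by (rule l1_dist_measurable) (auto simp: rep)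
      show "Measurable.pred (conf n) (\<lambda>z. l1_dist n z (rep k) \<le> \<epsilon>)" by measurable
    qed
    show "l1_dist n z (rep (D z)) \<le> \<epsilon>" for z unfolding D_def using ex[of z] by (rule LeastI_ex)
  qed (rule rep)
qed

lemma bind_in_prob_algebra:
  "M \<in> space (prob_algebra S) \<Longrightarrow> k \<in> S \<rightarrow>\<^sub>M prob_algebra T \<Longrightarrow> M \<bind> k \<in> space (prob_algebra T)"
  by (simp add: space_prob_algebra[of T] prob_space_bind' sets_bind')

lemma distr_bind_prob:
  assumes M: "M \<in> space (prob_algebra S)" and k: "k \<in> S \<rightarrow>\<^sub>M prob_algebra T" and f: "f \<in> T \<rightarrow>\<^sub>M R"
  shows "distr (M \<bind> k) R f = M \<bind> (\<lambda>x. distr (k x) R f)"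
proof (rule distr_bind[OF _ _ f])
  have sM: "sets M = sets S" and pM: "prob_space M" using M by (auto simp: space_prob_algebra)
  show "k \<in> M \<rightarrow>\<^sub>M subprob_algebra T"
    using measurable_prob_algebraD[OF k] by (simp add: measurable_cong_sets[OF sM refl])
  show "space M \<noteq> {}" using pM by (rule prob_space.not_empty)
qed

lemma nn_integral_bind_prob:
  assumes M: "M \<in> space (prob_algebra S)" and k: "k \<in> S \<rightarrow>\<^sub>M prob_algebra T" and F: "F \<in> borel_measurable T"
  shows "(\<integral>\<^sup>+y. F y \<partial>(M \<bind> k)) = (\<integral>\<^sup>+x. (\<integral>\<^sup>+y. F y \<partial>k x) \<partial>M)"
proof (rule nn_integral_bind[OF F])
  have sM: "sets M = sets S" using M by (auto simp: space_prob_algebra)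
  show "k \<in> M \<rightarrow>\<^sub>M subprob_algebra T"
    using measurable_prob_algebraD[OF k] by (simp add: measurable_cong_sets[OF sM refl])
qed

lemma ennreal_le_mult_INF:
  assumes c: "c > 0" and le: "\<And>i. i \<in> I \<Longrightarrow> W \<le> ennreal c * F i"
  shows "W \<le> ennreal c * (INF i\<in>I. F i)"
proof -
  have cc: "ennreal c * (ennreal (1 / c) * v) = v" for v
    using c by (simp add: mult.assoc[symmetric] ennreal_mult[symmetric])
  have "ennreal (1 / c) * W \<le> (INF i\<in>I. F i)"
  proof (rule INF_greatest)
    fix i assume "i \<in> I"
    have "ennreal (1 / c) * W \<le> ennreal (1 / c) * (ennreal c * F i)" by (intro mult_left_mono le \<open>i \<in> I\<close>) simp
    also have "\<dots> = F i" using c by (simp add: mult.assoc[symmetric] ennreal_mult[symmetric])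
    finally show "ennreal (1 / c) * W \<le> F i" .
  qed
  hence "ennreal c * (ennreal (1 / c) * W) \<le> ennreal c * (INF i\<in>I. F i)" by (intro mult_left_mono) auto
  thus ?thesis by (simp add: cc)
qed

text \<open>f is increasing with slope at most 1, so displacements of the end points may be measured
  in l1, while the middle term keeps the cost and hence the contraction factor.\<close>

lemma (in interacting) cost_triangle: "cost x y \<le> l1_dist n x x' + cost x' y' + l1_dist n y y'"
  unfolding cost_def l1_dist_def sum.distrib[symmetric]
proof (rule sum_mono)
  fix i
  have "norm (x i - y i) \<le> norm (x' i - y' i) + (norm (x i - x' i) + norm (y i - y' i))"
  proof -
    have "x i - y i = (x' i - y' i) + ((x i - x' i) - (y i - y' i))" by simp
    also have "norm \<dots> \<le> norm (x' i - y' i) + norm ((x i - x' i) - (y i - y' i))" by (rule norm_triangle_ineq)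
    finally show ?thesis using norm_triangle_ineq4[of "x i - x' i" "y i - y' i"] by linarith
  qed
  hence "f_fun U (norm (x i - y i)) \<le> f_fun U (norm (x' i - y' i) + (norm (x i - x' i) + norm (y i - y' i)))"
    by (intro f_mono) auto
  also have "\<dots> \<le> f_fun U (norm (x' i - y' i)) + (norm (x i - x' i) + norm (y i - y' i))"
    by (intro f_subadditive) auto
  finally show "f_fun U (norm (x i - y i)) \<le> norm (x i - x' i) + f_fun U (norm (x' i - y' i)) + norm (y i - y' i)"
    by simp
qed

section \<open>Transfer of the coupling from the chains to the diffusions\<close>

context driven
begin

definition err :: "nat \<Rightarrow> (nat \<Rightarrow> 'a) \<Rightarrow> ennreal" where
  "err j x = (\<integral>\<^sup>+w. ennreal (l1_dist n (sol x w) (zj j x w)) \<partial>\<Xi>)"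

definition pair_cost :: "nat \<Rightarrow> (nat \<Rightarrow> 'a) \<times> (nat \<Rightarrow> 'a) \<Rightarrow> ennreal" where
  "pair_cost j q = (\<integral>\<^sup>+q'. ennreal (cost (fst q') (snd q')) \<partial>pair_chain j q)"

lemma snd_Xi: "snd \<in> M \<Otimes>\<^sub>M \<Xi> \<rightarrow>\<^sub>M dyadic_space n"
  by (simp add: measurable_cong_sets[OF refl Xi_sets, symmetric])

lemma err_measurable [measurable]: "err j \<in> borel_measurable (conf n)"
proof -
  have [measurable]: "(\<lambda>p. sol (fst p) (snd p)) \<in> conf n \<Otimes>\<^sub>M \<Xi> \<rightarrow>\<^sub>M conf n"
    "(\<lambda>p. zj j (fst p) (snd p)) \<in> conf n \<Otimes>\<^sub>M \<Xi> \<rightarrow>\<^sub>M conf n"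
    by (rule sol_measurable[OF measurable_fst snd_Xi] zj_measurable[OF measurable_fst snd_Xi])+
  show ?thesis
    unfolding err_def[abs_def] by (rule Xi.borel_measurable_nn_integral) (simp add: case_prod_beta)
qed

lemma pair_cost_measurable [measurable]: "pair_cost j \<in> borel_measurable (conf2 n)"
  unfolding pair_cost_def[abs_def]
  by (rule nn_integral_measurable_subprob_algebra2[OF _ measurable_prob_algebraD[OF pair_chain_measurable]])
    (simp add: case_prod_beta)

definition good :: "real \<Rightarrow> nat \<Rightarrow> (nat \<Rightarrow> 'a) \<times> (nat \<Rightarrow> 'a) \<Rightarrow> bool" where
  "good \<epsilon> j q \<longleftrightarrow> err j (fst q) \<le> ennreal \<epsilon> \<and> err j (snd q) \<le> ennreal \<epsilon> \<and>
     pair_cost j q \<le> ennreal (exp (exponent * t) * cost (fst q) (snd q) + \<epsilon>)"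

text \<open>How fine the mesh must be depends on the starting pair, without uniformity. The least
  good level is a measurable function with countable range, so kernels chosen level by level fit
  together measurably.\<close>

definition level :: "real \<Rightarrow> (nat \<Rightarrow> 'a) \<times> (nat \<Rightarrow> 'a) \<Rightarrow> nat" where
  "level \<epsilon> q = (LEAST j. good \<epsilon> j q)"

lemma good_level:
  assumes q: "q \<in> space (conf2 n)" and \<epsilon>: "\<epsilon> > 0"
  shows "good \<epsilon> (level \<epsilon> q) q"
proof -
  have xy: "fst q \<in> space (conf n)" "snd q \<in> space (conf n)" using q by (auto simp: space_pair_measure)
  have e: "\<forall>\<^sub>F j in sequentially. err j x \<le> ennreal \<epsilon>" if "x \<in> space (conf n)" for x
    using order_tendstoD(2)[OF zj_sol_tendsto[OF that], of "ennreal \<epsilon>"] \<epsilon>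
    by (auto simp: err_def elim: eventually_mono)
  have "\<forall>\<^sub>F j in sequentially. good \<epsilon> j q"
    using e[OF xy(1)] e[OF xy(2)] pair_chain_full_cost[OF xy \<epsilon>]
    by eventually_elim (simp add: good_def pair_cost_def)
  hence "\<exists>j. good \<epsilon> j q" by (auto simp: eventually_sequentially)
  thus ?thesis unfolding level_def by (rule LeastI_ex)
qed

lemma level_measurable [measurable]: "level \<epsilon> \<in> conf2 n \<rightarrow>\<^sub>M N_space"
  unfolding level_def[abs_def] good_def by (rule measurable_Least) measurable

text \<open>For each starting pair, the joint laws of solution and rounded chain end point have the
  same discrete marginals as the rounded coupled chain. Integrating over the initial coupling and
  gluing gives a coupling of the solutions, with total error 2 \<epsilon> + 3 \<epsilon> + 2
  \<epsilon>.\<close>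

lemma coupling_of_transitions:
  assumes pm: "p \<in> conf n \<rightarrow>\<^sub>M prob_algebra (conf n)" and \<eta>: "\<eta> \<in> space (prob_algebra (conf2 n))" and \<epsilon>: "\<epsilon> > 0"
  obtains \<eta>' where "\<eta>' \<in> space (prob_algebra (conf2 n))"
    "distr \<eta>' (conf n) fst = distr \<eta> (conf n) fst \<bind> p" "distr \<eta>' (conf n) snd = distr \<eta> (conf n) snd \<bind> p"
    "(\<integral>\<^sup>+q. ennreal (cost (fst q) (snd q)) \<partial>\<eta>')
       \<le> ennreal (exp (exponent * t)) * (\<integral>\<^sup>+q. ennreal (cost (fst q) (snd q)) \<partial>\<eta>) + ennreal (7 * \<epsilon>)"
proof -
  obtain rep :: "nat \<Rightarrow> nat \<Rightarrow> 'a" and D where rep: "\<And>k. rep k \<in> space (conf n)"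
    and D [measurable]: "D \<in> conf n \<rightarrow>\<^sub>M N_space"
    and Drep: "\<And>z. z \<in> space (conf n) \<Longrightarrow> l1_dist n z (rep (D z)) \<le> \<epsilon>"
    using conf_rounding[OF n_pos \<epsilon>] by blast
  interpret \<eta>: prob_space \<eta> using \<eta> by (simp add: space_prob_algebra)
  have s\<eta> [measurable_cong]: "sets \<eta> = sets (conf2 n)" using \<eta> by (simp add: space_prob_algebra)
  have sp\<eta>: "space \<eta> = space (conf2 n)" using s\<eta> by (rule sets_eq_imp_space_eq)
  have fs: "fst q \<in> space (conf n)" "snd q \<in> space (conf n)" if "q \<in> space (conf2 n)" for q
    using that by (auto simp: space_pair_measure)
  define k where "k = (\<lambda>(s :: (nat \<Rightarrow> 'a) \<times> (nat \<Rightarrow> 'a) \<Rightarrow> (nat \<Rightarrow> 'a)) j q. distr \<Xi> (conf n \<Otimes>\<^sub>M N_space) (\<lambda>w. (sol (s q) w, D (zj j (s q) w))))"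
  define k\<pi> where "k\<pi> = (\<lambda>j q. distr (pair_chain j q) (N_space \<Otimes>\<^sub>M N_space) (\<lambda>q'. (D (fst q'), D (snd q'))))"
  have Xi_alg: "\<Xi> \<in> space (prob_algebra \<Xi>)" by (simp add: space_prob_algebra Xi_prob)
  have km: "(\<lambda>q. k s (level \<epsilon> q) q) \<in> conf2 n \<rightarrow>\<^sub>M prob_algebra (conf n \<Otimes>\<^sub>M N_space)"
    if s [measurable]: "s \<in> conf2 n \<rightarrow>\<^sub>M conf n" for s
  proof (rule measurable_compose_countable[OF _ level_measurable])
    fix j
    have [measurable]: "(\<lambda>x. sol (s (fst x)) (snd x)) \<in> conf2 n \<Otimes>\<^sub>M \<Xi> \<rightarrow>\<^sub>M conf n"
      "(\<lambda>x. zj j (s (fst x)) (snd x)) \<in> conf2 n \<Otimes>\<^sub>M \<Xi> \<rightarrow>\<^sub>M conf n"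
      by (rule sol_measurable[OF measurable_compose[OF measurable_fst s] snd_Xi]
          zj_measurable[OF measurable_compose[OF measurable_fst s] snd_Xi])+
    show "k s j \<in> conf2 n \<rightarrow>\<^sub>M prob_algebra (conf n \<Otimes>\<^sub>M N_space)"
      unfolding k_def
      by (rule measurable_distr_prob_space2[where M=\<Xi>, OF measurable_const[OF Xi_alg]]) (simp add: case_prod_beta)
  qed
  have k\<pi>m: "(\<lambda>q. k\<pi> (level \<epsilon> q) q) \<in> conf2 n \<rightarrow>\<^sub>M prob_algebra (N_space \<Otimes>\<^sub>M N_space)"
  proof (rule measurable_compose_countable[OF _ level_measurable])
    fix j
    show "k\<pi> j \<in> conf2 n \<rightarrow>\<^sub>M prob_algebra (N_space \<Otimes>\<^sub>M N_space)"
      unfolding k\<pi>_def by (rule measurable_distr_prob_space2[OF pair_chain_measurable]) (simp add: case_prod_beta)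
  qed
  define \<rho> where "\<rho> = (\<lambda>s. \<eta> \<bind> (\<lambda>q. k s (level \<epsilon> q) q))"
  define \<pi> where "\<pi> = \<eta> \<bind> (\<lambda>q. k\<pi> (level \<epsilon> q) q)"
  have \<rho>: "\<rho> s \<in> space (prob_algebra (conf n \<Otimes>\<^sub>M N_space))" if "s \<in> conf2 n \<rightarrow>\<^sub>M conf n" for s
    unfolding \<rho>_def by (rule bind_in_prob_algebra[OF \<eta> km[OF that]])
  have \<pi>: "\<pi> \<in> space (prob_algebra (N_space \<Otimes>\<^sub>M N_space))"
    unfolding \<pi>_def by (rule bind_in_prob_algebra[OF \<eta> k\<pi>m])
  have kfun: "(\<lambda>w. (sol x w, D (zj j x w))) \<in> \<Xi> \<rightarrow>\<^sub>M conf n \<Otimes>\<^sub>M N_space" if x: "x \<in> space (conf n)" for x j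
    using sol_meas[OF x] measurable_compose[OF zj_meas[OF x] D] by (rule measurable_Pair)
  have \<rho>_fst: "distr (\<rho> s) (conf n) fst = distr \<eta> (conf n) s \<bind> p" if s [measurable]: "s \<in> conf2 n \<rightarrow>\<^sub>M conf n" for s
  proof -
    have "distr (\<rho> s) (conf n) fst = \<eta> \<bind> (\<lambda>q. distr (k s (level \<epsilon> q) q) (conf n) fst)"
      unfolding \<rho>_def by (rule distr_bind_prob[OF \<eta> km[OF s]]) measurable
    also have "\<dots> = \<eta> \<bind> (\<lambda>q. p (s q))"
    proof (rule bind_cong[OF refl])
      fix q assume "q \<in> space \<eta>"
      hence sq: "s q \<in> space (conf n)" using measurable_space[OF s] by (simp add: sp\<eta>)
      show "distr (k s (level \<epsilon> q) q) (conf n) fst = p (s q)"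
        unfolding k_def by (subst distr_distr[OF measurable_fst kfun[OF sq]]) (simp add: comp_def sol_law[OF sq])
    qed
    also have "\<dots> = distr \<eta> (conf n) s \<bind> p"
      by (rule bind_distr[symmetric, OF _ measurable_prob_algebraD[OF pm] \<eta>.not_empty]) measurable
    finally show ?thesis .
  qed
  \<comment> \<open>Both sides come from the law of \<open>chain\<close>: on the noise space it is
    the law of \<open>zj\<close>, and it is a marginal of the coupled chain.\<close>
  have marg: "distr \<pi> N_space s = distr (\<rho> s') N_space snd"
    if s: "(s = fst \<and> s' = fst) \<or> (s = snd \<and> s' = snd)"
    for s :: "nat \<times> nat \<Rightarrow> nat" and s' :: "(nat \<Rightarrow> 'a) \<times> (nat \<Rightarrow> 'a) \<Rightarrow> (nat \<Rightarrow> 'a)"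
  proof -
    have s' [measurable]: "s' \<in> conf2 n \<rightarrow>\<^sub>M conf n" and s'' [measurable]: "s \<in> N_space \<Otimes>\<^sub>M N_space \<rightarrow>\<^sub>M N_space"
      using s by auto
    have "distr (\<rho> s') N_space snd = \<eta> \<bind> (\<lambda>q. distr (k s' (level \<epsilon> q) q) N_space snd)"
      unfolding \<rho>_def by (rule distr_bind_prob[OF \<eta> km[OF s']]) measurable
    also have "\<dots> = \<eta> \<bind> (\<lambda>q. distr (k\<pi> (level \<epsilon> q) q) N_space s)"
    proof (rule bind_cong[OF refl])
      fix q assume "q \<in> space \<eta>"
      hence q: "q \<in> space (conf2 n)" by (simp add: sp\<eta>)
      hence sq: "s' q \<in> space (conf n)" using measurable_space[OF s'] by simp
      define j where "j = level \<epsilon> q"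
      have spc: "sets (pair_chain j q) = sets (conf2 n)" using kernel_space[OF pair_chain_measurable q] by simp
      have s'c: "s' \<in> pair_chain j q \<rightarrow>\<^sub>M conf n" by (simp add: measurable_cong_sets[OF spc refl])
      have Dc: "(\<lambda>q'. (D (fst q'), D (snd q'))) \<in> pair_chain j q \<rightarrow>\<^sub>M N_space \<Otimes>\<^sub>M N_space"
        by (simp add: measurable_cong_sets[OF spc refl])
      have "distr (k s' j q) N_space snd = distr \<Xi> N_space (D \<circ> zj j (s' q))"
        unfolding k_def by (subst distr_distr[OF measurable_snd kfun[OF sq]]) (simp add: comp_def)
      also have "\<dots> = distr (chain j (s' q)) N_space D"
        by (subst distr_distr[OF D zj_meas[OF sq], symmetric]) (simp add: zj_law[OF sq])
      also have "chain j (s' q) = distr (pair_chain j q) (conf n) s'"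
        using s pair_chain_marginals[OF q] by auto
      also have "distr (distr (pair_chain j q) (conf n) s') N_space D = distr (pair_chain j q) N_space (D \<circ> s')"
        by (rule distr_distr[OF D s'c])
      also have "\<dots> = distr (k\<pi> j q) N_space s"
        unfolding k\<pi>_def by (subst distr_distr[OF s'' Dc]) (use s in \<open>auto simp: comp_def\<close>)
      finally show "distr (k s' (level \<epsilon> q) q) N_space snd = distr (k\<pi> (level \<epsilon> q) q) N_space s"
        by (simp add: j_def)
    qed
    also have "\<dots> = distr \<pi> N_space s"
      unfolding \<pi>_def by (rule distr_bind_prob[OF \<eta> k\<pi>m, symmetric]) measurable
    finally show ?thesis by simp
  qed
  define a where "a = (\<lambda>p. ennreal (l1_dist n (fst p) (rep (snd p))))"
  define d where "d = (\<lambda>p. ennreal (cost (rep (fst p)) (rep (snd p))))"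
  have am [measurable]: "a \<in> borel_measurable (conf n \<Otimes>\<^sub>M N_space)"
  proof -
    have "(\<lambda>p. l1_dist n (fst p) (rep (snd p))) \<in> borel_measurable (conf n \<Otimes>\<^sub>M N_space)"
    proof (rule measurable_compose_countable[where f="\<lambda>k p. l1_dist n (fst p) (rep k)" and g=snd])
      show "(\<lambda>p. l1_dist n (fst p) (rep k)) \<in> borel_measurable (conf n \<Otimes>\<^sub>M N_space)" for k
        by (rule l1_dist_measurable[OF measurable_fst measurable_const[OF rep]])
    qed measurable
    thus ?thesis unfolding a_def by measurable
  qed
  have dm: "d \<in> borel_measurable (N_space \<Otimes>\<^sub>M N_space)"
  proof -
    have "sets (N_space \<Otimes>\<^sub>M N_space) = UNIV" by (subst sets_pair_countable[of UNIV UNIV]) auto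
    thus ?thesis by (simp add: measurable_def)
  qed
  obtain \<eta>' where \<eta>': "\<eta>' \<in> space (prob_algebra (conf2 n))"
    "distr \<eta>' (conf n) fst = distr (\<rho> fst) (conf n) fst" "distr \<eta>' (conf n) snd = distr (\<rho> snd) (conf n) fst"
    and c: "(\<integral>\<^sup>+q. ennreal (cost (fst q) (snd q)) \<partial>\<eta>') \<le> (\<integral>\<^sup>+p. a p \<partial>\<rho> fst) + (\<integral>\<^sup>+p. d p \<partial>\<pi>) + (\<integral>\<^sup>+p. a p \<partial>\<rho> snd)"
  proof (rule glue_couplings[where c="\<lambda>q. ennreal (cost (fst q) (snd q))" and a=a and a'=a and d=d])
    show "\<rho> fst \<in> space (prob_algebra (conf n \<Otimes>\<^sub>M N_space))" "\<rho> snd \<in> space (prob_algebra (conf n \<Otimes>\<^sub>M N_space))"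
      by (rule \<rho>, measurable)+
    show "distr \<pi> N_space fst = distr (\<rho> fst) N_space snd" "distr \<pi> N_space snd = distr (\<rho> snd) N_space snd"
      by (rule marg, simp)+
    show "ennreal (cost (fst (x, y)) (snd (x, y))) \<le> a (x, k) + d (k, l) + a (y, l)" for x y k l
    proof -
      have "ennreal (cost x y) \<le> ennreal (l1_dist n x (rep k) + cost (rep k) (rep l) + l1_dist n y (rep l))"
        by (intro ennreal_leI cost_triangle)
      thus ?thesis by (simp add: a_def d_def)
    qed
  qed (use \<pi> in measurable)
  \<comment> \<open>One \<epsilon> for the distance between solution and chain at the chosen level,
    one for the rounding.\<close>
  have a_le: "(\<integral>\<^sup>+p. a p \<partial>\<rho> s) \<le> ennreal (2 * \<epsilon>)"
    if s: "s = fst \<or> s = snd" for s :: "(nat \<Rightarrow> 'a) \<times> (nat \<Rightarrow> 'a) \<Rightarrow> (nat \<Rightarrow> 'a)"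
  proof -
    have sm [measurable]: "s \<in> conf2 n \<rightarrow>\<^sub>M conf n" using s by auto
    have "(\<integral>\<^sup>+p. a p \<partial>\<rho> s) = (\<integral>\<^sup>+q. (\<integral>\<^sup>+p. a p \<partial>k s (level \<epsilon> q) q) \<partial>\<eta>)"
      unfolding \<rho>_def by (rule nn_integral_bind_prob[OF \<eta> km[OF sm] am])
    also have "\<dots> \<le> (\<integral>\<^sup>+q. ennreal (2 * \<epsilon>) \<partial>\<eta>)"
    proof (rule nn_integral_mono)
      fix q assume "q \<in> space \<eta>"
      hence q: "q \<in> space (conf2 n)" by (simp add: sp\<eta>)
      define j where "j = level \<epsilon> q"
      have sq: "s q \<in> space (conf n)" using measurable_space[OF sm q] .
      note [measurable] = sol_meas[OF sq] zj_meas[OF sq]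
      have "(\<integral>\<^sup>+p. a p \<partial>k s j q) = (\<integral>\<^sup>+w. a (sol (s q) w, D (zj j (s q) w)) \<partial>\<Xi>)"
        unfolding k_def by (rule nn_integral_distr[OF kfun[OF sq]]) (simp add: am)
      also have "\<dots> \<le> (\<integral>\<^sup>+w. ennreal (l1_dist n (sol (s q) w) (zj j (s q) w)) + ennreal \<epsilon> \<partial>\<Xi>)"
      proof (rule nn_integral_mono)
        fix w assume "w \<in> space \<Xi>"
        hence zw: "zj j (s q) w \<in> space (conf n)" using measurable_space[OF zj_meas[OF sq]] by blast
        have "l1_dist n (sol (s q) w) (rep (D (zj j (s q) w))) \<le> l1_dist n (sol (s q) w) (zj j (s q) w) + \<epsilon>"
          using l1_dist_triangle[of n "sol (s q) w" "rep (D (zj j (s q) w))" "zj j (s q) w"] Drep[OF zw] by linarith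
        hence "a (sol (s q) w, D (zj j (s q) w)) \<le> ennreal (l1_dist n (sol (s q) w) (zj j (s q) w) + \<epsilon>)"
          by (simp add: a_def ennreal_leI)
        also have "\<dots> = ennreal (l1_dist n (sol (s q) w) (zj j (s q) w)) + ennreal \<epsilon>"
          using \<epsilon> l1_dist_nonneg by (intro ennreal_plus) auto
        finally show "a (sol (s q) w, D (zj j (s q) w)) \<le> \<dots>" .
      qed
      also have "\<dots> = err j (s q) + ennreal \<epsilon>"
        by (subst nn_integral_add) (auto simp: err_def Xi.emeasure_space_1)
      also have "\<dots> \<le> ennreal \<epsilon> + ennreal \<epsilon>"
        using good_level[OF q \<epsilon>] s by (intro add_mono) (auto simp: good_def j_def)
      also have "\<dots> = ennreal (2 * \<epsilon>)" using \<epsilon> by (simp flip: ennreal_plus)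
      finally show "(\<integral>\<^sup>+p. a p \<partial>k s (level \<epsilon> q) q) \<le> ennreal (2 * \<epsilon>)" by (simp add: j_def)
    qed
    also have "\<dots> = ennreal (2 * \<epsilon>)" by (simp add: \<eta>.emeasure_space_1)
    finally show ?thesis .
  qed
  have costm [measurable]: "(\<lambda>q. ennreal (cost (fst q) (snd q))) \<in> borel_measurable (conf2 n)" by measurable
  \<comment> \<open>Both end points are rounded, and the cost estimate at the chosen level allows
    another \<epsilon>.\<close>
  have d_le: "(\<integral>\<^sup>+p. d p \<partial>\<pi>) \<le> ennreal (exp (exponent * t)) * (\<integral>\<^sup>+q. ennreal (cost (fst q) (snd q)) \<partial>\<eta>) + ennreal (3 * \<epsilon>)"
  proof -
    have "(\<integral>\<^sup>+p. d p \<partial>\<pi>) = (\<integral>\<^sup>+q. (\<integral>\<^sup>+p. d p \<partial>k\<pi> (level \<epsilon> q) q) \<partial>\<eta>)"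
      unfolding \<pi>_def by (rule nn_integral_bind_prob[OF \<eta> k\<pi>m dm])
    also have "\<dots> \<le> (\<integral>\<^sup>+q. ennreal (exp (exponent * t)) * ennreal (cost (fst q) (snd q)) + ennreal (3 * \<epsilon>) \<partial>\<eta>)"
    proof (rule nn_integral_mono)
      fix q assume "q \<in> space \<eta>"
      hence q: "q \<in> space (conf2 n)" by (simp add: sp\<eta>)
      define j where "j = level \<epsilon> q"
      have pc: "prob_space (pair_chain j q)" "sets (pair_chain j q) = sets (conf2 n)" "space (pair_chain j q) = space (conf2 n)"
        using kernel_space[OF pair_chain_measurable q] by auto
      have Dc: "(\<lambda>q'. (D (fst q'), D (snd q'))) \<in> pair_chain j q \<rightarrow>\<^sub>M N_space \<Otimes>\<^sub>M N_space"
        by (simp add: measurable_cong_sets[OF pc(2) refl])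
      have cm: "(\<lambda>q'. ennreal (cost (fst q') (snd q'))) \<in> borel_measurable (pair_chain j q)"
        using costm by (simp add: measurable_cong_sets[OF pc(2) refl])
      have "(\<integral>\<^sup>+p. d p \<partial>k\<pi> j q) = (\<integral>\<^sup>+q'. d (D (fst q'), D (snd q')) \<partial>pair_chain j q)"
        unfolding k\<pi>_def by (rule nn_integral_distr[OF Dc]) (simp add: dm)
      also have "\<dots> \<le> (\<integral>\<^sup>+q'. ennreal (cost (fst q') (snd q')) + ennreal (2 * \<epsilon>) \<partial>pair_chain j q)"
      proof (rule nn_integral_mono)
        fix q' assume "q' \<in> space (pair_chain j q)"
        hence z: "fst q' \<in> space (conf n)" "snd q' \<in> space (conf n)" using fs[of q'] by (simp_all add: pc(3))
        have "cost (rep (D (fst q'))) (rep (D (snd q'))) \<le> cost (fst q') (snd q') + 2 * \<epsilon>"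
          using cost_triangle[of "rep (D (fst q'))" "rep (D (snd q'))" "fst q'" "snd q'"] Drep[OF z(1)] Drep[OF z(2)]
          by (simp add: l1_dist_sym)
        hence "d (D (fst q'), D (snd q')) \<le> ennreal (cost (fst q') (snd q') + 2 * \<epsilon>)" by (simp add: d_def ennreal_leI)
        also have "\<dots> = ennreal (cost (fst q') (snd q')) + ennreal (2 * \<epsilon>)"
          using \<epsilon> cost_nonneg by (intro ennreal_plus) auto
        finally show "d (D (fst q'), D (snd q')) \<le> \<dots>" .
      qed
      also have "\<dots> = pair_cost j q + ennreal (2 * \<epsilon>)"
        using prob_space.emeasure_space_1[OF pc(1)] by (subst nn_integral_add[OF cm]) (auto simp: pair_cost_def)
      also have "\<dots> \<le> ennreal (exp (exponent * t) * cost (fst q) (snd q) + \<epsilon>) + ennreal (2 * \<epsilon>)"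
        using good_level[OF q \<epsilon>] by (intro add_mono) (auto simp: good_def j_def)
      also have "\<dots> = ennreal (exp (exponent * t) * cost (fst q) (snd q) + 3 * \<epsilon>)"
        using \<epsilon> cost_nonneg by (simp flip: ennreal_plus)
      also have "\<dots> = ennreal (exp (exponent * t)) * ennreal (cost (fst q) (snd q)) + ennreal (3 * \<epsilon>)"
        using \<epsilon> cost_nonneg by (simp add: ennreal_plus ennreal_mult)
      finally show "(\<integral>\<^sup>+p. d p \<partial>k\<pi> (level \<epsilon> q) q) \<le> \<dots>" by (simp add: j_def)
    qed
    also have "\<dots> = ennreal (exp (exponent * t)) * (\<integral>\<^sup>+q. ennreal (cost (fst q) (snd q)) \<partial>\<eta>) + ennreal (3 * \<epsilon>)"
    proof -
      have [measurable]: "(\<lambda>q. ennreal (cost (fst q) (snd q))) \<in> borel_measurable \<eta>"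
        using costm by (simp add: measurable_cong_sets[OF s\<eta> refl])
      show ?thesis by (subst nn_integral_add) (auto simp: nn_integral_cmult \<eta>.emeasure_space_1)
    qed
    finally show ?thesis .
  qed
  show ?thesis
  proof (rule that[OF \<eta>'(1)])
    show "distr \<eta>' (conf n) fst = distr \<eta> (conf n) fst \<bind> p" by (simp add: \<eta>'(2) \<rho>_fst)
    show "distr \<eta>' (conf n) snd = distr \<eta> (conf n) snd \<bind> p" by (simp add: \<eta>'(3) \<rho>_fst)
    have "(\<integral>\<^sup>+q. ennreal (cost (fst q) (snd q)) \<partial>\<eta>') \<le> ennreal (2 * \<epsilon>)
        + (ennreal (exp (exponent * t)) * (\<integral>\<^sup>+q. ennreal (cost (fst q) (snd q)) \<partial>\<eta>) + ennreal (3 * \<epsilon>)) + ennreal (2 * \<epsilon>)"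
      by (rule order_trans[OF c]) (intro add_mono a_le d_le; simp)
    also have "\<dots> = ennreal (exp (exponent * t)) * (\<integral>\<^sup>+q. ennreal (cost (fst q) (snd q)) \<partial>\<eta>)
        + (ennreal (2 * \<epsilon>) + ennreal (3 * \<epsilon>) + ennreal (2 * \<epsilon>))"
      by (simp add: ac_simps)
    also have "ennreal (2 * \<epsilon>) + ennreal (3 * \<epsilon>) + ennreal (2 * \<epsilon>) = ennreal (7 * \<epsilon>)"
      using \<epsilon> by (simp flip: ennreal_plus)
    finally show "(\<integral>\<^sup>+q. ennreal (cost (fst q) (snd q)) \<partial>\<eta>')
       \<le> ennreal (exp (exponent * t)) * (\<integral>\<^sup>+q. ennreal (cost (fst q) (snd q)) \<partial>\<eta>) + ennreal (7 * \<epsilon>)" .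
  qed
qed

end

section \<open>The contraction estimate\<close>

text \<open>A residue class modulo n meets {1..n} at most once, so each congruence contributes at
  most half of |\<alpha>|. For n \<le> 2 the two congruences coincide; bounding an entry by the sum
  of two indicators covers this without a case distinction.\<close>

lemma nearest_neighbour_row:
  assumes i: "i \<in> {1..n}"
  shows "(\<Sum>j\<in>{1..n}. \<bar>nearest_neighbour n \<alpha> i j\<bar>) \<le> \<bar>\<alpha>\<bar>"
    and "(\<Sum>j\<in>{1..n}. \<bar>nearest_neighbour n \<alpha> j i\<bar>) \<le> \<bar>\<alpha>\<bar>"
proof -
  have one: "(\<Sum>j\<in>{1..n}. if [int j = s] (mod int n) then \<bar>\<alpha>\<bar> / 2 else 0) \<le> \<bar>\<alpha>\<bar> / 2" for s
  proof -
    have "card {j \<in> {1..n}. [int j = s] (mod int n)} \<le> 1"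
    proof (rule card_le_Suc0_iff_eq[THEN iffD2, unfolded One_nat_def[symmetric]])
      show "\<forall>j\<in>{j \<in> {1..n}. [int j = s] (mod int n)}. \<forall>k\<in>{j \<in> {1..n}. [int j = s] (mod int n)}. j = k"
      proof (intro ballI)
        fix j k assume jk: "j \<in> {j \<in> {1..n}. [int j = s] (mod int n)}" "k \<in> {j \<in> {1..n}. [int j = s] (mod int n)}"
        hence "[int j = int k] (mod int n)" by (auto intro: cong_trans cong_sym)
        hence "int n dvd int j - int k" by (simp add: cong_iff_dvd_diff)
        moreover have "\<bar>int j - int k\<bar> < int n" using jk by auto
        ultimately show "j = k" using dvd_imp_le_int[of "int j - int k" "int n"] by fastforce
      qed
    qed simp
    hence "real (card {j \<in> {1..n}. [int j = s] (mod int n)}) * (\<bar>\<alpha>\<bar> / 2) \<le> 1 * (\<bar>\<alpha>\<bar> / 2)"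
      by (intro mult_right_mono) auto
    thus ?thesis by (simp add: sum.If_cases Int_def)
  qed
  have le: "\<bar>nearest_neighbour n \<alpha> k l\<bar> \<le> (if [int k - int l = 1] (mod int n) then \<bar>\<alpha>\<bar> / 2 else 0)
      + (if [int k - int l = - 1] (mod int n) then \<bar>\<alpha>\<bar> / 2 else 0)" for k l
    by (simp add: nearest_neighbour_def)
  have c1: "[int k - int l = e] (mod int n) \<longleftrightarrow> [int l = int k - e] (mod int n)" for k l e
    by (simp add: cong_iff_dvd_diff) (metis diff_diff_eq diff_diff_eq2 dvd_minus_iff minus_diff_eq add.commute)
  have c2: "[int k - int l = e] (mod int n) \<longleftrightarrow> [int k = int l + e] (mod int n)" for k l e
    by (simp add: cong_iff_dvd_diff algebra_simps)
  have "(\<Sum>j\<in>{1..n}. \<bar>nearest_neighbour n \<alpha> i j\<bar>) \<le>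
      (\<Sum>j\<in>{1..n}. (if [int i - int j = 1] (mod int n) then \<bar>\<alpha>\<bar> / 2 else 0)
      + (if [int i - int j = - 1] (mod int n) then \<bar>\<alpha>\<bar> / 2 else 0))"
    by (intro sum_mono le)
  also have "\<dots> \<le> \<bar>\<alpha>\<bar> / 2 + \<bar>\<alpha>\<bar> / 2" unfolding sum.distrib c1 by (intro add_mono one)
  finally show "(\<Sum>j\<in>{1..n}. \<bar>nearest_neighbour n \<alpha> i j\<bar>) \<le> \<bar>\<alpha>\<bar>" by simp
  have "(\<Sum>j\<in>{1..n}. \<bar>nearest_neighbour n \<alpha> j i\<bar>) \<le>
      (\<Sum>j\<in>{1..n}. (if [int j - int i = 1] (mod int n) then \<bar>\<alpha>\<bar> / 2 else 0)
      + (if [int j - int i = - 1] (mod int n) then \<bar>\<alpha>\<bar> / 2 else 0))"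
    by (intro sum_mono le)
  also have "\<dots> \<le> \<bar>\<alpha>\<bar> / 2 + \<bar>\<alpha>\<bar> / 2" unfolding sum.distrib c2 by (intro add_mono one)
  finally show "(\<Sum>j\<in>{1..n}. \<bar>nearest_neighbour n \<alpha> j i\<bar>) \<le> \<bar>\<alpha>\<bar>" by simp
qed

text \<open>The approximation by chains needs t > 0, so time 0 is settled from the equation itself:
  the solution starts at x almost surely.\<close>

lemma kernel_time_0:
  assumes p: "transition_kernels n b p" and \<mu>: "\<mu> \<in> space (prob_algebra (conf n))"
  shows "\<mu> \<bind> p 0 = \<mu>"
proof -
  have s\<mu>: "sets \<mu> = sets (conf n)" using \<mu> by (simp add: space_prob_algebra)
  have "p 0 x = return (conf n) x" if x: "x \<in> space (conf n)" for x
  proof -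
    obtain M :: "(real \<Rightarrow> nat \<Rightarrow> 'a) measure" and B :: "nat \<Rightarrow> real \<Rightarrow> (real \<Rightarrow> nat \<Rightarrow> 'a) \<Rightarrow> 'a" and X where
      M: "prob_space M" and B: "independent_brownian_motions M n B" and X: "sde_solution M n b B x X"
      and p0: "p 0 x = distr M (conf n) (X 0)"
      using p x unfolding transition_kernels_def by (meson order_refl)
    have Xm: "X 0 \<in> M \<rightarrow>\<^sub>M conf n" using X by (auto simp: sde_solution_def)
    have "AE \<omega> in M. B i 0 \<omega> = 0" if "i \<in> {1..n}" for i
      using B that unfolding independent_brownian_motions_def brownian_motion_def by blast
    hence "AE \<omega> in M. \<forall>i\<in>{1..n}. B i 0 \<omega> = 0" by (intro AE_finite_allI) auto
    moreover have "AE \<omega> in M. \<forall>i\<in>{1..n}. continuous_on {0..} (\<lambda>t. X t \<omega> i) \<and>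
        (\<forall>t\<ge>0. X t \<omega> i = x i + integral {0..t} (\<lambda>s. b (X s \<omega>) i) + B i t \<omega>)"
      using X unfolding sde_solution_def by blast
    ultimately have "AE \<omega> in M. X 0 \<omega> = x"
      using AE_space
    proof eventually_elim
      case (elim \<omega>)
      have "X 0 \<omega> i = x i" if "i \<in> {1..n}" for i
      proof -
        have "X 0 \<omega> i = x i + integral {0..0} (\<lambda>s. b (X s \<omega>) i) + B i 0 \<omega>" using elim(2) that by blast
        thus ?thesis using elim(1) that by simp
      qed
      moreover have "X 0 \<omega> \<in> extensional {1..n}" "x \<in> extensional {1..n}"
        using measurable_space[OF Xm elim(3)] x by (auto simp: space_PiM PiE_def)
      ultimately show ?case by (intro extensionalityI) auto
    qed
    hence "distr M (conf n) (X 0) = distr M (conf n) (\<lambda>_. x)"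
      by (intro distr_cong_AE) (use Xm x in auto)
    also have "\<dots> = return (conf n) x" by (rule prob_space.distr_const[OF M x])
    finally show ?thesis by (simp add: p0)
  qed
  moreover have "return (conf n) x = return \<mu> x" for x :: "nat \<Rightarrow> 'a"
    by (rule return_cong) (simp add: s\<mu>)
  ultimately have "\<mu> \<bind> p 0 = \<mu> \<bind> return \<mu>"
    by (intro bind_cong refl) (simp add: sets_eq_imp_space_eq[OF s\<mu>])
  thus ?thesis by (simp add: bind_return')
qed

text \<open>\<open>couplings\<close> takes the two measures themselves as base spaces, but the
  product space and the image measures see only their sigma-algebras.\<close>

lemma couplings_iff:
  assumes "\<mu> \<in> space (prob_algebra S)" "\<nu> \<in> space (prob_algebra S)"
  shows "\<eta> \<in> couplings \<mu> \<nu> \<longleftrightarrow> \<eta> \<in> space (prob_algebra (S \<Otimes>\<^sub>M S)) \<and> distr \<eta> S fst = \<mu> \<and> distr \<eta> S snd = \<nu>"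
proof -
  have s: "sets \<mu> = sets S" "sets \<nu> = sets S" using assms by (auto simp: space_prob_algebra)
  have "sets (\<mu> \<Otimes>\<^sub>M \<nu>) = sets (S \<Otimes>\<^sub>M S)" by (rule sets_pair_measure_cong[OF s])
  moreover have "distr \<eta> \<mu> fst = distr \<eta> S fst" "distr \<eta> \<nu> snd = distr \<eta> S snd"
    using s by (auto intro!: distr_cong)
  ultimately show ?thesis by (auto simp: couplings_def space_prob_algebra)
qed

context interacting
begin

lemma kantorovich_f: "W_f1 U n \<mu> \<nu> = (INF \<eta>\<in>couplings \<mu> \<nu>. \<integral>\<^sup>+q. ennreal (cost (fst q) (snd q)) \<partial>\<eta>)"
  by (simp add: W_f1_def kantorovich_def cost_def case_prod_unfold)

lemma kantorovich_l1: "W_l1 n \<mu> \<nu> = (INF \<eta>\<in>couplings \<mu> \<nu>. \<integral>\<^sup>+q. ennreal (l1_dist n (fst q) (snd q)) \<partial>\<eta>)"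
  by (simp add: W_l1_def kantorovich_def l1_dist_def case_prod_unfold)

lemma W_f1_le_W_l1: "W_f1 U n \<mu> \<nu> \<le> W_l1 n \<mu> \<nu>"
  unfolding kantorovich_f kantorovich_l1
  by (rule INF_mono', rule nn_integral_mono, rule ennreal_leI, rule cost_l1(1))

lemma W_l1_le_W_f1:
  assumes "\<mu> \<in> space (prob_algebra (conf n))" "\<nu> \<in> space (prob_algebra (conf n))"
  shows "W_l1 n \<mu> \<nu> \<le> ennreal (1 / df_min) * W_f1 U n \<mu> \<nu>"
  unfolding kantorovich_f
proof (rule ennreal_le_mult_INF)
  show "1 / df_min > 0" using df_min_pos by simp
  fix \<eta> assume \<eta>: "\<eta> \<in> couplings \<mu> \<nu>"
  hence s: "sets \<eta> = sets (conf2 n)" using couplings_iff[OF assms] by (auto simp: space_prob_algebra)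
  have m [measurable]: "(\<lambda>q. ennreal (cost (fst q) (snd q))) \<in> borel_measurable \<eta>"
    using cost_measurable[OF measurable_fst measurable_snd] by (simp add: measurable_cong_sets[OF s refl])
  have "W_l1 n \<mu> \<nu> \<le> (\<integral>\<^sup>+q. ennreal (l1_dist n (fst q) (snd q)) \<partial>\<eta>)"
    unfolding kantorovich_l1 by (rule INF_lower[OF \<eta>])
  also have "\<dots> \<le> (\<integral>\<^sup>+q. ennreal (1 / df_min) * ennreal (cost (fst q) (snd q)) \<partial>\<eta>)"
  proof (rule nn_integral_mono)
    fix q
    have "l1_dist n (fst q) (snd q) \<le> 1 / df_min * cost (fst q) (snd q)"
      using cost_l1(2)[of "fst q" "snd q"] df_min_pos by (simp add: field_simps)
    hence "ennreal (l1_dist n (fst q) (snd q)) \<le> ennreal (1 / df_min * cost (fst q) (snd q))" by (rule ennreal_leI)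
    also have "\<dots> = ennreal (1 / df_min) * ennreal (cost (fst q) (snd q))"
      using df_min_pos by (intro ennreal_mult) auto
    finally show "ennreal (l1_dist n (fst q) (snd q)) \<le> \<dots>" .
  qed
  also have "\<dots> = ennreal (1 / df_min) * (\<integral>\<^sup>+q. ennreal (cost (fst q) (snd q)) \<partial>\<eta>)"
    by (rule nn_integral_cmult) measurable
  finally show "W_l1 n \<mu> \<nu> \<le> \<dots>" .
qed

text \<open>The coupling estimate is applied to an arbitrary initial coupling with an arbitrary
  error, and the infimum is taken at the end, so no optimal coupling has to exist and infinite
  distances are included.\<close>

lemma W_f1_contraction:
  assumes p: "transition_kernels n b p" and t: "t \<ge> 0"
    and \<mu>: "\<mu> \<in> space (prob_algebra (conf n))" and \<nu>: "\<nu> \<in> space (prob_algebra (conf n))"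
  shows "W_f1 U n (\<mu> \<bind> p t) (\<nu> \<bind> p t) \<le> ennreal (exp (exponent * t)) * W_f1 U n \<mu> \<nu>"
proof (cases "t = 0")
  case True
  thus ?thesis using kernel_time_0[OF p] \<mu> \<nu> by simp
next
  case False
  hence t: "t > 0" using t by simp
  have pm: "p t \<in> conf n \<rightarrow>\<^sub>M prob_algebra (conf n)"
    using p t by (auto simp: transition_kernels_def)
  obtain C K \<delta> j0 where "approximation U V \<zeta> \<rho> LV n a \<alpha> t C K \<delta> j0"
  proof (rule good_parameters[OF t])
    fix C K \<delta> j0
    assume "C \<ge> 0" "filterlim K at_top sequentially"
      "\<And>j. j \<ge> j0 \<Longrightarrow> cost_step (real (K j)) (\<delta> j) (1 / (real (K j) + 1)) (t / 2 ^ j)"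
      "\<And>j. j \<ge> j0 \<Longrightarrow> moment_step C (real (K j)) (t / 2 ^ j)"
    note * = this
    show thesis
      by (rule that[of C K \<delta> j0], intro approximation.intro approximation_axioms.intro interacting_axioms t *)
  qed
  then obtain \<Xi> where D: "driven U V \<zeta> \<rho> LV n a \<alpha> t C K \<delta> j0 \<Xi> (p t)"
    using approximation.transition_kernels_driven[OF _ p] by blast
  have \<mu>p: "\<mu> \<bind> p t \<in> space (prob_algebra (conf n))" and \<nu>p: "\<nu> \<bind> p t \<in> space (prob_algebra (conf n))"
    by (rule bind_in_prob_algebra[OF _ pm]; fact)+
  show ?thesis
    unfolding kantorovich_f[of \<mu> \<nu>]
  proof (rule ennreal_le_mult_INF)
    fix \<eta> assume "\<eta> \<in> couplings \<mu> \<nu>"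
    hence \<eta>: "\<eta> \<in> space (prob_algebra (conf2 n))" "distr \<eta> (conf n) fst = \<mu>" "distr \<eta> (conf n) snd = \<nu>"
      using couplings_iff[OF \<mu> \<nu>] by auto
    show "W_f1 U n (\<mu> \<bind> p t) (\<nu> \<bind> p t) \<le> ennreal (exp (exponent * t)) * (\<integral>\<^sup>+q. ennreal (cost (fst q) (snd q)) \<partial>\<eta>)"
    proof (rule ennreal_le_epsilon)
      fix e :: real assume e: "0 < e"
      obtain \<eta>' where \<eta>': "\<eta>' \<in> space (prob_algebra (conf2 n))"
        "distr \<eta>' (conf n) fst = distr \<eta> (conf n) fst \<bind> p t" "distr \<eta>' (conf n) snd = distr \<eta> (conf n) snd \<bind> p t"
        and le: "(\<integral>\<^sup>+q. ennreal (cost (fst q) (snd q)) \<partial>\<eta>')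
          \<le> ennreal (exp (exponent * t)) * (\<integral>\<^sup>+q. ennreal (cost (fst q) (snd q)) \<partial>\<eta>) + ennreal (7 * (e / 7))"
        using driven.coupling_of_transitions[OF D pm \<eta>(1), of "e / 7"] e by auto
      have "\<eta>' \<in> couplings (\<mu> \<bind> p t) (\<nu> \<bind> p t)"
        using \<eta>' \<eta>(2,3) couplings_iff[OF \<mu>p \<nu>p] by simp
      hence "W_f1 U n (\<mu> \<bind> p t) (\<nu> \<bind> p t) \<le> (\<integral>\<^sup>+q. ennreal (cost (fst q) (snd q)) \<partial>\<eta>')"
        unfolding kantorovich_f by (rule INF_lower)
      thus "W_f1 U n (\<mu> \<bind> p t) (\<nu> \<bind> p t)
          \<le> ennreal (exp (exponent * t)) * (\<integral>\<^sup>+q. ennreal (cost (fst q) (snd q)) \<partial>\<eta>) + ennreal e"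
        using le by simp
    qed
  qed simp
qed

end

theorem corollary9:
  fixes U V :: "real ^ 'k \<Rightarrow> real" and z :: "real ^ 'k" and \<rho> :: real
  assumes "C2 U"
    and "strictly_convex_outside U (ball z \<rho>)"
    and "continuous_on {0<..} (kappa U)"
    and "Liminf at_top (\<lambda>r. ereal (kappa U r)) > 0"
    and "((\<lambda>r. r * kappa U r) \<longlongrightarrow> 0) (at_right 0)"
    and "C2 V"
    and "bdd_above (range (\<lambda>x. onorm (hess V x)))"
  shows "\<exists>c \<theta> A :: real. 0 < c \<and> 0 < \<theta> \<and> 0 < A \<and>
    (\<forall>n \<alpha> a p. n \<ge> 1 \<longrightarrow>
       (a = nearest_neighbour n \<alpha> \<or> a = mean_field n \<alpha>) \<longrightarrow>
       transition_kernels n (drift U V a n) p \<longrightarrow>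
       (\<forall>t\<ge>0. \<forall>\<mu>\<in>space (prob_algebra (conf n)). \<forall>\<nu>\<in>space (prob_algebra (conf n)).
          W_f1 U n (\<mu> \<bind> p t) (\<nu> \<bind> p t)
            \<le> ennreal (exp ((\<theta> * \<bar>\<alpha>\<bar> - c) * t)) * W_f1 U n \<mu> \<nu> \<and>
          W_l1 n (\<mu> \<bind> p t) (\<nu> \<bind> p t)
            \<le> ennreal (A * exp ((\<theta> * \<bar>\<alpha>\<bar> - c) * t)) * W_l1 n \<mu> \<nu>) \<and>
       (\<bar>\<alpha>\<bar> < c / \<theta> \<longrightarrow> \<theta> * \<bar>\<alpha>\<bar> - c < 0))"
proof -
  interpret kp: kappa_potential U by (rule kappa_potential.intro) (fact assms)+
  obtain LV where LV: "LV \<ge> 0" "\<And>x y. norm (grad V x - grad V y) \<le> LV * norm (x - y)"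
    using grad_lipschitz[OF assms(6,7)] by metis
  define \<theta> where "\<theta> = 2 * LV / kp.df_min + 1"
  have \<theta>: "\<theta> > 0" using LV(1) kp.df_min_pos by (simp add: \<theta>_def add_nonneg_pos)
  have main: "W_f1 U n (\<mu> \<bind> p t) (\<nu> \<bind> p t) \<le> ennreal (exp ((\<theta> * \<bar>\<alpha>\<bar> - kp.rate) * t)) * W_f1 U n \<mu> \<nu> \<and>
          W_l1 n (\<mu> \<bind> p t) (\<nu> \<bind> p t) \<le> ennreal (1 / kp.df_min * exp ((\<theta> * \<bar>\<alpha>\<bar> - kp.rate) * t)) * W_l1 n \<mu> \<nu>"
    if n: "n \<ge> 1" and a: "a = nearest_neighbour n \<alpha> \<or> a = mean_field n \<alpha>"
      and p: "transition_kernels n (drift U V a n) p" and t: "t \<ge> 0"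
      and \<mu>: "\<mu> \<in> space (prob_algebra (conf n))" and \<nu>: "\<nu> \<in> space (prob_algebra (conf n))"
    for n \<alpha> a p t \<mu> \<nu>
  proof -
    \<comment> \<open>Only the row and column bound by |\<alpha>| depends on the interaction
      pattern. The constants come from \<open>kp\<close> and \<open>LV\<close>, which were fixed
      before n.\<close>
    interpret I: interacting U V z \<rho> LV n a "\<bar>\<alpha>\<bar>"
    proof (intro interacting.intro interacting_axioms.intro kp.kappa_potential_axioms assms LV n)
      show "(\<Sum>j\<in>{1..n}. \<bar>a i j\<bar>) \<le> \<bar>\<alpha>\<bar>" if "i \<in> {1..n}" for i
        using a nearest_neighbour_row(1)[OF that] n by (auto simp: mean_field_def)
      show "(\<Sum>j\<in>{1..n}. \<bar>a j i\<bar>) \<le> \<bar>\<alpha>\<bar>" if "i \<in> {1..n}" for i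
        using a nearest_neighbour_row(2)[OF that] n by (auto simp: mean_field_def)
    qed
    have e: "I.exponent = \<theta> * \<bar>\<alpha>\<bar> - kp.rate" by (simp add: I.exponent_def I.theta_def \<theta>_def)
    have pm: "p t \<in> conf n \<rightarrow>\<^sub>M prob_algebra (conf n)" using p t by (auto simp: transition_kernels_def)
    note f = I.W_f1_contraction[OF p t \<mu> \<nu>, unfolded e]
    \<comment> \<open>\<open>df_min\<close> r \<le> f(r) \<le> r is used once after time t and once
      at time 0; the first use costs the prefactor \<open>1 / kp.df_min\<close>.\<close>
    have "W_l1 n (\<mu> \<bind> p t) (\<nu> \<bind> p t) \<le> ennreal (1 / kp.df_min) * W_f1 U n (\<mu> \<bind> p t) (\<nu> \<bind> p t)"
      by (intro I.W_l1_le_W_f1 bind_in_prob_algebra[OF _ pm] \<mu> \<nu>)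
    also have "\<dots> \<le> ennreal (1 / kp.df_min) * (ennreal (exp ((\<theta> * \<bar>\<alpha>\<bar> - kp.rate) * t)) * W_l1 n \<mu> \<nu>)"
      using f I.W_f1_le_W_l1[of \<mu> \<nu>] by (intro mult_left_mono) (auto elim!: order_trans intro!: mult_left_mono)
    also have "\<dots> = ennreal (1 / kp.df_min * exp ((\<theta> * \<bar>\<alpha>\<bar> - kp.rate) * t)) * W_l1 n \<mu> \<nu>"
      using kp.df_min_pos by (subst ennreal_mult) (auto simp: mult.assoc)
    finally show ?thesis using f by blast
  qed
  show ?thesis
  proof (rule exI[of _ kp.rate], rule exI[of _ \<theta>], rule exI[of _ "1 / kp.df_min"], intro conjI allI impI ballI)
    show "0 < kp.rate" "0 < \<theta>" "0 < 1 / kp.df_min" using kp.rate_pos \<theta> kp.df_min_pos by auto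
    show "\<theta> * \<bar>\<alpha>\<bar> - kp.rate < 0" if "\<bar>\<alpha>\<bar> < kp.rate / \<theta>" for \<alpha>
      using that \<theta> by (simp add: field_simps)
  qed (use main in blast)+
qed

end
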